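(* Consider the spectral curve $\mathbb{CP}^1$ with meromorphic functions $x(z)=\frac{z-1}{z^2}$ and $y(z)=-z$, and let $\omega_{g,n}$ ($g\ge 0$, $n\ge 1$) be the correlation differentials produced by the Eynard–Orantin topological recursion for this curve (described in the context). Then for all $(g,n)\neq(0,2)$, \[ \omega_{g,n}(z_1,\ldots,z_n)=\frac{\partial}{\partial x_1}\cdots\frac{\partial}{\partial x_n}F_{g,n}(x_1,\ldots,x_n)\,\mathrm{d}x_1\cdots \mathrm{d}x_n \] as expansions at $x_i=0$, where $x_i=x(z_i)$ and $z_i$ is the branch $z_i=\frac{1-\sqrt{1-4x_i}}{2x_i}$ (so $z_i=1$ at $x_i=0$).
   Context: Monotone Hurwitz numbers: for $g\ge0$, $n\ge1$ and positive integers $\mu_1,\ldots,\mu_n$ with $|\boldsymbol\mu|=\mu_1+\cdots+\mu_n$, let $m=2g-2+n+|\boldsymbol\mu|$. The monotone Hurwitz number $\vec H_{g,n}(\mu_1,\ldots,\mu_n)$ is $\frac{1}{|\boldsymbol\mu|!}$ times the number of $m$-tuples $(\sigma_1,\ldots,\sigma_m)$ of transpositions in the symmetric group $S_{|\boldsymbol\mu|}$, together with a labelling of the cycles of $\sigma_1\circ\cdots\circ\sigma_m$ by $1,\ldots,n$, such that: cycle $i$ has length $\mu_i$ for each $i$; $\sigma_1,\ldots,\sigma_m$ generate a transitive subgroup; and writing $\sigma_j=(a_j\,b_j)$ with $a_j<b_j$, one has $b_1\le b_2\le\cdots\le b_m$ (the number is $0$ if $m<0$). The free energy is the formal power series $F_{g,n}(x_1,\ldots,x_n)=\sum_{\mu_1,\ldots,\mu_n\ge1}\vec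 H_{g,n}(\mu_1,\ldots,\mu_n)x_1^{\mu_1}\cdots x_n^{\mu_n}$. Topological recursion for this curve: the only zero of $\mathrm{d}x$ is $z=2$, and $\overline{z}=\frac{z}{z-1}$ is the involution with $x(\overline z)=x(z)$. Set $\omega_{0,1}(z_1)=-y(z_1)\,\mathrm{d}x(z_1)=z_1\,\mathrm{d}x(z_1)$, $\omega_{0,2}(z_1,z_2)=\frac{\mathrm{d}z_1\,\mathrm{d}z_2}{(z_1-z_2)^2}$, and kernel $K(z_1,z)=-\frac{\int_{\infty}^{z}\omega_{0,2}(z_1,\cdot)}{[y(z)-y(\overline z)]\,\mathrm{d}x(z)}=\frac{\mathrm{d}z_1}{z_1-z}\cdot\frac{1}{(z-\overline z)\,\mathrm{d}x(z)}$. For $2g-2+n>0$, with $S=\{1,\ldots,n\}$ and $z_I=(z_i)_{i\in I}$, \[ \omega_{g,n}(z_S)=\operatorname*{Res}_{z=2}K(z_1,z)\Big[\omega_{g-1,n+1}(z,\overline z,z_{S\setminus\{1\}})+\sum^{\circ}_{\substack{g_1+g_2=g\\ I\sqcup J=S\setminus\{1\}}}\omega_{g_1,|I|+1}(z,z_I)\,\omega_{g_2,|J|+1}(\overline z,z_J)\Big], \] where $\omega_{g',n'}=0$ if $g'<0$, and $\circ$ means terms involving $\omega_{0,1}$ are excluded. Each $\omega_{g,n}$ is a meromorphic multidifferential on $(\mathbb{CP}^1)^n$. *)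

theory Defs
  imports "HOL-Complex_Analysis.Complex_Analysis" "HOL-Combinatorics.Transposition"
    "HOL-Library.FuncSet"
begin

definition perm_of_list :: "(nat \<times> nat) list \<Rightarrow> nat \<Rightarrow> nat" where
  "perm_of_list ts = foldr (\<circ>) (map (\<lambda>(a,b). Transposition.transpose a b) ts) id"

text \<open>The subgroup of S_d generated by the transpositions in ts acts transitively on
  {0..<d}. Since transpositions are involutions, the generated subgroup consists of
  the finite products of generators.\<close>
definition gen_transitive :: "nat \<Rightarrow> (nat \<times> nat) list \<Rightarrow> bool" where
  "gen_transitive d ts \<longleftrightarrow>
     (\<forall>x<d. \<forall>y<d. \<exists>ws. set ws \<subseteq> set ts \<and> perm_of_list ws x = y)"

definition same_cycle :: "(nat \<Rightarrow> nat) \<Rightarrow> nat \<Rightarrow> nat \<Rightarrow> bool" where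
  "same_cycle p x y \<longleftrightarrow> (\<exists>k. (p ^^ k) x = y)"

text \<open>A labelling of the cycles of p (a permutation of {0..<d}) by labels 0..<n,
  recorded as the map sending each point to the label of its cycle, such that the
  cycle labelled i has length mu!i.\<close>
definition cycle_labelling :: "nat \<Rightarrow> nat list \<Rightarrow> (nat \<Rightarrow> nat) \<Rightarrow> (nat \<Rightarrow> nat) \<Rightarrow> bool" where
  "cycle_labelling d mu p lab \<longleftrightarrow>
     lab \<in> {0..<d} \<rightarrow>\<^sub>E {0..<length mu} \<and>
     (\<forall>x<d. \<forall>y<d. lab x = lab y \<longleftrightarrow> same_cycle p x y) \<and>
     (\<forall>i<length mu. card {x. x < d \<and> lab x = i} = mu ! i)"

definition monotone_tuples :: "nat \<Rightarrow> nat list \<Rightarrow> ((nat \<times> nat) list \<times> (nat \<Rightarrow> nat)) set" where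
  "monotone_tuples g mu =
     (let d = sum_list mu; n = length mu; m = 2 * g + n + d - 2 in
      {(ts, lab). length ts = m \<and> (\<forall>(a,b)\<in>set ts. a < b \<and> b < d) \<and>
                  sorted (map snd ts) \<and> gen_transitive d ts \<and>
                  cycle_labelling d mu (perm_of_list ts) lab})"

text \<open>Monotone Hurwitz number H_{g,n}(mu_1,...,mu_n), n = length mu. (For n \<ge> 1 and
  all mu_i \<ge> 1 one always has m = 2g-2+n+|mu| \<ge> 0.)\<close>
definition monoH :: "nat \<Rightarrow> nat list \<Rightarrow> complex" where
  "monoH g mu =
     (if 2 * g + length mu + sum_list mu < 2 then 0
      else of_nat (card (monotone_tuples g mu)) / of_nat (fact (sum_list mu)))"

definition xcurve :: "complex \<Rightarrow> complex" where
  "xcurve z = (z - 1) / z ^ 2"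

definition ycurve :: "complex \<Rightarrow> complex" where
  "ycurve z = - z"

definition zbar :: "complex \<Rightarrow> complex" where
  "zbar z = z / (z - 1)"

text \<open>Coefficient of the recursion kernel K(z1,z) with respect to dz1 (and as a
  (-1)-form in z):  -1/((z1 - z) (y(z) - y(zbar z)) x'(z)) = 1/((z1-z)(z-zbar z) x'(z)).\<close>
definition kernel :: "complex \<Rightarrow> complex \<Rightarrow> complex" where
  "kernel z1 z = - 1 / ((z1 - z) * (ycurve z - ycurve (zbar z)) * deriv xcurve z)"

lemma length_nths_sub: "I \<subseteq> {..<length zs} \<Longrightarrow> length (nths zs I) = card I"
  by (simp add: length_nths) (metis Collect_mem_eq inf.absorb_iff2 lessThan_def Collect_conj_eq)

lemma length_nths_compl:
  "I \<subseteq> {..<length zs} \<Longrightarrow> length (nths zs ({..<length zs} - I)) = length zs - card I"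
  by (subst length_nths_sub) (auto simp: card_Diff_subset finite_subset)

lemma card_lt_proper: "I \<subseteq> {..<(L::nat)} \<Longrightarrow> I \<noteq> {..<L} \<Longrightarrow> card I < L"
  by (metis card_lessThan card_mono card_subset_eq finite_lessThan le_neq_implies_less)

lemma card_le_sub: "I \<subseteq> {..<(L::nat)} \<Longrightarrow> card I \<le> L"
  by (metis card_lessThan card_mono finite_lessThan)

text \<open>omega g zs is the coefficient of dz_1 ... dz_n of omega_{g,n}(z_1,...,z_n), where
  zs = [z_1,...,z_n]. Since exactly one argument in each term of the recursion is
  zbar z, the quadratic differential in z carries the factor d(zbar z)/dz.\<close>
function omega :: "nat \<Rightarrow> complex list \<Rightarrow> complex" where
  "omega g [] = 0"
| "omega g (z1 # zs) =
     (if g = 0 \<and> zs = [] then z1 * deriv xcurve z1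
      else if g = 0 \<and> length zs = 1 then 1 / (z1 - hd zs) ^ 2
      else residue (\<lambda>z. kernel z1 z * deriv zbar z *
         ((if g = 0 then 0 else omega (g - 1) (z # zbar z # zs)) +
          (\<Sum>g1\<in>{0..g}. \<Sum>I\<in>Pow {..<length zs}.
             if (g1 = 0 \<and> I = {}) \<or> (g1 = g \<and> I = {..<length zs}) then 0
             else omega g1 (z # nths zs I) *
                  omega (g - g1) (zbar z # nths zs ({..<length zs} - I))))) 2)"
  by pat_completeness auto
termination
proof (relation "Wellfounded.measure (\<lambda>(g,zs). 2*g + length zs)", goal_cases)
  case 1 then show ?case by simp
next
  case 2 then show ?case by simp
next
  case (3 g z1 zs z g1 I)
  then have I: "I \<subseteq> {..<length zs}" by auto
  show ?case
  proof (cases "I = {..<length zs}")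
    case True then show ?thesis using 3 by (auto simp: length_nths_sub[OF I])
  next
    case False then show ?thesis using 3 card_lt_proper[OF I False]
      by (auto simp: length_nths_sub[OF I])
  qed
next
  case (4 g z1 zs z g1 I)
  then have I: "I \<subseteq> {..<length zs}" by auto
  show ?case
  proof (cases "I = {}")
    case True then show ?thesis using 4 by (auto simp: length_nths_compl[OF I])
  next
    case False
    then have "card I > 0" using I by (meson card_gt_0_iff finite_lessThan finite_subset)
    then show ?thesis using 4 card_le_sub[OF I] by (auto simp: length_nths_compl[OF I])
  qed
qed

text \<open>The branch z(x) = (1 - sqrt(1 - 4x))/(2x) of the inverse of x(z), with z(0) = 1.\<close>
definition zbranch :: "complex \<Rightarrow> complex" where
  "zbranch x = (if x = 0 then 1 else (1 - csqrt (1 - 4 * x)) / (2 * x))"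

end

theory Submission
  imports Defs "HOL-Combinatorics.Permutations" "HOL-Combinatorics.Cycles"
begin

text \<open>
  Monotone factorisations are sums of complete symmetric polynomials in the Jucys-Murphy elements,
  hence central, so the largest point lies on the cycle of length \<open>\<mu> i\<close> labelled \<open>i\<close> in a
  fraction \<open>\<mu> i / |\<mu>|\<close> of all cases. Since the last transposition of a transitive monotone factorisation moves the largest point, removing it
  gives a cut-join recursion for monotone Hurwitz numbers. Fix all arguments but the first as coefficient indices, and
  put \<open>s = sqrt (1 - 4 x) = (2 - z)/z\<close>. Dividing the recursion by \<open>s\<close> expresses every stable
  generating series through smaller ones, as a polynomial in \<open>1/s\<close>.

  On the other side, the residue at \<open>z = 2\<close> against the kernel only sees principal parts, and the
  functions \<open>z^(2k-2) / (2-z)^(2k)\<close>, which are odd powers of \<open>1/s\<close> times \<open>x'(z)\<close>, form a basis of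
  those that occur. In these bases the two recursions have the same structure constants and
  the same initial data for \<open>(0,3)\<close> and \<open>(1,1)\<close>, so one finite tensor describes both sides.
\<close>

section \<open>Cycle labellings and transpositions\<close>

text \<open>Removing the last transposition gives a recursion for counts that remember the label of
  the largest point, and these do not close up by themselves. Centrality closes the recursion: the
  label is distributed as for a point chosen uniformly, and this stays true among connected
  sequences.

  The obstacle in matching the two recursions is their unstable terms. The (0,1) terms are absorbed
  by the division by s, because 1 - 2xz = s; topological recursion omits them from the start. The
  (0,2) terms are handled only together with the join term: the combined operator, divided by s,
  sends odd powers of 1/s to combinations of odd powers with coefficients 2(2l + 1) and their
  negatives. The same numbers arise on the other side as partial fractions of the double poles of
  omega_{0,2}. The constant 1/4 in all product terms is 4x = 1 - s^2, once as a relation of power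
  series and once as an identity in z.

  The initial data are built from (0,2) itself. They are computed by applying an Euler operator,
  which multiplies coefficients by the total degree plus a constant and is therefore
  injective.\<close>

lemma same_cycle_refl [simp]: "same_cycle p x x"
  unfolding same_cycle_def by (rule exI[of _ 0]) simp

lemma same_cycle_step: "same_cycle p x (p x)"
  unfolding same_cycle_def by (rule exI[of _ 1]) simp

lemma same_cycle_trans: "same_cycle p x y \<Longrightarrow> same_cycle p y z \<Longrightarrow> same_cycle p x z"
  unfolding same_cycle_def by (metis funpow_add o_apply)

lemma same_cycle_closed:
  assumes "same_cycle p x y" "x \<in> S" "\<And>z. z \<in> S \<Longrightarrow> p z \<in> S"
  shows "y \<in> S"
proof -
  have "(p ^^ k) x \<in> S" for k
    by (induction k) (use assms in auto)
  then show ?thesis using assms(1) by (auto simp: same_cycle_def)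
qed

lemma same_cycle_sym:
  assumes "p permutes D" "finite D" "same_cycle p x y"
  shows "same_cycle p y x"
proof -
  obtain k where k: "(p ^^ k) x = y" using assms(3) by (auto simp: same_cycle_def)
  have "permutation p" using assms permutation_permutes by blast
  then obtain n where n: "p ^^ n = id" "n > k" using permutation_is_nilpotent' by blast
  have "(p ^^ (n - k)) y = (p ^^ n) x"
    using k n(2) by (metis funpow_add le_add_diff_inverse2 less_imp_le o_apply)
  then show ?thesis using n(1) unfolding same_cycle_def by auto
qed

lemma same_cycle_in:
  assumes "p permutes D" "same_cycle p x y" "x \<in> D"
  shows "y \<in> D"
  using same_cycle_closed[OF assms(2,3)] permutes_in_image[OF assms(1)] by blast

text \<open>Points and labels range over arbitrary sets because removing a transposition adds or
  deletes a label, and a disconnected sequence is treated block by block.\<close>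

definition labs :: "nat set \<Rightarrow> nat set \<Rightarrow> (nat \<Rightarrow> nat) \<Rightarrow> (nat \<Rightarrow> nat) \<Rightarrow> (nat \<Rightarrow> nat) set" where
  "labs D \<Lambda> \<mu> p = {lab \<in> D \<rightarrow>\<^sub>E \<Lambda>. (\<forall>x\<in>D. \<forall>y\<in>D. lab x = lab y \<longleftrightarrow> same_cycle p x y) \<and>
     (\<forall>i\<in>\<Lambda>. card {x\<in>D. lab x = i} = \<mu> i)}"

lemma finite_labs: "finite D \<Longrightarrow> finite \<Lambda> \<Longrightarrow> finite (labs D \<Lambda> \<mu> p)"
  unfolding labs_def by (rule finite_subset[of _ "D \<rightarrow>\<^sub>E \<Lambda>"]) (auto intro: finite_PiE)

lemma labs_step:
  assumes "L \<in> labs D \<Lambda> \<mu> p" "p permutes D" "x \<in> D"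
  shows "L (p x) = L x"
proof -
  have "p x \<in> D" using assms permutes_in_image by metis
  moreover have "\<forall>x\<in>D. \<forall>y\<in>D. L x = L y \<longleftrightarrow> same_cycle p x y"
    using assms(1) by (simp add: labs_def)
  ultimately show ?thesis using assms(3) same_cycle_step[of p x] by metis
qed

lemma same_cycle_inv:
  assumes "p permutes D" "same_cycle p x y" "x \<in> D" "\<And>z. z \<in> D \<Longrightarrow> f (p z) = f z"
  shows "f y = f x"
proof -
  have "y \<in> {z\<in>D. f z = f x}"
    by (rule same_cycle_closed[OF assms(2)]) (use assms permutes_in_image[OF assms(1)] in auto)
  then show ?thesis by simp
qed

lemma comp_transpose_permutes:
  assumes "p permutes D" "a \<in> D" "c \<in> D"
  shows "p \<circ> Transposition.transpose a c permutes D"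
  using assms permutes_compose permutes_swap_id by metis

text \<open>After the multiplication \<open>a\<close> is sent to \<open>q c\<close>, and from there
  the new orbit follows the \<open>q\<close>-cycle of \<open>c\<close>, which does not meet
  \<open>a\<close>, until it reaches \<open>c\<close>. Thus the whole cycle of \<open>c\<close> is
  absorbed into the orbit of \<open>a\<close>.\<close>

lemma same_cycle_transpose_join:
  assumes q: "q permutes D" "finite D" and ne: "\<not> same_cycle q a c" and x: "same_cycle q c x"
  shows "same_cycle (q \<circ> Transposition.transpose a c) a x"
proof -
  let ?q1 = "q \<circ> Transposition.transpose a c"
  define O1 where "O1 = {y. same_cycle ?q1 a y}"
  have cl: "?q1 y \<in> O1" if "y \<in> O1" for y
    using that same_cycle_trans same_cycle_step unfolding O1_def by blast
  have aO: "a \<in> O1" by (simp add: O1_def)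
  then have qc: "q c \<in> O1" using cl[of a] by simp
  have other: "?q1 y = q y" if "y \<noteq> a" "y \<noteq> c" for y
    using that by (simp add: Transposition.transpose_def)
  have na: "y \<noteq> a" if "same_cycle q c y" for y
    using that ne same_cycle_sym[OF q] by blast
  have cO: "c \<in> O1"
  proof (rule ccontr)
    assume nc: "c \<notin> O1"
    \<comment> \<open>If \<open>c\<close> were outside the orbit, the two permutations would agree
      along the path from \<open>q c\<close> back to \<open>c\<close>, so this path could never
      leave the orbit.\<close>
    have "c \<in> {y\<in>O1. same_cycle q c y}"
    proof (rule same_cycle_closed[of q "q c"])
      show "same_cycle q (q c) c" by (rule same_cycle_sym[OF q same_cycle_step])
      show "q c \<in> {y \<in> O1. same_cycle q c y}" using qc same_cycle_step by simp
      fix z assume z: "z \<in> {y \<in> O1. same_cycle q c y}"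
      then have "z \<noteq> c" "z \<noteq> a" using nc na by auto
      then show "q z \<in> {y \<in> O1. same_cycle q c y}"
        using z cl[of z] other[of z] same_cycle_trans[OF _ same_cycle_step] by auto
    qed
    then show False using nc by simp
  qed
  have "x \<in> {y\<in>O1. same_cycle q c y}"
  proof (rule same_cycle_closed[OF x])
    show "c \<in> {y \<in> O1. same_cycle q c y}" using cO by simp
    fix z assume z: "z \<in> {y \<in> O1. same_cycle q c y}"
    then have za: "z \<noteq> a" using na by auto
    have "q z \<in> O1"
    proof (cases "z = c")
      case True then show ?thesis using qc by simp
    next
      case False then show ?thesis using z cl[of z] other[of z] za by auto
    qed
    then show "q z \<in> {y \<in> O1. same_cycle q c y}"
      using z same_cycle_trans[OF _ same_cycle_step] by auto
  qed
  then show ?thesis by (simp add: O1_def)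
qed

definition merge :: "nat set \<Rightarrow> nat \<Rightarrow> nat \<Rightarrow> (nat \<Rightarrow> nat) \<Rightarrow> nat \<Rightarrow> nat" where
  "merge D i j L = restrict (\<lambda>x. if L x = j then i else L x) D"

text \<open>The transposition fuses the cycles through \<open>a\<close> and \<open>c\<close>, by
  \<open>same_cycle_transpose_join\<close> in both directions, and agrees with \<open>q\<close> on
  all other cycles. So the only change in a labelling is that the label \<open>j\<close> becomes
  \<open>i\<close>.\<close>

lemma merge_labs:
  assumes q: "q permutes D" "finite D" and L: "L \<in> labs D \<Lambda> \<mu> q"
    and ij: "i \<in> \<Lambda>" "i \<noteq> j" "j \<in> \<Lambda>" and D: "a \<in> D" "c \<in> D" "L c = i" "L a = j"
  shows "merge D i j L \<in> labs D (\<Lambda> - {j}) (\<mu>(i := \<mu> i + \<mu> j)) (q \<circ> Transposition.transpose a c)"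
    and "same_cycle (q \<circ> Transposition.transpose a c) a c"
proof -
  let ?q1 = "q \<circ> Transposition.transpose a c"
  let ?m = "merge D i j L"
  have q1: "?q1 permutes D" using comp_transpose_permutes[OF q(1) D(1,2)] .
  have LPi: "L \<in> D \<rightarrow>\<^sub>E \<Lambda>" and Lsame: "\<And>x y. x \<in> D \<Longrightarrow> y \<in> D \<Longrightarrow> L x = L y \<longleftrightarrow> same_cycle q x y"
    and Lcard: "\<And>i. i \<in> \<Lambda> \<Longrightarrow> card {x\<in>D. L x = i} = \<mu> i"
    using L by (auto simp: labs_def)
  have ne: "\<not> same_cycle q a c" "\<not> same_cycle q c a" using Lsame D ij(2) by metis+
  have c1: "same_cycle ?q1 a x" if "same_cycle q c x" for x
    using same_cycle_transpose_join[OF q ne(1) that] .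
  have c2: "same_cycle ?q1 c x" if "same_cycle q a x" for x
    using same_cycle_transpose_join[OF q ne(2) that] by (simp add: transpose_commute)
  show ac: "same_cycle ?q1 a c" by (rule c1) simp
  note sym = same_cycle_sym[OF q1 q(2)]
  have inv: "?m (?q1 z) = ?m z" if "z \<in> D" for z
  proof -
    have "L (q z) = L z" if "z \<in> D" for z using labs_step[OF L q(1) that] .
    moreover have "q z \<in> D" if "z \<in> D" for z using permutes_in_image[OF q(1)] that by blast
    ultimately show ?thesis
      using that D by (auto simp: merge_def Transposition.transpose_def)
  qed
  have in_c: "same_cycle ?q1 c x" if "x \<in> D" "?m x = i" for x
  proof (cases "L x = j")
    case True
    then have "same_cycle q a x" using Lsame D that by metis
    then show ?thesis using c2 by blast
  next
    case False
    then have "L x = L c" using that D by (simp add: merge_def)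
    then have "same_cycle q c x" using Lsame D that by metis
    then show ?thesis using c1 ac sym same_cycle_trans by blast
  qed
  have same: "?m x = ?m y \<longleftrightarrow> same_cycle ?q1 x y" if "x \<in> D" "y \<in> D" for x y
  proof
    assume "same_cycle ?q1 x y"
    then show "?m x = ?m y" using same_cycle_inv[OF q1 _ that(1), of y ?m] inv by metis
  next
    assume eq: "?m x = ?m y"
    show "same_cycle ?q1 x y"
    proof (cases "?m x = i")
      case True
      then show ?thesis using in_c[OF that(1)] in_c[OF that(2)] eq sym same_cycle_trans by metis
    next
      case False
      then have Lx: "L x \<noteq> i" "L x \<noteq> j" "L x = L y"
        using eq that by (auto simp: merge_def split: if_splits)
      have "same_cycle q x y" using Lx(3) Lsame that by blast
      then have "y \<in> {y\<in>D. L y = L x \<and> same_cycle ?q1 x y}"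
      proof (rule same_cycle_closed)
        show "x \<in> {y \<in> D. L y = L x \<and> same_cycle ?q1 x y}" using that by simp
        fix z assume z: "z \<in> {y \<in> D. L y = L x \<and> same_cycle ?q1 x y}"
        then have "z \<noteq> a" "z \<noteq> c" using Lx D by auto
        then have "?q1 z = q z" by (simp add: Transposition.transpose_def)
        then show "q z \<in> {y \<in> D. L y = L x \<and> same_cycle ?q1 x y}"
          using z labs_step[OF L q(1), of z] permutes_in_image[OF q(1), of z]
            same_cycle_trans[OF _ same_cycle_step, of ?q1 x z] by simp
      qed
      then show ?thesis by simp
    qed
  qed
  have card: "card {x\<in>D. ?m x = k} = (\<mu>(i := \<mu> i + \<mu> j)) k" if "k \<in> \<Lambda> - {j}" for k
  proof (cases "k = i")
    case True
    have "{x\<in>D. ?m x = k} = {x\<in>D. L x = i} \<union> {x\<in>D. L x = j}"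
      using True by (auto simp: merge_def split: if_splits)
    moreover have "card ({x\<in>D. L x = i} \<union> {x\<in>D. L x = j}) = \<mu> i + \<mu> j"
      by (subst card_Un_disjoint) (use q(2) ij Lcard in auto)
    ultimately show ?thesis using True by simp
  next
    case False
    then have "{x\<in>D. ?m x = k} = {x\<in>D. L x = k}"
      using that by (auto simp: merge_def split: if_splits)
    then show ?thesis using that False Lcard by simp
  qed
  have "?m \<in> D \<rightarrow>\<^sub>E (\<Lambda> - {j})"
    using LPi ij by (auto simp: merge_def PiE_iff split: if_splits)
  then show "?m \<in> labs D (\<Lambda> - {j}) (\<mu>(i := \<mu> i + \<mu> j)) ?q1"
    unfolding labs_def using same card by blast
qed

text \<open>The enumeration starts at \<open>p c\<close> and ends at \<open>c\<close> itself. With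
  this shift the points cut off by a transposition form an initial block of indices, and
  \<open>c\<close> stays in the remainder.\<close>

lemma cycle_enum:
  assumes p: "p permutes D" "finite D" and c: "c \<in> D"
    and N: "card {x\<in>D. same_cycle p c x} = N"
  shows "bij_betw (\<lambda>k. (p ^^ k) c) {1..N} {x\<in>D. same_cycle p c x}" "(p ^^ N) c = c" "N > 0"
proof -
  have pm: "permutation p" using p permutation_permutes by blast
  let ?P = "least_power p c" and ?e = "\<lambda>k. (p ^^ k) c"
  have P: "(p ^^ ?P) c = c" "?P > 0" using least_power_of_permutation[OF pm] by auto
  have inj: "inj_on ?e {..<?P}"
    using cycle_of_permutation[OF pm, of c] by (simp add: distinct_map atLeast_upt)
  have img: "?e ` {..<?P} = {x\<in>D. same_cycle p c x}"
  proof -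
    have "?e ` {..<?P} = range ?e" using support_set[OF pm, of c] by (simp add: atLeast_upt)
    also have "\<dots> = {x\<in>D. same_cycle p c x}"
      using same_cycle_in[OF p(1) _ c] by (auto simp: same_cycle_def)
    finally show ?thesis .
  qed
  have "N = ?P" using card_image[OF inj] img N by simp
  have img1: "?e ` {1..?P} = ?e ` {..<?P}"
  proof
    show "?e ` {1..?P} \<subseteq> ?e ` {..<?P}"
    proof
      fix y assume "y \<in> ?e ` {1..?P}"
      then obtain k where k: "k \<in> {1..?P}" "y = ?e k" by auto
      show "y \<in> ?e ` {..<?P}"
      proof (cases "k = ?P")
        case True then have "y = ?e 0" using k P by simp
        then show ?thesis using P(2) by blast
      next
        case False then show ?thesis using k by auto
      qed
    qed
    show "?e ` {..<?P} \<subseteq> ?e ` {1..?P}"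
    proof
      fix y assume "y \<in> ?e ` {..<?P}"
      then obtain k where k: "k < ?P" "y = ?e k" by auto
      show "y \<in> ?e ` {1..?P}"
      proof (cases "k = 0")
        case True then have "y = ?e ?P" using k P by simp
        moreover have "?P \<in> {1..?P}" using P(2) by simp
        ultimately show ?thesis by blast
      next
        case False then show ?thesis using k by auto
      qed
    qed
  qed
  have "inj_on ?e {1..?P}"
    by (rule eq_card_imp_inj_on) (use img1 card_image[OF inj] in auto)
  then show "bij_betw ?e {1..N} {x\<in>D. same_cycle p c x}"
    using img1 img \<open>N = ?P\<close> by (simp add: bij_betw_def)
  show "(p ^^ N) c = c" "N > 0" using P \<open>N = ?P\<close> by auto
qed

text \<open>The product sends \<open>c\<close> to \<open>(p ^^ Suc k) c\<close> and \<open>a\<close>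
  to \<open>p c\<close>. So the indices from 1 to k close up to a cycle through \<open>a\<close>,
  and those from k + 1 to the full length close up to a cycle through \<open>c\<close>.\<close>

lemma split_labs:
  assumes p: "p permutes D" "finite D" and l: "l \<in> labs D \<Lambda> \<nu> p"
    and ij: "i \<in> \<Lambda>" "j \<notin> \<Lambda>" and c: "c \<in> D" "l c = i" and k: "0 < k" "k < \<nu> i"
  defines "a \<equiv> (p ^^ k) c"
  obtains L where "a \<in> D" "a \<noteq> c" "l a = i"
    "L \<in> labs D (insert j \<Lambda>) (\<nu>(i := \<nu> i - k, j := k)) (p \<circ> Transposition.transpose a c)"
    "L c = i" "L a = j" "merge D i j L = l"
proof -
  define N where "N = \<nu> i"
  let ?e = "\<lambda>k. (p ^^ k) c"
  let ?q = "p \<circ> Transposition.transpose a c"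
  have lPi: "l \<in> D \<rightarrow>\<^sub>E \<Lambda>" and lsame: "\<And>x y. x \<in> D \<Longrightarrow> y \<in> D \<Longrightarrow> l x = l y \<longleftrightarrow> same_cycle p x y"
    and lcard: "\<And>i. i \<in> \<Lambda> \<Longrightarrow> card {x\<in>D. l x = i} = \<nu> i"
    using l by (auto simp: labs_def)
  have fib: "{x\<in>D. same_cycle p c x} = {x\<in>D. l x = i}" using lsame c by metis
  then have cN: "card {x\<in>D. same_cycle p c x} = N" using lcard ij N_def by simp
  note e = cycle_enum[OF p c(1) cN]
  have bij: "bij_betw ?e {1..N} {x\<in>D. l x = i}" using e(1) fib by simp
  have inj: "\<And>r s. r \<in> {1..N} \<Longrightarrow> s \<in> {1..N} \<Longrightarrow> ?e r = ?e s \<Longrightarrow> r = s"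
    using bij_betw_imp_inj_on[OF bij] inj_onD by metis
  have eN: "?e N = c" by (rule e(2))
  have ein: "?e r \<in> D" "l (?e r) = i" if "r \<in> {1..N}" for r
    using bij that by (auto simp: bij_betw_def)
  have step: "p (?e r) = ?e (Suc r)" for r by simp
  have kN: "k \<in> {1..N}" "k < N" using k N_def by auto
  have aD: "a \<in> D" "l a = i" using ein[OF kN(1)] by (auto simp: a_def)
  have ac: "a \<noteq> c" using inj[of k N] eN kN e(3) by (auto simp: a_def)
  have q: "?q permutes D" using comp_transpose_permutes[OF p(1) aD(1) c(1)] .
  define A where "A = ?e ` {1..k}"
  define L where "L = restrict (\<lambda>x. if x \<in> A then j else l x) D"
  have AD: "A \<subseteq> {x\<in>D. l x = i}" using ein kN by (auto simp: A_def)
  have aA: "a \<in> A" unfolding A_def a_def using k by auto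
  have cA: "c \<notin> A"
  proof
    assume "c \<in> A"
    then obtain r where "r \<in> {1..k}" "?e r = ?e N" using eN by (auto simp: A_def)
    then show False using inj[of r N] kN by auto
  qed
  have Aiff: "?e r \<in> A \<longleftrightarrow> r \<le> k" if "r \<in> {1..N}" for r
  proof
    assume "?e r \<in> A"
    then obtain s where "s \<in> {1..k}" "?e r = ?e s" by (auto simp: A_def)
    then show "r \<le> k" using inj[of r s] that kN by auto
  qed (use that in \<open>auto simp: A_def\<close>)
  have q_c: "?q c = ?e (Suc k)" and q_a: "?q a = ?e 1"
    by (simp_all add: a_def)
  have q_o: "?q (?e r) = ?e (Suc r)" if "r \<in> {1..N}" "r \<noteq> k" "r \<noteq> N" for r
  proof -
    have "?e r \<noteq> a" "?e r \<noteq> c"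
      using inj[of r k] inj[of r N] that kN e(3) eN by (auto simp: a_def)
    then show ?thesis by (simp add: Transposition.transpose_def)
  qed
  have Lval: "L (?e r) = (if r \<le> k then j else i)" if "r \<in> {1..N}" for r
    using ein[OF that] Aiff[OF that] by (simp add: L_def)
  have Lout: "L x = l x" if "x \<in> D" "l x \<noteq> i" for x
    using that AD by (auto simp: L_def)
  have enum: "\<exists>r\<in>{1..N}. x = ?e r" if "x \<in> D" "l x = i" for x
    using bij that unfolding bij_betw_def by blast
  have Lc: "L c = i" using cA c by (simp add: L_def)
  have La: "L a = j" using aA aD by (simp add: L_def)
  have inv: "L (?q x) = L x" if x: "x \<in> D" for x
  proof (cases "l x = i")
    case True
    then obtain r where r: "r \<in> {1..N}" "x = ?e r" using enum x by blast
    consider "r = k" | "r = N" | "r \<noteq> k" "r \<noteq> N" by blast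
    then show ?thesis
    proof cases
      case 1
      then have "?q x = ?e 1" using r q_a a_def by simp
      moreover have "1 \<in> {1..N}" "1 \<le> k" using k kN by auto
      ultimately show ?thesis using Lval[of 1] Lval[OF r(1)] r 1 by simp
    next
      case 2
      then have "?q x = ?e (Suc k)" using r q_c eN by simp
      moreover have "Suc k \<in> {1..N}" using kN by auto
      ultimately show ?thesis using Lval[of "Suc k"] Lval[OF r(1)] r 2 kN by simp
    next
      case 3
      then have "?q x = ?e (Suc r)" using r q_o by blast
      moreover have "Suc r \<in> {1..N}" "Suc r \<le> k \<longleftrightarrow> r \<le> k" using r 3 by auto
      ultimately show ?thesis using Lval[of "Suc r"] Lval[OF r(1)] r by simp
    qed
  next
    case False
    then have "x \<noteq> a" "x \<noteq> c" using aD c by auto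
    then have "?q x = p x" by (simp add: Transposition.transpose_def)
    moreover have "l (p x) = l x" using labs_step[OF l p(1) x] .
    moreover have "p x \<in> D" using permutes_in_image[OF p(1)] x by blast
    ultimately show ?thesis using Lout False x by simp
  qed
  note sym = same_cycle_sym[OF q p(2)]
  have reach_a: "same_cycle ?q a (?e r)" if "1 \<le> r" "r \<le> k" for r
    using that
  proof (induction r rule: dec_induct)
    case base
    then show ?case using same_cycle_step[of ?q a] q_a by metis
  next
    case (step r)
    then have "?q (?e r) = ?e (Suc r)" using q_o[of r] kN by auto
    then show ?case using step same_cycle_trans[OF _ same_cycle_step] by (metis Suc_leD)
  qed
  have reach_c: "same_cycle ?q c (?e r)" if "Suc k \<le> r" "r \<le> N" for r
    using that
  proof (induction r rule: dec_induct)
    case base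
    then show ?case using same_cycle_step[of ?q c] q_c by metis
  next
    case (step r)
    then have "?q (?e r) = ?e (Suc r)" using q_o[of r] kN by auto
    then show ?case using step same_cycle_trans[OF _ same_cycle_step] by (metis Suc_leD)
  qed
  have jn: "l x \<noteq> j" if "x \<in> D" for x using lPi that ij by (auto simp: PiE_iff)
  have in_j: "same_cycle ?q a x" if x: "x \<in> D" "L x = j" for x
  proof -
    have "x \<in> A" using x jn by (auto simp: L_def split: if_splits)
    then show ?thesis using reach_a by (auto simp: A_def)
  qed
  have in_i: "same_cycle ?q c x" if x: "x \<in> D" "L x = i" for x
  proof -
    have lx: "l x = i" using x ij by (auto simp: L_def split: if_splits)
    then obtain r where r: "r \<in> {1..N}" "x = ?e r" using enum x by blast
    then have "\<not> r \<le> k" using Lval[of r] x ij by auto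
    then show ?thesis using reach_c[of r] r by auto
  qed
  have same: "L x = L y \<longleftrightarrow> same_cycle ?q x y" if xy: "x \<in> D" "y \<in> D" for x y
  proof
    assume "same_cycle ?q x y"
    then show "L x = L y" using same_cycle_inv[OF q _ xy(1), of y L] inv by metis
  next
    assume eq: "L x = L y"
    consider "L x = j" | "L x = i" | "L x \<noteq> j" "L x \<noteq> i" by blast
    then show "same_cycle ?q x y"
    proof cases
      case 1 then show ?thesis using in_j xy eq sym same_cycle_trans by metis
    next
      case 2 then show ?thesis using in_i xy eq sym same_cycle_trans by metis
    next
      case 3
      have lx: "l x \<noteq> i" "l x = l y" "l x = L x"
        using 3 eq xy AD jn by (auto simp: L_def split: if_splits)
      then have "same_cycle p x y" using lsame xy by blast
      then have "y \<in> {y\<in>D. l y = l x \<and> same_cycle ?q x y}"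
      proof (rule same_cycle_closed)
        show "x \<in> {y \<in> D. l y = l x \<and> same_cycle ?q x y}" using xy by simp
        fix z assume z: "z \<in> {y \<in> D. l y = l x \<and> same_cycle ?q x y}"
        then have "z \<noteq> a" "z \<noteq> c" using lx aD c by auto
        then have "?q z = p z" by (simp add: Transposition.transpose_def)
        then show "p z \<in> {y \<in> D. l y = l x \<and> same_cycle ?q x y}"
          using z labs_step[OF l p(1), of z] permutes_in_image[OF p(1), of z]
            same_cycle_trans[OF _ same_cycle_step, of ?q x z] by simp
      qed
      then show ?thesis by simp
    qed
  qed
  have cardA: "card A = k"
  proof -
    have "inj_on ?e {1..k}" using inj kN by (auto intro!: inj_onI)
    then show ?thesis by (simp add: A_def card_image)
  qed
  have card: "card {x\<in>D. L x = m} = (\<nu>(i := \<nu> i - k, j := k)) m" if "m \<in> insert j \<Lambda>" for m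
  proof -
    consider "m = j" | "m = i" | "m \<noteq> j" "m \<noteq> i" by blast
    then show ?thesis
    proof cases
      case 1
      have "{x\<in>D. L x = j} = A" using AD jn by (auto simp: L_def split: if_splits)
      then show ?thesis using 1 cardA by simp
    next
      case 2
      have "{x\<in>D. L x = i} = {x\<in>D. l x = i} - A" using ij by (auto simp: L_def split: if_splits)
      moreover have "card ({x\<in>D. l x = i} - A) = card {x\<in>D. l x = i} - k"
        using card_Diff_subset[OF _ AD] cardA finite_subset[OF AD] p(2) by auto
      ultimately show ?thesis using 2 ij lcard by auto
    next
      case 3
      have "{x\<in>D. L x = m} = {x\<in>D. l x = m}" using 3 AD by (auto simp: L_def split: if_splits)
      then show ?thesis using 3 that lcard by simp
    qed
  qed
  have "L \<in> D \<rightarrow>\<^sub>E insert j \<Lambda>"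
    using lPi by (auto simp: L_def PiE_iff)
  then have "L \<in> labs D (insert j \<Lambda>) (\<nu>(i := \<nu> i - k, j := k)) ?q"
    unfolding labs_def using same card by blast
  moreover have "merge D i j L = l"
  proof
    fix x show "merge D i j L x = l x"
      using AD jn lPi by (cases "x \<in> D") (auto simp: merge_def L_def PiE_iff extensional_def)
  qed
  ultimately show ?thesis using that aD ac Lc La by blast
qed

text \<open>Merging forgets only which points carried \<open>i\<close> and which carried
  \<open>j\<close>. These two fibres are the \<open>q\<close>-cycles of \<open>c\<close> and
  \<open>a\<close>, the same for both labellings.\<close>

lemma merge_inj:
  assumes "L \<in> labs D \<Lambda> \<mu> q" "L' \<in> labs D \<Lambda>' \<mu>' q" "c \<in> D" "L c = i" "L' c = i"
    "merge D i j L = merge D i j L'" "i \<noteq> j" "a \<in> D" "L a = j" "L' a = j"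
  shows "L = L'"
proof
  fix x
  show "L x = L' x"
  proof (cases "x \<in> D")
    case False then show ?thesis using assms(1,2) by (auto simp: labs_def PiE_iff extensional_def)
  next
    case True
    have "(if L x = j then i else L x) = (if L' x = j then i else L' x)"
      using fun_cong[OF assms(6), of x] True by (simp add: merge_def)
    moreover have "L x = i \<longleftrightarrow> L' x = i" "L x = j \<longleftrightarrow> L' x = j"
    proof -
      have "\<forall>x\<in>D. \<forall>y\<in>D. L x = L y \<longleftrightarrow> same_cycle q x y"
        "\<forall>x\<in>D. \<forall>y\<in>D. L' x = L' y \<longleftrightarrow> same_cycle q x y"
        using assms(1,2) by (simp_all add: labs_def)
      then have "L x = L c \<longleftrightarrow> same_cycle q x c" "L' x = L' c \<longleftrightarrow> same_cycle q x c"
        "L x = L a \<longleftrightarrow> same_cycle q x a" "L' x = L' a \<longleftrightarrow> same_cycle q x a"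
        using assms(3,8) True by blast+
      then show "L x = i \<longleftrightarrow> L' x = i" "L x = j \<longleftrightarrow> L' x = j" using assms by auto
    qed
    ultimately show ?thesis by (auto split: if_splits)
  qed
qed

lemma labs_cong: "(\<And>i. i \<in> \<Lambda> \<Longrightarrow> \<mu> i = \<mu>' i) \<Longrightarrow> labs D \<Lambda> \<mu> p = labs D \<Lambda> \<mu>' p"
  by (simp add: labs_def)

lemma enum_point:
  assumes p: "p permutes D" "finite D" and l: "l \<in> labs D \<Lambda> \<nu> p"
    and c: "c \<in> D" "l c = i" and a: "a \<in> D" "a \<noteq> c" "l a = i" and i: "i \<in> \<Lambda>"
  obtains k where "0 < k" "k < \<nu> i" "a = (p ^^ k) c"
proof -
  have *: "l c = l x \<longleftrightarrow> same_cycle p c x" if "x \<in> D" for x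
    using l c that by (auto simp: labs_def)
  then have fib: "{x\<in>D. same_cycle p c x} = {x\<in>D. l x = i}" using c(2) by (intro Collect_cong) metis
  have "card {x\<in>D. l x = i} = \<nu> i" using l i by (auto simp: labs_def)
  then have cN: "card {x\<in>D. same_cycle p c x} = \<nu> i" using fib by simp
  note e = cycle_enum[OF p c(1) cN]
  have "a \<in> (\<lambda>k. (p ^^ k) c) ` {1..\<nu> i}"
    using e(1) a fib unfolding bij_betw_def by auto
  then obtain k where k: "k \<in> {1..\<nu> i}" "a = (p ^^ k) c" by auto
  then have "k \<noteq> \<nu> i" using e(2) a by auto
  then show ?thesis by (intro that[of k]) (use k in auto)
qed

lemma comp_transpose_twice [simp]:
  "p \<circ> Transposition.transpose a c \<circ> Transposition.transpose a c = p"
  by (simp add: comp_assoc)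

lemma merge_at: "x \<in> D \<Longrightarrow> merge D i j L x = (if L x = j then i else L x)"
  by (simp add: merge_def)

text \<open>Cutting the merged labelling at \<open>a\<close> gives \<open>L\<close> back by
  \<open>merge_inj\<close>, and the piece cut off has as many points as there are steps from
  \<open>c\<close> to \<open>a\<close>. Hence the position of \<open>a\<close> can be recovered
  after merging.\<close>

lemma merge_point:
  assumes p: "p permutes D" "finite D" and ij: "i \<in> \<Lambda>" "j \<in> \<Lambda>" "i \<noteq> j" and D: "a \<in> D" "c \<in> D"
    and L: "L \<in> labs D \<Lambda> \<mu> (p \<circ> Transposition.transpose a c)" "L c = i" "L a = j"
  shows "a = (p ^^ \<mu> j) c"
proof -
  let ?q = "p \<circ> Transposition.transpose a c" and ?l = "merge D i j L"
  have q: "?q permutes D" using comp_transpose_permutes[OF p(1) D] .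
  have l: "?l \<in> labs D (\<Lambda> - {j}) (\<mu>(i := \<mu> i + \<mu> j)) p"
    using merge_labs(1)[OF q p(2) L(1) ij(1,3,2) D L(2,3)] by simp
  have lac: "?l c = i" "?l a = i" using D L ij by (simp_all add: merge_at)
  have ac: "a \<noteq> c" using L ij by auto
  obtain k where k: "0 < k" "k < \<mu> i + \<mu> j" "a = (p ^^ k) c"
    using enum_point[OF p l D(2) lac(1) D(1) ac lac(2)] ij by auto
  then obtain L0 where L0: "L0 \<in> labs D (insert j (\<Lambda> - {j})) ((\<mu>(i := \<mu> i + \<mu> j))(i := \<mu> i + \<mu> j - k, j := k)) ?q"
    "L0 c = i" "L0 a = j" "merge D i j L0 = ?l"
    using split_labs[OF p l _ _ D(2) lac(1), of j k] ij by (metis DiffI Diff_iff fun_upd_same singletonD singletonI)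
  have "L = L0" by (rule merge_inj[OF L(1) L0(1) D(2) L(2) L0(2) L0(4)[symmetric] ij(3) D(1) L(3) L0(3)])
  have "card {x\<in>D. L x = j} = \<mu> j" using L(1) ij by (auto simp: labs_def)
  moreover have "card {x\<in>D. L0 x = j} = k" using L0(1) by (auto simp: labs_def)
  ultimately show ?thesis using k \<open>L = L0\<close> by simp
qed

text \<open>Summing over \<open>a\<close> produces no multiplicity: a labelling of the joined cycle
  can be cut in exactly one way into pieces of the prescribed lengths with \<open>c\<close> in the
  first, namely \<open>\<mu> j\<close> steps after \<open>c\<close>, as in
  \<open>merge_point\<close>.\<close>

lemma card_join:
  assumes p: "p permutes D" "finite D" and ij: "i \<in> \<Lambda>" "j \<in> \<Lambda>" "i \<noteq> j"
    and c: "c \<in> D" and pos: "\<mu> i > 0" "\<mu> j > 0"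
  shows "card (SIGMA a:D - {c}. {L \<in> labs D \<Lambda> \<mu> (p \<circ> Transposition.transpose a c). L c = i \<and> L a = j})
       = card {l \<in> labs D (\<Lambda> - {j}) (\<mu>(i := \<mu> i + \<mu> j)) p. l c = i}" (is "card ?S = card ?T")
proof (rule bij_betw_same_card)
  let ?\<nu> = "\<mu>(i := \<mu> i + \<mu> j)"
  show "bij_betw (\<lambda>(a, L). merge D i j L) ?S ?T"
    unfolding bij_betw_def
  proof
    show "inj_on (\<lambda>(a, L). merge D i j L) ?S"
    proof (rule inj_onI)
      fix x y assume xy: "x \<in> ?S" "y \<in> ?S" "(\<lambda>(a, L). merge D i j L) x = (\<lambda>(a, L). merge D i j L) y"
      obtain a L where x: "x = (a, L)" by (cases x)
      have L: "a \<in> D" "L \<in> labs D \<Lambda> \<mu> (p \<circ> Transposition.transpose a c)" "L c = i" "L a = j"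
        using xy(1) unfolding x by simp_all
      obtain a' L' where y: "y = (a', L')" by (cases y)
      have L': "a' \<in> D" "L' \<in> labs D \<Lambda> \<mu> (p \<circ> Transposition.transpose a' c)" "L' c = i" "L' a' = j"
        using xy(2) unfolding y by simp_all
      have "a = a'" using merge_point[OF p ij L(1) c L(2-4)] merge_point[OF p ij L'(1) c L'(2-4)] by simp
      moreover have "merge D i j L = merge D i j L'" using xy(3) x y by simp
      ultimately have "L = L'" using L' by (intro merge_inj[OF L(2), of L' \<Lambda> \<mu> c i j a]) (use c L ij in auto)
      then show "x = y" using x y \<open>a = a'\<close> by simp
    qed
    show "(\<lambda>(a, L). merge D i j L) ` ?S = ?T"
    proof
      show "(\<lambda>(a, L). merge D i j L) ` ?S \<subseteq> ?T"
      proof (rule image_subsetI)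
        fix x assume xS: "x \<in> ?S"
        obtain a L where x: "x = (a, L)" by (cases x)
        have L: "a \<in> D" "L \<in> labs D \<Lambda> \<mu> (p \<circ> Transposition.transpose a c)" "L c = i" "L a = j"
          using xS unfolding x by simp_all
        have q: "p \<circ> Transposition.transpose a c permutes D"
          using comp_transpose_permutes[OF p(1) L(1) c] .
        have "merge D i j L \<in> labs D (\<Lambda> - {j}) ?\<nu> p"
          using merge_labs(1)[OF q p(2) L(2) ij(1,3,2) L(1) c L(3,4)] by simp
        then show "(\<lambda>(a, L). merge D i j L) x \<in> ?T"
          using x c L(3) ij(3) by (simp add: merge_at)
      qed
      show "?T \<subseteq> (\<lambda>(a, L). merge D i j L) ` ?S"
      proof
        fix l assume "l \<in> ?T"
        then have l: "l \<in> labs D (\<Lambda> - {j}) ?\<nu> p" "l c = i" by auto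
        define a where "a = (p ^^ \<mu> j) c"
        have "i \<in> \<Lambda> - {j}" "j \<notin> \<Lambda> - {j}" "\<mu> j < ?\<nu> i" using ij pos by auto
        note sl = split_labs[OF p l(1) this(1,2) c l(2) pos(2) this(3), folded a_def]
        obtain L where L: "a \<in> D" "a \<noteq> c" "l a = i"
          "L \<in> labs D (insert j (\<Lambda> - {j})) (?\<nu>(i := ?\<nu> i - \<mu> j, j := \<mu> j)) (p \<circ> Transposition.transpose a c)"
          "L c = i" "L a = j" "merge D i j L = l"
          by (rule sl) (rule that)
        have "?\<nu>(i := ?\<nu> i - \<mu> j, j := \<mu> j) = \<mu>" by auto
        moreover have "insert j (\<Lambda> - {j}) = \<Lambda>" using ij by auto
        ultimately have "(a, L) \<in> ?S" using L by simp
        then show "l \<in> (\<lambda>(a, L). merge D i j L) ` ?S" using L(7) by force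
      qed
    qed
  qed
qed

text \<open>Here \<open>a\<close> is given, so its distance from \<open>c\<close> along the cycle
  labelled \<open>i\<close> varies with the labelling. That distance is the length of the second
  cycle, which receives the fresh label \<open>j\<close>.\<close>

lemma card_cut:
  assumes q: "q permutes D" "finite D" and fin: "finite \<Lambda>" and ij: "i \<in> \<Lambda>" "j \<notin> \<Lambda>"
    and D: "a \<in> D" "c \<in> D" "a \<noteq> c"
  shows "card {l \<in> labs D \<Lambda> \<mu> (q \<circ> Transposition.transpose a c). l c = i \<and> l a = i}
       = (\<Sum>k\<in>{1..<\<mu> i}. card {L \<in> labs D (insert j \<Lambda>) (\<mu>(i := \<mu> i - k, j := k)) q. L c = i \<and> L a = j})"
    (is "card ?T = (\<Sum>k\<in>?K. card (?S k))")
proof -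
  let ?p = "q \<circ> Transposition.transpose a c"
  have p: "?p permutes D" using comp_transpose_permutes[OF q(1) D(1,2)] .
  have inej: "i \<noteq> j" using ij by auto
  have "bij_betw (merge D i j) (\<Union>k\<in>?K. ?S k) ?T"
    unfolding bij_betw_def
  proof
    show "inj_on (merge D i j) (\<Union>k\<in>?K. ?S k)"
    proof (rule inj_onI)
      fix L L' assume h: "L \<in> (\<Union>k\<in>?K. ?S k)" "L' \<in> (\<Union>k\<in>?K. ?S k)" "merge D i j L = merge D i j L'"
      obtain k k' where "L \<in> ?S k" "L' \<in> ?S k'" using h by auto
      then show "L = L'"
        using merge_inj[of L D _ _ q L' _ _ c i j a] h(3) D inej by blast
    qed
    show "merge D i j ` (\<Union>k\<in>?K. ?S k) = ?T"
    proof
      show "merge D i j ` (\<Union>k\<in>?K. ?S k) \<subseteq> ?T"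
      proof (rule image_subsetI)
        fix L assume "L \<in> (\<Union>k\<in>?K. ?S k)"
        then obtain k where k: "k \<in> ?K" "L \<in> ?S k" by blast
        then have L: "L \<in> labs D (insert j \<Lambda>) (\<mu>(i := \<mu> i - k, j := k)) q" "L c = i" "L a = j"
          by simp_all
        let ?m = "\<mu>(i := \<mu> i - k, j := k)"
        have "merge D i j L \<in> labs D (insert j \<Lambda> - {j}) (?m(i := ?m i + ?m j)) ?p"
          using merge_labs(1)[OF q L(1) _ inej _ D(1,2) L(2,3)] ij by auto
        also have "insert j \<Lambda> - {j} = \<Lambda>" using ij by auto
        also have "labs D \<Lambda> (?m(i := ?m i + ?m j)) ?p = labs D \<Lambda> \<mu> ?p"
          by (rule labs_cong) (use k ij inej in auto)
        finally show "merge D i j L \<in> ?T"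
          using L D inej by (simp add: merge_at)
      qed
      show "?T \<subseteq> merge D i j ` (\<Union>k\<in>?K. ?S k)"
      proof
        fix l assume "l \<in> ?T"
        then have l: "l \<in> labs D \<Lambda> \<mu> ?p" "l c = i" "l a = i" by auto
        obtain k where k: "0 < k" "k < \<mu> i" "a = (?p ^^ k) c"
          using enum_point[OF p q(2) l(1) D(2) l(2) D(1,3) l(3) ij(1)] by blast
        obtain L where L: "L \<in> labs D (insert j \<Lambda>) (\<mu>(i := \<mu> i - k, j := k)) (?p \<circ> Transposition.transpose a c)"
          "L c = i" "L a = j" "merge D i j L = l"
          using split_labs[OF p q(2) l(1) ij D(2) l(2) k(1,2)] k(3) by metis
        then have "L \<in> ?S k" by simp
        then show "l \<in> merge D i j ` (\<Union>k\<in>?K. ?S k)" using k L(4) by force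
      qed
    qed
  qed
  then have "card ?T = card (\<Union>k\<in>?K. ?S k)" by (rule bij_betw_same_card[symmetric])
  also have "\<dots> = (\<Sum>k\<in>?K. card (?S k))"
  proof (rule card_UN_disjoint)
    show "\<forall>k\<in>?K. finite (?S k)"
    proof
      fix k
      show "finite (?S k)"
      proof (rule finite_subset)
        show "?S k \<subseteq> labs D (insert j \<Lambda>) (\<mu>(i := \<mu> i - k, j := k)) q" by (rule Collect_restrict)
        show "finite (labs D (insert j \<Lambda>) (\<mu>(i := \<mu> i - k, j := k)) q)"
          by (rule finite_labs[OF q(2)]) (simp add: fin)
      qed
    qed
    show "\<forall>k\<in>?K. \<forall>k'\<in>?K. k \<noteq> k' \<longrightarrow> ?S k \<inter> ?S k' = {}"
    proof (intro ballI impI)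
      fix k k' :: nat assume "k \<noteq> k'"
      have *: "card {x\<in>D. L x = j} = k" if "L \<in> ?S k" for L k
      proof -
        have "\<forall>m\<in>insert j \<Lambda>. card {x\<in>D. L x = m} = (\<mu>(i := \<mu> i - k, j := k)) m"
          using that unfolding labs_def by blast
        then show ?thesis by simp
      qed
      show "?S k \<inter> ?S k' = {}"
      proof (rule ccontr)
        assume "?S k \<inter> ?S k' \<noteq> {}"
        then obtain L where "L \<in> ?S k" "L \<in> ?S k'" by blast
        then show False using *[of L k] *[of L k'] \<open>k \<noteq> k'\<close> by simp
      qed
    qed
  qed simp
  finally show ?thesis .
qed

section \<open>Counts of connected monotone sequences\<close>

definition mono_seqs :: "nat set \<Rightarrow> nat \<Rightarrow> (nat \<times> nat) list set" where
  "mono_seqs D m = {ts. length ts = m \<and> (\<forall>(a,b)\<in>set ts. a < b \<and> a \<in> D \<and> b \<in> D) \<and> sorted (map snd ts)}"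

text \<open>Transitivity is expressed through invariant sets because this form restricts to blocks
  of points and can be recorded while transpositions are multiplied;
  \<open>gen_transitive_iff_conn\<close> links it to the generated group.\<close>

definition conn :: "nat set \<Rightarrow> (nat \<times> nat) list \<Rightarrow> bool" where
  "conn D ts \<longleftrightarrow> (\<forall>S\<subseteq>D. (\<forall>(a,b)\<in>set ts. a \<in> S \<longleftrightarrow> b \<in> S) \<longrightarrow> S = {} \<or> S = D)"

definition cnt :: "nat \<Rightarrow> nat set \<Rightarrow> nat set \<Rightarrow> (nat \<Rightarrow> nat) \<Rightarrow> nat" where
  "cnt m D \<Lambda> \<mu> = (\<Sum>ts | ts \<in> mono_seqs D m \<and> conn D ts. card (labs D \<Lambda> \<mu> (perm_of_list ts)))"

text \<open>The effect of deleting the last transposition depends on which cycle contains the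
  largest point, so the recursion has to run on counts refined by the label of a point.\<close>

definition cntat :: "nat \<Rightarrow> nat set \<Rightarrow> nat set \<Rightarrow> (nat \<Rightarrow> nat) \<Rightarrow> nat \<Rightarrow> nat \<Rightarrow> nat" where
  "cntat m D \<Lambda> \<mu> x i =
     (\<Sum>ts | ts \<in> mono_seqs D m \<and> conn D ts. card {lab \<in> labs D \<Lambda> \<mu> (perm_of_list ts). lab x = i})"

text \<open>The cut of a connected factorisation at its last transposition \<open>(a c)\<close>, where \<open>c\<close> is the
  largest point, may disconnect it; the pairs \<open>(ts, a)\<close> for which it does are counted, with \<open>i\<close> and \<open>j\<close> the labels
  of the two cycles.\<close>
definition disc :: "nat \<Rightarrow> nat set \<Rightarrow> nat set \<Rightarrow> (nat \<Rightarrow> nat) \<Rightarrow> nat \<Rightarrow> nat \<Rightarrow> nat \<Rightarrow> nat" where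
  "disc m D \<Lambda> \<mu> c i j = (\<Sum>ts | ts \<in> mono_seqs D m \<and> \<not> conn D ts. \<Sum>a | a \<in> D \<and> conn D (ts @ [(a, c)]).
      card {L \<in> labs D \<Lambda> \<mu> (perm_of_list ts). L c = i \<and> L a = j})"

lemma finite_mono_seqs: "finite D \<Longrightarrow> finite (mono_seqs D m)"
  by (rule finite_subset[OF _ finite_lists_length_eq[of "D \<times> D" m]]) (auto simp: mono_seqs_def)

lemma perm_of_list_Nil [simp]: "perm_of_list [] = id"
  by (simp add: perm_of_list_def)

lemma perm_of_list_Cons [simp]:
  "perm_of_list (t # ts) = Transposition.transpose (fst t) (snd t) \<circ> perm_of_list ts"
  by (simp add: perm_of_list_def case_prod_unfold)

lemma perm_of_list_append [simp]: "perm_of_list (ts @ us) = perm_of_list ts \<circ> perm_of_list us"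
  by (induction ts) (auto simp: comp_assoc)

lemma perm_of_list_permutes:
  assumes "\<forall>(a,b)\<in>set ts. a \<in> D \<and> b \<in> D"
  shows "perm_of_list ts permutes D"
  using assms
proof (induction ts)
  case (Cons t ts)
  have "Transposition.transpose (fst t) (snd t) permutes D"
    using Cons.prems by (intro permutes_swap_id) auto
  moreover have "perm_of_list ts permutes D" using Cons by simp
  ultimately show ?case unfolding perm_of_list_Cons by (rule permutes_compose[rotated])
qed (simp add: permutes_id)

lemma mono_seqs_permutes: "ts \<in> mono_seqs D m \<Longrightarrow> perm_of_list ts permutes D"
  by (rule perm_of_list_permutes) (auto simp: mono_seqs_def)

lemma perm_of_list_invariant:
  assumes "\<forall>(a,b)\<in>set ts. a \<in> S \<longleftrightarrow> b \<in> S"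
  shows "perm_of_list ts x \<in> S \<longleftrightarrow> x \<in> S"
  using assms by (induction ts) (auto simp: Transposition.transpose_def split: if_splits)

lemma same_cycle_invariant:
  assumes "\<forall>(a,b)\<in>set ts. a \<in> S \<longleftrightarrow> b \<in> S" "same_cycle (perm_of_list ts) x y"
  shows "x \<in> S \<longleftrightarrow> y \<in> S"
proof
  show "x \<in> S \<Longrightarrow> y \<in> S"
    using same_cycle_closed[OF assms(2)] perm_of_list_invariant[OF assms(1)] by blast
next
  show "y \<in> S \<Longrightarrow> x \<in> S"
    using same_cycle_closed[OF assms(2), of "- S"] perm_of_list_invariant[OF assms(1)] by blast
qed

lemma conn_snoc: "conn D ts \<Longrightarrow> conn D (ts @ us)"
  by (simp add: conn_def)

text \<open>If \<open>a\<close> and \<open>c\<close> share a cycle of the product, every invariant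
  set contains both or neither, so the transposition links nothing new.\<close>

lemma conn_snoc_same_cycle:
  assumes "same_cycle (perm_of_list ts) a c" "conn D (ts @ [(a, c)])"
  shows "conn D ts"
  using assms(2) same_cycle_invariant[OF _ assms(1)] unfolding conn_def by auto

text \<open>If the last larger entry were below the maximum \<open>c\<close>, monotonicity would
  keep every transposition away from \<open>c\<close>, and \<open>{c}\<close> would be a proper
  invariant set.\<close>

lemma mono_seqs_Suc:
  assumes "finite D" "c = Max D"
  shows "{ts. ts \<in> mono_seqs D (Suc m) \<and> conn D ts}
       = (\<lambda>(ts, a). ts @ [(a, c)]) ` {(ts, a). ts \<in> mono_seqs D m \<and> a \<in> D - {c} \<and> conn D (ts @ [(a, c)])}"
    (is "?A = ?f ` ?B")
proof
  show "?f ` ?B \<subseteq> ?A"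
  proof
    fix us assume "us \<in> ?f ` ?B"
    then obtain ts a where us: "us = ts @ [(a, c)]"
      and h: "ts \<in> mono_seqs D m" "conn D (ts @ [(a, c)])" "a \<in> D" "a \<noteq> c" by auto
    have D: "D \<noteq> {}" using h by auto
    have le: "x \<le> c" if "x \<in> D" for x using assms that by simp
    have "c \<in> D" using assms D by simp
    moreover have "a < c" using le[of a] h by auto
    ultimately show "us \<in> ?A" unfolding us
      using h le by (fastforce simp: mono_seqs_def sorted_append)
  qed
  show "?A \<subseteq> ?f ` ?B"
  proof
    fix us assume "us \<in> ?A"
    then have us: "us \<in> mono_seqs D (Suc m)" "conn D us" by auto
    then obtain ts t where t: "us = ts @ [t]"
      by (metis (mono_tags, lifting) append_butlast_last_id length_0_conv mem_Collect_eq mono_seqs_def nat.distinct(1))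
    obtain a b where ab: "t = (a, b)" by (cases t)
    have h: "a < b" "a \<in> D" "b \<in> D" "length ts = m" "\<forall>(a,b)\<in>set ts. a < b \<and> a \<in> D \<and> b \<in> D"
      "sorted (map snd ts)" "\<forall>x\<in>set ts. snd x \<le> b"
      using us(1) t ab by (auto simp: mono_seqs_def sorted_append)
    have "b = c"
    proof (rule ccontr)
      assume "b \<noteq> c"
      have "b \<le> c" using assms h(3) by simp
      have cD: "c \<in> D" using assms h(3) Max_in[of D] by blast
      have "\<forall>(x,y)\<in>set us. x \<noteq> c \<and> y \<noteq> c"
      proof (clarify, rule conjI; rule notI)
        fix x y assume xy: "(x, y) \<in> set us"
        have "x < y" "y \<le> b" using xy h t ab by auto
        then show "x = c \<Longrightarrow> False" "y = c \<Longrightarrow> False" using \<open>b \<noteq> c\<close> \<open>b \<le> c\<close> by auto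
      qed
      then have "\<forall>(x,y)\<in>set us. x \<in> {c} \<longleftrightarrow> y \<in> {c}" by auto
      then have "{c} = D"
        using us(2)[unfolded conn_def, rule_format, of "{c}"] cD by simp
      then have "a \<in> {c}" "b \<in> {c}" using h(2,3) by (simp_all only:)
      then show False using h(1) by simp
    qed
    then have "(ts, a) \<in> ?B" using h us t ab by (auto simp: mono_seqs_def)
    then show "us \<in> ?f ` ?B" using t ab \<open>b = c\<close> by force
  qed
qed

lemma sum_card_fibre:
  assumes "finite D" "finite \<Lambda>" "j \<in> \<Lambda>" "A = {lab \<in> labs D \<Lambda> \<mu> p. P lab}"
  shows "(\<Sum>a\<in>D. card {lab \<in> A. lab a = j}) = \<mu> j * card A"
proof -
  have fA: "finite A" using finite_labs[OF assms(1,2)] assms(4) by simp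
  have "(\<Sum>a\<in>D. card {lab \<in> A. lab a = j}) = (\<Sum>a\<in>D. \<Sum>lab\<in>A. of_bool (lab a = j))"
    using fA by (intro sum.cong refl) (simp add: sum_of_bool_eq Int_def)
  also have "\<dots> = (\<Sum>lab\<in>A. \<Sum>a\<in>D. of_bool (lab a = j))" by (rule sum.swap)
  also have "\<dots> = (\<Sum>lab\<in>A. \<mu> j)"
  proof (rule sum.cong[OF refl])
    fix lab assume "lab \<in> A"
    then have "card {a\<in>D. lab a = j} = \<mu> j" using assms by (auto simp: labs_def)
    then show "(\<Sum>a\<in>D. of_bool (lab a = j)) = \<mu> j"
      using assms(1) by (simp add: sum_of_bool_eq Int_def)
  qed
  finally show ?thesis by simp
qed

text \<open>The last transposition is \<open>(a c)\<close>, and the cases are sorted by the label of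
  \<open>a\<close> in the full product. A label other than \<open>i\<close> means that two cycles
  come from a single one before (\<open>card_join\<close>). The label \<open>i\<close> means that
  one cycle comes from two (\<open>card_cut\<close>), and the second of these gets the fresh label
  \<open>j\<close>. Only in the latter case can the shorter sequence be disconnected.\<close>

lemma cntat_Suc:
  assumes D: "finite D" "c = Max D" "D \<noteq> {}" and fin: "finite \<Lambda>" and ij: "i \<in> \<Lambda>" "j \<notin> \<Lambda>"
    and pos: "\<And>k. k \<in> \<Lambda> \<Longrightarrow> \<mu> k > 0"
  shows "cntat (Suc m) D \<Lambda> \<mu> c i =
      (\<Sum>k\<in>\<Lambda> - {i}. cntat m D (\<Lambda> - {k}) (\<mu>(i := \<mu> i + \<mu> k)) c i)
    + (\<Sum>k\<in>{1..<\<mu> i}. k * cntat m D (insert j \<Lambda>) (\<mu>(i := \<mu> i - k, j := k)) c i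
         + disc m D (insert j \<Lambda>) (\<mu>(i := \<mu> i - k, j := k)) c i j)"
proof -
  have cD: "c \<in> D" using D by simp
  let ?M = "mono_seqs D m"
  let ?\<tau> = "\<lambda>a. Transposition.transpose a c"
  let ?\<mu> = "\<lambda>k. \<mu>(i := \<mu> i - k, j := k)"
  let ?lab = "\<lambda>ts a k. {lab \<in> labs D \<Lambda> \<mu> (perm_of_list ts \<circ> ?\<tau> a). lab c = i \<and> lab a = k}"
  let ?fine = "\<lambda>ts k a. {L \<in> labs D (insert j \<Lambda>) (?\<mu> k) (perm_of_list ts). L c = i \<and> L a = j}"
  let ?J = "\<lambda>ts. \<Sum>k\<in>\<Lambda>-{i}. card {l \<in> labs D (\<Lambda> - {k}) (\<mu>(i := \<mu> i + \<mu> k)) (perm_of_list ts). l c = i}"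
  have finM: "finite ?M" by (rule finite_mono_seqs[OF D(1)])
  have finl: "finite (labs D \<Lambda> \<mu> p)" for p by (rule finite_labs[OF D(1) fin])
  have inj: "inj_on (\<lambda>(ts, a). ts @ [(a, c)]) X" for X :: "((nat \<times> nat) list \<times> nat) set"
    by (auto simp: inj_on_def)
  have set_eq: "{(ts, a). ts \<in> ?M \<and> a \<in> D - {c} \<and> conn D (ts @ [(a, c)])} =
     (SIGMA ts:?M. {a \<in> D - {c}. conn D (ts @ [(a, c)])})" by auto
  have split: "card {lab \<in> labs D \<Lambda> \<mu> (perm_of_list ts \<circ> ?\<tau> a). lab c = i} = (\<Sum>k\<in>\<Lambda>. card (?lab ts a k))"
    if "a \<in> D" for ts a
  proof -
    have "{lab \<in> labs D \<Lambda> \<mu> (perm_of_list ts \<circ> ?\<tau> a). lab c = i} = (\<Union>k\<in>\<Lambda>. ?lab ts a k)"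
      using that by (auto simp: labs_def PiE_iff)
    then show ?thesis by (simp, subst card_UN_disjoint) (use fin finl in auto)
  qed
  have "cntat (Suc m) D \<Lambda> \<mu> c i =
     (\<Sum>ts\<in>?M. \<Sum>a | a \<in> D - {c} \<and> conn D (ts @ [(a, c)]). \<Sum>k\<in>\<Lambda>. card (?lab ts a k))"
  proof -
    have "cntat (Suc m) D \<Lambda> \<mu> c i = (\<Sum>(ts, a)\<in>(SIGMA ts:?M. {a \<in> D - {c}. conn D (ts @ [(a, c)])}).
        card {lab \<in> labs D \<Lambda> \<mu> (perm_of_list ts \<circ> ?\<tau> a). lab c = i})"
      unfolding cntat_def mono_seqs_Suc[OF D(1,2)] set_eq
      by (subst sum.reindex[OF inj]) (simp add: case_prod_unfold)
    also have "\<dots> = (\<Sum>ts\<in>?M. \<Sum>a | a \<in> D - {c} \<and> conn D (ts @ [(a, c)]).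
        card {lab \<in> labs D \<Lambda> \<mu> (perm_of_list ts \<circ> ?\<tau> a). lab c = i})"
      by (rule sum.Sigma[symmetric]) (use finM D in auto)
    also have "\<dots> = (\<Sum>ts\<in>?M. \<Sum>a | a \<in> D - {c} \<and> conn D (ts @ [(a, c)]). \<Sum>k\<in>\<Lambda>. card (?lab ts a k))"
      by (intro sum.cong refl split) auto
    finally show ?thesis .
  qed
  also have "\<dots> = (\<Sum>ts\<in>?M. (if conn D ts then ?J ts else 0)
      + (\<Sum>k\<in>{1..<\<mu> i}. \<Sum>a | a \<in> D \<and> conn D (ts @ [(a, c)]). card (?fine ts k a)))"
  proof (rule sum.cong[OF refl])
    fix ts assume ts: "ts \<in> ?M"
    let ?X = "{a. a \<in> D - {c} \<and> conn D (ts @ [(a, c)])}"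
    have pp: "perm_of_list ts permutes D" by (rule mono_seqs_permutes[OF ts])
    have J: "(\<Sum>a\<in>?X. \<Sum>k\<in>\<Lambda>-{i}. card (?lab ts a k)) = (if conn D ts then ?J ts else 0)"
    proof -
      have "(\<Sum>a\<in>?X. \<Sum>k\<in>\<Lambda>-{i}. card (?lab ts a k)) = (\<Sum>k\<in>\<Lambda>-{i}. \<Sum>a\<in>?X. card (?lab ts a k))"
        by (rule sum.swap)
      also have "\<dots> = (\<Sum>k\<in>\<Lambda>-{i}. if conn D ts then card {l \<in> labs D (\<Lambda> - {k}) (\<mu>(i := \<mu> i + \<mu> k)) (perm_of_list ts). l c = i} else 0)"
      proof (rule sum.cong[OF refl])
        fix k assume k: "k \<in> \<Lambda> - {i}"
        show "(\<Sum>a\<in>?X. card (?lab ts a k)) = (if conn D ts then card {l \<in> labs D (\<Lambda> - {k}) (\<mu>(i := \<mu> i + \<mu> k)) (perm_of_list ts). l c = i} else 0)"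
        proof (cases "conn D ts")
          case True
          then have X: "?X = D - {c}" using conn_snoc by auto
          show ?thesis
          proof -
            have "card (SIGMA a:D - {c}. ?lab ts a k) = (\<Sum>a\<in>D - {c}. card (?lab ts a k))"
              by (rule card_SigmaI) (use D finl in auto)
            then show ?thesis
              unfolding X using card_join[OF pp D(1) ij(1), of k c \<mu>] k cD pos ij(1) True by auto
          qed
        next
          case False
          \<comment> \<open>Points on different cycles of the full product share a cycle before the
            last transposition, so that transposition cannot be what connects the sequence.\<close>
          have "card (?lab ts a k) = 0" if a: "a \<in> ?X" for a
          proof (rule ccontr)
            assume "card (?lab ts a k) \<noteq> 0"
            then obtain L where L: "L \<in> ?lab ts a k" by (metis (no_types, lifting) card.empty ex_in_conv)
            have aD: "a \<in> D" using a by simp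
            have L': "L \<in> labs D \<Lambda> \<mu> (perm_of_list ts \<circ> ?\<tau> a)" "L c = i" "L a = k" using L by simp_all
            have k': "i \<noteq> k" "k \<in> \<Lambda>" using k by auto
            have "same_cycle (perm_of_list ts \<circ> ?\<tau> a \<circ> ?\<tau> a) a c"
              by (rule merge_labs(2)[OF comp_transpose_permutes[OF pp aD cD] D(1) L'(1) ij(1) k' aD cD L'(2,3)])
            then have "same_cycle (perm_of_list ts) a c" by simp
            then show False using conn_snoc_same_cycle a False by blast
          qed
          then show ?thesis using False by simp
        qed
      qed
      finally show ?thesis by simp
    qed
    have C: "(\<Sum>a\<in>?X. card (?lab ts a i)) =
       (\<Sum>k\<in>{1..<\<mu> i}. \<Sum>a | a \<in> D \<and> conn D (ts @ [(a, c)]). card (?fine ts k a))"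
    proof -
      have "(\<Sum>a\<in>?X. card (?lab ts a i)) = (\<Sum>a\<in>?X. \<Sum>k\<in>{1..<\<mu> i}. card (?fine ts k a))"
        by (rule sum.cong[OF refl]) (use card_cut[OF pp D(1) fin ij _ cD] in auto)
      also have "\<dots> = (\<Sum>k\<in>{1..<\<mu> i}. \<Sum>a\<in>?X. card (?fine ts k a))" by (rule sum.swap)
      \<comment> \<open>Admitting \<open>a = c\<close> adds nothing, since this point would need
        both labels \<open>i\<close> and \<open>j\<close>. Without the exception the sum over
        \<open>a\<close> is the count of a fibre.\<close>
      also have "\<dots> = (\<Sum>k\<in>{1..<\<mu> i}. \<Sum>a | a \<in> D \<and> conn D (ts @ [(a, c)]). card (?fine ts k a))"
      proof (rule sum.cong[OF refl], rule sum.mono_neutral_left)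
        fix k
        have "i \<noteq> j" using ij by auto
        then have empty: "?fine ts k c = {}" by blast
        show "\<forall>a\<in>{a. a \<in> D \<and> conn D (ts @ [(a, c)])} - ?X. card (?fine ts k a) = 0"
        proof
          fix a assume "a \<in> {a. a \<in> D \<and> conn D (ts @ [(a, c)])} - ?X"
          then have "a = c" by blast
          then show "card (?fine ts k a) = 0" unfolding \<open>a = c\<close> empty by simp
        qed
      qed (use D in auto)
      finally show ?thesis .
    qed
    have "(\<Sum>a\<in>?X. \<Sum>k\<in>\<Lambda>. card (?lab ts a k)) =
        (\<Sum>a\<in>?X. card (?lab ts a i) + (\<Sum>k\<in>\<Lambda>-{i}. card (?lab ts a k)))"
      by (rule sum.cong[OF refl]) (use fin ij in \<open>simp add: sum.remove\<close>)
    then show "(\<Sum>a\<in>?X. \<Sum>k\<in>\<Lambda>. card (?lab ts a k)) = (if conn D ts then ?J ts else 0)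
      + (\<Sum>k\<in>{1..<\<mu> i}. \<Sum>a | a \<in> D \<and> conn D (ts @ [(a, c)]). card (?fine ts k a))"
      using J C by (simp add: sum.distrib)
  qed
  also have "\<dots> = (\<Sum>ts | ts \<in> ?M \<and> conn D ts. ?J ts)
      + (\<Sum>k\<in>{1..<\<mu> i}. \<Sum>ts\<in>?M. \<Sum>a | a \<in> D \<and> conn D (ts @ [(a, c)]). card (?fine ts k a))"
  proof -
    have "(\<Sum>ts | ts \<in> ?M \<and> conn D ts. ?J ts) = (\<Sum>ts\<in>?M. if conn D ts then ?J ts else 0)"
      using sum.inter_filter[OF finM] by auto
    then show ?thesis by (simp add: sum.distrib, subst sum.swap, simp)
  qed
  also have "(\<Sum>ts | ts \<in> ?M \<and> conn D ts. ?J ts)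
      = (\<Sum>k\<in>\<Lambda> - {i}. cntat m D (\<Lambda> - {k}) (\<mu>(i := \<mu> i + \<mu> k)) c i)"
    unfolding cntat_def by (rule sum.swap)
  also have "(\<Sum>k\<in>{1..<\<mu> i}. \<Sum>ts\<in>?M. \<Sum>a | a \<in> D \<and> conn D (ts @ [(a, c)]). card (?fine ts k a))
     = (\<Sum>k\<in>{1..<\<mu> i}. k * cntat m D (insert j \<Lambda>) (?\<mu> k) c i + disc m D (insert j \<Lambda>) (?\<mu> k) c i j)"
  proof (rule sum.cong[OF refl])
    fix k assume k: "k \<in> {1..<\<mu> i}"
    let ?g = "\<lambda>ts. \<Sum>a | a \<in> D \<and> conn D (ts @ [(a, c)]). card (?fine ts k a)"
    have "(\<Sum>ts\<in>?M. ?g ts) = (\<Sum>ts | ts \<in> ?M \<and> conn D ts. ?g ts) + (\<Sum>ts | ts \<in> ?M \<and> \<not> conn D ts. ?g ts)"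
      using sum.Int_Diff[OF finM, of ?g "Collect (conn D)"]
      by (simp add: Int_def set_diff_eq)
    also have "(\<Sum>ts | ts \<in> ?M \<and> conn D ts. ?g ts) = k * cntat m D (insert j \<Lambda>) (?\<mu> k) c i"
      unfolding cntat_def sum_distrib_left
    proof (rule sum.cong[OF refl])
      fix ts assume "ts \<in> {ts \<in> ?M. conn D ts}"
      \<comment> \<open>For connected \<open>ts\<close> every point is admissible as
        \<open>a\<close>, and \<open>k\<close> of them carry the label \<open>j\<close>; this is the
        factor \<open>k\<close>.\<close>
      then have "{a. a \<in> D \<and> conn D (ts @ [(a, c)])} = D" using conn_snoc by auto
      then show "?g ts = k * card {lab \<in> labs D (insert j \<Lambda>) (?\<mu> k) (perm_of_list ts). lab c = i}"
        using sum_card_fibre[OF D(1), of "insert j \<Lambda>" j _ "?\<mu> k" "perm_of_list ts" "\<lambda>L. L c = i"] fin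
        by simp
    qed
    finally show "(\<Sum>ts\<in>?M. ?g ts) = k * cntat m D (insert j \<Lambda>) (?\<mu> k) c i + disc m D (insert j \<Lambda>) (?\<mu> k) c i j"
      unfolding disc_def .
  qed
  finally show ?thesis .
qed

section \<open>Disconnected monotone sequences\<close>

abbreviation inner :: "nat set \<Rightarrow> (nat \<times> nat) list \<Rightarrow> (nat \<times> nat) list" where
  "inner B \<equiv> filter (\<lambda>t. snd t \<in> B)"

abbreviation outer :: "nat set \<Rightarrow> (nat \<times> nat) list \<Rightarrow> (nat \<times> nat) list" where
  "outer B \<equiv> filter (\<lambda>t. snd t \<notin> B)"

definition separated :: "nat set \<Rightarrow> (nat \<times> nat) list \<Rightarrow> bool" where
  "separated B ts \<longleftrightarrow> (\<forall>(a,b)\<in>set ts. a \<in> B \<longleftrightarrow> b \<in> B)"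

text \<open>Two monotone sequences on disjoint sets have a unique monotone shuffle, since
  their larger entries never coincide.\<close>
lemma sum_separated:
  fixes F :: "_ \<Rightarrow> _ \<Rightarrow> nat"
  assumes D: "finite D" and B: "B \<subseteq> D"
  shows "(\<Sum>ts | ts \<in> mono_seqs D m \<and> separated B ts. F (inner B ts) (outer B ts))
    = (\<Sum>k\<le>m. \<Sum>u\<in>mono_seqs B k. \<Sum>v\<in>mono_seqs (D - B) (m - k). F u v)"
proof -
  let ?T = "{ts. ts \<in> mono_seqs D m \<and> separated B ts}"
  let ?P = "SIGMA k:{..m}. mono_seqs B k \<times> mono_seqs (D - B) (m - k)"
  let ?f = "\<lambda>ts. (length (inner B ts), inner B ts, outer B ts)"
  let ?g = "\<lambda>(k :: nat, u, v). sort_key (snd :: nat \<times> nat \<Rightarrow> nat) (u @ v)"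
  have in_un: "inner B u = u" "outer B u = []" if "u \<in> mono_seqs B k" for u k
    using that by (auto simp: mono_seqs_def filter_id_conv filter_empty_conv)
  have out_un: "inner B v = []" "outer B v = v" if "v \<in> mono_seqs (D - B) k" for v k
    using that by (auto simp: mono_seqs_def filter_id_conv filter_empty_conv)
  have bij: "bij_betw ?f ?T ?P"
  proof (rule bij_betw_byWitness[where f' = ?g])
    show "\<forall>ts\<in>?T. ?g (?f ts) = ts"
    proof
      fix ts assume ts: "ts \<in> ?T"
      \<comment> \<open>Sorting by key is stable, and transpositions with equal larger entry all lie
        in the same part, so their order in \<open>ts\<close> is restored.\<close>
      have "sort_key snd (inner B ts @ outer B ts) = ts"
      proof (rule properties_for_sort_key)
        show "mset ts = mset (inner B ts @ outer B ts)" by simp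
        show "sorted (map snd ts)" using ts by (simp add: mono_seqs_def)
        fix k assume "k \<in> set ts"
        show "filter (\<lambda>x. snd k = snd x) ts = filter (\<lambda>x. snd k = snd x) (inner B ts @ outer B ts)"
        proof (cases "snd k \<in> B")
          case True
          then have "filter (\<lambda>x. snd k = snd x) (outer B ts) = []"
            by (auto simp: filter_empty_conv)
          moreover have "filter (\<lambda>x. snd k = snd x) (inner B ts) = filter (\<lambda>x. snd k = snd x) ts"
            using True by (auto intro!: filter_cong)
          ultimately show ?thesis by simp
        next
          case False
          then have "filter (\<lambda>x. snd k = snd x) (inner B ts) = []"
            by (auto simp: filter_empty_conv)
          moreover have "filter (\<lambda>x. snd k = snd x) (outer B ts) = filter (\<lambda>x. snd k = snd x) ts"
            using False by (auto intro!: filter_cong)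
          ultimately show ?thesis by simp
        qed
      qed
      then show "?g (?f ts) = ts" by simp
    qed
    show "\<forall>x\<in>?P. ?f (?g x) = x"
    proof
      fix x assume x: "x \<in> ?P"
      obtain k u v where kuv: "x = (k, u, v)" by (cases x)
      have u: "u \<in> mono_seqs B k" and v: "v \<in> mono_seqs (D - B) (m - k)" using x kuv by auto
      have su: "sort_key snd u = u" "sort_key snd v = v"
        by (rule sort_key_id_if_sorted, use u v in \<open>simp add: mono_seqs_def\<close>)+
      have len: "length u = k" using u by (simp add: mono_seqs_def)
      have "inner B (sort_key snd (u @ v)) = sort_key snd (inner B u @ inner B v)"
        "outer B (sort_key snd (u @ v)) = sort_key snd (outer B u @ outer B v)"
        by (simp_all only: filter_sort filter_append)
      then have "inner B (sort_key snd (u @ v)) = u" "outer B (sort_key snd (u @ v)) = v"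
        unfolding in_un[OF u] out_un[OF v] append_Nil append_Nil2 su .
      then show "?f (?g x) = x" using kuv len by simp
    qed
    show "?f ` ?T \<subseteq> ?P"
    proof (rule image_subsetI)
      fix ts assume ts: "ts \<in> ?T"
      then have len: "length (inner B ts) + length (outer B ts) = m"
        using sum_length_filter_compl[of "\<lambda>t. snd t \<in> B" ts] by (simp add: mono_seqs_def)
      have "inner B ts \<in> mono_seqs B (length (inner B ts))" "outer B ts \<in> mono_seqs (D - B) (length (outer B ts))"
        using ts by (auto simp: mono_seqs_def separated_def sorted_filter)
      moreover have "length (outer B ts) = m - length (inner B ts)" "length (inner B ts) \<le> m"
        using len by auto
      ultimately show "?f ts \<in> ?P" by simp
    qed
    show "?g ` ?P \<subseteq> ?T"
    proof (rule image_subsetI)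
      fix x assume x: "x \<in> ?P"
      obtain k u v where kuv: "x = (k, u, v)" by (cases x)
      have u: "u \<in> mono_seqs B k" and v: "v \<in> mono_seqs (D - B) (m - k)" and k: "k \<le> m" using x kuv by auto
      have "sort_key snd (u @ v) \<in> mono_seqs D m"
        using u v k B by (auto simp: mono_seqs_def)
      moreover have "separated B (sort_key snd (u @ v))"
        using u v by (auto simp: mono_seqs_def separated_def)
      ultimately show "?g x \<in> ?T" using kuv by simp
    qed
  qed
  have fin: "finite (mono_seqs B k)" "finite (mono_seqs (D - B) k)" for k
    by (auto intro!: finite_mono_seqs D finite_subset[OF B D])
  have "(\<Sum>ts\<in>?T. F (inner B ts) (outer B ts)) = (\<Sum>ts\<in>?T. (\<lambda>(k, u, v). F u v) (?f ts))" by simp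
  also have "\<dots> = (\<Sum>(k, u, v)\<in>?P. F u v)" by (rule sum.reindex_bij_betw[OF bij])
  also have "\<dots> = (\<Sum>k\<in>{..m}. \<Sum>(u, v)\<in>mono_seqs B k \<times> mono_seqs (D - B) (m - k). F u v)"
    by (subst sum.Sigma) (use fin in auto)
  also have "\<dots> = (\<Sum>k\<le>m. \<Sum>u\<in>mono_seqs B k. \<Sum>v\<in>mono_seqs (D - B) (m - k). F u v)"
    by (simp add: sum.cartesian_product)
  finally show ?thesis .
qed

lemma perm_of_list_inner:
  assumes "separated B ts" "x \<in> B"
  shows "perm_of_list ts x = perm_of_list (inner B ts) x"
  using assms(1)
proof (induction ts)
  case (Cons t ts)
  then have sep: "separated B ts" and t: "fst t \<in> B \<longleftrightarrow> snd t \<in> B" by (auto simp: separated_def)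
  have "perm_of_list ts x \<in> B"
    using perm_of_list_invariant[of ts B x] sep assms(2) by (simp add: separated_def)
  then have "Transposition.transpose (fst t) (snd t) (perm_of_list ts x) = perm_of_list ts x" if "snd t \<notin> B"
    using t that by (intro transpose_apply_other) auto
  then show ?case using Cons.IH[OF sep] by (cases "snd t \<in> B") simp_all
qed simp

lemma perm_of_list_outer:
  assumes "separated B ts" "x \<notin> B"
  shows "perm_of_list ts x = perm_of_list (outer B ts) x"
  using assms(1)
proof (induction ts)
  case (Cons t ts)
  then have sep: "separated B ts" and t: "fst t \<in> B \<longleftrightarrow> snd t \<in> B" by (auto simp: separated_def)
  have "perm_of_list ts x \<notin> B"
    using perm_of_list_invariant[of ts B x] sep assms(2) by (simp add: separated_def)
  then have "Transposition.transpose (fst t) (snd t) (perm_of_list ts x) = perm_of_list ts x" if "snd t \<in> B"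
    using t that by (intro transpose_apply_other) auto
  then show ?case using Cons.IH[OF sep] by (cases "snd t \<in> B") simp_all
qed simp

lemma same_cycle_restrict:
  assumes "\<And>x. x \<in> B \<Longrightarrow> p x = pB x" "\<And>x. x \<in> B \<Longrightarrow> p x \<in> B" "x \<in> B"
  shows "same_cycle p x y \<longleftrightarrow> same_cycle pB x y" "same_cycle p x y \<Longrightarrow> y \<in> B"
proof -
  have *: "(p ^^ k) x = (pB ^^ k) x \<and> (p ^^ k) x \<in> B" for k
    by (induction k) (use assms in auto)
  show "same_cycle p x y \<longleftrightarrow> same_cycle pB x y" unfolding same_cycle_def using * by metis
  show "y \<in> B" if "same_cycle p x y" using * that unfolding same_cycle_def by metis
qed

text \<open>Every cycle lies inside \<open>B\<close> or inside \<open>D - B\<close>, so a labelling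
  is a distribution of the labels over the two blocks together with a labelling of each. The set
  \<open>I\<close> collects the labels on \<open>B\<close> other than \<open>i\<close>; as
  \<open>a\<close> lies outside, \<open>j\<close> is never among them.\<close>

lemma card_labs_separated:
  assumes fin: "finite D" "finite \<Lambda>" and BD: "B \<subseteq> D" and c: "c \<in> B" and a: "a \<in> D - B"
    and ij: "i \<in> \<Lambda>" "j \<in> \<Lambda>" "i \<noteq> j" and pos: "\<And>k. k \<in> \<Lambda> \<Longrightarrow> \<mu> k > 0"
    and pB: "\<And>x. x \<in> B \<Longrightarrow> p x = pB x" "\<And>x. x \<in> B \<Longrightarrow> p x \<in> B"
    and pA: "\<And>x. x \<in> D - B \<Longrightarrow> p x = pA x" "\<And>x. x \<in> D - B \<Longrightarrow> p x \<in> D - B"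
  shows "card {L \<in> labs D \<Lambda> \<mu> p. L c = i \<and> L a = j} =
    (\<Sum>I\<in>Pow (\<Lambda> - {i,j}). card {L \<in> labs B (insert i I) \<mu> pB. L c = i}
       * card {L \<in> labs (D - B) (\<Lambda> - insert i I) \<mu> pA. L a = j})"
proof -
  let ?S = "{L \<in> labs D \<Lambda> \<mu> p. L c = i \<and> L a = j}"
  let ?X = "\<lambda>I. {L \<in> labs B (insert i I) \<mu> pB. L c = i}"
  let ?Y = "\<lambda>I. {L \<in> labs (D - B) (\<Lambda> - insert i I) \<mu> pA. L a = j}"
  let ?P = "SIGMA I:Pow (\<Lambda> - {i,j}). ?X I \<times> ?Y I"
  let ?f = "\<lambda>L. (L ` B - {i}, restrict L B, restrict L (D - B))"
  let ?g = "\<lambda>(I :: nat set, LB, LA). \<lambda>x. if x \<in> B then LB x else LA x :: nat"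
  have scB: "same_cycle p x y \<longleftrightarrow> same_cycle pB x y" "same_cycle p x y \<Longrightarrow> y \<in> B" if "x \<in> B" for x y
    using same_cycle_restrict[of B p pB x y] pB that by blast+
  have scA: "same_cycle p x y \<longleftrightarrow> same_cycle pA x y" "same_cycle p x y \<Longrightarrow> y \<in> D - B" if "x \<in> D - B" for x y
    using same_cycle_restrict[of "D - B" p pA x y] pA that by blast+
  have bij: "bij_betw ?f ?S ?P"
  proof (rule bij_betw_byWitness[where f' = ?g])
    show "\<forall>L\<in>?S. ?g (?f L) = L"
      using BD by (auto simp: labs_def PiE_iff extensional_def restrict_def fun_eq_iff)
    show "\<forall>x\<in>?P. ?f (?g x) = x"
    proof
      fix x assume x: "x \<in> ?P"
      obtain I LB LA where xe: "x = (I, LB, LA)" by (cases x)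
      have I: "I \<subseteq> \<Lambda> - {i,j}" and LB: "LB \<in> labs B (insert i I) \<mu> pB" and LA: "LA \<in> labs (D - B) (\<Lambda> - insert i I) \<mu> pA"
        using x xe by auto
      have extB: "LB \<in> extensional B" "LB ` B \<subseteq> insert i I" using LB by (auto simp: labs_def PiE_iff)
      have extA: "LA \<in> extensional (D - B)" using LA by (auto simp: labs_def PiE_iff)
      \<comment> \<open>All parts are positive, so every label allotted to \<open>B\<close> occurs
        there, and \<open>I\<close> can be recovered from the image.\<close>
      have "k \<in> LB ` B" if k: "k \<in> insert i I" for k
      proof -
        have "card {x\<in>B. LB x = k} = \<mu> k" using LB k by (auto simp: labs_def)
        moreover have "\<mu> k > 0" using pos k I ij by auto
        ultimately have "{x\<in>B. LB x = k} \<noteq> {}" by (metis card.empty less_numeral_extra(3))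
        then show ?thesis by auto
      qed
      then have "LB ` B = insert i I" using extB by auto
      then have "LB ` B - {i} = I" using I by auto
      moreover have "?g x ` B = LB ` B" using xe by auto
      moreover have "restrict (?g x) B = LB" using extB xe by (auto simp: restrict_def extensional_def fun_eq_iff)
      moreover have "restrict (?g x) (D - B) = LA" using extA xe by (auto simp: restrict_def extensional_def fun_eq_iff)
      ultimately show "?f (?g x) = x" using xe by simp
    qed
    show "?f ` ?S \<subseteq> ?P"
    proof (rule image_subsetI)
      fix L assume LS: "L \<in> ?S"
      then have L: "L \<in> labs D \<Lambda> \<mu> p" "L c = i" "L a = j" by simp_all
      have LPi: "L ` D \<subseteq> \<Lambda>" using L(1) by (auto simp: labs_def PiE_iff)
      have same: "\<And>x y. x \<in> D \<Longrightarrow> y \<in> D \<Longrightarrow> L x = L y \<longleftrightarrow> same_cycle p x y"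
        using L(1) unfolding labs_def by blast
      have crd: "\<And>k. k \<in> \<Lambda> \<Longrightarrow> card {x\<in>D. L x = k} = \<mu> k" using L(1) unfolding labs_def by blast
      have sep: "y \<in> B" if "x \<in> B" "y \<in> D" "L x = L y" for x y
      proof -
        have "same_cycle p x y" using same[of x y] that BD by blast
        then show ?thesis using scB(2)[OF that(1)] by simp
      qed
      have out: "L x \<notin> L ` B" if x: "x \<in> D - B" for x
      proof
        assume "L x \<in> L ` B"
        then obtain y where y: "y \<in> B" "L y = L x" by auto
        have "x \<in> B" by (rule sep[OF y(1) _ y(2)]) (use x in simp)
        then show False using x by simp
      qed
      have jB: "j \<notin> L ` B" using out[OF a] L(3) by simp
      have "L ` B - {i} \<in> Pow (\<Lambda> - {i,j})" using LPi BD jB by blast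
      moreover have "restrict L B \<in> labs B (L ` B) \<mu> pB"
      proof -
        have "restrict L B \<in> B \<rightarrow>\<^sub>E L ` B" by auto
        moreover have "\<forall>x\<in>B. \<forall>y\<in>B. restrict L B x = restrict L B y \<longleftrightarrow> same_cycle pB x y"
        proof (intro ballI)
          fix x y assume xy: "x \<in> B" "y \<in> B"
          then show "restrict L B x = restrict L B y \<longleftrightarrow> same_cycle pB x y"
            using same[of x y] scB(1)[OF xy(1), of y] BD by (simp add: subsetD)
        qed
        moreover have "card {x\<in>B. restrict L B x = k} = \<mu> k" if k: "k \<in> L ` B" for k
        proof -
          obtain y where y: "y \<in> B" "L y = k" using k by auto
          have "{x\<in>B. restrict L B x = k} = {x\<in>D. L x = k}"
          proof (intro Collect_cong iffI)
            fix x assume x: "x \<in> D \<and> L x = k"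
            then have "x \<in> B" using sep[OF y(1), of x] y(2) by simp
            then show "x \<in> B \<and> restrict L B x = k" using x by simp
          qed (use BD in auto)
          moreover have "k \<in> \<Lambda>" using k LPi BD by blast
          ultimately show ?thesis using crd[of k] by simp
        qed
        ultimately show ?thesis unfolding labs_def by blast
      qed
      moreover have "restrict L (D - B) \<in> labs (D - B) (\<Lambda> - L ` B) \<mu> pA"
      proof -
        have "restrict L (D - B) \<in> (D - B) \<rightarrow>\<^sub>E (\<Lambda> - L ` B)"
        proof (rule PiE_I)
          fix x assume x: "x \<in> D - B"
          then show "restrict L (D - B) x \<in> \<Lambda> - L ` B" using out[OF x] LPi by auto
        qed (simp only: restrict_apply if_False)
        moreover have "\<forall>x\<in>D - B. \<forall>y\<in>D - B. restrict L (D - B) x = restrict L (D - B) y \<longleftrightarrow> same_cycle pA x y"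
        proof (intro ballI)
          fix x y assume xy: "x \<in> D - B" "y \<in> D - B"
          show "restrict L (D - B) x = restrict L (D - B) y \<longleftrightarrow> same_cycle pA x y"
            unfolding restrict_apply'[OF xy(1)] restrict_apply'[OF xy(2)]
            using same[of x y] scA(1)[OF xy(1), of y] xy by blast
        qed
        moreover have "card {x\<in>D - B. restrict L (D - B) x = k} = \<mu> k" if k: "k \<in> \<Lambda> - L ` B" for k
        proof -
          have "{x\<in>D - B. restrict L (D - B) x = k} = {x\<in>D. L x = k}"
          proof (intro Collect_cong iffI)
            fix x assume x: "x \<in> D \<and> L x = k"
            then have xB: "x \<in> D - B" using k by blast
            show "x \<in> D - B \<and> restrict L (D - B) x = k"
              unfolding restrict_apply'[OF xB] using x xB by blast
          next
            fix x assume x: "x \<in> D - B \<and> restrict L (D - B) x = k"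
            then have xB: "x \<in> D - B" by blast
            show "x \<in> D \<and> L x = k"
              using x unfolding restrict_apply'[OF xB] by blast
          qed
          then show ?thesis using crd[of k] k by simp
        qed
        ultimately show ?thesis unfolding labs_def by blast
      qed
      moreover have "i \<in> L ` B" using L(2) c by blast
      ultimately show "?f L \<in> ?P" using L(2,3) a c by (simp add: insert_absorb)
    qed
    show "?g ` ?P \<subseteq> ?S"
    proof (rule image_subsetI)
      fix x assume x: "x \<in> ?P"
      obtain I LB LA where xe: "x = (I, LB, LA)" by (cases x)
      have I: "I \<subseteq> \<Lambda> - {i,j}" and LB: "LB \<in> labs B (insert i I) \<mu> pB" "LB c = i"
        and LA: "LA \<in> labs (D - B) (\<Lambda> - insert i I) \<mu> pA" "LA a = j"
        using x unfolding xe by simp_all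
      note LBu = LB(1)[unfolded labs_def mem_Collect_eq] and LAu = LA(1)[unfolded labs_def mem_Collect_eq]
      have PB: "LB \<in> B \<rightarrow>\<^sub>E insert i I" and PA: "LA \<in> (D - B) \<rightarrow>\<^sub>E (\<Lambda> - insert i I)"
        and sB: "\<And>x y. x \<in> B \<Longrightarrow> y \<in> B \<Longrightarrow> LB x = LB y \<longleftrightarrow> same_cycle pB x y"
        and sA: "\<And>x y. x \<in> D - B \<Longrightarrow> y \<in> D - B \<Longrightarrow> LA x = LA y \<longleftrightarrow> same_cycle pA x y"
        and cB: "\<And>k. k \<in> insert i I \<Longrightarrow> card {x\<in>B. LB x = k} = \<mu> k"
        and cA: "\<And>k. k \<in> \<Lambda> - insert i I \<Longrightarrow> card {x\<in>D - B. LA x = k} = \<mu> k"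
        using LBu LAu by blast+
      define L where "L = ?g x"
      have LB': "L y = LB y" "LB y \<in> insert i I" if "y \<in> B" for y
        using that PiE_mem[OF PB that] by (simp_all add: L_def xe)
      have LA': "L y = LA y" "LA y \<in> \<Lambda> - insert i I" if "y \<in> D - B" for y
        using that PiE_mem[OF PA that] by (simp_all add: L_def xe)
      have LBi: "L y \<in> insert i I" if "y \<in> B" for y using LB'[OF that] by simp
      have LAi: "L y \<notin> insert i I" "L y \<in> \<Lambda>" if "y \<in> D - B" for y using LA'[OF that] by simp_all
      have "L \<in> D \<rightarrow>\<^sub>E \<Lambda>"
      proof (rule PiE_I)
        fix y assume y: "y \<in> D"
        show "L y \<in> \<Lambda>"
        proof (cases "y \<in> B")
          case True then show ?thesis using LB'[OF True] I ij by auto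
        next
          case False then show ?thesis using LA'[of y] y by simp
        qed
      next
        fix y assume y: "y \<notin> D"
        then have "y \<notin> B" using BD by blast
        then show "L y = undefined" using PA y by (simp add: L_def xe PiE_iff extensional_def)
      qed
      moreover have "L x = L y \<longleftrightarrow> same_cycle p x y" if "x \<in> D" "y \<in> D" for x y
      proof (cases "x \<in> B"; cases "y \<in> B")
        assume "x \<in> B" "y \<in> B" then show ?thesis using LB'[of x] LB'[of y] sB[of x y] scB(1)[of x y] by simp
      next
        assume *: "x \<in> B" "y \<notin> B"
        have "y \<in> D - B" using * that by simp
        then have "L x \<noteq> L y" using LBi[OF *(1)] LAi(1)[of y] by (intro notI) simp
        moreover have "\<not> same_cycle p x y" using scB(2)[OF *(1), of y] *(2) by (intro notI) simp
        ultimately show ?thesis by simp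
      next
        assume *: "x \<notin> B" "y \<in> B"
        have "x \<in> D - B" using * that by simp
        then have "L x \<noteq> L y" using LBi[OF *(2)] LAi(1)[of x] by (intro notI) simp
        moreover have "\<not> same_cycle p x y" using scA(2)[of x y] * that by (intro notI) simp
        ultimately show ?thesis by simp
      next
        assume "x \<notin> B" "y \<notin> B" then show ?thesis using LA'[of x] LA'[of y] sA[of x y] scA(1)[of x y] that by simp
      qed
      moreover have "card {y\<in>D. L y = k} = \<mu> k" if "k \<in> \<Lambda>" for k
      proof (cases "k \<in> insert i I")
        case True
        have "{y\<in>D. L y = k} = {y\<in>B. LB y = k}"
        proof (intro Collect_cong iffI conjI)
          fix y assume y: "y \<in> D \<and> L y = k"
          show "y \<in> B"
          proof (rule ccontr)
            assume "y \<notin> B"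
            then have "L y \<notin> insert i I" using LAi(1)[of y] y by simp
            then show False using y True by simp
          qed
          then show "LB y = k" using y LB'(1)[of y] by simp
        next
          fix y assume y: "y \<in> B \<and> LB y = k"
          show "y \<in> D" using y BD by auto
          show "L y = k" using y LB'(1)[of y] by simp
        qed
        then show ?thesis using cB True by simp
      next
        case False
        have "{y\<in>D. L y = k} = {y\<in>D - B. LA y = k}"
        proof (intro Collect_cong iffI conjI)
          fix y assume y: "y \<in> D \<and> L y = k"
          show "y \<in> D - B"
          proof (rule ccontr)
            assume "y \<notin> D - B"
            then have "L y \<in> insert i I" using LBi[of y] y by simp
            then show False using y False by simp
          qed
          then show "LA y = k" using y LA'(1)[of y] by simp
        next
          fix y assume y: "y \<in> D - B \<and> LA y = k"
          show "y \<in> D" using y by auto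
          show "L y = k" using y LA'(1)[of y] by simp
        qed
        then show ?thesis using cA False that by simp
      qed
      ultimately have "L \<in> labs D \<Lambda> \<mu> p" unfolding labs_def by blast
      moreover have "L c = i" "L a = j" using LB'(1)[OF c] LA'(1)[OF a] LB(2) LA(2) by simp_all
      ultimately have "L \<in> ?S" by simp
      then show "?g x \<in> ?S" unfolding L_def .
    qed
  qed
  have finX: "finite (?X I)" "finite (?Y I)" if "I \<in> Pow (\<Lambda> - {i,j})" for I
  proof -
    have "finite I" "finite B" using that fin finite_subset[of I \<Lambda>] finite_subset[OF BD] by auto
    then have "finite (labs B (insert i I) \<mu> pB)" "finite (labs (D - B) (\<Lambda> - insert i I) \<mu> pA)"
      using finite_labs fin by auto
    then show "finite (?X I)" "finite (?Y I)" by simp_all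
  qed
  have "card ?S = card ?P" by (rule bij_betw_same_card[OF bij])
  also have "\<dots> = (\<Sum>I\<in>Pow (\<Lambda> - {i,j}). card (?X I \<times> ?Y I))"
    by (rule card_SigmaI) (use fin finX in auto)
  finally show ?thesis by (simp add: card_cartesian_product)
qed

text \<open>When both are nonempty, \<open>B\<close> and its complement are exactly the orbits of
  the sequence; below, \<open>c\<close> lies in \<open>B\<close> and \<open>a\<close>
  outside.\<close>

definition comps :: "nat set \<Rightarrow> (nat \<times> nat) list \<Rightarrow> nat set \<Rightarrow> bool" where
  "comps D ts B \<longleftrightarrow> separated B ts \<and> conn B (inner B ts) \<and> conn (D - B) (outer B ts)"

lemma separatedI: "(\<And>x y. (x, y) \<in> set ts \<Longrightarrow> x \<in> B \<longleftrightarrow> y \<in> B) \<Longrightarrow> separated B ts"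
  by (auto simp: separated_def)

lemma separatedD: "separated B ts \<Longrightarrow> (x, y) \<in> set ts \<Longrightarrow> x \<in> B \<longleftrightarrow> y \<in> B"
  by (auto simp: separated_def)

lemma conn_iff: "conn D ts \<longleftrightarrow> (\<forall>S. S \<subseteq> D \<longrightarrow> separated S ts \<longrightarrow> S = {} \<or> S = D)"
  by (simp only: conn_def separated_def)

lemma connD: "conn D ts \<Longrightarrow> S \<subseteq> D \<Longrightarrow> separated S ts \<Longrightarrow> S = {} \<or> S = D"
  by (simp add: conn_iff)

lemma connI: "(\<And>S. S \<subseteq> D \<Longrightarrow> separated S ts \<Longrightarrow> S = {} \<or> S = D) \<Longrightarrow> conn D ts"
  by (simp add: conn_iff)

lemma conn_inner:
  assumes "conn B (inner B ts)" "separated B ts" "separated S ts"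
  shows "S \<inter> B = {} \<or> S \<inter> B = B"
proof (rule connD[OF assms(1)])
  show "separated (S \<inter> B) (inner B ts)"
  proof (rule separatedI)
    fix x y assume "(x, y) \<in> set (inner B ts)"
    then have "(x, y) \<in> set ts" by simp
    then show "x \<in> S \<inter> B \<longleftrightarrow> y \<in> S \<inter> B"
      using separatedD[OF assms(2), of x y] separatedD[OF assms(3), of x y] by simp
  qed
qed simp

lemma conn_outer:
  assumes "conn (D - B) (outer B ts)" "separated B ts" "separated S ts" "separated D ts"
  shows "S \<inter> (D - B) = {} \<or> S \<inter> (D - B) = D - B"
proof (rule connD[OF assms(1)])
  show "separated (S \<inter> (D - B)) (outer B ts)"
  proof (rule separatedI)
    fix x y assume "(x, y) \<in> set (outer B ts)"
    then have "(x, y) \<in> set ts" by simp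
    then show "x \<in> S \<inter> (D - B) \<longleftrightarrow> y \<in> S \<inter> (D - B)"
      using separatedD[OF assms(2), of x y] separatedD[OF assms(3), of x y]
        separatedD[OF assms(4), of x y] by simp
  qed
qed simp

lemma separated_snoc: "separated S (ts @ [(a, c)]) \<longleftrightarrow> separated S ts \<and> (a \<in> S \<longleftrightarrow> c \<in> S)"
  by (auto simp: separated_def)

lemma separated_Diff: "separated S ts \<Longrightarrow> separated T ts \<Longrightarrow> separated (S - T) ts"
  by (rule separatedI) (auto dest: separatedD)

lemma separated_of_inner:
  assumes "separated S (inner B ts)" "separated B ts" "S \<subseteq> B"
  shows "separated S ts"
proof (rule separatedI)
  fix x y assume xy: "(x, y) \<in> set ts"
  show "x \<in> S \<longleftrightarrow> y \<in> S"
  proof (cases "y \<in> B")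
    case True
    then have "(x, y) \<in> set (inner B ts)" using xy by simp
    then show ?thesis by (rule separatedD[OF assms(1)])
  next
    case False
    then show ?thesis using assms(3) separatedD[OF assms(2) xy] by blast
  qed
qed

lemma separated_of_outer:
  assumes "separated S (outer B ts)" "separated B ts" "S \<inter> B = {}"
  shows "separated S ts"
proof (rule separatedI)
  fix x y assume xy: "(x, y) \<in> set ts"
  show "x \<in> S \<longleftrightarrow> y \<in> S"
  proof (cases "y \<in> B")
    case False
    then have "(x, y) \<in> set (outer B ts)" using xy by simp
    then show ?thesis by (rule separatedD[OF assms(1)])
  next
    case True
    then show ?thesis using assms(3) separatedD[OF assms(2) xy] by blast
  qed
qed

text \<open>An invariant set that does not tell \<open>a\<close> from \<open>c\<close> remains
  invariant when \<open>(a c)\<close> is added, and is therefore trivial. So a proper invariant set,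
  taken on the side of \<open>c\<close>, omits \<open>a\<close>. If it or its complement could be
  divided further, one piece would contain neither of the two points.\<close>

lemma comps_exists:
  assumes ts: "separated D ts" and ac: "a \<in> D" "c \<in> D"
    and nc: "\<not> conn D ts" and cn: "conn D (ts @ [(a, c)])"
  shows "\<exists>B. B \<subseteq> D \<and> c \<in> B \<and> comps D ts B \<and> a \<notin> B"
proof -
  have key: "S = {} \<or> S = D" if "S \<subseteq> D" "separated S ts" "a \<in> S \<longleftrightarrow> c \<in> S" for S
    by (rule connD[OF cn that(1)]) (use that in \<open>simp add: separated_snoc\<close>)
  obtain S0 where S0: "S0 \<subseteq> D" "separated S0 ts" "S0 \<noteq> {}" "S0 \<noteq> D"
    using nc unfolding conn_iff by auto
  define B where "B = (if c \<in> S0 then S0 else D - S0)"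
  have B: "B \<subseteq> D" "separated B ts" "c \<in> B" "B \<noteq> D"
    using S0 separated_Diff[OF ts S0(2)] ac unfolding B_def by auto
  have aB: "a \<notin> B" using key[OF B(1,2)] B by blast
  have "conn B (inner B ts)"
  proof (rule connI)
    fix S assume S: "S \<subseteq> B" "separated S (inner B ts)"
    have S': "separated S ts" by (rule separated_of_inner[OF S(2) B(2) S(1)])
    show "S = {} \<or> S = B"
    proof (cases "c \<in> S")
      case True
      have "B - S = {} \<or> B - S = D"
        by (rule key) (use B(1) aB True separated_Diff[OF B(2) S'] in auto)
      then show ?thesis using S(1) B by blast
    next
      case False
      have "S = {} \<or> S = D" by (rule key) (use B(1) S S' False aB in auto)
      then show ?thesis using False ac by blast
    qed
  qed
  moreover have "conn (D - B) (outer B ts)"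
  proof (rule connI)
    fix S assume S: "S \<subseteq> D - B" "separated S (outer B ts)"
    have S': "separated S ts" by (rule separated_of_outer[OF S(2) B(2)]) (use S(1) in blast)
    show "S = {} \<or> S = D - B"
    proof (cases "a \<in> S")
      case True
      have "D - B - S = {} \<or> D - B - S = D"
        by (rule key) (use B True separated_Diff[OF separated_Diff[OF ts B(2)] S'] in auto)
      then show ?thesis using S(1) True ac by blast
    next
      case False
      have "S = {} \<or> S = D" by (rule key) (use B S S' False in auto)
      then show ?thesis using False ac by blast
    qed
  qed
  ultimately show ?thesis using B aB unfolding comps_def by blast
qed

lemma comps_imp:
  assumes ts: "separated D ts" and ac: "a \<in> D" "c \<in> D"
    and B: "B \<subseteq> D" "c \<in> B" "comps D ts B" "a \<notin> B"
  shows "\<not> conn D ts" "conn D (ts @ [(a, c)])"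
proof -
  have B': "separated B ts" "conn B (inner B ts)" "conn (D - B) (outer B ts)"
    using B(3) by (simp_all add: comps_def)
  show "\<not> conn D ts"
    using connD[OF _ B(1) B'(1)] B ac by blast
  show "conn D (ts @ [(a, c)])"
  proof (rule connI)
    fix S assume S: "S \<subseteq> D" "separated S (ts @ [(a, c)])"
    then have inv: "separated S ts" and aS: "a \<in> S \<longleftrightarrow> c \<in> S" by (simp_all add: separated_snoc)
    have "S \<inter> B = {} \<or> S \<inter> B = B" by (rule conn_inner[OF B'(2,1) inv])
    moreover have "S \<inter> (D - B) = {} \<or> S \<inter> (D - B) = D - B" by (rule conn_outer[OF B'(3,1) inv ts])
    ultimately show "S = {} \<or> S = D" using aS B(1,2,4) S(1) ac by blast
  qed
qed

text \<open>Existence is \<open>comps_exists\<close>; two such blocks meet in \<open>c\<close>, so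
  the connectedness of each makes them equal. Writing the indicator as a cardinality lets the sum
  over sequences be exchanged with a sum over blocks.\<close>

lemma card_comps:
  assumes D: "finite D" and ts: "\<forall>(a,b)\<in>set ts. a \<in> D \<and> b \<in> D" and ac: "a \<in> D" "c \<in> D"
  shows "card {B. B \<subseteq> D \<and> c \<in> B \<and> comps D ts B \<and> a \<notin> B} = of_bool (\<not> conn D ts \<and> conn D (ts @ [(a, c)]))"
    (is "card ?G = _")
proof -
  have sD: "separated D ts" by (rule separatedI) (use ts in auto)
  have uniq: "B = B'" if "B \<in> ?G" "B' \<in> ?G" for B B'
  proof -
    have B: "c \<in> B" "separated B ts" "conn B (inner B ts)" and B': "c \<in> B'" "separated B' ts" "conn B' (inner B' ts)"
      using that by (simp_all add: comps_def)
    have "B' \<inter> B = {} \<or> B' \<inter> B = B" by (rule conn_inner[OF B(3,2) B'(2)])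
    moreover have "B \<inter> B' = {} \<or> B \<inter> B' = B'" by (rule conn_inner[OF B'(3,2) B(2)])
    ultimately show ?thesis using B(1) B'(1) by blast
  qed
  show ?thesis
  proof (cases "\<not> conn D ts \<and> conn D (ts @ [(a, c)])")
    case True
    then obtain B where B: "B \<in> ?G" using comps_exists[OF sD ac] by blast
    have "?G = {B}"
    proof (rule set_eqI)
      fix B' show "B' \<in> ?G \<longleftrightarrow> B' \<in> {B}" using uniq[OF B, of B'] B by auto
    qed
    then have "card ?G = 1" by simp
    then show ?thesis using True by simp
  next
    case False
    have "?G = {}"
    proof (rule equals0I)
      fix B assume "B \<in> ?G"
      then show False using comps_imp[OF sD ac, of B] False by blast
    qed
    then have "card ?G = 0" by (simp only: card.empty)
    then show ?thesis using False by simp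
  qed
qed

text \<open>Grouping by the component \<open>B\<close> of \<open>c\<close> turns each sequence into
  a shuffle of two connected ones. The other end \<open>a\<close> of the removed transposition runs
  through the complement, where \<open>\<mu> j\<close> points have the label \<open>j\<close>; thus
  only the factor for \<open>B\<close> still refers to a point.\<close>

lemma disc_eq:
  assumes D: "finite D" "finite \<Lambda>" and c: "c \<in> D"
    and ij: "i \<in> \<Lambda>" "j \<in> \<Lambda>" "i \<noteq> j" and pos: "\<And>k. k \<in> \<Lambda> \<Longrightarrow> \<mu> k > 0"
  shows "disc m D \<Lambda> \<mu> c i j = (\<Sum>B | B \<subseteq> D \<and> c \<in> B. \<Sum>k\<le>m. \<Sum>I\<in>Pow (\<Lambda> - {i,j}).
      \<mu> j * cntat k B (insert i I) \<mu> c i * cnt (m - k) (D - B) (\<Lambda> - insert i I) \<mu>)"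
proof -
  let ?M = "mono_seqs D m"
  let ?PB = "{B. B \<subseteq> D \<and> c \<in> B}"
  let ?g = "\<lambda>ts a. card {L \<in> labs D \<Lambda> \<mu> (perm_of_list ts). L c = i \<and> L a = j}"
  let ?X = "\<lambda>B I u. card {L \<in> labs B (insert i I) \<mu> (perm_of_list u). L c = i}"
  let ?Y = "\<lambda>B I v. card (labs (D - B) (\<Lambda> - insert i I) \<mu> (perm_of_list v))"
  let ?F = "\<lambda>B u v. of_bool (conn B u \<and> conn (D - B) v) * (\<Sum>I\<in>Pow (\<Lambda> - {i,j}). ?X B I u * (\<mu> j * ?Y B I v))"
  have finM: "finite ?M" by (rule finite_mono_seqs[OF D(1)])
  have finPB: "finite ?PB" using D by simp
  have "disc m D \<Lambda> \<mu> c i j = (\<Sum>ts\<in>?M. \<Sum>a\<in>D. of_bool (\<not> conn D ts \<and> conn D (ts @ [(a, c)])) * ?g ts a)"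
  proof -
    have "disc m D \<Lambda> \<mu> c i j = (\<Sum>ts\<in>?M. if \<not> conn D ts then (\<Sum>a\<in>D. if conn D (ts @ [(a, c)]) then ?g ts a else 0) else 0)"
      unfolding disc_def using finM D(1) by (simp only: sum.inter_filter)
    also have "\<dots> = (\<Sum>ts\<in>?M. \<Sum>a\<in>D. of_bool (\<not> conn D ts \<and> conn D (ts @ [(a, c)])) * ?g ts a)"
      by (intro sum.cong refl) (auto intro!: sum.cong)
    finally show ?thesis .
  qed
  also have "\<dots> = (\<Sum>ts\<in>?M. \<Sum>a\<in>D. \<Sum>B\<in>?PB. of_bool (comps D ts B \<and> a \<notin> B) * ?g ts a)"
  proof (intro sum.cong refl)
    fix ts a assume ts: "ts \<in> ?M" and a: "a \<in> D"
    have "\<forall>(a,b)\<in>set ts. a \<in> D \<and> b \<in> D" using ts by (auto simp: mono_seqs_def)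
    note card_comps[OF D(1) this a c, symmetric]
    also have "{B. B \<subseteq> D \<and> c \<in> B \<and> comps D ts B \<and> a \<notin> B} = ?PB \<inter> {B. comps D ts B \<and> a \<notin> B}" by auto
    also have "card \<dots> = (\<Sum>B\<in>?PB. of_bool (comps D ts B \<and> a \<notin> B))"
      using finPB by simp
    finally show "of_bool (\<not> conn D ts \<and> conn D (ts @ [(a, c)])) * ?g ts a
        = (\<Sum>B\<in>?PB. of_bool (comps D ts B \<and> a \<notin> B) * ?g ts a)"
      by (simp only: sum_distrib_right)
  qed
  also have "\<dots> = (\<Sum>ts\<in>?M. \<Sum>B\<in>?PB. \<Sum>a\<in>D. of_bool (comps D ts B \<and> a \<notin> B) * ?g ts a)"
    by (rule sum.cong[OF refl], rule sum.swap)
  also have "\<dots> = (\<Sum>B\<in>?PB. \<Sum>ts\<in>?M. \<Sum>a\<in>D. of_bool (comps D ts B \<and> a \<notin> B) * ?g ts a)"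
    by (rule sum.swap)
  also have "\<dots> = (\<Sum>B\<in>?PB. \<Sum>ts | ts \<in> ?M \<and> separated B ts. ?F B (inner B ts) (outer B ts))"
  proof (rule sum.cong[OF refl])
    fix B assume "B \<in> ?PB"
    then have B: "B \<subseteq> D" "c \<in> B" by auto
    have "(\<Sum>a\<in>D. of_bool (comps D ts B \<and> a \<notin> B) * ?g ts a) =
        (if separated B ts then ?F B (inner B ts) (outer B ts) else 0)" if ts: "ts \<in> ?M" for ts
    proof (cases "comps D ts B")
      case False then show ?thesis by (auto simp: comps_def)
    next
      case True
      then have sep: "separated B ts" and cn: "conn B (inner B ts)" "conn (D - B) (outer B ts)"
        by (auto simp: comps_def)
      have pD: "perm_of_list ts permutes D" by (rule mono_seqs_permutes[OF ts])
      have inv: "perm_of_list ts x \<in> B \<longleftrightarrow> x \<in> B" for x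
        using perm_of_list_invariant[of ts B x] sep by (simp add: separated_def)
      have "(\<Sum>a\<in>D. of_bool (comps D ts B \<and> a \<notin> B) * ?g ts a) = (\<Sum>a\<in>D - B. ?g ts a)"
        by (rule sum.mono_neutral_cong_right) (use D True in auto)
      also have "\<dots> = (\<Sum>a\<in>D - B. \<Sum>I\<in>Pow (\<Lambda> - {i,j}). ?X B I (inner B ts) *
          card {L \<in> labs (D - B) (\<Lambda> - insert i I) \<mu> (perm_of_list (outer B ts)). L a = j})"
      proof (rule sum.cong[OF refl])
        fix a assume a: "a \<in> D - B"
        show "?g ts a = (\<Sum>I\<in>Pow (\<Lambda> - {i,j}). ?X B I (inner B ts) *
          card {L \<in> labs (D - B) (\<Lambda> - insert i I) \<mu> (perm_of_list (outer B ts)). L a = j})"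
        proof (rule card_labs_separated[OF D B a ij pos])
          fix x
          show "x \<in> B \<Longrightarrow> perm_of_list ts x = perm_of_list (inner B ts) x"
            by (rule perm_of_list_inner[OF sep])
          show "x \<in> D - B \<Longrightarrow> perm_of_list ts x = perm_of_list (outer B ts) x"
            by (rule perm_of_list_outer[OF sep]) simp
          show "x \<in> B \<Longrightarrow> perm_of_list ts x \<in> B" using inv by simp
          show "x \<in> D - B \<Longrightarrow> perm_of_list ts x \<in> D - B" using inv permutes_in_image[OF pD] by simp
        qed
      qed
      also have "\<dots> = (\<Sum>I\<in>Pow (\<Lambda> - {i,j}). ?X B I (inner B ts) *
          (\<Sum>a\<in>D - B. card {L \<in> labs (D - B) (\<Lambda> - insert i I) \<mu> (perm_of_list (outer B ts)). L a = j}))"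
        by (subst sum.swap) (simp only: sum_distrib_left)
      also have "\<dots> = (\<Sum>I\<in>Pow (\<Lambda> - {i,j}). ?X B I (inner B ts) * (\<mu> j * ?Y B I (outer B ts)))"
      proof (rule sum.cong[OF refl])
        fix I assume "I \<in> Pow (\<Lambda> - {i,j})"
        then have "j \<in> \<Lambda> - insert i I" using ij by auto
        then have "(\<Sum>a\<in>D - B. card {L \<in> labs (D - B) (\<Lambda> - insert i I) \<mu> (perm_of_list (outer B ts)). L a = j})
            = \<mu> j * ?Y B I (outer B ts)"
          using sum_card_fibre[of "D - B" "\<Lambda> - insert i I" j "labs (D - B) (\<Lambda> - insert i I) \<mu> (perm_of_list (outer B ts))"
            \<mu> "perm_of_list (outer B ts)" "\<lambda>_. True"] D by simp
        then show "?X B I (inner B ts) * (\<Sum>a\<in>D - B. card {L \<in> labs (D - B) (\<Lambda> - insert i I) \<mu> (perm_of_list (outer B ts)). L a = j})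
          = ?X B I (inner B ts) * (\<mu> j * ?Y B I (outer B ts))" by (simp only:)
      qed
      finally show ?thesis using sep cn by simp
    qed
    then have "(\<Sum>ts\<in>?M. \<Sum>a\<in>D. of_bool (comps D ts B \<and> a \<notin> B) * ?g ts a)
        = (\<Sum>ts\<in>?M. if separated B ts then ?F B (inner B ts) (outer B ts) else 0)"
      by (rule sum.cong[OF refl])
    also have "\<dots> = (\<Sum>ts | ts \<in> ?M \<and> separated B ts. ?F B (inner B ts) (outer B ts))"
      by (rule sum.inter_filter[OF finM, symmetric])
    finally show "(\<Sum>ts\<in>?M. \<Sum>a\<in>D. of_bool (comps D ts B \<and> a \<notin> B) * ?g ts a)
        = (\<Sum>ts | ts \<in> ?M \<and> separated B ts. ?F B (inner B ts) (outer B ts))" .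
  qed
  also have "\<dots> = (\<Sum>B\<in>?PB. \<Sum>k\<le>m. \<Sum>u\<in>mono_seqs B k. \<Sum>v\<in>mono_seqs (D - B) (m - k). ?F B u v)"
    by (rule sum.cong[OF refl], rule sum_separated[OF D(1)]) simp
  also have "\<dots> = (\<Sum>B\<in>?PB. \<Sum>k\<le>m. \<Sum>I\<in>Pow (\<Lambda> - {i,j}).
      \<mu> j * cntat k B (insert i I) \<mu> c i * cnt (m - k) (D - B) (\<Lambda> - insert i I) \<mu>)"
  proof (intro sum.cong refl)
    fix B k assume "B \<in> ?PB" and k: "k \<in> {..m}"
    then have B: "B \<subseteq> D" "c \<in> B" by auto
    have f1: "finite (mono_seqs B k)" "finite (mono_seqs (D - B) (m - k))"
      using finite_mono_seqs finite_subset[OF B(1) D(1)] D(1) by auto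
    have e1: "(\<Sum>u\<in>mono_seqs B k. of_bool (conn B u) * ?X B I u) = cntat k B (insert i I) \<mu> c i" for I
      unfolding cntat_def using sum.inter_filter[OF f1(1), of "?X B I" "conn B"]
      by (simp add: of_bool_def if_distrib[of "\<lambda>x. x * _"] cong: if_cong)
    have e2: "(\<Sum>v\<in>mono_seqs (D - B) (m - k). of_bool (conn (D - B) v) * ?Y B I v) = cnt (m - k) (D - B) (\<Lambda> - insert i I) \<mu>" for I
      unfolding cnt_def using sum.inter_filter[OF f1(2), of "?Y B I" "conn (D - B)"]
      by (simp add: of_bool_def if_distrib[of "\<lambda>x. x * _"] cong: if_cong)
    have "(\<Sum>u\<in>mono_seqs B k. \<Sum>v\<in>mono_seqs (D - B) (m - k). ?F B u v)
      = (\<Sum>u\<in>mono_seqs B k. \<Sum>v\<in>mono_seqs (D - B) (m - k). \<Sum>I\<in>Pow (\<Lambda> - {i,j}).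
          \<mu> j * ((of_bool (conn B u) * ?X B I u) * (of_bool (conn (D - B) v) * ?Y B I v)))"
      by (intro sum.cong refl) (simp only: sum_distrib_left of_bool_conj ac_simps)
    also have "\<dots> = (\<Sum>u\<in>mono_seqs B k. \<Sum>I\<in>Pow (\<Lambda> - {i,j}). \<Sum>v\<in>mono_seqs (D - B) (m - k).
          \<mu> j * ((of_bool (conn B u) * ?X B I u) * (of_bool (conn (D - B) v) * ?Y B I v)))"
      by (rule sum.cong[OF refl], rule sum.swap)
    also have "\<dots> = (\<Sum>I\<in>Pow (\<Lambda> - {i,j}). \<Sum>u\<in>mono_seqs B k. \<Sum>v\<in>mono_seqs (D - B) (m - k).
          \<mu> j * ((of_bool (conn B u) * ?X B I u) * (of_bool (conn (D - B) v) * ?Y B I v)))"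
      by (rule sum.swap)
    also have "\<dots> = (\<Sum>I\<in>Pow (\<Lambda> - {i,j}). \<mu> j * ((\<Sum>u\<in>mono_seqs B k. of_bool (conn B u) * ?X B I u)
          * (\<Sum>v\<in>mono_seqs (D - B) (m - k). of_bool (conn (D - B) v) * ?Y B I v)))"
      by (intro sum.cong refl) (simp only: sum_distrib_left[symmetric] sum_product)
    finally show "(\<Sum>u\<in>mono_seqs B k. \<Sum>v\<in>mono_seqs (D - B) (m - k). ?F B u v) =
        (\<Sum>I\<in>Pow (\<Lambda> - {i,j}). \<mu> j * cntat k B (insert i I) \<mu> c i * cnt (m - k) (D - B) (\<Lambda> - insert i I) \<mu>)"
      by (simp only: e1 e2 mult.assoc)
  qed
  finally show ?thesis .
qed

section \<open>Symmetric polynomials in the Jucys-Murphy elements\<close>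

text \<open>A state records a permutation together with the family of sets that are invariant under the
  transpositions multiplied so far. Carrying the second component makes the Jucys-Murphy
  argument work for connected sequences.\<close>
type_synonym walk_state = "(nat \<Rightarrow> nat) \<times> nat set set"

definition walk_step :: "nat \<times> nat \<Rightarrow> walk_state \<Rightarrow> walk_state" where
  "walk_step t st = (fst st \<circ> Transposition.transpose (fst t) (snd t), {S \<in> snd st. fst t \<in> S \<longleftrightarrow> snd t \<in> S})"

text \<open>Multiplication by a Jucys-Murphy element, the sum of the transpositions
  \<open>(a k)\<close> with \<open>a < k\<close>, transposed to functions of states. Points start at
  0, so the element with index 0 vanishes.\<close>

definition jm :: "nat \<Rightarrow> (walk_state \<Rightarrow> int) \<Rightarrow> walk_state \<Rightarrow> int" where
  "jm k F st = (\<Sum>a<k. F (walk_step (a, k) st))"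

text \<open>The complete homogeneous polynomial of degree \<open>m\<close> in the first
  \<open>d\<close> Jucys-Murphy elements, by h_m(x_0, ..., x_d) = h_m(x_0, ..., x_{d-1}) + x_d
  h_{m-1}(x_0, ..., x_d). It acts on functions, so the last transposition of a walk is the one
  applied to \<open>F\<close> first.\<close>

fun jm_complete :: "nat \<Rightarrow> nat \<Rightarrow> (walk_state \<Rightarrow> int) \<Rightarrow> walk_state \<Rightarrow> int" where
  "jm_complete d 0 F = F"
| "jm_complete 0 (Suc m) F = (\<lambda>_. 0)"
| "jm_complete (Suc d) (Suc m) F = (\<lambda>st. jm_complete d (Suc m) F st + jm_complete (Suc d) m (jm d F) st)"

definition walk :: "walk_state \<Rightarrow> (nat \<times> nat) list \<Rightarrow> walk_state" where
  "walk st ts = foldl (\<lambda>st t. walk_step t st) st ts"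

lemma walk_eq: "walk (q, R) ts = (q \<circ> perm_of_list ts, {S \<in> R. \<forall>(a,b)\<in>set ts. a \<in> S \<longleftrightarrow> b \<in> S})"
proof (induction ts arbitrary: q R)
  case (Cons t ts)
  have "walk (q, R) (t # ts) = walk (walk_step t (q, R)) ts" by (simp add: walk_def)
  also have "\<dots> = walk (q \<circ> Transposition.transpose (fst t) (snd t), {S \<in> R. fst t \<in> S \<longleftrightarrow> snd t \<in> S}) ts"
    by (simp add: walk_step_def)
  also have "\<dots> = (q \<circ> perm_of_list (t # ts), {S \<in> R. \<forall>(a,b)\<in>set (t # ts). a \<in> S \<longleftrightarrow> b \<in> S})"
    unfolding Cons.IH by (auto simp: comp_assoc)
  finally show ?case .
qed (simp add: walk_def)

lemma walk_snoc: "walk st (ts @ [t]) = walk_step t (walk st ts)"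
  by (simp add: walk_def)

lemma mono_seqs_0: "mono_seqs D 0 = {[]}"
  by (auto simp: mono_seqs_def)

lemma mono_seqs_empty: "mono_seqs {} (Suc m) = {}"
proof (rule equals0I)
  fix ts assume ts: "ts \<in> mono_seqs {} (Suc m)"
  then obtain a b us where "ts = (a, b) # us" by (cases ts) (auto simp: mono_seqs_def)
  then show False using ts unfolding mono_seqs_def by auto
qed

lemma mono_seqs_lessThan_Suc:
  "mono_seqs {..<Suc d} (Suc m) =
     mono_seqs {..<d} (Suc m) \<union> (\<lambda>(ts, a). ts @ [(a, d)]) ` (mono_seqs {..<Suc d} m \<times> {..<d})"
  (is "?A = ?B \<union> ?f ` ?C")
proof
  show "?B \<union> ?f ` ?C \<subseteq> ?A"
    by (fastforce simp: mono_seqs_def sorted_append)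
  show "?A \<subseteq> ?B \<union> ?f ` ?C"
  proof
    fix us assume us: "us \<in> ?A"
    then have "us \<noteq> []" by (auto simp: mono_seqs_def)
    then obtain ts a b where t: "us = ts @ [(a, b)]" by (metis append_butlast_last_id surj_pair)
    have h: "a < b" "b < Suc d" "length ts = m" "\<forall>(x,y)\<in>set ts. x < y \<and> x < Suc d \<and> y < Suc d"
      "sorted (map snd ts)" "\<forall>x\<in>set ts. snd x \<le> b"
      using us t by (auto simp: mono_seqs_def sorted_append)
    show "us \<in> ?B \<union> ?f ` ?C"
    proof (cases "b = d")
      case True
      have "(ts, a) \<in> ?C" using h True by (auto simp: mono_seqs_def)
      then have "?f (ts, a) \<in> ?f ` ?C" by (rule imageI)
      then show ?thesis using t True by simp
    next
      case False
      have "\<forall>(x,y)\<in>set us. x < y \<and> x < d \<and> y < d"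
      proof clarify
        fix x y assume "(x, y) \<in> set us"
        then have "x < y" "y \<le> b" using h t by auto
        then show "x < y \<and> x < d \<and> y < d" using h(2) False by auto
      qed
      then have "us \<in> ?B" using us by (auto simp: mono_seqs_def)
      then show ?thesis by simp
    qed
  qed
qed

text \<open>Expanding the polynomial into monomials lists each weakly increasing choice of larger
  entries once, and expanding the elements chooses the smaller entries.\<close>

lemma sum_mono_seqs:
  "(\<Sum>ts\<in>mono_seqs {..<d} m. F (walk st ts)) = jm_complete d m F st"
proof (induction d m F arbitrary: st rule: jm_complete.induct)
  case (1 d F)
  then show ?case by (simp add: mono_seqs_0 walk_def)
next
  case (2 m F)
  then show ?case by (simp add: mono_seqs_empty)
next
  case (3 d m F)
  let ?f = "\<lambda>(ts, a). ts @ [(a, d)]"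
  let ?C = "mono_seqs {..<Suc d} m \<times> {..<d}"
  have inj: "inj_on ?f ?C" by (auto simp: inj_on_def)
  have "(\<Sum>ts\<in>mono_seqs {..<Suc d} (Suc m). F (walk st ts)) =
     (\<Sum>ts\<in>mono_seqs {..<d} (Suc m). F (walk st ts)) + (\<Sum>ts\<in>?f ` ?C. F (walk st ts))"
    unfolding mono_seqs_lessThan_Suc
  proof (rule sum.union_disjoint)
    show "mono_seqs {..<d} (Suc m) \<inter> ?f ` ?C = {}" by (auto simp: mono_seqs_def)
  qed (auto intro: finite_mono_seqs)
  also have "(\<Sum>ts\<in>?f ` ?C. F (walk st ts)) = (\<Sum>(ts, a)\<in>?C. F (walk_step (a, d) (walk st ts)))"
    by (subst sum.reindex[OF inj]) (simp add: case_prod_unfold walk_snoc)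
  also have "\<dots> = (\<Sum>ts\<in>mono_seqs {..<Suc d} m. jm d F (walk st ts))"
    by (simp add: sum.cartesian_product jm_def)
  finally show ?case using 3 by simp
qed

lemma jm_complete_add:
  "jm_complete d m (\<lambda>st. F st + G st) st = jm_complete d m F st + jm_complete d m G st"
proof (induction d m F arbitrary: G st rule: jm_complete.induct)
  case (3 d m F)
  have "jm d (\<lambda>st. F st + G st) = (\<lambda>st. jm d F st + jm d G st)"
    by (simp add: jm_def sum.distrib fun_eq_iff)
  then show ?case using 3 by simp
qed simp_all

text \<open>Conjugation by neighbouring transpositions suffices, since they carry any point to any
  other.\<close>

definition adj :: "nat \<Rightarrow> nat \<Rightarrow> nat" where "adj i = Transposition.transpose i (Suc i)"

definition conj_state :: "nat \<Rightarrow> walk_state \<Rightarrow> walk_state" where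
  "conj_state i st = (adj i \<circ> fst st \<circ> adj i, image (adj i) ` snd st)"

lemma adj_adj [simp]: "adj i (adj i x) = x" "adj i \<circ> adj i = id"
  by (simp_all add: adj_def)

lemma inj_adj: "inj (adj i)" by (rule inj_on_inverseI[where g = "adj i"]) simp

lemma conj_step: "conj_state i (walk_step (a, b) st) = walk_step (adj i a, adj i b) (conj_state i st)"
proof -
  have "Transposition.transpose a b \<circ> adj i = adj i \<circ> Transposition.transpose (adj i a) (adj i b)"
  proof
    fix x
    have "adj i x = a \<longleftrightarrow> x = adj i a" "adj i x = b \<longleftrightarrow> x = adj i b" by (metis adj_adj(1))+
    then show "(Transposition.transpose a b \<circ> adj i) x = (adj i \<circ> Transposition.transpose (adj i a) (adj i b)) x"
      by (simp add: Transposition.transpose_def)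
  qed
  then have 1: "adj i \<circ> (fst st \<circ> Transposition.transpose a b) \<circ> adj i
      = adj i \<circ> fst st \<circ> adj i \<circ> Transposition.transpose (adj i a) (adj i b)"
    by (simp add: comp_assoc)
  have key: "(a \<in> S \<longleftrightarrow> b \<in> S) \<longleftrightarrow> (adj i a \<in> adj i ` S \<longleftrightarrow> adj i b \<in> adj i ` S)" for S
    unfolding inj_image_mem_iff[OF inj_adj] ..
  then have 2: "image (adj i) ` {S \<in> R. a \<in> S \<longleftrightarrow> b \<in> S} = {S \<in> image (adj i) ` R. adj i a \<in> S \<longleftrightarrow> adj i b \<in> S}" for R
    unfolding key by blast
  show ?thesis using 1 2 by (simp add: conj_state_def walk_step_def)
qed

lemma walk_step_commute:
  "walk_step (b, a) st = walk_step (a, b) st"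
  by (auto simp: walk_step_def transpose_commute)

lemma walk_step_disjoint:
  assumes "a \<noteq> b" "a \<noteq> i" "b \<noteq> j" "i \<noteq> j"
  shows "walk_step (a, j) (walk_step (b, i) st) = walk_step (b, i) (walk_step (a, j) st)"
proof -
  have "Transposition.transpose b i \<circ> Transposition.transpose a j = Transposition.transpose a j \<circ> Transposition.transpose b i"
    using assms by (auto simp: Transposition.transpose_def fun_eq_iff)
  then show ?thesis by (auto simp: walk_step_def comp_assoc)
qed

text \<open>Any two different transpositions of three points impose the same condition on invariant
  sets, so these relations of the symmetric group also hold in the second component.\<close>

lemma walk_step_triangle:
  assumes "a \<noteq> i" "a \<noteq> j" "i \<noteq> j"
  shows "walk_step (a, j) (walk_step (a, i) st) = walk_step (a, i) (walk_step (i, j) st)"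
    and "walk_step (a, j) (walk_step (i, j) st) = walk_step (a, i) (walk_step (a, j) st)"
proof -
  have "Transposition.transpose a i \<circ> Transposition.transpose a j = Transposition.transpose i j \<circ> Transposition.transpose a i"
    "Transposition.transpose i j \<circ> Transposition.transpose a j = Transposition.transpose a j \<circ> Transposition.transpose a i"
    using assms by (auto simp: Transposition.transpose_def fun_eq_iff)
  then show "walk_step (a, j) (walk_step (a, i) st) = walk_step (a, i) (walk_step (i, j) st)"
    "walk_step (a, j) (walk_step (i, j) st) = walk_step (a, i) (walk_step (a, j) st)"
    by (auto simp: walk_step_def comp_assoc)
qed

lemma adj_apply [simp]: "adj i i = Suc i" "adj i (Suc i) = i" "x \<noteq> i \<Longrightarrow> x \<noteq> Suc i \<Longrightarrow> adj i x = x"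
  by (simp_all add: adj_def)

lemma jm_conj_below: "k < i \<Longrightarrow> jm k (\<lambda>st. F (conj_state i st)) = (\<lambda>st. jm k F (conj_state i st))"
  by (simp add: jm_def conj_step fun_eq_iff)

text \<open>Conjugation fixes \<open>k\<close> and only permutes the smaller entries of the
  transpositions in the sum.\<close>

lemma jm_conj_above:
  assumes "Suc i < k"
  shows "jm k (\<lambda>st. F (conj_state i st)) = (\<lambda>st. jm k F (conj_state i st))"
proof
  fix st
  have bij: "bij_betw (adj i) {..<k} {..<k}"
    by (rule bij_betw_byWitness[where f' = "adj i"])
      (use assms in \<open>auto simp: adj_def Transposition.transpose_def\<close>)
  have "jm k (\<lambda>st. F (conj_state i st)) st = (\<Sum>a<k. F (walk_step (adj i a, k) (conj_state i st)))"
    using assms by (simp add: jm_def conj_step)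
  also have "\<dots> = jm k F (conj_state i st)"
    unfolding jm_def by (rule sum.reindex_bij_betw[OF bij])
  finally show "jm k (\<lambda>st. F (conj_state i st)) st = jm k F (conj_state i st)" .
qed

text \<open>Conjugation exchanges \<open>(a, i)\<close> with \<open>(a, Suc i)\<close> for
  \<open>a < i\<close> and fixes \<open>(i, Suc i)\<close>, so it permutes the terms of the two
  elements taken together.\<close>

lemma jm_conj_e1:
  "jm i (\<lambda>st. F (conj_state i st)) st + jm (Suc i) (\<lambda>st. F (conj_state i st)) st
    = jm i F (conj_state i st) + jm (Suc i) F (conj_state i st)"
  by (simp add: jm_def conj_step walk_step_commute[of "Suc i" i])

lemma sum_off_diagonal:
  fixes G :: "nat \<Rightarrow> nat \<Rightarrow> int"
  shows "(\<Sum>b<i. \<Sum>a<i. G b a) = (\<Sum>b<i. \<Sum>a<i. if a = b then 0 else G b a) + (\<Sum>a<i. G a a)"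
proof -
  have "(\<Sum>a<i. G b a) = (\<Sum>a<i. if a = b then 0 else G b a) + G b b" if "b < i" for b
  proof -
    have "(\<Sum>a<i. G b a) = (\<Sum>a<i. (if a = b then 0 else G b a) + (if a = b then G b b else 0))"
      by (intro sum.cong refl) auto
    then show ?thesis using that by (simp add: sum.distrib)
  qed
  then show ?thesis by (simp add: sum.distrib)
qed

text \<open>In the product of the two elements, terms with distinct smaller entries consist of
  commuting transpositions. Terms with equal smaller entries are exchanged with those containing
  \<open>(i, Suc i)\<close>, by the triangle relations.\<close>

lemma jm_conj_e2:
  "jm (Suc i) (jm i (\<lambda>st. F (conj_state i st))) st = jm (Suc i) (jm i F) (conj_state i st)"
proof -
  define u where "u = conj_state i st"
  let ?j = "Suc i"
  have "jm ?j (jm i (\<lambda>st. F (conj_state i st))) st =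
     (\<Sum>b<i. \<Sum>a<i. F (walk_step (a, ?j) (walk_step (b, i) u))) + (\<Sum>a<i. F (walk_step (a, ?j) (walk_step (i, ?j) u)))"
    by (simp add: jm_def conj_step u_def walk_step_commute[of ?j i])
  also have "(\<Sum>b<i. \<Sum>a<i. F (walk_step (a, ?j) (walk_step (b, i) u))) =
     (\<Sum>b<i. \<Sum>a<i. if a = b then 0 else F (walk_step (a, ?j) (walk_step (b, i) u)))
     + (\<Sum>a<i. F (walk_step (a, ?j) (walk_step (a, i) u)))"
    by (rule sum_off_diagonal)
  also have "(\<Sum>b<i. \<Sum>a<i. if a = b then 0 else F (walk_step (a, ?j) (walk_step (b, i) u)))
     = (\<Sum>b<i. \<Sum>a<i. if b = a then 0 else F (walk_step (b, i) (walk_step (a, ?j) u)))"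
    by (intro sum.cong refl) (auto simp: walk_step_disjoint)
  also have "\<dots> = (\<Sum>a<i. \<Sum>b<i. if b = a then 0 else F (walk_step (b, i) (walk_step (a, ?j) u)))"
    by (rule sum.swap)
  also have "(\<Sum>a<i. F (walk_step (a, ?j) (walk_step (a, i) u))) = (\<Sum>a<i. F (walk_step (a, i) (walk_step (i, ?j) u)))"
    by (intro sum.cong refl) (simp add: walk_step_triangle(1))
  also have "(\<Sum>a<i. F (walk_step (a, ?j) (walk_step (i, ?j) u))) = (\<Sum>a<i. F (walk_step (a, i) (walk_step (a, ?j) u)))"
    by (intro sum.cong refl) (simp add: walk_step_triangle(2))
  finally have "jm ?j (jm i (\<lambda>st. F (conj_state i st))) st =
     (\<Sum>b<i. \<Sum>a<i. F (walk_step (a, i) (walk_step (b, ?j) u))) + (\<Sum>a<i. F (walk_step (a, i) (walk_step (i, ?j) u)))"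
    by (simp add: sum_off_diagonal[of "\<lambda>b a. F (walk_step (a, i) (walk_step (b, ?j) u))" i])
  also have "\<dots> = jm ?j (jm i F) u" by (simp add: jm_def)
  finally show ?thesis by (simp add: u_def)
qed

text \<open>The complete symmetric polynomials satisfy a three-term recurrence in the two
  variables attached to the exchanged indices, whose coefficients are invariant.\<close>
lemma jm_complete_three_term:
  "jm_complete (Suc (Suc i)) (Suc (Suc m)) F st = jm_complete i (Suc (Suc m)) F st
     + jm_complete (Suc (Suc i)) (Suc m) (\<lambda>st. jm i F st + jm (Suc i) F st) st
     - jm_complete (Suc (Suc i)) m (jm (Suc i) (jm i F)) st"
proof -
  have "jm_complete (Suc (Suc i)) (Suc m) (\<lambda>st. jm i F st + jm (Suc i) F st) st
     = jm_complete (Suc (Suc i)) (Suc m) (jm i F) st + jm_complete (Suc (Suc i)) (Suc m) (jm (Suc i) F) st"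
    by (rule jm_complete_add)
  moreover have "jm_complete (Suc (Suc i)) (Suc m) (jm i F) st
     = jm_complete (Suc i) (Suc m) (jm i F) st + jm_complete (Suc (Suc i)) m (jm (Suc i) (jm i F)) st"
    by (simp only: jm_complete.simps)
  moreover have "jm_complete (Suc (Suc i)) (Suc (Suc m)) F st = jm_complete (Suc i) (Suc (Suc m)) F st
     + jm_complete (Suc (Suc i)) (Suc m) (jm (Suc i) F) st"
    by (simp only: jm_complete.simps)
  moreover have "jm_complete (Suc i) (Suc (Suc m)) F st = jm_complete i (Suc (Suc m)) F st + jm_complete (Suc i) (Suc m) (jm i F) st"
    by (simp only: jm_complete.simps)
  ultimately show ?thesis by linarith
qed

lemma jm_complete_conj_below:
  "d \<le> i \<Longrightarrow> jm_complete d m (\<lambda>st. F (conj_state i st)) st = jm_complete d m F (conj_state i st)"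
proof (induction d m F arbitrary: st rule: jm_complete.induct)
  case (3 d m F)
  then have "jm d (\<lambda>st. F (conj_state i st)) = (\<lambda>st. jm d F (conj_state i st))" by (simp add: jm_conj_below)
  then show ?case using 3 by simp
qed simp_all

text \<open>The three-term recurrence contains the two elements only through their sum and product,
  which are invariant. Degrees 0 and 1 start an induction in which the degree drops by one or
  two.\<close>

lemma jm_complete_conj_base:
  "jm_complete (Suc (Suc i)) m (\<lambda>st. F (conj_state i st)) st = jm_complete (Suc (Suc i)) m F (conj_state i st)"
proof (induction m arbitrary: F st rule: less_induct)
  case (less m)
  note below = jm_complete_conj_below[of i i]
  consider "m = 0" | "m = 1" | k where "m = Suc (Suc k)" by (metis One_nat_def not0_implies_Suc)
  then show ?case
  proof cases
    case 2
    then show ?thesis using jm_conj_e1[of i F st] below[of "Suc 0" F st] by simp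
  next
    case 3
    have e1: "(\<lambda>st. jm i (\<lambda>st. F (conj_state i st)) st + jm (Suc i) (\<lambda>st. F (conj_state i st)) st)
       = (\<lambda>st. (\<lambda>st. jm i F st + jm (Suc i) F st) (conj_state i st))" by (simp add: jm_conj_e1 fun_eq_iff)
    have e2: "jm (Suc i) (jm i (\<lambda>st. F (conj_state i st))) = (\<lambda>st. jm (Suc i) (jm i F) (conj_state i st))"
      by (simp add: jm_conj_e2 fun_eq_iff)
    have i1: "jm_complete (Suc (Suc i)) (Suc k) (\<lambda>st. jm i F (conj_state i st) + jm (Suc i) F (conj_state i st)) st
       = jm_complete (Suc (Suc i)) (Suc k) (\<lambda>st. jm i F st + jm (Suc i) F st) (conj_state i st)"
      by (rule less.IH) (simp add: 3)
    have i2: "jm_complete (Suc (Suc i)) k (\<lambda>st. jm (Suc i) (jm i F) (conj_state i st)) st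
       = jm_complete (Suc (Suc i)) k (jm (Suc i) (jm i F)) (conj_state i st)"
      by (rule less.IH) (simp add: 3)
    have b: "jm_complete i (Suc (Suc k)) (\<lambda>st. F (conj_state i st)) st = jm_complete i (Suc (Suc k)) F (conj_state i st)"
      by (rule below) simp
    show ?thesis
      unfolding 3 jm_complete_three_term e1 e2 i1 i2 b ..
  qed simp
qed

text \<open>Elements with index above \<open>Suc i\<close> commute with the conjugation, so the
  number of variables can be raised one at a time.\<close>

lemma jm_complete_conj:
  assumes "Suc i < d"
  shows "jm_complete d m (\<lambda>st. F (conj_state i st)) st = jm_complete d m F (conj_state i st)"
  using assms
proof (induction d m F arbitrary: st rule: jm_complete.induct)
  case (3 d m F)
  show ?case
  proof (cases "d = Suc i")
    case True
    show ?thesis unfolding True by (rule jm_complete_conj_base)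
  next
    case False
    then have "Suc i < d" using 3 by simp
    then have "jm d (\<lambda>st. F (conj_state i st)) = (\<lambda>st. jm d F (conj_state i st))" by (simp add: jm_conj_above)
    then show ?thesis using 3 \<open>Suc i < d\<close> by simp
  qed
qed simp_all

text \<open>The walk starts from all sets of numbers, not just those inside \<open>D\<close>, so
  that its initial state is invariant under conjugation. Connectedness is then tested on
  intersections with \<open>D\<close>.\<close>

lemma conn_walk:
  assumes "ts \<in> mono_seqs D m"
  shows "conn D ts \<longleftrightarrow> (\<forall>S\<in>snd (walk (id, UNIV) ts). S \<inter> D = {} \<or> D \<subseteq> S)"
proof -
  have sD: "separated D ts" by (rule separatedI) (use assms in \<open>auto simp: mono_seqs_def\<close>)
  have eq: "S \<in> snd (walk (id, UNIV) ts) \<longleftrightarrow> separated S ts" for S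
    by (simp add: walk_eq separated_def)
  show ?thesis
    unfolding eq Ball_def
  proof (intro iffI allI impI)
    fix S assume c: "conn D ts" and S: "separated S ts"
    have "separated (S \<inter> D) ts" by (rule separatedI) (use separatedD[OF S] separatedD[OF sD] in auto)
    then have "S \<inter> D = {} \<or> S \<inter> D = D" using connD[OF c, of "S \<inter> D"] by simp
    then show "S \<inter> D = {} \<or> D \<subseteq> S" by blast
  next
    assume h: "\<forall>S. separated S ts \<longrightarrow> S \<inter> D = {} \<or> D \<subseteq> S"
    show "conn D ts"
    proof (rule connI)
      fix S assume "S \<subseteq> D" "separated S ts"
      then show "S = {} \<or> S = D" using h by blast
    qed
  qed
qed

lemma same_cycle_conj:
  "same_cycle (adj i \<circ> q \<circ> adj i) x y \<longleftrightarrow> same_cycle q (adj i x) (adj i y)"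
proof -
  have "((adj i \<circ> q \<circ> adj i) ^^ k) x = adj i ((q ^^ k) (adj i x))" for k
    by (induction k) simp_all
  then show ?thesis unfolding same_cycle_def by (metis adj_adj(1))
qed

lemma labs_conj_into:
  assumes d: "Suc i < d" and L: "L \<in> labs {..<d} \<Lambda> \<mu> (adj i \<circ> q \<circ> adj i)"
  shows "L \<circ> adj i \<in> labs {..<d} \<Lambda> \<mu> q"
proof -
  have adj_lt: "adj i x < d \<longleftrightarrow> x < d" for x
    using d by (auto simp: adj_def Transposition.transpose_def)
  note Lu = L[unfolded labs_def mem_Collect_eq]
  have P: "L \<in> {..<d} \<rightarrow>\<^sub>E \<Lambda>" and same: "\<And>x y. x < d \<Longrightarrow> y < d \<Longrightarrow> L x = L y \<longleftrightarrow> same_cycle (adj i \<circ> q \<circ> adj i) x y"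
    and crd: "\<And>k. k \<in> \<Lambda> \<Longrightarrow> card {x\<in>{..<d}. L x = k} = \<mu> k"
    using Lu by (auto simp del: o_apply)
  have "L \<circ> adj i \<in> {..<d} \<rightarrow>\<^sub>E \<Lambda>"
    using P adj_lt by (auto simp: PiE_iff extensional_def)
  moreover have "(L \<circ> adj i) x = (L \<circ> adj i) y \<longleftrightarrow> same_cycle q x y" if "x \<in> {..<d}" "y \<in> {..<d}" for x y
    using same[of "adj i x" "adj i y"] adj_lt that unfolding same_cycle_conj by simp
  moreover have "card {x\<in>{..<d}. (L \<circ> adj i) x = k} = \<mu> k" if "k \<in> \<Lambda>" for k
  proof -
    have "bij_betw (adj i) {x\<in>{..<d}. (L \<circ> adj i) x = k} {x\<in>{..<d}. L x = k}"
      by (rule bij_betw_byWitness[where f' = "adj i"]) (auto simp: adj_lt)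
    from bij_betw_same_card[OF this] crd[OF that] show ?thesis by simp
  qed
  ultimately show ?thesis unfolding labs_def by blast
qed

lemma card_labs_conj:
  assumes d: "Suc i < d"
  shows "card {L \<in> labs {..<d} \<Lambda> \<mu> (adj i \<circ> q \<circ> adj i). L x = k} = card {L \<in> labs {..<d} \<Lambda> \<mu> q. L (adj i x) = k}"
proof (rule bij_betw_same_card, rule bij_betw_byWitness[where f = "\<lambda>L. L \<circ> adj i" and f' = "\<lambda>L. L \<circ> adj i"])
  show "(\<lambda>L. L \<circ> adj i) ` {L \<in> labs {..<d} \<Lambda> \<mu> (adj i \<circ> q \<circ> adj i). L x = k} \<subseteq> {L \<in> labs {..<d} \<Lambda> \<mu> q. L (adj i x) = k}"
    using labs_conj_into[OF d] by auto
  have "adj i \<circ> (adj i \<circ> q \<circ> adj i) \<circ> adj i = q" by (simp add: fun_eq_iff)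
  then show "(\<lambda>L. L \<circ> adj i) ` {L \<in> labs {..<d} \<Lambda> \<mu> q. L (adj i x) = k} \<subseteq> {L \<in> labs {..<d} \<Lambda> \<mu> (adj i \<circ> q \<circ> adj i). L x = k}"
    using labs_conj_into[OF d, of _ \<Lambda> \<mu> "adj i \<circ> q \<circ> adj i"] by auto
qed (simp_all add: comp_assoc)

text \<open>The count is the complete polynomial applied to a function of states and evaluated at
  \<open>(id, UNIV)\<close>. Conjugation fixes this state and changes the function only by moving
  \<open>x\<close>; the test for connectedness is unaffected because \<open>adj i\<close> maps the
  set of points to itself.\<close>

lemma cntat_adj:
  assumes d: "Suc i < d"
  shows "cntat m {..<d} \<Lambda> \<mu> x k = cntat m {..<d} \<Lambda> \<mu> (adj i x) k"
proof -
  define F :: "nat \<Rightarrow> walk_state \<Rightarrow> int" where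
    "F x st = int (card {L \<in> labs {..<d} \<Lambda> \<mu> (fst st). L x = k}) * of_bool (\<forall>S\<in>snd st. S \<inter> {..<d} = {} \<or> {..<d} \<subseteq> S)" for x st
  have F: "int (cntat m {..<d} \<Lambda> \<mu> x k) = jm_complete d m (F x) (id, UNIV)" for x
  proof -
    have "int (cntat m {..<d} \<Lambda> \<mu> x k) = (\<Sum>ts\<in>mono_seqs {..<d} m.
        if conn {..<d} ts then int (card {lab \<in> labs {..<d} \<Lambda> \<mu> (perm_of_list ts). lab x = k}) else 0)"
      unfolding cntat_def of_nat_sum by (rule sum.inter_filter) (simp add: finite_mono_seqs)
    also have "\<dots> = (\<Sum>ts\<in>mono_seqs {..<d} m. F x (walk (id, UNIV) ts))"
    proof (rule sum.cong[OF refl])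
      fix ts assume ts: "ts \<in> mono_seqs {..<d} m"
      have "fst (walk (id, UNIV) ts) = perm_of_list ts" by (simp add: walk_eq)
      then show "(if conn {..<d} ts then int (card {lab \<in> labs {..<d} \<Lambda> \<mu> (perm_of_list ts). lab x = k}) else 0)
         = F x (walk (id, UNIV) ts)"
        unfolding F_def conn_walk[OF ts] by simp
    qed
    finally show ?thesis by (simp add: sum_mono_seqs)
  qed
  have "F x (conj_state i st) = F (adj i x) st" for st
  proof -
    have img: "adj i ` {..<d} = {..<d}"
      using d by (auto simp: adj_def Transposition.transpose_def image_iff)
    have "S \<inter> {..<d} = {} \<longleftrightarrow> adj i ` S \<inter> {..<d} = {}" "{..<d} \<subseteq> S \<longleftrightarrow> {..<d} \<subseteq> adj i ` S" for S
    proof -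
      have "adj i ` S \<inter> {..<d} = adj i ` (S \<inter> {..<d})"
        using image_Int[OF inj_adj, of i S "{..<d}"] img by simp
      then show "S \<inter> {..<d} = {} \<longleftrightarrow> adj i ` S \<inter> {..<d} = {}" by simp
      show "{..<d} \<subseteq> S \<longleftrightarrow> {..<d} \<subseteq> adj i ` S"
        using inj_image_subset_iff[OF inj_adj, of i "{..<d}" S] img by simp
    qed
    then have "(\<forall>S\<in>image (adj i) ` snd st. S \<inter> {..<d} = {} \<or> {..<d} \<subseteq> S) \<longleftrightarrow> (\<forall>S\<in>snd st. S \<inter> {..<d} = {} \<or> {..<d} \<subseteq> S)"
      by simp
    then show ?thesis
      unfolding F_def conj_state_def fst_conv snd_conv card_labs_conj[OF d] by simp
  qed
  then have "jm_complete d m (F (adj i x)) (id, UNIV) = jm_complete d m (F x) (conj_state i (id, UNIV))"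
    using jm_complete_conj[OF d, of m "F x" "(id, UNIV)"] by simp
  also have "conj_state i (id, UNIV) = (id, UNIV)"
  proof -
    have "range ((`) (adj i)) = UNIV"
    proof (rule surjI)
      fix S show "adj i ` (adj i ` S) = S" by (simp add: image_image)
    qed
    then show ?thesis by (simp add: conj_state_def)
  qed
  finally have "int (cntat m {..<d} \<Lambda> \<mu> (adj i x) k) = int (cntat m {..<d} \<Lambda> \<mu> x k)"
    unfolding F .
  then show ?thesis by simp
qed

text \<open>By \<open>cntat_adj\<close> the count is the same at all points, and summing over the
  points counts each labelling \<open>\<mu> k\<close> times.\<close>

lemma cntat_lessThan:
  assumes "x < d" and "finite \<Lambda>" "k \<in> \<Lambda>"
  shows "d * cntat m {..<d} \<Lambda> \<mu> x k = \<mu> k * cnt m {..<d} \<Lambda> \<mu>"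
proof -
  have step: "cntat m {..<d} \<Lambda> \<mu> (Suc i) k = cntat m {..<d} \<Lambda> \<mu> i k" if "Suc i < d" for i
    using cntat_adj[OF that, of m \<Lambda> \<mu> i k] by simp
  have const: "cntat m {..<d} \<Lambda> \<mu> y k = cntat m {..<d} \<Lambda> \<mu> 0 k" if "y < d" for y
    using that by (induction y) (simp_all add: step)
  have "d * cntat m {..<d} \<Lambda> \<mu> x k = (\<Sum>y<d. cntat m {..<d} \<Lambda> \<mu> y k)"
  proof -
    have "cntat m {..<d} \<Lambda> \<mu> y k = cntat m {..<d} \<Lambda> \<mu> x k" if "y < d" for y
      unfolding const[OF that] const[OF assms(1)] ..
    then have "(\<Sum>y<d. cntat m {..<d} \<Lambda> \<mu> y k) = (\<Sum>y<d. cntat m {..<d} \<Lambda> \<mu> x k)"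
      by (intro sum.cong) simp_all
    then show ?thesis by simp
  qed
  also have "\<dots> = (\<Sum>ts | ts \<in> mono_seqs {..<d} m \<and> conn {..<d} ts.
      \<Sum>y<d. card {lab \<in> labs {..<d} \<Lambda> \<mu> (perm_of_list ts). lab y = k})"
    unfolding cntat_def by (rule sum.swap)
  also have "\<dots> = (\<Sum>ts | ts \<in> mono_seqs {..<d} m \<and> conn {..<d} ts. \<mu> k * card (labs {..<d} \<Lambda> \<mu> (perm_of_list ts)))"
  proof (rule sum.cong[OF refl])
    fix ts
    show "(\<Sum>y<d. card {lab \<in> labs {..<d} \<Lambda> \<mu> (perm_of_list ts). lab y = k}) = \<mu> k * card (labs {..<d} \<Lambda> \<mu> (perm_of_list ts))"
      using sum_card_fibre[of "{..<d}" \<Lambda> k "labs {..<d} \<Lambda> \<mu> (perm_of_list ts)" \<mu> "perm_of_list ts" "\<lambda>_. True"] assms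
      by simp
  qed
  also have "\<dots> = \<mu> k * cnt m {..<d} \<Lambda> \<mu>" by (simp add: cnt_def sum_distrib_left)
  finally show ?thesis .
qed

section \<open>Relabelling of points and labels\<close>

lemma perm_of_list_map:
  assumes "inj_on f D" "\<forall>(a,b)\<in>set ts. a \<in> D \<and> b \<in> D" "x \<in> D"
  shows "perm_of_list (map (map_prod f f) ts) (f x) = f (perm_of_list ts x)"
  using assms(2)
proof (induction ts)
  case (Cons t ts)
  then have ts: "\<forall>(a,b)\<in>set ts. a \<in> D \<and> b \<in> D" and t: "fst t \<in> D" "snd t \<in> D" by auto
  have y: "perm_of_list ts x \<in> D"
    using permutes_in_image[OF perm_of_list_permutes[OF ts]] assms(3) by simp
  have "Transposition.transpose (f (fst t)) (f (snd t)) (f y) = f (Transposition.transpose (fst t) (snd t) y)"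
    if "y \<in> D" for y
    using inj_on_eq_iff[OF assms(1) that] t by (simp add: Transposition.transpose_def)
  then show ?case using Cons.IH[OF ts] y by simp
qed simp

lemma same_cycle_map:
  assumes inj: "inj_on f D" and p: "\<And>x. x \<in> D \<Longrightarrow> p x \<in> D" and p': "\<And>x. x \<in> D \<Longrightarrow> p' (f x) = f (p x)"
    and xy: "x \<in> D" "y \<in> D"
  shows "same_cycle p' (f x) (f y) \<longleftrightarrow> same_cycle p x y"
proof -
  have "(p ^^ k) x \<in> D \<and> (p' ^^ k) (f x) = f ((p ^^ k) x)" for k
    by (induction k) (use xy p p' in simp_all)
  then show ?thesis unfolding same_cycle_def using inj_on_eq_iff[OF inj _ xy(2)] by metis
qed

lemma card_labs_le:
  assumes fin: "finite D" "finite \<Lambda>" and f: "bij_betw f D D'" and g: "bij_betw g \<Lambda> \<Lambda>'"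
    and \<mu>: "\<And>k. k \<in> \<Lambda> \<Longrightarrow> \<mu>' (g k) = \<mu> k" and p: "\<And>x. x \<in> D \<Longrightarrow> p x \<in> D" and p': "\<And>x. x \<in> D \<Longrightarrow> p' (f x) = f (p x)"
    and x: "x \<in> D" and i: "i \<in> \<Lambda>"
  shows "card {lab \<in> labs D \<Lambda> \<mu> p. lab x = i} \<le> card {lab \<in> labs D' \<Lambda>' \<mu>' p'. lab (f x) = g i}"
proof (rule card_inj_on_le)
  let ?h = "inv_into D f"
  let ?\<phi> = "\<lambda>lab. restrict (\<lambda>y. g (lab (?h y))) D'"
  have injf: "inj_on f D" and imf: "f ` D = D'" and injg: "inj_on g \<Lambda>" and img: "g ` \<Lambda> = \<Lambda>'"
    using f g by (simp_all add: bij_betw_def)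
  have h: "?h (f z) = z" if "z \<in> D" for z by (rule inv_into_f_f[OF injf that])
  have fD: "f z \<in> D'" if "z \<in> D" for z using that imf by blast
  have \<phi>: "?\<phi> lab (f z) = g (lab z)" if "z \<in> D" for lab z
    using h[OF that] fD[OF that] by simp
  show "finite {lab \<in> labs D' \<Lambda>' \<mu>' p'. lab (f x) = g i}"
  proof -
    have "finite D'" "finite \<Lambda>'" using fin imf img by auto
    then show ?thesis using finite_labs by simp
  qed
  show "inj_on ?\<phi> {lab \<in> labs D \<Lambda> \<mu> p. lab x = i}"
  proof (rule inj_onI)
    fix L L' assume L: "L \<in> {lab \<in> labs D \<Lambda> \<mu> p. lab x = i}" and L': "L' \<in> {lab \<in> labs D \<Lambda> \<mu> p. lab x = i}"
      and eq: "?\<phi> L = ?\<phi> L'"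
    have P: "L \<in> D \<rightarrow>\<^sub>E \<Lambda>" "L' \<in> D \<rightarrow>\<^sub>E \<Lambda>" using L L' by (simp_all add: labs_def)
    show "L = L'"
    proof (rule PiE_ext[OF P])
      fix z assume z: "z \<in> D"
      have "g (L z) = g (L' z)" using fun_cong[OF eq, of "f z"] unfolding \<phi>[OF z] .
      then show "L z = L' z" by (rule inj_onD[OF injg]) (use PiE_mem[OF P(1) z] PiE_mem[OF P(2) z] in simp_all)
    qed
  qed
  show "?\<phi> ` {lab \<in> labs D \<Lambda> \<mu> p. lab x = i} \<subseteq> {lab \<in> labs D' \<Lambda>' \<mu>' p'. lab (f x) = g i}"
  proof (rule image_subsetI)
    fix L assume "L \<in> {lab \<in> labs D \<Lambda> \<mu> p. lab x = i}"
    then have L: "L \<in> labs D \<Lambda> \<mu> p" "L x = i" by simp_all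
    note Lu = L(1)[unfolded labs_def mem_Collect_eq]
    define M where "M = ?\<phi> L"
    have M: "M (f z) = g (L z)" if "z \<in> D" for z unfolding M_def by (rule \<phi>[OF that])
    have Lm: "L z \<in> \<Lambda>" if "z \<in> D" for z using Lu that by blast
    have "M \<in> D' \<rightarrow>\<^sub>E \<Lambda>'"
    proof (rule PiE_I)
      fix y assume "y \<in> D'"
      then obtain z where "z \<in> D" "y = f z" using imf by blast
      then show "M y \<in> \<Lambda>'" using M Lm img by blast
    qed (simp add: M_def)
    moreover have "\<forall>y\<in>D'. \<forall>y'\<in>D'. M y = M y' \<longleftrightarrow> same_cycle p' y y'"
    proof (intro ballI)
      fix y y' assume "y \<in> D'" "y' \<in> D'"
      then obtain z z' where z: "z \<in> D" "y = f z" "z' \<in> D" "y' = f z'" using imf by blast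
      have "M y = M y' \<longleftrightarrow> L z = L z'"
        using M[OF z(1)] M[OF z(3)] inj_on_eq_iff[OF injg Lm[OF z(1)] Lm[OF z(3)]] z by simp
      also have "\<dots> \<longleftrightarrow> same_cycle p z z'" using Lu z(1,3) by blast
      also have "\<dots> \<longleftrightarrow> same_cycle p' y y'" unfolding z(2,4)
        by (rule same_cycle_map[symmetric, of f D p p']) (use injf p p' z(1,3) in simp_all)
      finally show "M y = M y' \<longleftrightarrow> same_cycle p' y y'" .
    qed
    moreover have "\<forall>k\<in>\<Lambda>'. card {y\<in>D'. M y = k} = \<mu>' k"
    proof
      fix k assume "k \<in> \<Lambda>'"
      then obtain k0 where k: "k0 \<in> \<Lambda>" "k = g k0" using img by blast
      have "{y\<in>D'. M y = k} = f ` {z\<in>D. L z = k0}"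
      proof (rule set_eqI)
        fix y
        show "y \<in> {y\<in>D'. M y = k} \<longleftrightarrow> y \<in> f ` {z\<in>D. L z = k0}"
        proof
          assume y: "y \<in> {y\<in>D'. M y = k}"
          then obtain z where z: "z \<in> D" "y = f z" using imf by blast
          then have "g (L z) = g k0" using y M k by simp
          then have "L z = k0" by (rule inj_onD[OF injg]) (use Lm z k in simp_all)
          then show "y \<in> f ` {z\<in>D. L z = k0}" using z by blast
        next
          assume "y \<in> f ` {z\<in>D. L z = k0}"
          then obtain z where "z \<in> D" "L z = k0" "y = f z" by blast
          then show "y \<in> {y\<in>D'. M y = k}" using M k fD by simp
        qed
      qed
      moreover have "card (f ` {z\<in>D. L z = k0}) = card {z\<in>D. L z = k0}"
        by (rule card_image) (rule inj_on_subset[OF injf], blast)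
      moreover have "card {z\<in>D. L z = k0} = \<mu> k0" using Lu k(1) by blast
      ultimately show "card {y\<in>D'. M y = k} = \<mu>' k" using \<mu>[OF k(1)] k(2) by simp
    qed
    ultimately have "M \<in> labs D' \<Lambda>' \<mu>' p'" unfolding labs_def by blast
    moreover have "M (f x) = g i" using M[OF x] L(2) by simp
    ultimately show "?\<phi> L \<in> {lab \<in> labs D' \<Lambda>' \<mu>' p'. lab (f x) = g i}" unfolding M_def by simp
  qed
qed

lemma separated_map:
  assumes "separated S (map (map_prod f f) ts)" "\<And>x. x \<in> D \<Longrightarrow> x \<in> T \<longleftrightarrow> f x \<in> S" "\<forall>(a,b)\<in>set ts. a \<in> D \<and> b \<in> D"
  shows "separated T ts"
proof (rule separatedI)
  fix x y assume xy: "(x, y) \<in> set ts"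
  then have "(f x, f y) \<in> set (map (map_prod f f) ts)" by force
  then have "f x \<in> S \<longleftrightarrow> f y \<in> S" by (rule separatedD[OF assms(1)])
  then show "x \<in> T \<longleftrightarrow> y \<in> T" using assms(2)[of x] assms(2)[of y] assms(3) xy by auto
qed

lemma conn_map:
  assumes f: "bij_betw f D D'" and ts: "\<forall>(a,b)\<in>set ts. a \<in> D \<and> b \<in> D" and c: "conn D ts"
  shows "conn D' (map (map_prod f f) ts)"
proof (rule connI)
  fix S assume S: "S \<subseteq> D'" "separated S (map (map_prod f f) ts)"
  let ?T = "{x\<in>D. f x \<in> S}"
  have "separated ?T ts" by (rule separated_map[OF S(2) _ ts]) simp
  then have "?T = {} \<or> ?T = D" using connD[OF c, of ?T] by simp
  moreover have "f ` ?T = S" using f S(1) by (auto simp: bij_betw_def)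
  moreover have "f ` D = D'" using f by (simp add: bij_betw_def)
  ultimately show "S = {} \<or> S = D'" by auto
qed

text \<open>The points are mapped monotonically, since both \<open>a < b\<close> and the order of
  the larger entries have to survive. An inequality is enough here, because the inverse maps satisfy
  the same hypotheses.\<close>

lemma cntat_le:
  assumes fin: "finite D" "finite \<Lambda>" and f: "bij_betw f D D'" "strict_mono_on D f" and g: "bij_betw g \<Lambda> \<Lambda>'"
    and \<mu>: "\<And>k. k \<in> \<Lambda> \<Longrightarrow> \<mu>' (g k) = \<mu> k" and x: "x \<in> D" and i: "i \<in> \<Lambda>"
  shows "cntat m D \<Lambda> \<mu> x i \<le> cntat m D' \<Lambda>' \<mu>' (f x) (g i)"
  unfolding cntat_def
proof (rule sum_le_included[where i = "map (map_prod (inv_into D f) (inv_into D f))"])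
  have injf: "inj_on f D" and imf: "f ` D = D'" using f by (simp_all add: bij_betw_def)
  show "finite {ts. ts \<in> mono_seqs D m \<and> conn D ts}" using finite_mono_seqs[OF fin(1)] by simp
  have "finite D'" using fin imf by auto
  then show "finite {ts. ts \<in> mono_seqs D' m \<and> conn D' ts}" using finite_mono_seqs by simp
  show "\<forall>ts\<in>{ts. ts \<in> mono_seqs D m \<and> conn D ts}. \<exists>us\<in>{ts. ts \<in> mono_seqs D' m \<and> conn D' ts}.
     map (map_prod (inv_into D f) (inv_into D f)) us = ts \<and>
     card {lab \<in> labs D \<Lambda> \<mu> (perm_of_list ts). lab x = i} \<le> card {lab \<in> labs D' \<Lambda>' \<mu>' (perm_of_list us). lab (f x) = g i}"
  proof
    fix ts assume ts0: "ts \<in> {ts. ts \<in> mono_seqs D m \<and> conn D ts}"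
    then have ts: "\<forall>(a,b)\<in>set ts. a \<in> D \<and> b \<in> D" "\<forall>(a,b)\<in>set ts. a < b" "length ts = m" "sorted (map snd ts)" and c: "conn D ts"
      by (auto simp: mono_seqs_def)
    let ?us = "map (map_prod f f) ts"
    have "sorted (map snd ?us)"
    proof -
      have sD: "y \<in> D" if "y \<in> set (map snd ts)" for y using that ts(1) by auto
      have "sorted (map f (map snd ts))"
        unfolding sorted_map
      proof (rule sorted_wrt_mono_rel[OF _ ts(4)])
        fix y y' assume y: "y \<in> set (map snd ts)" "y' \<in> set (map snd ts)" "y \<le> y'"
        show "f y \<le> f y'" by (rule strict_mono_on_leD[OF f(2) sD[OF y(1)] sD[OF y(2)] y(3)])
      qed
      then show ?thesis by (simp add: comp_def)
    qed
    moreover have "\<forall>(a,b)\<in>set ?us. a < b \<and> a \<in> D' \<and> b \<in> D'"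
      using ts(1,2) f(2) imf by (fastforce simp: strict_mono_on_def)
    ultimately have us: "?us \<in> mono_seqs D' m" using ts(3) by (simp add: mono_seqs_def)
    have inv: "map (map_prod (inv_into D f) (inv_into D f)) ?us = ts"
      unfolding map_map
    proof (rule map_idI)
      fix t assume "t \<in> set ts"
      then have "fst t \<in> D" "snd t \<in> D" using ts(1) by auto
      then show "(map_prod (inv_into D f) (inv_into D f) \<circ> map_prod f f) t = t"
        using inv_into_f_f[OF injf] by (cases t) simp
    qed
    have pin: "perm_of_list ts x \<in> D" if "x \<in> D" for x
      using permutes_in_image[OF perm_of_list_permutes[OF ts(1)]] that by simp
    have "card {lab \<in> labs D \<Lambda> \<mu> (perm_of_list ts). lab x = i} \<le> card {lab \<in> labs D' \<Lambda>' \<mu>' (perm_of_list ?us). lab (f x) = g i}"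
    proof (rule card_labs_le[OF fin f(1) g])
      show "perm_of_list ?us (f z) = f (perm_of_list ts z)" if "z \<in> D" for z
        by (rule perm_of_list_map[OF injf ts(1) that])
    qed (use \<mu> pin x i in simp_all)
    then show "\<exists>us\<in>{ts. ts \<in> mono_seqs D' m \<and> conn D' ts}.
     map (map_prod (inv_into D f) (inv_into D f)) us = ts \<and>
     card {lab \<in> labs D \<Lambda> \<mu> (perm_of_list ts). lab x = i} \<le> card {lab \<in> labs D' \<Lambda>' \<mu>' (perm_of_list us). lab (f x) = g i}"
      using us conn_map[OF f(1) ts(1) c] inv by blast
  qed
qed simp

lemma cntat_relabel:
  assumes fin: "finite D" "finite \<Lambda>" and f: "bij_betw f D D'" "strict_mono_on D f" and g: "bij_betw g \<Lambda> \<Lambda>'"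
    and \<mu>: "\<And>k. k \<in> \<Lambda> \<Longrightarrow> \<mu>' (g k) = \<mu> k" and x: "x \<in> D" and i: "i \<in> \<Lambda>"
  shows "cntat m D \<Lambda> \<mu> x i = cntat m D' \<Lambda>' \<mu>' (f x) (g i)"
proof (rule antisym)
  have injf: "inj_on f D" and imf: "f ` D = D'" and injg: "inj_on g \<Lambda>" and img: "g ` \<Lambda> = \<Lambda>'"
    using f g by (simp_all add: bij_betw_def)
  show "cntat m D \<Lambda> \<mu> x i \<le> cntat m D' \<Lambda>' \<mu>' (f x) (g i)" by (rule cntat_le) (use assms in simp_all)
  let ?f = "inv_into D f" and ?g = "inv_into \<Lambda> g"
  have "finite D'" "finite \<Lambda>'" using fin imf img by auto
  moreover have "bij_betw ?f D' D" "bij_betw ?g \<Lambda>' \<Lambda>" using f g bij_betw_inv_into by auto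
  moreover have "strict_mono_on D' ?f"
  proof (rule strict_mono_onI)
    fix y y' assume y: "y \<in> D'" "y' \<in> D'" "y < y'"
    obtain z z' where z: "z \<in> D" "y = f z" "z' \<in> D" "y' = f z'" using y imf by blast
    have "z < z'" using y(3) z strict_mono_on_leD[OF f(2), of z' z] by (meson leD le_less_linear)
    then show "?f y < ?f y'" using z inv_into_f_f[OF injf] by simp
  qed
  moreover have "\<mu> (?g k) = \<mu>' k" if k: "k \<in> \<Lambda>'" for k
    using \<mu>[of "?g k"] f_inv_into_f[of k g \<Lambda>] inv_into_into[of k g \<Lambda>] k img by simp
  moreover have "f x \<in> D'" "g i \<in> \<Lambda>'" using x i imf img by auto
  ultimately have "cntat m D' \<Lambda>' \<mu>' (f x) (g i) \<le> cntat m D \<Lambda> \<mu> (?f (f x)) (?g (g i))"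
    by (intro cntat_le) simp_all
  then show "cntat m D' \<Lambda>' \<mu>' (f x) (g i) \<le> cntat m D \<Lambda> \<mu> x i"
    using inv_into_f_f[OF injf x] inv_into_f_f[OF injg i] by simp
qed

lemma cnt_eq_sum_cntat:
  assumes "finite D" "finite \<Lambda>" "x \<in> D"
  shows "cnt m D \<Lambda> \<mu> = (\<Sum>i\<in>\<Lambda>. cntat m D \<Lambda> \<mu> x i)"
proof -
  have "card (labs D \<Lambda> \<mu> p) = (\<Sum>i\<in>\<Lambda>. card {lab \<in> labs D \<Lambda> \<mu> p. lab x = i})" for p
  proof -
    have "labs D \<Lambda> \<mu> p = (\<Union>i\<in>\<Lambda>. {lab \<in> labs D \<Lambda> \<mu> p. lab x = i})"
      using assms(3) by (auto simp: labs_def)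
    then have "card (labs D \<Lambda> \<mu> p) = card (\<Union>i\<in>\<Lambda>. {lab \<in> labs D \<Lambda> \<mu> p. lab x = i})" by (rule arg_cong)
    also have "\<dots> = (\<Sum>i\<in>\<Lambda>. card {lab \<in> labs D \<Lambda> \<mu> p. lab x = i})"
      by (rule card_UN_disjoint) (use assms finite_labs in auto)
    finally show ?thesis .
  qed
  then show ?thesis unfolding cnt_def cntat_def by (subst sum.swap) simp
qed

lemma labs_empty_card:
  assumes "finite D" "finite \<Lambda>" "labs D \<Lambda> \<mu> p \<noteq> {}"
  shows "card D = sum \<mu> \<Lambda>"
proof -
  obtain L where L: "L \<in> labs D \<Lambda> \<mu> p" using assms(3) by blast
  note Lu = L[unfolded labs_def mem_Collect_eq]
  have "D = (\<Union>i\<in>\<Lambda>. {x\<in>D. L x = i})" using Lu by auto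
  then have "card D = card (\<Union>i\<in>\<Lambda>. {x\<in>D. L x = i})" by (rule arg_cong)
  also have "\<dots> = (\<Sum>i\<in>\<Lambda>. card {x\<in>D. L x = i})"
    by (rule card_UN_disjoint) (use assms in auto)
  also have "\<dots> = sum \<mu> \<Lambda>" using Lu by (intro sum.cong) auto
  finally show ?thesis .
qed

lemma cnt_eq_0:
  assumes "finite D" "finite \<Lambda>" "card D \<noteq> sum \<mu> \<Lambda>"
  shows "cnt m D \<Lambda> \<mu> = 0" "cntat m D \<Lambda> \<mu> x i = 0"
proof -
  have e: "labs D \<Lambda> \<mu> p = {}" for p using labs_empty_card[OF assms(1,2)] assms(3) by blast
  show "cnt m D \<Lambda> \<mu> = 0" "cntat m D \<Lambda> \<mu> x i = 0" unfolding cnt_def cntat_def e by simp_all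
qed

section \<open>The cut-join recursion\<close>

text \<open>The parameter is the number of transpositions, not the genus.\<close>
definition hur :: "nat \<Rightarrow> nat list \<Rightarrow> complex" where
  "hur m mu = of_nat (cnt m {..<sum_list mu} {..<length mu} (nth mu)) / fact (sum_list mu)"

text \<open>Relabelling along the increasing bijection with an initial segment leads to
  \<open>hur\<close>. In the refined count \<open>fact (card D - 1)\<close> is d!/d, where 1/d comes
  from the fraction in \<open>cntat_lessThan\<close>.\<close>

lemma cnt_list:
  assumes D: "finite D" and ls: "distinct ls" "ls \<noteq> []" and pos: "\<And>k. k \<in> set ls \<Longrightarrow> \<mu> k > 0"
  shows "of_nat (cnt m D (set ls) \<mu>) =
      (if card D = sum_list (map \<mu> ls) then fact (card D) * hur m (map \<mu> ls) else 0 :: complex)" (is ?c)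
    and "x \<in> D \<Longrightarrow> i \<in> set ls \<Longrightarrow> of_nat (cntat m D (set ls) \<mu> x i) =
      (if card D = sum_list (map \<mu> ls) then fact (card D - 1) * of_nat (\<mu> i) * hur m (map \<mu> ls) else 0 :: complex)"
proof -
  have sum: "sum \<mu> (set ls) = sum_list (map \<mu> ls)"
    using sum_list_distinct_conv_sum_set[OF ls(1), of \<mu>] by simp
  define d where "d = card D"
  define n where "n = length ls"
  let ?mu = "map \<mu> ls"
  have main: "?c \<and> (x \<in> D \<longrightarrow> i \<in> set ls \<longrightarrow> of_nat (cntat m D (set ls) \<mu> x i) =
      (if card D = sum_list (map \<mu> ls) then fact (card D - 1) * of_nat (\<mu> i) * hur m (map \<mu> ls) else 0 :: complex))"
  proof (cases "card D = sum_list ?mu")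
    case False
    then have "card D \<noteq> sum \<mu> (set ls)" using sum by simp
    then show ?thesis using cnt_eq_0[OF D, of "set ls" \<mu>] False by simp
  next
    case True
    obtain k0 where k0: "k0 \<in> set ls" using ls(2) by (cases ls) auto
    have "\<mu> k0 \<le> sum \<mu> (set ls)" by (rule member_le_sum) (use k0 in auto)
    then have dpos: "d > 0" using pos[OF k0] True sum d_def by simp
    obtain f where f: "bij_betw f {..<d} D" "strict_mono_on {..<d} f"
      using ex_bij_betw_strict_mono_card[OF D] d_def by blast
    have g: "bij_betw (nth ls) {..<n} (set ls)"
      by (rule bij_betw_nth[OF ls(1)]) (simp_all add: n_def)
    have rel: "cntat m {..<d} {..<n} (nth ?mu) x k = cntat m D (set ls) \<mu> (f x) (ls ! k)" if "x < d" "k < n" for x k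
      by (rule cntat_relabel[OF _ _ f g]) (use that in \<open>simp_all add: n_def\<close>)
    have f0: "f 0 \<in> D" using f(1) dpos by (auto simp: bij_betw_def)
    have "cnt m D (set ls) \<mu> = (\<Sum>i\<in>set ls. cntat m D (set ls) \<mu> (f 0) i)"
      by (rule cnt_eq_sum_cntat[OF D _ f0]) simp
    also have "\<dots> = (\<Sum>k<n. cntat m D (set ls) \<mu> (f 0) (ls ! k))"
      by (rule sum.reindex_bij_betw[OF g, symmetric])
    also have "\<dots> = (\<Sum>k<n. cntat m {..<d} {..<n} (nth ?mu) 0 k)"
      by (rule sum.cong[OF refl]) (use rel dpos in simp)
    also have "\<dots> = cnt m {..<d} {..<n} (nth ?mu)"
      by (rule cnt_eq_sum_cntat[symmetric]) (use dpos in simp_all)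
    finally have c1: "cnt m D (set ls) \<mu> = cnt m {..<d} {..<n} (nth ?mu)" .
    have h: "of_nat (cnt m {..<d} {..<n} (nth ?mu)) = (fact d * hur m ?mu :: complex)"
      using True by (simp add: hur_def d_def n_def)
    have c2: "of_nat (cntat m D (set ls) \<mu> x i) = (fact (d - 1) * of_nat (\<mu> i) * hur m ?mu :: complex)"
      if x: "x \<in> D" and i: "i \<in> set ls"
    proof -
      obtain x' where x': "x' < d" "x = f x'" using f(1) x by (auto simp: bij_betw_def)
      obtain k where k: "k < n" "i = ls ! k" using i by (auto simp: in_set_conv_nth n_def)
      have \<mu>k: "?mu ! k = \<mu> i" using k by (simp add: n_def)
      have "d * cntat m {..<d} {..<n} (nth ?mu) x' k = \<mu> i * cnt m {..<d} {..<n} (nth ?mu)"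
        unfolding \<mu>k[symmetric] by (rule cntat_lessThan) (use x' k in simp_all)
      then have "of_nat d * of_nat (cntat m D (set ls) \<mu> x i) = (of_nat (\<mu> i) * (fact d * hur m ?mu) :: complex)"
        unfolding rel[OF x'(1) k(1)] x'(2)[symmetric] k(2)[symmetric] h[symmetric] of_nat_mult[symmetric] by simp
      also have "fact d = (of_nat d * fact (d - 1) :: complex)"
        using dpos fact_reduce[of d, where 'a = complex] by simp
      finally show ?thesis using dpos by (simp add: field_simps)
    qed
    show ?thesis using True c1 c2 h by (simp add: d_def)
  qed
  show ?c using main by blast
  show "x \<in> D \<Longrightarrow> i \<in> set ls \<Longrightarrow> of_nat (cntat m D (set ls) \<mu> x i) =
      (if card D = sum_list (map \<mu> ls) then fact (card D - 1) * of_nat (\<mu> i) * hur m (map \<mu> ls) else 0 :: complex)"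
    using main by blast
qed

text \<open>Increasing enumeration of \<open>I\<close>, the order in which \<open>nths\<close> picks
  entries; it passes between label sets and lists.\<close>

definition ilist :: "nat \<Rightarrow> nat set \<Rightarrow> nat list" where
  "ilist N I = filter (\<lambda>i. i \<in> I) [0..<N]"

lemma distinct_ilist [simp]: "distinct (ilist N I)" by (simp add: ilist_def)

lemma set_ilist: "I \<subseteq> {..<N} \<Longrightarrow> set (ilist N I) = I" by (auto simp: ilist_def)

lemma nths_ilist: "nths xs I = map (nth xs) (ilist (length xs) I)"
proof -
  have z: "zip xs [0..<length xs] = map (\<lambda>i. (xs ! i, i)) [0..<length xs]"
    by (rule nth_equalityI) simp_all
  show ?thesis unfolding nths_def z ilist_def filter_map map_map by (simp add: comp_def)
qed

lemma card_subsets_through: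
  assumes "finite D" "c \<in> D" "e > 0"
  shows "card {B. B \<subseteq> D \<and> c \<in> B \<and> card B = e} = (card D - 1) choose (e - 1)"
proof -
  have "bij_betw (insert c) {B. B \<subseteq> D - {c} \<and> card B = e - 1} {B. B \<subseteq> D \<and> c \<in> B \<and> card B = e}"
  proof (rule bij_betw_byWitness[where f' = "\<lambda>B. B - {c}"])
    show "insert c ` {B. B \<subseteq> D - {c} \<and> card B = e - 1} \<subseteq> {B. B \<subseteq> D \<and> c \<in> B \<and> card B = e}"
    proof (rule image_subsetI)
      fix B assume B: "B \<in> {B. B \<subseteq> D - {c} \<and> card B = e - 1}"
      then have "finite B" "c \<notin> B" using assms(1) finite_subset by blast+
      then have "card (insert c B) = e" using B assms(3) by simp
      then show "insert c B \<in> {B. B \<subseteq> D \<and> c \<in> B \<and> card B = e}" using B assms(2) by auto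
    qed
    show "(\<lambda>B. B - {c}) ` {B. B \<subseteq> D \<and> c \<in> B \<and> card B = e} \<subseteq> {B. B \<subseteq> D - {c} \<and> card B = e - 1}"
      by auto
  qed auto
  then have "card {B. B \<subseteq> D \<and> c \<in> B \<and> card B = e} = card {B. B \<subseteq> D - {c} \<and> card B = e - 1}"
    by (rule bij_betw_same_card[symmetric])
  also have "\<dots> = (card D - 1) choose (e - 1)"
    using n_subsets[of "D - {c}" "e - 1"] assms by simp
  finally show ?thesis .
qed

lemma sum_list_nths_split:
  assumes "I \<subseteq> {..<length xs}"
  shows "sum_list (nths xs I) + sum_list (nths xs ({..<length xs} - I)) = (sum_list xs :: nat)"
proof -
  have *: "sum_list (nths xs J) = sum (nth xs) J" if "J \<subseteq> {..<length xs}" for J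
    unfolding nths_ilist using sum_list_distinct_conv_sum_set[of "ilist (length xs) J" "nth xs"] set_ilist[OF that] by simp
  have "sum_list xs = sum (nth xs) {..<length xs}" by (simp add: sum_list_sum_nth lessThan_atLeast0)
  also have "\<dots> = sum (nth xs) I + sum (nth xs) ({..<length xs} - I)"
    using sum.subset_diff[OF assms, of "nth xs"] by simp
  finally show ?thesis using *[OF assms] *[of "{..<length xs} - I"] by simp
qed

lemma nths_pos:
  fixes nu :: "nat list"
  assumes "\<forall>k\<in>set nu. k > 0" shows "\<forall>k\<in>set (nths nu I). k > 0"
  using assms by (auto dest: in_set_nthsD)

text \<open>A block with e points through the largest one can be chosen in binomial(d - 1, e - 1)
  ways, and the two factors bring (e - 1)! and (d - e)!, so that (d - 1)! results for every e. Label
  0 belongs to the cycle of the largest point, and \<open>Suc N\<close> is the fresh label.\<close>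

lemma disc_list:
  fixes a k :: nat and nu :: "nat list"
  assumes k: "0 < k" "k < a" and pos: "\<forall>x\<in>set nu. x > 0"
  defines "d \<equiv> a + sum_list nu" and "N \<equiv> length nu"
  defines "\<mu> \<equiv> (nth (a # nu))(0 := a - k, Suc N := k)"
  shows "of_nat (disc m {..<d} (insert (Suc N) {..<Suc N}) \<mu> (d - 1) 0 (Suc N)) =
    (fact (d - 1) * of_nat (k * (a - k)) * (\<Sum>l\<le>m. \<Sum>I\<in>Pow {..<N}.
        hur l ((a - k) # nths nu I) * hur (m - l) (k # nths nu ({..<N} - I))) :: complex)"
proof -
  let ?D = "{..<d}" and ?c = "d - 1" and ?\<Lambda> = "insert (Suc N) {..<Suc N}"
  have dpos: "d > 0" using k by (simp add: d_def)
  have \<mu>0: "\<mu> 0 = a - k" "\<mu> (Suc N) = k" by (simp_all add: \<mu>_def)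
  have \<mu>S: "\<mu> (Suc r) = nu ! r" if "r < N" for r using that by (simp add: \<mu>_def)
  have mpos: "\<mu> r > 0" if "r \<in> ?\<Lambda>" for r
  proof -
    show ?thesis
    proof (cases r)
      case 0
      then show ?thesis using \<mu>0 k by simp
    next
      case (Suc r')
      then show ?thesis using \<mu>0 \<mu>S[of r'] k pos that by (cases "r' = N") (auto simp: N_def)
    qed
  qed
  have Lam: "?\<Lambda> - {0, Suc N} = Suc ` {..<N}"
    by (auto simp: image_iff) (metis Suc_pred lessThan_iff not_less_eq)
  have disc1: "disc m ?D ?\<Lambda> \<mu> ?c 0 (Suc N) = (\<Sum>B | B \<subseteq> ?D \<and> ?c \<in> B. \<Sum>l\<le>m. \<Sum>I\<in>Pow (?\<Lambda> - {0, Suc N}).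
      \<mu> (Suc N) * cntat l B (insert 0 I) \<mu> ?c 0 * cnt (m - l) (?D - B) (?\<Lambda> - insert 0 I) \<mu>)"
    by (rule disc_eq) (use dpos mpos in auto)
  have reidx: "(\<Sum>I\<in>Pow (?\<Lambda> - {0, Suc N}). G I) = (\<Sum>I\<in>Pow {..<N}. G (Suc ` I))" for G :: "nat set \<Rightarrow> nat"
  proof -
    have "bij_betw ((`) Suc) (Pow {..<N}) (Pow (Suc ` {..<N}))"
      by (rule bij_betw_Pow) (simp add: bij_betw_def)
    then show ?thesis unfolding Lam by (rule sum.reindex_bij_betw[symmetric])
  qed
  have "disc m ?D ?\<Lambda> \<mu> ?c 0 (Suc N) = (\<Sum>B | B \<subseteq> ?D \<and> ?c \<in> B. \<Sum>l\<le>m. \<Sum>I\<in>Pow {..<N}.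
      \<mu> (Suc N) * cntat l B (insert 0 (Suc ` I)) \<mu> ?c 0 * cnt (m - l) (?D - B) (?\<Lambda> - insert 0 (Suc ` I)) \<mu>)"
    unfolding disc1 reidx ..
  also have "\<dots> = (\<Sum>l\<le>m. \<Sum>B | B \<subseteq> ?D \<and> ?c \<in> B. \<Sum>I\<in>Pow {..<N}.
      \<mu> (Suc N) * cntat l B (insert 0 (Suc ` I)) \<mu> ?c 0 * cnt (m - l) (?D - B) (?\<Lambda> - insert 0 (Suc ` I)) \<mu>)"
    by (rule sum.swap)
  also have "\<dots> = (\<Sum>l\<le>m. \<Sum>I\<in>Pow {..<N}. \<Sum>B | B \<subseteq> ?D \<and> ?c \<in> B.
      \<mu> (Suc N) * cntat l B (insert 0 (Suc ` I)) \<mu> ?c 0 * cnt (m - l) (?D - B) (?\<Lambda> - insert 0 (Suc ` I)) \<mu>)"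
    by (rule sum.cong[OF refl], rule sum.swap)
  finally have "of_nat (disc m ?D ?\<Lambda> \<mu> ?c 0 (Suc N)) = (\<Sum>l\<le>m. \<Sum>I\<in>Pow {..<N}. \<Sum>B | B \<subseteq> ?D \<and> ?c \<in> B.
      of_nat (\<mu> (Suc N)) * of_nat (cntat l B (insert 0 (Suc ` I)) \<mu> ?c 0) * of_nat (cnt (m - l) (?D - B) (?\<Lambda> - insert 0 (Suc ` I)) \<mu>) :: complex)"
    by simp
  also have "\<dots> = (\<Sum>l\<le>m. \<Sum>I\<in>Pow {..<N}. fact (d - 1) * of_nat (k * (a - k)) *
     (hur l ((a - k) # nths nu I) * hur (m - l) (k # nths nu ({..<N} - I))))"
  proof (intro sum.cong refl)
    fix l I assume I: "I \<in> Pow {..<N}"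
    then have IN: "I \<subseteq> {..<N}" by simp
    let ?J = "{..<N} - I"
    let ?ls = "0 # map Suc (ilist N I)" and ?ks = "Suc N # map Suc (ilist N ?J)"
    have sls: "set ?ls = insert 0 (Suc ` I)" using set_ilist[OF IN] by simp
    have sks: "set ?ks = ?\<Lambda> - insert 0 (Suc ` I)"
    proof -
      have "set ?ks = insert (Suc N) (Suc ` ?J)" using set_ilist[of ?J N] by simp
      also have "\<dots> = ?\<Lambda> - insert 0 (Suc ` I)"
      proof (rule set_eqI)
        fix r show "r \<in> insert (Suc N) (Suc ` ?J) \<longleftrightarrow> r \<in> ?\<Lambda> - insert 0 (Suc ` I)"
          using IN by (cases r) auto
      qed
      finally show ?thesis .
    qed
    have dls: "distinct ?ls" "distinct ?ks"
      using set_ilist[of ?J N] by (auto simp: distinct_map)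
    have mls: "map \<mu> ?ls = (a - k) # nths nu I"
    proof -
      have "map \<mu> (map Suc (ilist N I)) = map (nth nu) (ilist N I)"
        unfolding map_map by (rule map_cong[OF refl]) (use \<mu>S set_ilist[OF IN] IN in auto)
      then show ?thesis using \<mu>0 by (simp add: nths_ilist N_def)
    qed
    have mks: "map \<mu> ?ks = k # nths nu ?J"
    proof -
      have "map \<mu> (map Suc (ilist N ?J)) = map (nth nu) (ilist N ?J)"
        unfolding map_map by (rule map_cong[OF refl]) (use \<mu>S set_ilist[of ?J N] in auto)
      then show ?thesis using \<mu>0 by (simp add: nths_ilist N_def)
    qed
    have pls: "\<mu> r > 0" if "r \<in> set ?ls" for r using mpos that IN unfolding sls by auto
    have pks: "\<mu> r > 0" if "r \<in> set ?ks" for r 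
    proof -
      have "r \<in> ?\<Lambda>" using that unfolding sks by (rule DiffD1)
      then show ?thesis by (rule mpos)
    qed
    define e where "e = (a - k) + sum_list (nths nu I)"
    define e' where "e' = k + sum_list (nths nu ?J)"
    have ee: "e + e' = d" "e > 0"
      using sum_list_nths_split[of I nu] IN k by (simp_all add: e_def e'_def d_def N_def)
    let ?X = "hur l ((a - k) # nths nu I)" and ?Y = "hur (m - l) (k # nths nu ?J)"
    have "(\<Sum>B | B \<subseteq> ?D \<and> ?c \<in> B. of_nat (\<mu> (Suc N)) * of_nat (cntat l B (insert 0 (Suc ` I)) \<mu> ?c 0) * of_nat (cnt (m - l) (?D - B) (?\<Lambda> - insert 0 (Suc ` I)) \<mu>))
      = (\<Sum>B | B \<subseteq> ?D \<and> ?c \<in> B. if card B = e then of_nat k * (fact (e - 1) * of_nat (a - k) * ?X) * (fact e' * ?Y) else 0 :: complex)"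
    proof (rule sum.cong[OF refl])
      fix B assume "B \<in> {B. B \<subseteq> ?D \<and> ?c \<in> B}"
      then have B: "B \<subseteq> ?D" "?c \<in> B" by auto
      have fB: "finite B" "finite (?D - B)" using B finite_subset by auto
      have cB: "card (?D - B) = d - card B" "card B \<le> d"
        using card_Diff_subset[OF fB(1) B(1)] card_mono[OF _ B(1)] by auto
      have X: "of_nat (cntat l B (insert 0 (Suc ` I)) \<mu> ?c 0) = (if card B = e then fact (card B - 1) * of_nat (a - k) * ?X else 0 :: complex)"
        using cnt_list(2)[of B ?ls \<mu> ?c 0 l, OF fB(1) dls(1) _ pls B(2)] unfolding sls mls by (simp add: \<mu>0 e_def)
      have Y: "of_nat (cnt (m - l) (?D - B) (?\<Lambda> - insert 0 (Suc ` I)) \<mu>) = (if card (?D - B) = e' then fact (card (?D - B)) * ?Y else 0 :: complex)"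
        using cnt_list(1)[of "?D - B" ?ks \<mu> "m - l", OF fB(2) dls(2) _ pks] unfolding sks mks by (simp add: e'_def)
      show "of_nat (\<mu> (Suc N)) * of_nat (cntat l B (insert 0 (Suc ` I)) \<mu> ?c 0) * of_nat (cnt (m - l) (?D - B) (?\<Lambda> - insert 0 (Suc ` I)) \<mu>)
        = (if card B = e then of_nat k * (fact (e - 1) * of_nat (a - k) * ?X) * (fact e' * ?Y) else 0 :: complex)"
        unfolding X Y \<mu>0(2) using ee cB by auto
    qed
    also have "\<dots> = (\<Sum>B | B \<subseteq> ?D \<and> ?c \<in> B \<and> card B = e. of_nat k * (fact (e - 1) * of_nat (a - k) * ?X) * (fact e' * ?Y))"
    proof -
      have "{B. B \<subseteq> ?D \<and> ?c \<in> B \<and> card B = e} = {B \<in> {B. B \<subseteq> ?D \<and> ?c \<in> B}. card B = e}" by auto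
      then show ?thesis by (simp only:) (rule sum.inter_filter[symmetric], simp)
    qed
    also have "\<dots> = of_nat ((d - 1) choose (e - 1)) * (of_nat k * (fact (e - 1) * of_nat (a - k) * ?X) * (fact e' * ?Y))"
      using card_subsets_through[of ?D ?c e] dpos ee(2) by simp
    also have "\<dots> = fact (d - 1) * of_nat (k * (a - k)) * (?X * ?Y)"
    proof -
      have "fact (e - 1) * fact (d - 1 - (e - 1)) * ((d - 1) choose (e - 1)) = fact (d - 1)"
        by (rule binomial_fact_lemma) (use ee in simp)
      moreover have "d - 1 - (e - 1) = e'" using ee by simp
      ultimately have "fact (e - 1) * fact e' * ((d - 1) choose (e - 1)) = fact (d - 1)" by simp
      then have "of_nat (fact (e - 1) * fact e' * ((d - 1) choose (e - 1))) = (of_nat (fact (d - 1)) :: complex)" by (simp only:)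
      then have f: "fact (e - 1) * fact e' * of_nat ((d - 1) choose (e - 1)) = (fact (d - 1) :: complex)"
        by simp
      show ?thesis unfolding f[symmetric] by (simp add: mult_ac)
    qed
    finally show "(\<Sum>B | B \<subseteq> ?D \<and> ?c \<in> B. of_nat (\<mu> (Suc N)) * of_nat (cntat l B (insert 0 (Suc ` I)) \<mu> ?c 0) * of_nat (cnt (m - l) (?D - B) (?\<Lambda> - insert 0 (Suc ` I)) \<mu>))
      = fact (d - 1) * of_nat (k * (a - k)) * (?X * ?Y)" .
  qed
  finally show ?thesis by (simp only: sum_distrib_left)
qed

text \<open>This is \<open>cntat_Suc\<close> for the label 0, divided by (d - 1)!. Each refined
  count contributes the length of its marked cycle, which explains the factors \<open>a\<close>,
  \<open>a + nu ! r\<close> and \<open>a - k\<close>; the further \<open>k\<close> counts the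
  positions of the other end of the removed transposition.\<close>

lemma hur_Suc:
  fixes a :: nat and nu :: "nat list"
  assumes a: "a > 0" and pos: "\<forall>x\<in>set nu. x > 0"
  defines "N \<equiv> length nu"
  shows "of_nat a * hur (Suc m) (a # nu) =
     (\<Sum>r<N. of_nat (a + nu ! r) * hur m ((a + nu ! r) # nths nu ({..<N} - {r})))
     + (\<Sum>k\<in>{1..<a}. of_nat (k * (a - k)) * (hur m ((a - k) # k # nu)
         + (\<Sum>l\<le>m. \<Sum>I\<in>Pow {..<N}. hur l ((a - k) # nths nu I) * hur (m - l) (k # nths nu ({..<N} - I)))))"
proof -
  define d where "d = a + sum_list nu"
  define \<mu> where "\<mu> = nth (a # nu)"
  let ?D = "{..<d}" and ?c = "d - 1" and ?\<Lambda> = "{..<Suc N}"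
  have dpos: "d > 0" using a by (simp add: d_def)
  have \<mu>0: "\<mu> 0 = a" and \<mu>S: "\<mu> (Suc r) = nu ! r" for r by (simp_all add: \<mu>_def)
  have mpos: "\<mu> r > 0" if "r \<in> ?\<Lambda>" for r
    using that a pos by (cases r) (auto simp: \<mu>0 \<mu>S N_def)
  have cD: "?c \<in> ?D" "finite ?D" using dpos by auto
  have mx: "?c = Max ?D" by (rule Max_eqI[symmetric]) (use dpos in auto)
  have rec: "cntat (Suc m) ?D ?\<Lambda> \<mu> ?c 0 =
      (\<Sum>k\<in>?\<Lambda> - {0}. cntat m ?D (?\<Lambda> - {k}) (\<mu>(0 := \<mu> 0 + \<mu> k)) ?c 0)
    + (\<Sum>k\<in>{1..<\<mu> 0}. k * cntat m ?D (insert (Suc N) ?\<Lambda>) (\<mu>(0 := \<mu> 0 - k, Suc N := k)) ?c 0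
         + disc m ?D (insert (Suc N) ?\<Lambda>) (\<mu>(0 := \<mu> 0 - k, Suc N := k)) ?c 0 (Suc N))"
    by (rule cntat_Suc) (use cD mx mpos dpos in auto)
  have "map \<mu> [0..<Suc N] = a # nu"
    by (rule nth_equalityI) (simp_all add: \<mu>_def N_def nth_append del: upt_Suc)
  then have L: "of_nat (cntat (Suc m) ?D ?\<Lambda> \<mu> ?c 0) = (fact (d - 1) * (of_nat a * hur (Suc m) (a # nu)) :: complex)"
    using cnt_list(2)[OF cD(2), of "[0..<Suc N]" \<mu> ?c 0 "Suc m"] mpos cD(1)
    by (simp add: \<mu>0 d_def lessThan_atLeast0 del: upt_Suc)
  have J: "of_nat (cntat m ?D (?\<Lambda> - {Suc r}) (\<mu>(0 := \<mu> 0 + \<mu> (Suc r))) ?c 0)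
      = (fact (d - 1) * (of_nat (a + nu ! r) * hur m ((a + nu ! r) # nths nu ({..<N} - {r}))) :: complex)" if r: "r < N" for r
  proof -
    let ?ls = "0 # map Suc (ilist N ({..<N} - {r}))"
    let ?\<mu> = "\<mu>(0 := \<mu> 0 + \<mu> (Suc r))"
    have si: "set (ilist N ({..<N} - {r})) = {..<N} - {r}" by (rule set_ilist) auto
    have s: "set ?ls = ?\<Lambda> - {Suc r}"
    proof (rule set_eqI)
      fix x show "x \<in> set ?ls \<longleftrightarrow> x \<in> ?\<Lambda> - {Suc r}" using si by (cases x) auto
    qed
    have di: "distinct ?ls" by (auto simp: distinct_map)
    have mm: "map ?\<mu> ?ls = (a + nu ! r) # nths nu ({..<N} - {r})"
      by (simp add: \<mu>0 \<mu>S nths_ilist N_def)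
    have sl: "sum_list (map ?\<mu> ?ls) = d"
    proof -
      have "sum_list (nths nu {r}) = nu ! r"
        using sum_list_distinct_conv_sum_set[of "ilist N {r}" "nth nu"] set_ilist[of "{r}" N] r
        by (simp add: nths_ilist N_def)
      then show ?thesis unfolding mm using sum_list_nths_split[of "{r}" nu] r by (simp add: d_def N_def)
    qed
    have "?\<mu> x > 0" if "x \<in> set ?ls" for x
      using that mpos a unfolding s by (cases x) (auto simp: \<mu>0)
    from cnt_list(2)[of ?D ?ls ?\<mu> ?c 0 m, OF cD(2) di _ this cD(1)]
    moreover have "a + nu ! r + sum_list (nths nu ({..<N} - {r})) = d" using sl unfolding mm by simp
    ultimately show ?thesis unfolding s mm using dpos by (simp add: \<mu>0 \<mu>S)
  qed
  have C: "of_nat (cntat m ?D (insert (Suc N) ?\<Lambda>) (\<mu>(0 := \<mu> 0 - k, Suc N := k)) ?c 0)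
      = (fact (d - 1) * (of_nat (a - k) * hur m ((a - k) # k # nu)) :: complex)" if k: "k \<in> {1..<a}" for k
  proof -
    let ?ls = "0 # Suc N # map Suc [0..<N]"
    let ?\<mu> = "\<mu>(0 := \<mu> 0 - k, Suc N := k)"
    have s: "set ?ls = insert (Suc N) ?\<Lambda>"
    proof (rule set_eqI)
      fix x show "x \<in> set ?ls \<longleftrightarrow> x \<in> insert (Suc N) ?\<Lambda>" by (cases x) auto
    qed
    have di: "distinct ?ls" by (auto simp: distinct_map)
    have "map ?\<mu> (map Suc [0..<N]) = nu"
      by (rule nth_equalityI) (simp_all add: \<mu>S N_def)
    then have mm: "map ?\<mu> ?ls = (a - k) # k # nu" by (simp add: \<mu>0)
    have sl: "sum_list (map ?\<mu> ?ls) = d" unfolding mm using k by (simp add: d_def)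
    have "?\<mu> x > 0" if "x \<in> set ?ls" for x
      using that mpos[of x] k unfolding s by (auto simp: \<mu>0)
    from cnt_list(2)[of ?D ?ls ?\<mu> ?c 0 m, OF cD(2) di _ this cD(1)]
    moreover have "(a - k) + (k + sum_list nu) = d" using sl unfolding mm by simp
    ultimately show ?thesis unfolding s mm using dpos by (simp add: \<mu>0)
  qed
  have Di: "of_nat (disc m ?D (insert (Suc N) ?\<Lambda>) (\<mu>(0 := \<mu> 0 - k, Suc N := k)) ?c 0 (Suc N))
    = (fact (d - 1) * of_nat (k * (a - k)) * (\<Sum>l\<le>m. \<Sum>I\<in>Pow {..<N}.
        hur l ((a - k) # nths nu I) * hur (m - l) (k # nths nu ({..<N} - I))) :: complex)" if k: "k \<in> {1..<a}" for k
    using disc_list[of k a nu m] k pos unfolding \<mu>0 unfolding \<mu>_def d_def N_def by simp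
  have Lset: "?\<Lambda> - {0} = Suc ` {..<N}"
    by (rule set_eqI, rename_tac x, case_tac x) auto
  have "fact (d - 1) * (of_nat a * hur (Suc m) (a # nu)) =
     (\<Sum>r<N. fact (d - 1) * (of_nat (a + nu ! r) * hur m ((a + nu ! r) # nths nu ({..<N} - {r}))))
     + (\<Sum>k\<in>{1..<a}. of_nat k * (fact (d - 1) * (of_nat (a - k) * hur m ((a - k) # k # nu)))
         + fact (d - 1) * of_nat (k * (a - k)) * (\<Sum>l\<le>m. \<Sum>I\<in>Pow {..<N}. hur l ((a - k) # nths nu I) * hur (m - l) (k # nths nu ({..<N} - I))))"
  proof -
    have 1: "(\<Sum>k\<in>?\<Lambda> - {0}. of_nat (cntat m ?D (?\<Lambda> - {k}) (\<mu>(0 := \<mu> 0 + \<mu> k)) ?c 0)) =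
      (\<Sum>r<N. fact (d - 1) * (of_nat (a + nu ! r) * hur m ((a + nu ! r) # nths nu ({..<N} - {r}))) :: complex)"
    proof -
      have "inj_on Suc {..<N}" by simp
      then show ?thesis unfolding Lset sum.reindex[OF \<open>inj_on Suc {..<N}\<close>] comp_def
        by (intro sum.cong[OF refl] J) simp
    qed
    have 2: "(\<Sum>k\<in>{1..<\<mu> 0}. of_nat k * of_nat (cntat m ?D (insert (Suc N) ?\<Lambda>) (\<mu>(0 := \<mu> 0 - k, Suc N := k)) ?c 0)
         + of_nat (disc m ?D (insert (Suc N) ?\<Lambda>) (\<mu>(0 := \<mu> 0 - k, Suc N := k)) ?c 0 (Suc N)))
      = (\<Sum>k\<in>{1..<a}. of_nat k * (fact (d - 1) * (of_nat (a - k) * hur m ((a - k) # k # nu)))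
         + fact (d - 1) * of_nat (k * (a - k)) * (\<Sum>l\<le>m. \<Sum>I\<in>Pow {..<N}. hur l ((a - k) # nths nu I) * hur (m - l) (k # nths nu ({..<N} - I))) :: complex)"
    proof (rule sum.cong)
      fix k assume k: "k \<in> {1..<a}"
      show "of_nat k * of_nat (cntat m ?D (insert (Suc N) ?\<Lambda>) (\<mu>(0 := \<mu> 0 - k, Suc N := k)) ?c 0)
         + of_nat (disc m ?D (insert (Suc N) ?\<Lambda>) (\<mu>(0 := \<mu> 0 - k, Suc N := k)) ?c 0 (Suc N))
        = (of_nat k * (fact (d - 1) * (of_nat (a - k) * hur m ((a - k) # k # nu)))
         + fact (d - 1) * of_nat (k * (a - k)) * (\<Sum>l\<le>m. \<Sum>I\<in>Pow {..<N}. hur l ((a - k) # nths nu I) * hur (m - l) (k # nths nu ({..<N} - I))) :: complex)"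
        unfolding C[OF k] Di[OF k] ..
    qed (simp add: \<mu>0)
    show ?thesis
      unfolding L[symmetric] rec of_nat_add of_nat_sum of_nat_mult 1[unfolded of_nat_mult] 2[unfolded of_nat_mult] ..
  qed
  also have "\<dots> = fact (d - 1) * ((\<Sum>r<N. of_nat (a + nu ! r) * hur m ((a + nu ! r) # nths nu ({..<N} - {r})))
     + (\<Sum>k\<in>{1..<a}. of_nat (k * (a - k)) * (hur m ((a - k) # k # nu)
         + (\<Sum>l\<le>m. \<Sum>I\<in>Pow {..<N}. hur l ((a - k) # nths nu I) * hur (m - l) (k # nths nu ({..<N} - I))))))"
  proof -
    have "of_nat k * (fact (d - 1) * (of_nat (a - k) * X)) + fact (d - 1) * of_nat (k * (a - k)) * Y
      = fact (d - 1) * (of_nat (k * (a - k)) * (X + Y))" for k and X Y :: complex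
      unfolding of_nat_mult distrib_left by (simp add: mult_ac)
    then show ?thesis by (simp only: distrib_left[of "fact (d - 1)" "sum _ _"] sum_distrib_left[of "fact (d - 1)"])
  qed
  finally show ?thesis by (simp only: mult_cancel_left) (simp add: fact_nonzero)
qed

lemma hur_0:
  assumes "mu \<noteq> []" "\<forall>x\<in>set mu. x > 0"
  shows "hur 0 mu = (if mu = [1] then 1 else 0)"
proof -
  let ?d = "sum_list mu" and ?n = "length mu"
  have d: "?d > 0" using assms by (cases mu) auto
  have conn: "conn {..<?d} [] \<longleftrightarrow> ?d = 1"
  proof
    assume "conn {..<?d} []"
    then have "{0} = {} \<or> {0} = {..<?d}" using d connD[of "{..<?d}" "[]" "{0}"] by (simp add: separated_def)
    then have "card {..<?d} = card {0::nat}" by simp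
    then show "?d = 1" by simp
  next
    assume "?d = 1"
    show "conn {..<?d} []" unfolding \<open>?d = 1\<close> by (rule connI) auto
  qed
  show ?thesis
  proof (cases "?d = 1")
    case False
    then have "cnt 0 {..<?d} {..<?n} (nth mu) = 0" unfolding cnt_def mono_seqs_0 using conn by simp
    moreover have "mu \<noteq> [1]" using False by auto
    ultimately show ?thesis by (simp add: hur_def)
  next
    case True
    have "mu = [1]"
    proof (cases mu)
      case (Cons a nu)
      have "a + sum_list nu = 1" "a > 0" using Cons True assms(2) by simp_all
      then have "a = 1" "sum_list nu = 0" by linarith+
      moreover have "nu = []" using \<open>sum_list nu = 0\<close> assms(2) Cons by (cases nu) auto
      ultimately show ?thesis using Cons by simp
    qed (use assms in simp)
    moreover have "labs {..<1} {..<1} (nth [1]) id = {restrict (\<lambda>_. 0) {..<1}}"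
    proof
      show "labs {..<1} {..<1} (nth [1]) id \<subseteq> {restrict (\<lambda>_. 0) {..<1}}"
      proof
        fix L assume "L \<in> labs {..<1} {..<1} (nth [1]) id"
        then have P: "L \<in> {..<1} \<rightarrow>\<^sub>E {..<1}" by (simp add: labs_def)
        have "L = restrict (\<lambda>_. 0) {..<1}"
          by (rule extensionalityI[of _ "{..<1}"]) (use P in \<open>auto simp: PiE_iff\<close>)
        then show "L \<in> {restrict (\<lambda>_. 0) {..<1}}" by simp
      qed
      have "{x. x < Suc 0 \<and> restrict (\<lambda>_. 0) {..<Suc 0} x = (0::nat)} = {0}" by auto
      then show "{restrict (\<lambda>_. 0) {..<1}} \<subseteq> labs {..<1} {..<1} (nth [1]) id"
        by (simp add: labs_def)
    qed
    moreover have "{ts. ts \<in> mono_seqs {..<1::nat} 0 \<and> conn {..<1} ts} = {[]}"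
      unfolding mono_seqs_0 using conn True by auto
    ultimately show ?thesis by (simp add: hur_def cnt_def)
  qed
qed

section \<open>Agreement with the original definition, and the genus\<close>

lemma gen_transitive_iff_conn:
  assumes ts: "\<forall>(a,b)\<in>set ts. a < d \<and> b < d"
  shows "gen_transitive d ts \<longleftrightarrow> conn {..<d} ts"
proof
  assume t: "gen_transitive d ts"
  show "conn {..<d} ts"
  proof (rule connI)
    fix S assume S: "S \<subseteq> {..<d}" "separated S ts"
    have "{..<d} \<subseteq> S" if ne: "S \<noteq> {}"
    proof
      fix y assume y: "y \<in> {..<d}"
      obtain x where x: "x \<in> S" using ne by blast
      then have "x < d" using S by blast
      then obtain ws where ws: "set ws \<subseteq> set ts" "perm_of_list ws x = y"
        using t y unfolding gen_transitive_def by blast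
      have "\<forall>(a,b)\<in>set ws. a \<in> S \<longleftrightarrow> b \<in> S" using S(2) ws(1) by (auto simp: separated_def)
      then show "y \<in> S" using perm_of_list_invariant[of ws S x] x ws(2) by simp
    qed
    then show "S = {} \<or> S = {..<d}" using S(1) by blast
  qed
next
  assume c: "conn {..<d} ts"
  show "gen_transitive d ts"
    unfolding gen_transitive_def
  proof (intro allI impI)
    fix x y assume x: "x < d" and y: "y < d"
    define S where "S = {y. y < d \<and> (\<exists>ws. set ws \<subseteq> set ts \<and> perm_of_list ws x = y)}"
    have step: "Transposition.transpose a b z \<in> S" if ab: "(a, b) \<in> set ts" and z: "z \<in> S" for a b z
    proof -
      obtain ws where ws: "set ws \<subseteq> set ts" "perm_of_list ws x = z" using z by (auto simp: S_def)
      have "set ((a, b) # ws) \<subseteq> set ts" "perm_of_list ((a, b) # ws) x = Transposition.transpose a b z"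
        using ws ab by simp_all
      moreover have "Transposition.transpose a b z < d"
        using ts ab z by (auto simp: Transposition.transpose_def S_def)
      ultimately show ?thesis unfolding S_def by blast
    qed
    have "separated S ts"
    proof (rule separatedI)
      fix a b assume ab: "(a, b) \<in> set ts"
      show "a \<in> S \<longleftrightarrow> b \<in> S" using step[OF ab, of a] step[OF ab, of b] by auto
    qed
    moreover have "x \<in> S" unfolding S_def using x by (auto intro!: exI[of _ "[]"])
    moreover have "S \<subseteq> {..<d}" by (auto simp: S_def)
    ultimately have "S = {..<d}" using connD[OF c, of S] by blast
    then have "y \<in> S" using y by simp
    then show "\<exists>ws. set ws \<subseteq> set ts \<and> perm_of_list ws x = y" by (simp add: S_def)
  qed
qed

lemma monoH_eq:
  assumes "mu \<noteq> []" "\<forall>x\<in>set mu. x > 0"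
  shows "monoH g mu = hur (2 * g + length mu + sum_list mu - 2) mu"
proof -
  let ?d = "sum_list mu" and ?n = "length mu"
  let ?m = "2 * g + ?n + ?d - 2"
  have "?n > 0" "?d > 0" using assms by (cases mu; simp)+
  then have ge: "\<not> 2 * g + ?n + ?d < 2" by linarith
  have cl: "cycle_labelling ?d mu p lab \<longleftrightarrow> lab \<in> labs {..<?d} {..<?n} (nth mu) p" for p lab
    by (simp add: cycle_labelling_def labs_def lessThan_atLeast0[symmetric] Ball_def)
  have "monotone_tuples g mu = (SIGMA ts:{ts. ts \<in> mono_seqs {..<?d} ?m \<and> conn {..<?d} ts}. labs {..<?d} {..<?n} (nth mu) (perm_of_list ts))"
  proof (rule set_eqI, safe)
    fix ts lab assume t: "(ts, lab) \<in> monotone_tuples g mu"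
    then have h: "length ts = ?m" "\<forall>(a,b)\<in>set ts. a < b \<and> b < ?d" "sorted (map snd ts)" "gen_transitive ?d ts"
      "cycle_labelling ?d mu (perm_of_list ts) lab"
      unfolding monotone_tuples_def Let_def by auto
    have h2: "\<forall>(a,b)\<in>set ts. a < ?d \<and> b < ?d" using h(2) by fastforce
    show "ts \<in> mono_seqs {..<?d} ?m" using h(1-3) h2 by (fastforce simp: mono_seqs_def)
    show "conn {..<?d} ts" using h(4) gen_transitive_iff_conn[OF h2] by simp
    show "lab \<in> labs {..<?d} {..<?n} (nth mu) (perm_of_list ts)" using h(5) cl by simp
  next
    fix ts lab assume t: "ts \<in> mono_seqs {..<?d} ?m" "conn {..<?d} ts" "lab \<in> labs {..<?d} {..<?n} (nth mu) (perm_of_list ts)"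
    have h2: "\<forall>(a,b)\<in>set ts. a < ?d \<and> b < ?d" using t(1) by (auto simp: mono_seqs_def)
    have "gen_transitive ?d ts" using t(2) gen_transitive_iff_conn[OF h2] by simp
    then show "(ts, lab) \<in> monotone_tuples g mu"
      using t(1) t(3) cl by (auto simp: monotone_tuples_def Let_def mono_seqs_def)
  qed
  then have "card (monotone_tuples g mu) = cnt ?m {..<?d} {..<?n} (nth mu)"
    unfolding cnt_def
    by (simp only:) (rule card_SigmaI, use finite_mono_seqs finite_labs in auto)
  then show ?thesis using ge by (simp add: monoH_def hur_def)
qed

text \<open>The Riemann-Hurwitz formula, read off from the recursion: a join keeps the genus, a cut
  with connected remainder raises it by one, and a disconnecting cut adds the two genera.\<close>

lemma hur_nonzero:
  assumes "hur m mu \<noteq> 0" "mu \<noteq> []" "\<forall>x\<in>set mu. x > 0"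
  shows "\<exists>g. m + 2 = 2 * g + length mu + sum_list mu"
  using assms
proof (induction m arbitrary: mu rule: less_induct)
  case (less m)
  show ?case
  proof (cases m)
    case 0
    then have "mu = [1]" using less.prems hur_0[of mu] by (auto split: if_splits)
    then show ?thesis using 0 by simp
  next
    case (Suc m')
    obtain a nu where mu: "mu = a # nu" using less.prems(2) by (cases mu) auto
    let ?N = "length nu"
    have a: "a > 0" and pos: "\<forall>x\<in>set nu. x > 0" using less.prems(3) mu by auto
    have pn: "\<forall>x\<in>set (nths nu I). x > 0" for I using nths_pos[OF pos] .
    have ne: "(\<Sum>r<?N. of_nat (a + nu ! r) * hur m' ((a + nu ! r) # nths nu ({..<?N} - {r})))
     + (\<Sum>k\<in>{1..<a}. of_nat (k * (a - k)) * (hur m' ((a - k) # k # nu)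
         + (\<Sum>l\<le>m'. \<Sum>I\<in>Pow {..<?N}. hur l ((a - k) # nths nu I) * hur (m' - l) (k # nths nu ({..<?N} - I))))) \<noteq> (0::complex)"
      using hur_Suc[OF a pos, of m'] less.prems(1) a unfolding mu Suc by auto
    consider (join) r where "r < ?N" "hur m' ((a + nu ! r) # nths nu ({..<?N} - {r})) \<noteq> 0"
      | (cut) k where "k \<in> {1..<a}" "hur m' ((a - k) # k # nu) \<noteq> 0"
      | (disc) k l I where "k \<in> {1..<a}" "l \<le> m'" "I \<in> Pow {..<?N}" "hur l ((a - k) # nths nu I) \<noteq> 0" "hur (m' - l) (k # nths nu ({..<?N} - I)) \<noteq> 0"
    proof -
      assume *: "\<And>r. r < ?N \<Longrightarrow> hur m' ((a + nu ! r) # nths nu ({..<?N} - {r})) \<noteq> 0 \<Longrightarrow> thesis"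
        "\<And>k. k \<in> {1..<a} \<Longrightarrow> hur m' ((a - k) # k # nu) \<noteq> 0 \<Longrightarrow> thesis"
        "\<And>k l I. k \<in> {1..<a} \<Longrightarrow> l \<le> m' \<Longrightarrow> I \<in> Pow {..<?N} \<Longrightarrow> hur l ((a - k) # nths nu I) \<noteq> 0 \<Longrightarrow> hur (m' - l) (k # nths nu ({..<?N} - I)) \<noteq> 0 \<Longrightarrow> thesis"
      show thesis
      proof (rule ccontr)
        assume nt: "\<not> thesis"
        have 1: "hur m' ((a + nu ! r) # nths nu ({..<?N} - {r})) = 0" if "r < ?N" for r using *(1)[OF that] nt by blast
        have 2: "hur m' ((a - k) # k # nu) = 0" if "k \<in> {1..<a}" for k using *(2)[OF that] nt by blast
        have 3: "hur l ((a - k) # nths nu I) * hur (m' - l) (k # nths nu ({..<?N} - I)) = 0"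
          if "k \<in> {1..<a}" "l \<le> m'" "I \<in> Pow {..<?N}" for k l I using *(3)[OF that] nt by auto
        show False using ne by (simp add: 1 2 3)
      qed
    qed
    then show ?thesis
    proof cases
      case join
      have s: "nu ! r + sum_list (nths nu ({..<?N} - {r})) = sum_list nu"
      proof -
        have "sum_list (nths nu {r}) = nu ! r"
          using sum_list_distinct_conv_sum_set[of "ilist ?N {r}" "nth nu"] set_ilist[of "{r}" ?N] join(1)
          by (simp add: nths_ilist)
        then show ?thesis using sum_list_nths_split[of "{r}" nu] join(1) by simp
      qed
      have l: "Suc (length (nths nu ({..<?N} - {r}))) = ?N" using length_nths_compl[of "{r}" nu] join(1) by simp
      obtain g where "m' + 2 = 2 * g + length ((a + nu ! r) # nths nu ({..<?N} - {r})) + sum_list ((a + nu ! r) # nths nu ({..<?N} - {r}))"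
        using less.IH[OF _ join(2)] Suc a pn by auto
      then have "m + 2 = 2 * g + length mu + sum_list mu" using s l Suc mu by simp
      then show ?thesis ..
    next
      case cut
      obtain g where "m' + 2 = 2 * g + length ((a - k) # k # nu) + sum_list ((a - k) # k # nu)"
        using less.IH[OF _ cut(2)] Suc cut(1) pos by auto
      then have "m + 2 = 2 * (g + 1) + length mu + sum_list mu" using Suc mu cut(1) by simp
      then show ?thesis ..
    next
      case disc
      obtain g1 where g1: "l + 2 = 2 * g1 + length ((a - k) # nths nu I) + sum_list ((a - k) # nths nu I)"
        using less.IH[OF _ disc(4)] Suc disc(1,2) pn by auto
      obtain g2 where g2: "m' - l + 2 = 2 * g2 + length (k # nths nu ({..<?N} - I)) + sum_list (k # nths nu ({..<?N} - I))"
        using less.IH[of "m' - l", OF _ disc(5)] Suc disc(1,2) pn by (auto simp: less_Suc_eq_le)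
      have I: "I \<subseteq> {..<?N}" using disc(3) by simp
      have "length (nths nu I) + length (nths nu ({..<?N} - I)) = ?N"
        using length_nths_sub[OF I] length_nths_compl[OF I] card_le_sub[OF I] by simp
      then have "m + 2 = 2 * (g1 + g2) + length mu + sum_list mu"
        using g1 g2 sum_list_nths_split[OF I] disc(1,2) Suc mu by simp
      then show ?thesis ..
    qed
  qed
qed

text \<open>The excluded case is the factorisation without any transposition to remove. In genus 0
  the cut with connected remainder would come from negative genus and vanishes by
  \<open>hur_nonzero\<close>; the same lemma reduces the sum over numbers of transpositions to a sum
  over genera.\<close>

lemma monoH_rec:
  fixes a :: nat and nu :: "nat list"
  assumes a: "a > 0" and pos: "\<forall>x\<in>set nu. x > 0" and ne: "\<not> (g = 0 \<and> nu = [] \<and> a = 1)"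
  defines "N \<equiv> length nu"
  shows "of_nat a * monoH g (a # nu) =
     (\<Sum>r<N. of_nat (a + nu ! r) * monoH g ((a + nu ! r) # nths nu ({..<N} - {r})))
     + (\<Sum>k\<in>{1..<a}. of_nat (k * (a - k)) * ((if g = 0 then 0 else monoH (g - 1) ((a - k) # k # nu))
         + (\<Sum>h\<le>g. \<Sum>I\<in>Pow {..<N}. monoH h ((a - k) # nths nu I) * monoH (g - h) (k # nths nu ({..<N} - I)))))"
proof -
  define m where "m = 2 * g + N + a + sum_list nu - 2"
  have nu: "sum_list nu = 0 \<longleftrightarrow> nu = []" "nu \<noteq> [] \<Longrightarrow> N > 0" using pos by (cases nu; auto simp: N_def)+
  have ge: "2 * g + N + a + sum_list nu \<ge> 2"
  proof (cases "nu = []")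
    case True
    then show ?thesis using a ne by (cases "g = 0") auto
  next
    case False
    then show ?thesis using nu(2) a by linarith
  qed
  have pn: "\<forall>x\<in>set (nths nu I). x > 0" for I using nths_pos[OF pos] .
  have "2 * g + length (a # nu) + sum_list (a # nu) - 2 = Suc m" using ge by (simp add: m_def N_def)
  then have L: "monoH g (a # nu) = hur (Suc m) (a # nu)" using monoH_eq[of "a # nu" g] a pos by simp
  have J: "hur m ((a + nu ! r) # nths nu ({..<N} - {r})) = monoH g ((a + nu ! r) # nths nu ({..<N} - {r}))" if r: "r < N" for r
  proof -
    have s: "nu ! r + sum_list (nths nu ({..<N} - {r})) = sum_list nu"
    proof -
      have "sum_list (nths nu {r}) = nu ! r"
        using sum_list_distinct_conv_sum_set[of "ilist N {r}" "nth nu"] set_ilist[of "{r}" N] r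
        by (simp add: nths_ilist N_def)
      then show ?thesis using sum_list_nths_split[of "{r}" nu] r by (simp add: N_def)
    qed
    have l: "Suc (length (nths nu ({..<N} - {r}))) = N" using length_nths_compl[of "{r}" nu] r by (simp add: N_def)
    have "2 * g + length ((a + nu ! r) # nths nu ({..<N} - {r})) + sum_list ((a + nu ! r) # nths nu ({..<N} - {r})) - 2 = m"
      using s l by (simp add: m_def)
    then show ?thesis using monoH_eq[of "(a + nu ! r) # nths nu ({..<N} - {r})" g] a pn by simp
  qed
  have C: "hur m ((a - k) # k # nu) = (if g = 0 then 0 else monoH (g - 1) ((a - k) # k # nu))" if k: "k \<in> {1..<a}" for k
  proof (cases "g = 0")
    case True
    have "hur m ((a - k) # k # nu) = 0"
    proof (rule ccontr)
      assume "hur m ((a - k) # k # nu) \<noteq> 0"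
      then obtain h where "m + 2 = 2 * h + length ((a - k) # k # nu) + sum_list ((a - k) # k # nu)"
        using hur_nonzero[of m "(a - k) # k # nu"] k pos by auto
      then show False using ge True k by (simp add: m_def N_def)
    qed
    then show ?thesis using True by simp
  next
    case False
    have "2 * (g - 1) + length ((a - k) # k # nu) + sum_list ((a - k) # k # nu) - 2 = m"
      using False k by (simp add: m_def N_def)
    then show ?thesis using monoH_eq[of "(a - k) # k # nu" "g - 1"] False k pos by simp
  qed
  have Di: "(\<Sum>l\<le>m. hur l ((a - k) # nths nu I) * hur (m - l) (k # nths nu ({..<N} - I)))
      = (\<Sum>h\<le>g. monoH h ((a - k) # nths nu I) * monoH (g - h) (k # nths nu ({..<N} - I)))"
    if k: "k \<in> {1..<a}" and I: "I \<in> Pow {..<N}" for k I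
  proof -
    let ?A = "(a - k) # nths nu I" and ?B = "k # nths nu ({..<N} - I)"
    define p where "p = length ?A + sum_list ?A"
    define q where "q = length ?B + sum_list ?B"
    have IN: "I \<subseteq> {..<length nu}" using I by (simp add: N_def)
    have "length (nths nu I) + length (nths nu ({..<N} - I)) = N"
      using length_nths_sub[OF IN] length_nths_compl[OF IN] card_le_sub[OF IN] by (simp add: N_def)
    moreover have "p = 1 + length (nths nu I) + ((a - k) + sum_list (nths nu I))" by (simp add: p_def)
    moreover have "q = 1 + length (nths nu ({..<N} - I)) + (k + sum_list (nths nu ({..<N} - I)))" by (simp add: q_def)
    moreover have "sum_list (nths nu I) + sum_list (nths nu ({..<N} - I)) = sum_list nu"
      using sum_list_nths_split[OF IN] by (simp add: N_def)
    moreover have "m + 2 = 2 * g + N + a + sum_list nu" using ge by (simp add: m_def)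
    moreover have "(a - k) + k = a" "a - k \<ge> 1" "k \<ge> 1" using k by auto
    ultimately have pq: "m + 4 = 2 * g + p + q" "p \<ge> 2" "q \<ge> 2" by linarith+
    \<comment> \<open>The number of transpositions of the first factor when its genus is
      \<open>h\<close>. All other ways of dividing \<open>m\<close> contribute zero.\<close>
    let ?\<phi> = "\<lambda>h. 2 * h + p - 2"
    have A: "monoH h ?A = hur (?\<phi> h) ?A" for h
      using monoH_eq[of ?A h] k pn by (simp add: p_def add.assoc)
    have B: "monoH (g - h) ?B = hur (m - ?\<phi> h) ?B" if "h \<le> g" for h
    proof -
      have "2 * (g - h) + length ?B + sum_list ?B - 2 = m - ?\<phi> h" using pq that by (simp add: q_def)
      then show ?thesis using monoH_eq[of ?B "g - h"] k pn by simp
    qed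
    have inj: "inj_on ?\<phi> {..g}" by (rule inj_onI) (use pq in auto)
    have "(\<Sum>l\<le>m. hur l ?A * hur (m - l) ?B) = (\<Sum>l\<in>?\<phi> ` {..g}. hur l ?A * hur (m - l) ?B)"
    proof (rule sum.mono_neutral_right)
      show "?\<phi> ` {..g} \<subseteq> {..m}" using pq by auto
      show "\<forall>l\<in>{..m} - ?\<phi> ` {..g}. hur l ?A * hur (m - l) ?B = 0"
      proof
        fix l assume l: "l \<in> {..m} - ?\<phi> ` {..g}"
        show "hur l ?A * hur (m - l) ?B = 0"
        proof (rule ccontr)
          assume "hur l ?A * hur (m - l) ?B \<noteq> 0"
          then have n: "hur l ?A \<noteq> 0" "hur (m - l) ?B \<noteq> 0" by auto
          obtain h1 where h1: "l + 2 = 2 * h1 + length ?A + sum_list ?A" using hur_nonzero[OF n(1)] k pn by auto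
          obtain h2 where h2: "m - l + 2 = 2 * h2 + length ?B + sum_list ?B" using hur_nonzero[OF n(2)] k pn by auto
          have e: "l + 2 = 2 * h1 + p" "m - l + 2 = 2 * h2 + q" "l \<le> m" using h1 h2 l by (simp_all add: p_def q_def)
          then have "h1 + h2 = g" using pq(1) by linarith
          then have "h1 \<le> g" "l = ?\<phi> h1" using e by simp_all
          then show False using l by blast
        qed
      qed
    qed simp
    also have "\<dots> = (\<Sum>h\<le>g. monoH h ?A * monoH (g - h) ?B)"
      unfolding sum.reindex[OF inj] comp_def by (rule sum.cong[OF refl]) (simp add: A B)
    finally show ?thesis .
  qed
  have "of_nat a * monoH g (a # nu) =
     (\<Sum>r<N. of_nat (a + nu ! r) * hur m ((a + nu ! r) # nths nu ({..<N} - {r})))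
     + (\<Sum>k\<in>{1..<a}. of_nat (k * (a - k)) * (hur m ((a - k) # k # nu)
         + (\<Sum>l\<le>m. \<Sum>I\<in>Pow {..<N}. hur l ((a - k) # nths nu I) * hur (m - l) (k # nths nu ({..<N} - I)))))"
    unfolding L N_def by (rule hur_Suc[OF a pos])
  also have "\<dots> = (\<Sum>r<N. of_nat (a + nu ! r) * monoH g ((a + nu ! r) # nths nu ({..<N} - {r})))
     + (\<Sum>k\<in>{1..<a}. of_nat (k * (a - k)) * ((if g = 0 then 0 else monoH (g - 1) ((a - k) # k # nu))
         + (\<Sum>h\<le>g. \<Sum>I\<in>Pow {..<N}. monoH h ((a - k) # nths nu I) * monoH (g - h) (k # nths nu ({..<N} - I)))))"
  proof (intro arg_cong2[of _ _ _ _ plus] sum.cong refl)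
    fix r assume "r \<in> {..<N}"
    then show "of_nat (a + nu ! r) * hur m ((a + nu ! r) # nths nu ({..<N} - {r})) = of_nat (a + nu ! r) * monoH g ((a + nu ! r) # nths nu ({..<N} - {r}))"
      using J by simp
  next
    fix k assume k: "k \<in> {1..<a}"
    have "(\<Sum>l\<le>m. \<Sum>I\<in>Pow {..<N}. hur l ((a - k) # nths nu I) * hur (m - l) (k # nths nu ({..<N} - I)))
      = (\<Sum>I\<in>Pow {..<N}. \<Sum>l\<le>m. hur l ((a - k) # nths nu I) * hur (m - l) (k # nths nu ({..<N} - I)))"
      by (rule sum.swap)
    also have "\<dots> = (\<Sum>I\<in>Pow {..<N}. \<Sum>h\<le>g. monoH h ((a - k) # nths nu I) * monoH (g - h) (k # nths nu ({..<N} - I)))"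
      by (rule sum.cong[OF refl]) (rule Di[OF k])
    also have "\<dots> = (\<Sum>h\<le>g. \<Sum>I\<in>Pow {..<N}. monoH h ((a - k) # nths nu I) * monoH (g - h) (k # nths nu ({..<N} - I)))"
      by (rule sum.swap)
    finally show "of_nat (k * (a - k)) * (hur m ((a - k) # k # nu)
         + (\<Sum>l\<le>m. \<Sum>I\<in>Pow {..<N}. hur l ((a - k) # nths nu I) * hur (m - l) (k # nths nu ({..<N} - I))))
       = of_nat (k * (a - k)) * ((if g = 0 then 0 else monoH (g - 1) ((a - k) # k # nu))
         + (\<Sum>h\<le>g. \<Sum>I\<in>Pow {..<N}. monoH h ((a - k) # nths nu I) * monoH (g - h) (k # nths nu ({..<N} - I))))"
      by (simp only: C[OF k])
  qed
  finally show ?thesis .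
qed

lemma monoH_base: "monoH 0 [1] = 1"
  using monoH_eq[of "[1]" 0] hur_0[of "[1]"] by simp

text \<open>The coefficient of the monomial with exponents \<open>ms\<close> in the mixed derivative
  of the free energy: \<open>x ^ Suc m\<close> has the derivative \<open>Suc m\<close> times
  \<open>x ^ m\<close>.\<close>

definition wcoeff :: "nat \<Rightarrow> nat list \<Rightarrow> complex" where
  "wcoeff g ms = monoH g (map Suc ms) * prod_list (map (\<lambda>m. of_nat (Suc m)) ms)"

text \<open>The factor \<open>k * (a - k)\<close> of a cut is exactly the weight of the two new
  parts, and \<open>a + nu ! r\<close> is the weight of the enlarged part in a join, so only the
  weight of the part that disappears remains. In shifted indices \<open>k\<close> is
  \<open>Suc i\<close> and \<open>a - k\<close> is \<open>Suc (m - 1 - i)\<close>.\<close>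

lemma wcoeff_rec:
  fixes ms :: "nat list"
  defines "N \<equiv> length ms"
  shows "wcoeff g (m # ms) = (if g = 0 \<and> ms = [] \<and> m = 0 then 1 else 0)
     + (\<Sum>r<N. of_nat (Suc (ms ! r)) * wcoeff g ((m + ms ! r + 1) # nths ms ({..<N} - {r})))
     + (\<Sum>i<m. (if g = 0 then 0 else wcoeff (g - 1) ((m - 1 - i) # i # ms))
         + (\<Sum>h\<le>g. \<Sum>I\<in>Pow {..<N}. wcoeff h ((m - 1 - i) # nths ms I) * wcoeff (g - h) (i # nths ms ({..<N} - I))))"
proof (cases "g = 0 \<and> ms = [] \<and> m = 0")
  case True
  then show ?thesis using monoH_base by (simp add: wcoeff_def N_def)
next
  case False
  let ?P = "\<lambda>xs. prod_list (map (\<lambda>m. of_nat (Suc m)) xs) :: complex"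
  have P_split: "?P ms = ?P (nths ms I) * ?P (nths ms ({..<N} - I))" if "I \<subseteq> {..<N}" for I
  proof -
    have *: "?P (nths ms J) = (\<Prod>i\<in>J. of_nat (Suc (ms ! i)))" if "J \<subseteq> {..<N}" for J
      unfolding nths_ilist map_map comp_def
      using prod.distinct_set_conv_list[of "ilist N J" "\<lambda>i. of_nat (Suc (ms ! i)) :: complex"] set_ilist[OF that]
      by (simp add: N_def)
    have "?P ms = ?P (nths ms {..<N})" by (simp add: N_def nths_all)
    also have "\<dots> = (\<Prod>i<N. of_nat (Suc (ms ! i)))" by (rule *) simp
    also have "\<dots> = (\<Prod>i\<in>{..<N} - I. of_nat (Suc (ms ! i))) * (\<Prod>i\<in>I. of_nat (Suc (ms ! i)))"
      by (rule prod.subset_diff[OF that]) simp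
    finally show ?thesis using *[OF that] *[of "{..<N} - I"] by (simp add: mult.commute)
  qed
  have single: "?P (nths ms {r}) = of_nat (Suc (ms ! r))" if "r < N" for r
  proof -
    have "set (ilist N {r}) = {r}" by (rule set_ilist) (use that in auto)
    then have "ilist N {r} = [r]"
      using distinct_ilist[of N "{r}"] by (cases "ilist N {r}") (auto simp: subset_singleton_iff)
    then show ?thesis by (simp add: nths_ilist N_def)
  qed
  let ?nu = "map Suc ms"
  have rec: "of_nat (Suc m) * monoH g (Suc m # ?nu) =
     (\<Sum>r<N. of_nat (Suc m + ?nu ! r) * monoH g ((Suc m + ?nu ! r) # nths ?nu ({..<N} - {r})))
     + (\<Sum>k\<in>{1..<Suc m}. of_nat (k * (Suc m - k)) * ((if g = 0 then 0 else monoH (g - 1) ((Suc m - k) # k # ?nu))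
         + (\<Sum>h\<le>g. \<Sum>I\<in>Pow {..<N}. monoH h ((Suc m - k) # nths ?nu I) * monoH (g - h) (k # nths ?nu ({..<N} - I)))))"
    using monoH_rec[of "Suc m" ?nu g] False by (simp add: N_def)
  have "wcoeff g (m # ms) = (of_nat (Suc m) * monoH g (Suc m # ?nu)) * ?P ms"
    by (simp add: wcoeff_def)
  also have "\<dots> = (\<Sum>r<N. of_nat (Suc m + ?nu ! r) * monoH g ((Suc m + ?nu ! r) # nths ?nu ({..<N} - {r})) * ?P ms)
     + (\<Sum>k\<in>{1..<Suc m}. of_nat (k * (Suc m - k)) * ((if g = 0 then 0 else monoH (g - 1) ((Suc m - k) # k # ?nu))
         + (\<Sum>h\<le>g. \<Sum>I\<in>Pow {..<N}. monoH h ((Suc m - k) # nths ?nu I) * monoH (g - h) (k # nths ?nu ({..<N} - I)))) * ?P ms)"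
    unfolding rec distrib_right sum_distrib_right ..
  also have "(\<Sum>r<N. of_nat (Suc m + ?nu ! r) * monoH g ((Suc m + ?nu ! r) # nths ?nu ({..<N} - {r})) * ?P ms)
     = (\<Sum>r<N. of_nat (Suc (ms ! r)) * wcoeff g ((m + ms ! r + 1) # nths ms ({..<N} - {r})))"
  proof (rule sum.cong[OF refl])
    fix r assume "r \<in> {..<N}"
    then have r: "r < N" by simp
    have "?P ms = of_nat (Suc (ms ! r)) * ?P (nths ms ({..<N} - {r}))"
      using P_split[of "{r}"] single[OF r] r by simp
    then show "of_nat (Suc m + ?nu ! r) * monoH g ((Suc m + ?nu ! r) # nths ?nu ({..<N} - {r})) * ?P ms
      = of_nat (Suc (ms ! r)) * wcoeff g ((m + ms ! r + 1) # nths ms ({..<N} - {r}))"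
      using r by (simp add: wcoeff_def nths_map N_def mult_ac add_ac)
  qed
  also have "(\<Sum>k\<in>{1..<Suc m}. of_nat (k * (Suc m - k)) * ((if g = 0 then 0 else monoH (g - 1) ((Suc m - k) # k # ?nu))
         + (\<Sum>h\<le>g. \<Sum>I\<in>Pow {..<N}. monoH h ((Suc m - k) # nths ?nu I) * monoH (g - h) (k # nths ?nu ({..<N} - I)))) * ?P ms)
     = (\<Sum>i<m. (if g = 0 then 0 else wcoeff (g - 1) ((m - 1 - i) # i # ms))
         + (\<Sum>h\<le>g. \<Sum>I\<in>Pow {..<N}. wcoeff h ((m - 1 - i) # nths ms I) * wcoeff (g - h) (i # nths ms ({..<N} - I))))"
  proof (rule sum.reindex_bij_witness[where i = Suc and j = "\<lambda>k. k - 1"])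
    fix k assume k: "k \<in> {1..<Suc m}"
    define i where "i = k - 1"
    define j where "j = m - 1 - i"
    have ij: "k = Suc i" "m - i = Suc j" using k by (auto simp: i_def j_def)
    have 1: "of_nat (k * (Suc m - k)) * (if g = 0 then 0 else monoH (g - 1) ((Suc m - k) # k # ?nu)) * ?P ms
      = (if g = 0 then 0 else wcoeff (g - 1) (j # i # ms))"
      unfolding ij(1) diff_Suc_Suc ij(2) of_nat_mult by (simp add: wcoeff_def mult_ac del: of_nat_Suc)
    have 2: "of_nat (k * (Suc m - k)) * (\<Sum>h\<le>g. \<Sum>I\<in>Pow {..<N}. monoH h ((Suc m - k) # nths ?nu I) * monoH (g - h) (k # nths ?nu ({..<N} - I))) * ?P ms
      = (\<Sum>h\<le>g. \<Sum>I\<in>Pow {..<N}. wcoeff h (j # nths ms I) * wcoeff (g - h) (i # nths ms ({..<N} - I)))"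
      unfolding sum_distrib_left sum_distrib_right
    proof (intro sum.cong refl)
      fix h I assume I: "I \<in> Pow {..<N}"
      then have "?P ms = ?P (nths ms I) * ?P (nths ms ({..<N} - I))" by (intro P_split) simp
      then show "of_nat (k * (Suc m - k)) * (monoH h ((Suc m - k) # nths ?nu I) * monoH (g - h) (k # nths ?nu ({..<N} - I))) * ?P ms
        = wcoeff h (j # nths ms I) * wcoeff (g - h) (i # nths ms ({..<N} - I))"
        unfolding ij(1) diff_Suc_Suc ij(2) of_nat_mult by (simp add: wcoeff_def nths_map mult_ac del: of_nat_Suc)
    qed
    show "(if g = 0 then 0 else wcoeff (g - 1) ((m - 1 - (k - 1)) # (k - 1) # ms))
         + (\<Sum>h\<le>g. \<Sum>I\<in>Pow {..<N}. wcoeff h ((m - 1 - (k - 1)) # nths ms I) * wcoeff (g - h) ((k - 1) # nths ms ({..<N} - I)))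
       = of_nat (k * (Suc m - k)) * ((if g = 0 then 0 else monoH (g - 1) ((Suc m - k) # k # ?nu))
         + (\<Sum>h\<le>g. \<Sum>I\<in>Pow {..<N}. monoH h ((Suc m - k) # nths ?nu I) * monoH (g - h) (k # nths ?nu ({..<N} - I)))) * ?P ms"
      unfolding distrib_left distrib_right 1 2 j_def i_def ..
  qed auto
  finally show ?thesis using False by (simp only: if_False add_0)
qed

section \<open>Generating series in the first variable\<close>

definition wser :: "nat \<Rightarrow> nat list \<Rightarrow> complex fps" where
  "wser g ms = Abs_fps (\<lambda>m. wcoeff g (m # ms))"

text \<open>Restriction of the first two variables to the diagonal.\<close>

definition wdiag :: "nat \<Rightarrow> nat list \<Rightarrow> complex fps" where
  "wdiag g ms = Abs_fps (\<lambda>m. \<Sum>i\<le>m. wcoeff g ((m - i) # i # ms))"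

text \<open>The coefficient of y^N in the derivative with respect to y of y (f(x) - f(y)) / (x - y),
  the join term in generating-function form.\<close>

definition joinop :: "nat \<Rightarrow> complex fps \<Rightarrow> complex fps" where
  "joinop N f = fps_const (of_nat (Suc N)) * fps_shift (Suc N) f"

lemma wser_rec:
  fixes ms :: "nat list"
  defines "N \<equiv> length ms"
  shows "wser g ms = (if g = 0 \<and> ms = [] then 1 else 0)
     + (\<Sum>r<N. joinop (ms ! r) (wser g (nths ms ({..<N} - {r}))))
     + fps_X * ((if g = 0 then 0 else wdiag (g - 1) ms)
         + (\<Sum>h\<le>g. \<Sum>I\<in>Pow {..<N}. wser h (nths ms I) * wser (g - h) (nths ms ({..<N} - I))))"
    (is "_ = ?d + ?J + fps_X * (?D + ?P)")
proof (rule fps_ext)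
  fix m
  have J: "?J $ m = (\<Sum>r<N. of_nat (Suc (ms ! r)) * wcoeff g ((m + ms ! r + 1) # nths ms ({..<N} - {r})))"
    by (simp add: joinop_def wser_def fps_sum_nth add_ac)
  have X: "(fps_X * (?D + ?P)) $ m = (\<Sum>i<m. (if g = 0 then 0 else wcoeff (g - 1) ((m - 1 - i) # i # ms))
         + (\<Sum>h\<le>g. \<Sum>I\<in>Pow {..<N}. wcoeff h ((m - 1 - i) # nths ms I) * wcoeff (g - h) (i # nths ms ({..<N} - I))))"
  proof (cases m)
    case (Suc k)
    have P: "(wser h A * wser h' B) $ k = (\<Sum>i\<le>k. wcoeff h ((k - i) # A) * wcoeff h' (i # B))" for h h' A B
    proof -
      have "(wser h' B * wser h A) $ k = (\<Sum>i\<le>k. wcoeff h' (i # B) * wcoeff h ((k - i) # A))"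
        by (simp add: fps_mult_nth wser_def atLeast0AtMost)
      then show ?thesis by (simp add: mult.commute)
    qed
    have "?P $ k = (\<Sum>h\<le>g. \<Sum>I\<in>Pow {..<N}. \<Sum>i\<le>k. wcoeff h ((k - i) # nths ms I) * wcoeff (g - h) (i # nths ms ({..<N} - I)))"
      by (simp add: fps_sum_nth P)
    also have "\<dots> = (\<Sum>h\<le>g. \<Sum>i\<le>k. \<Sum>I\<in>Pow {..<N}. wcoeff h ((k - i) # nths ms I) * wcoeff (g - h) (i # nths ms ({..<N} - I)))"
      by (rule sum.cong[OF refl], rule sum.swap)
    also have "\<dots> = (\<Sum>i\<le>k. \<Sum>h\<le>g. \<Sum>I\<in>Pow {..<N}. wcoeff h ((k - i) # nths ms I) * wcoeff (g - h) (i # nths ms ({..<N} - I)))"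
      by (rule sum.swap)
    finally have "?P $ k = (\<Sum>i\<le>k. \<Sum>h\<le>g. \<Sum>I\<in>Pow {..<N}. wcoeff h ((k - i) # nths ms I) * wcoeff (g - h) (i # nths ms ({..<N} - I)))" .
    then show ?thesis unfolding Suc
      by (simp add: wdiag_def sum.distrib lessThan_Suc_atMost)
  qed simp
  have "wser g ms $ m = wcoeff g (m # ms)" by (simp add: wser_def)
  also have "\<dots> = (if g = 0 \<and> ms = [] \<and> m = 0 then 1 else 0)
     + (\<Sum>r<N. of_nat (Suc (ms ! r)) * wcoeff g ((m + ms ! r + 1) # nths ms ({..<N} - {r})))
     + (\<Sum>i<m. (if g = 0 then 0 else wcoeff (g - 1) ((m - 1 - i) # i # ms))
         + (\<Sum>h\<le>g. \<Sum>I\<in>Pow {..<N}. wcoeff h ((m - 1 - i) # nths ms I) * wcoeff (g - h) (i # nths ms ({..<N} - I))))"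
    unfolding N_def by (rule wcoeff_rec)
  finally show "wser g ms $ m = (?d + ?J + fps_X * (?D + ?P)) $ m"
    unfolding fps_add_nth[of _ "fps_X * _"] fps_add_nth[of ?d] J X by simp
qed

text \<open>\<open>Zs\<close>, \<open>Ss\<close> and \<open>Sv\<close> are the expansions of \<open>z\<close>, \<open>s = (2 - z)/z\<close> and \<open>1/s\<close> at \<open>x = 0\<close>, where
  \<open>s = sqrt (1 - 4 x)\<close>.\<close>
definition Zs :: "complex fps" where "Zs = wser 0 []"

definition Ss :: "complex fps" where "Ss = 1 - 2 * fps_X * Zs"

definition Sv :: "complex fps" where "Sv = inverse Ss"

definition wk :: "nat \<Rightarrow> nat \<Rightarrow> complex" where "wk k m = (Sv ^ (2 * k + 1)) $ m"

lemma Zs_eq: "Zs = 1 + fps_X * Zs\<^sup>2"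
  using wser_rec[of 0 "[]"] by (simp add: Zs_def power2_eq_square)

lemma Ss_sq: "Ss\<^sup>2 = 1 - 4 * fps_X"
proof -
  have "Ss\<^sup>2 = 1 - 4 * fps_X * (Zs - fps_X * Zs\<^sup>2)"
    by (simp add: Ss_def power2_eq_square algebra_simps)
  also have "Zs - fps_X * Zs\<^sup>2 = 1" using Zs_eq by (metis add_diff_cancel_right')
  finally show ?thesis by simp
qed

lemma Ss_0 [simp]: "Ss $ 0 = 1"
  by (simp add: Ss_def)

lemma Ss_Sv [simp]: "Ss * Sv = 1" "Sv * Ss = 1"
  unfolding Sv_def by (simp_all add: inverse_mult_eq_1 inverse_mult_eq_1')

lemma Ss_Sv_cancel: "Ss * a = Ss * b \<Longrightarrow> a = b"
  by (metis Ss_Sv(2) mult.assoc mult_1)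

lemma four_X: "4 * fps_X = 1 - Ss\<^sup>2"
  using Ss_sq by simp

lemma X_Sv: "4 * fps_X * Sv ^ (j + 2) = Sv ^ (j + 2) - Sv ^ j"
proof -
  have "4 * fps_X * Sv ^ (j + 2) = Sv ^ (j + 2) - (Ss * Sv)\<^sup>2 * Sv ^ j"
    unfolding four_X
    by (simp only: power_mult_distrib power_add left_diff_distrib right_diff_distrib mult_1 mult.assoc mult.commute mult.left_commute)
  then show ?thesis by simp
qed

lemma deriv_Ss: "fps_deriv Ss = - 2 * Sv"
proof -
  have "fps_deriv (Ss\<^sup>2) = - 4" unfolding Ss_sq by simp
  then have "2 * (Ss * fps_deriv Ss) = 2 * (- 2)" by (simp add: power2_eq_square algebra_simps)
  then have "Ss * fps_deriv Ss = - 2" by (simp only: mult_cancel_left) simp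
  then have "Ss * fps_deriv Ss = Ss * (- 2 * Sv)" by (simp add: mult.left_commute)
  then show ?thesis by (rule Ss_Sv_cancel)
qed

lemma deriv_Sv: "fps_deriv Sv = 2 * Sv ^ 3"
proof -
  have "Ss * fps_deriv Sv + fps_deriv Ss * Sv = 0"
    using fps_deriv_mult[of Ss Sv] by simp
  then have "Ss * fps_deriv Sv = - (fps_deriv Ss * Sv)" by (simp only: eq_neg_iff_add_eq_0)
  then have "Ss * fps_deriv Sv = 2 * Sv * Sv" by (simp add: deriv_Ss)
  also have "\<dots> = Ss * (2 * Sv ^ 3)"
  proof -
    have "Ss * (2 * Sv ^ 3) = 2 * (Ss * Sv) * Sv * Sv" by (simp add: power3_eq_cube algebra_simps)
    then show ?thesis by simp
  qed
  finally show ?thesis by (rule Ss_Sv_cancel)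
qed

lemma deriv_X_Zs: "fps_deriv (fps_X * Zs) = Sv"
proof -
  have "2 * (fps_X * Zs) = 1 - Ss" by (simp add: Ss_def algebra_simps)
  then have "fps_deriv (2 * (fps_X * Zs)) = fps_deriv (1 - Ss)" by (rule arg_cong)
  then have "2 * fps_deriv (fps_X * Zs) = 2 * Sv" by (simp add: deriv_Ss)
  then show ?thesis by (simp only: mult_cancel_left) simp
qed

text \<open>\<open>Zs\<close> is the Catalan series, and \<open>wk 0\<close> lists the central
  binomial coefficients.\<close>

lemma Zs_nth: "of_nat (Suc N) * Zs $ N = wk 0 N"
proof -
  have "fps_deriv (fps_X * Zs) $ N = of_nat (Suc N) * Zs $ N"
    unfolding fps_deriv_nth by simp
  then show ?thesis unfolding deriv_X_Zs by (simp add: wk_def)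
qed

lemma X_deriv_nth: "(fps_X * fps_deriv f) $ m = of_nat m * f $ m" for f :: "complex fps"
  by (cases m) simp_all

lemma X_deriv_Sv: "2 * (fps_X * fps_deriv (Sv ^ j)) = of_nat j * (Sv ^ (j + 2) - Sv ^ j)"
proof (cases j)
  case (Suc i)
  have "2 * (fps_X * fps_deriv (Sv ^ j)) = of_nat j * (4 * fps_X * Sv ^ (j + 2))"
    unfolding Suc fps_deriv_power' by (simp add: deriv_Sv algebra_simps power_add numeral_eq_Suc)
  then show ?thesis by (simp only: X_Sv)
qed simp

text \<open>Coefficient form of the differential equation \<open>X_deriv_Sv\<close>. The odd numbers
  in the join coefficients originate here.\<close>

lemma wk_rec: "of_nat (2 * m + 2 * b + 1) * wk b m = of_nat (2 * b + 1) * wk (Suc b) m"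
proof -
  let ?j = "2 * b + 1"
  have "(2 * (fps_X * fps_deriv (Sv ^ ?j))) $ m = 2 * (of_nat m * wk b m)"
    by (simp only: numeral_fps_const fps_mult_left_const_nth X_deriv_nth wk_def)
  moreover have "(of_nat ?j * (Sv ^ (?j + 2) - Sv ^ ?j)) $ m = of_nat ?j * (wk (Suc b) m - wk b m)"
    unfolding fps_of_nat[symmetric] by (simp add: wk_def)
  ultimately have "2 * (of_nat m * wk b m) = of_nat ?j * (wk (Suc b) m - wk b m)"
    unfolding X_deriv_Sv by simp
  then show ?thesis by (simp add: algebra_simps)
qed

section \<open>The join operator on odd powers of 1/s\<close>

lemma joinop_add: "joinop N (f + g) = joinop N f + joinop N g"
  by (rule fps_ext) (simp add: joinop_def algebra_simps)

lemma joinop_diff: "joinop N (f - g) = joinop N f - joinop N g"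
  by (rule fps_ext) (simp add: joinop_def algebra_simps)

lemma joinop_scale: "joinop N (fps_const c * f) = fps_const c * joinop N f"
  by (rule fps_ext) (simp add: joinop_def)

lemma joinop_numeral: "joinop N (numeral k * f) = numeral k * joinop N f"
  unfolding numeral_fps_const by (rule joinop_scale)

lemma joinop_X: "joinop N (fps_X * f) = fps_X * joinop N f + fps_const (of_nat (Suc N) * f $ N)"
proof (rule fps_ext)
  fix m show "joinop N (fps_X * f) $ m = (fps_X * joinop N f + fps_const (of_nat (Suc N) * f $ N)) $ m"
    by (cases m) (simp_all add: joinop_def)
qed

text \<open>Multiplication by x commutes with the shift up to the one coefficient that crosses the
  boundary, and \<open>Ss\<^sup>2\<close> is 1 - 4x.\<close>

lemma joinop_sq: "Ss\<^sup>2 * joinop N g = joinop N (Ss\<^sup>2 * g) + fps_const (4 * of_nat (Suc N) * g $ N)"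
proof -
  have e: "Ss\<^sup>2 * f = f - 4 * (fps_X * f)" for f
    unfolding Ss_sq by (simp add: algebra_simps)
  have c: "fps_const (4 * of_nat (Suc N) * g $ N) = 4 * fps_const (of_nat (Suc N) * g $ N)"
    by (simp only: numeral_fps_const fps_const_mult mult.assoc)
  have gen: "a - 4 * x = a - 4 * (x + y) + 4 * y" for a x y :: "complex fps"
    by (simp add: algebra_simps)
  show ?thesis
    unfolding e joinop_diff joinop_numeral joinop_X c by (rule gen)
qed

definition W02 :: "nat \<Rightarrow> complex fps" where "W02 N = wser 0 [N]"

lemma Pow_lessThan_1: "Pow {..<Suc 0} = {{}, {0}}" by auto

lemma W02_eq: "Ss * W02 N = joinop N Zs"
proof -
  have "W02 N = joinop N Zs + fps_X * (Zs * W02 N + W02 N * Zs)"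
    using wser_rec[of 0 "[N]"] by (simp add: W02_def Zs_def Pow_lessThan_1)
  then show ?thesis by (simp add: Ss_def algebra_simps)
qed

text \<open>The join operator together with the two unstable terms containing \<open>W02\<close>; only this
  combination preserves polynomials in \<open>Sv\<close>.\<close>
definition joinT :: "nat \<Rightarrow> complex fps \<Rightarrow> complex fps" where
  "joinT N f = joinop N f + 2 * fps_X * W02 N * f"

lemma joinT_scale: "joinT N (fps_const c * f) = fps_const c * joinT N f"
  unfolding joinT_def joinop_scale by (simp only: distrib_left mult_ac)

lemma joinT_sq: "Ss\<^sup>2 * joinT N g = joinT N (Ss\<^sup>2 * g) + fps_const (4 * of_nat (Suc N) * g $ N)"
  unfolding joinT_def distrib_left joinop_sq by (simp only: add_ac mult_ac)

text \<open>The ladder of odd powers starts at s, one step below 1/s. On s = 1 - 2xz the join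
  operator gives a constant and -2x times its value on z; by \<open>W02_eq\<close> the added
  \<open>W02\<close> term cancels the latter.\<close>

lemma joinT_Ss: "joinT N Ss = fps_const (- 2 * wk 0 N)"
proof -
  have "joinop N Ss = - 2 * (fps_X * joinop N Zs + fps_const (of_nat (Suc N) * Zs $ N))"
  proof -
    have "joinop N 1 = 0" by (rule fps_ext) (simp add: joinop_def)
    then show ?thesis
      unfolding Ss_def mult.assoc joinop_diff joinop_numeral joinop_X by simp
  qed
  moreover have "2 * fps_X * W02 N * Ss = 2 * (fps_X * joinop N Zs)"
    unfolding W02_eq[symmetric] by (simp add: algebra_simps)
  moreover have gen: "- 2 * (a + b) + 2 * a = - 2 * b" for a b :: "complex fps" by (simp add: algebra_simps)
  ultimately have "joinT N Ss = - 2 * fps_const (of_nat (Suc N) * Zs $ N)"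
    unfolding joinT_def by (simp only: gen)
  then show ?thesis unfolding Zs_nth by (simp add: numeral_fps_const)
qed

text \<open>\<open>joinT_sq\<close> solved for the higher power: raising the exponent by two costs
  only one known coefficient.\<close>

lemma joinT_up: "joinT N (Sv\<^sup>2 * f) = Sv\<^sup>2 * (joinT N f + fps_const (4 * of_nat (Suc N) * (Sv\<^sup>2 * f) $ N))"
proof -
  have e: "Ss\<^sup>2 * Sv\<^sup>2 = 1" by (simp add: power_mult_distrib[symmetric])
  have "Ss\<^sup>2 * joinT N (Sv\<^sup>2 * f) = joinT N f + fps_const (4 * of_nat (Suc N) * (Sv\<^sup>2 * f) $ N)"
    unfolding joinT_sq mult.assoc[symmetric] e by simp
  then have "Sv\<^sup>2 * (Ss\<^sup>2 * joinT N (Sv\<^sup>2 * f)) = Sv\<^sup>2 * (joinT N f + fps_const (4 * of_nat (Suc N) * (Sv\<^sup>2 * f) $ N))"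
    by (rule arg_cong)
  then show ?thesis unfolding mult.assoc[symmetric, of "Sv\<^sup>2" "Ss\<^sup>2"] mult.commute[of "Sv\<^sup>2" "Ss\<^sup>2"] e by simp
qed

lemma joinT_Sv: "joinT N Sv = fps_const (2 * wk 1 N) * Sv\<^sup>2"
proof -
  have S: "Sv\<^sup>2 * Ss = Sv" by (simp add: power2_eq_square mult.assoc)
  have "(2 * of_nat N + 1) * wk 0 N = wk 1 N" using wk_rec[of N 0] by (simp add: add.commute)
  then have "2 * ((2 * of_nat N + 1) * wk 0 N) = 2 * wk 1 N" by (rule arg_cong)
  then have "- 2 * wk 0 N + 4 * of_nat (Suc N) * Sv $ N = 2 * wk 1 N"
    by (simp add: wk_def[of 0] algebra_simps)
  then show ?thesis
    using joinT_up[of N Ss] unfolding S joinT_Ss by (simp add: fps_const_add[symmetric] mult.commute del: fps_const_add)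
qed

text \<open>Each use of \<open>joinT_up\<close> shifts all exponents by two and adds a multiple of
  \<open>Sv ^ 3\<close>. The result has the shape of \<open>Tsum\<close>, with
  \<open>wk (Suc l) N\<close> in the place of \<open>phi (Suc l) y\<close>.\<close>

lemma joinT_Sv_power:
  "Sv * joinT N (Sv ^ (2 * k + 1)) =
     (\<Sum>l\<le>k. fps_const (2 * of_nat (2 * l + 1) * wk (Suc l) N) * Sv ^ (2 * Suc (k - l) + 1))
   - (\<Sum>l<k. fps_const (2 * of_nat (2 * l + 1) * wk (Suc l) N) * Sv ^ (2 * Suc (k - 1 - l) + 1))"
proof (induction k)
  case 0
  then show ?case by (simp add: joinT_Sv power3_eq_cube power2_eq_square numeral_eq_Suc mult_ac)
next
  case (Suc k)
  let ?c = "\<lambda>l. fps_const (2 * of_nat (2 * l + 1) * wk (Suc l) N)"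
  have e: "Sv ^ (2 * Suc k + 1) = Sv\<^sup>2 * Sv ^ (2 * k + 1)" by (simp add: power2_eq_square)
  have w: "(Sv\<^sup>2 * Sv ^ (2 * k + 1)) $ N = wk (Suc k) N" unfolding wk_def e ..
  \<comment> \<open>By \<open>wk_rec\<close> the boundary term is a difference of consecutive
    coefficients, and its two parts extend the two sums by one term each.\<close>
  have r: "4 * of_nat (Suc N) * wk (Suc k) N = 2 * of_nat (2 * Suc k + 1) * wk (Suc (Suc k)) N - 2 * of_nat (2 * k + 1) * wk (Suc k) N"
  proof -
    have "2 * (of_nat (2 * N + 2 * Suc k + 1) * wk (Suc k) N) = 2 * (of_nat (2 * Suc k + 1) * wk (Suc (Suc k)) N)"
      unfolding wk_rec ..
    then show ?thesis by (simp add: algebra_simps)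
  qed
  have s1: "(\<Sum>l\<le>Suc k. ?c l * Sv ^ (2 * Suc (Suc k - l) + 1)) = Sv\<^sup>2 * (\<Sum>l\<le>k. ?c l * Sv ^ (2 * Suc (k - l) + 1)) + ?c (Suc k) * Sv ^ 3"
  proof -
    have "(\<Sum>l\<le>k. ?c l * Sv ^ (2 * Suc (Suc k - l) + 1)) = (\<Sum>l\<le>k. Sv\<^sup>2 * (?c l * Sv ^ (2 * Suc (k - l) + 1)))"
      by (rule sum.cong[OF refl]) (simp add: Suc_diff_le power2_eq_square algebra_simps)
    then show ?thesis by (simp add: sum_distrib_left numeral_eq_Suc)
  qed
  have s2: "(\<Sum>l<Suc k. ?c l * Sv ^ (2 * Suc (Suc k - 1 - l) + 1)) = Sv\<^sup>2 * (\<Sum>l<k. ?c l * Sv ^ (2 * Suc (k - 1 - l) + 1)) + ?c k * Sv ^ 3"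
  proof -
    have "(\<Sum>l<k. ?c l * Sv ^ (2 * Suc (Suc k - 1 - l) + 1)) = (\<Sum>l<k. Sv\<^sup>2 * (?c l * Sv ^ (2 * Suc (k - 1 - l) + 1)))"
    proof (rule sum.cong[OF refl])
      fix l assume "l \<in> {..<k}"
      then have "Suc k - 1 - l = Suc (k - 1 - l)" by auto
      then show "?c l * Sv ^ (2 * Suc (Suc k - 1 - l) + 1) = Sv\<^sup>2 * (?c l * Sv ^ (2 * Suc (k - 1 - l) + 1))"
        by (simp add: power2_eq_square algebra_simps)
    qed
    then show ?thesis by (simp add: sum_distrib_left numeral_eq_Suc)
  qed
  have "Sv * joinT N (Sv ^ (2 * Suc k + 1)) = Sv\<^sup>2 * (Sv * joinT N (Sv ^ (2 * k + 1))) + fps_const (4 * of_nat (Suc N) * wk (Suc k) N) * Sv ^ 3"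
    unfolding e joinT_up w by (simp add: algebra_simps power2_eq_square power3_eq_cube)
  also have "fps_const (4 * of_nat (Suc N) * wk (Suc k) N) = ?c (Suc k) - ?c k"
    unfolding r by (simp only: fps_const_sub)
  finally show ?case unfolding s1 s2 Suc.IH by (simp only: algebra_simps)
qed

text \<open>Multiplying a coefficient by m + N + 2 is an Euler operator in both variables. It turns
  the (0,2) series into a product of two one-variable series and can be undone, because the factor
  never vanishes. The initial cases rest on this.\<close>

lemma W02_euler: "of_nat (m + N + 2) * W02 N $ m = 2 * wk 1 N * wk 1 m"
proof -
  define V where "V = joinop N Zs"
  have W: "W02 N = Sv * V"
  proof (rule Ss_Sv_cancel)
    show "Ss * W02 N = Ss * (Sv * V)" unfolding W02_eq V_def mult.assoc[symmetric] by simp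
  qed
  have V: "fps_X * fps_deriv V + of_nat (N + 2) * V = joinop N Sv"
  proof (rule fps_ext)
    fix i
    have "of_nat (Suc (i + Suc N)) * Zs $ (i + Suc N) = Sv $ (i + Suc N)"
      using Zs_nth[of "i + Suc N"] by (simp add: wk_def)
    then have "(of_nat i + of_nat (N + 2)) * Zs $ (i + Suc N) = Sv $ (i + Suc N)" by (simp add: algebra_simps)
    then have "of_nat (Suc N) * ((of_nat i + of_nat (N + 2)) * Zs $ (i + Suc N)) = of_nat (Suc N) * Sv $ (i + Suc N)" by (rule arg_cong)
    then show "(fps_X * fps_deriv V + of_nat (N + 2) * V) $ i = joinop N Sv $ i"
      unfolding fps_add_nth X_deriv_nth fps_of_nat[symmetric] fps_mult_left_const_nth V_def
      by (simp add: joinop_def algebra_simps del: of_nat_Suc)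
  qed
  have "fps_X * fps_deriv (Sv * V) + of_nat (N + 2) * (Sv * V) = Sv * (joinop N Sv + 2 * fps_X * (Sv * V) * Sv)"
    unfolding V[symmetric] by (simp add: deriv_Sv algebra_simps power3_eq_cube)
  also have "\<dots> = Sv * joinT N Sv" by (simp add: joinT_def W)
  also have "\<dots> = fps_const (2 * wk 1 N) * Sv ^ (2 * 1 + 1)"
    unfolding joinT_Sv by (simp add: power2_eq_square numeral_eq_Suc mult_ac)
  finally have "(fps_X * fps_deriv (W02 N) + of_nat (N + 2) * W02 N) $ m = (fps_const (2 * wk 1 N) * Sv ^ (2 * 1 + 1)) $ m"
    unfolding W by simp
  then show ?thesis
    unfolding fps_add_nth X_deriv_nth fps_of_nat[symmetric] fps_mult_left_const_nth wk_def[symmetric]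
    by (simp add: algebra_simps)
qed

text \<open>On the diagonal the Euler factor m + 2 is constant in each sum, which thus becomes a
  convolution, a coefficient of 2 \<open>Sv ^ 6\<close>. The fourth power satisfies the same
  identity by \<open>X_deriv_Sv\<close>.\<close>

lemma wdiag_0: "wdiag 0 [] = Sv ^ 4"
proof (rule fps_ext)
  fix m
  have "2 * (fps_X * fps_deriv (Sv ^ 4)) + 4 * Sv ^ 4 = 4 * Sv ^ 6"
    unfolding X_deriv_Sv by (simp add: algebra_simps)
  then have "(2 * (fps_X * fps_deriv (Sv ^ 4)) + 4 * Sv ^ 4) $ m = (4 * Sv ^ 6) $ m" by simp
  then have 1: "of_nat (m + 2) * (Sv ^ 4) $ m = 2 * (Sv ^ 6) $ m"
  proof -
    have "2 * (of_nat (m + 2) * (Sv ^ 4) $ m) = 2 * (2 * (Sv ^ 6) $ m)"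
      using \<open>(2 * (fps_X * fps_deriv (Sv ^ 4)) + 4 * Sv ^ 4) $ m = (4 * Sv ^ 6) $ m\<close>
      unfolding fps_add_nth numeral_fps_const fps_mult_left_const_nth X_deriv_nth by (simp add: algebra_simps)
    then show ?thesis by (simp only: mult_cancel_left) simp
  qed
  have "of_nat (m + 2) * wdiag 0 [] $ m = (\<Sum>i\<le>m. of_nat (m + 2) * W02 i $ (m - i))"
    by (simp add: wdiag_def W02_def wser_def sum_distrib_left)
  also have "\<dots> = (\<Sum>i\<le>m. 2 * (wk 1 i * wk 1 (m - i)))"
  proof (rule sum.cong[OF refl])
    fix i assume "i \<in> {..m}"
    then show "of_nat (m + 2) * W02 i $ (m - i) = 2 * (wk 1 i * wk 1 (m - i))"
      using W02_euler[of "m - i" i] by simp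
  qed
  also have "\<dots> = 2 * (Sv ^ 3 * Sv ^ 3) $ m"
    by (simp add: fps_mult_nth wk_def sum_distrib_left atLeast0AtMost numeral_eq_Suc)
  also have "Sv ^ 3 * Sv ^ 3 = Sv ^ 6" by (simp add: power_add[symmetric])
  finally have "of_nat (m + 2) * wdiag 0 [] $ m = of_nat (m + 2) * (Sv ^ 4) $ m" using 1 by simp
  then show "wdiag 0 [] $ m = (Sv ^ 4) $ m" by (simp only: mult_cancel_left of_nat_eq_0_iff) simp
qed

text \<open>The only source term is the diagonal of (0,2). After division by s it is x times
  \<open>Sv ^ 5\<close>, and 4x = 1 - s^2 gives the factor 1/4.\<close>

lemma wser_11: "wser 1 [] = fps_const (1/4) * (Sv ^ 5 - Sv ^ 3)"
proof -
  have "wser 1 [] = fps_X * (Sv ^ 4 + (Zs * wser 1 [] + wser 1 [] * Zs))"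
    using wser_rec[of 1 "[]"] by (simp add: Zs_def wdiag_0 atMost_Suc)
  then have "Ss * wser 1 [] = fps_X * Sv ^ 4" by (simp add: Ss_def algebra_simps)
  then have "Ss * wser 1 [] = Ss * (fps_X * Sv ^ 5)"
    by (simp add: numeral_eq_Suc mult.left_commute[of Ss] mult.assoc[symmetric, of Ss Sv])
  then have "wser 1 [] = fps_X * Sv ^ 5" by (rule Ss_Sv_cancel)
  moreover have "4 * fps_X * Sv ^ 5 = Sv ^ 5 - Sv ^ 3" using X_Sv[of 3] by simp
  ultimately have "4 * wser 1 [] = Sv ^ 5 - Sv ^ 3" by (simp add: mult.assoc)
  then have "fps_const (1/4) * (4 * wser 1 []) = fps_const (1/4) * (Sv ^ 5 - Sv ^ 3)" by (rule arg_cong)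
  then show ?thesis by (simp add: numeral_fps_const mult.assoc[symmetric])
qed

lemma Pow_lessThan_2: "Pow {..<Suc (Suc 0)} = {{}, {0}, {1}, {0, 1}}"
  by (auto simp: lessThan_Suc)

text \<open>\<open>Q\<close> collects the terms built from (0,2), so it is not visibly a polynomial
  in \<open>Sv\<close>. The operator x d/dx + N + M + 3 turns it into known values of
  \<open>joinT\<close> at \<open>Sv ^ 3\<close>. It maps a multiple of \<open>Sv\<^sup>2\<close> to
  the same series, and it is injective.\<close>

lemma wser_03: "wser 0 [N, M] = fps_const (8 * wk 1 N * wk 1 M) * Sv ^ 3"
proof -
  define Q where "Q = joinop N (W02 M) + joinop M (W02 N) + 2 * fps_X * W02 N * W02 M"
  have ne: "{0} \<noteq> {1::nat}" "{} \<noteq> {0::nat}" "{0::nat} \<noteq> {0, 1}" by auto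
  have n1: "{..<Suc (Suc 0)} - {0} = {1::nat}" "{..<Suc (Suc 0)} - {1} = {0::nat}" "{..<Suc (Suc 0)} - {0,1} = {}" "{..<Suc (Suc 0)} = {0,1::nat}"
    by auto
  have n2: "nths [N, M] {0, 1} = [N, M]" "nths [N, M] {0} = [N]" "nths [N, M] {1} = [M]"
    by (simp_all add: nths_Cons)
  have "wser 0 [N, M] = (\<Sum>r<Suc (Suc 0). joinop ([N, M] ! r) (wser 0 (nths [N, M] ({..<Suc (Suc 0)} - {r}))))
      + fps_X * (\<Sum>I\<in>{{}, {0}, {1}, {0, 1}}. wser 0 (nths [N, M] I) * wser 0 (nths [N, M] ({..<Suc (Suc 0)} - I)))"
  proof -
    have s0: "(\<Sum>h\<le>(0::nat). G h) = G 0" for G :: "nat \<Rightarrow> complex fps" by simp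
    show ?thesis using wser_rec[of 0 "[N, M]"] unfolding s0 by (simp add: Pow_lessThan_2 del: sum.insert)
  qed
  also have "(\<Sum>r<Suc (Suc 0). joinop ([N, M] ! r) (wser 0 (nths [N, M] ({..<Suc (Suc 0)} - {r}))))
     = joinop N (W02 M) + joinop M (W02 N)"
  proof -
    have "{..<Suc (Suc 0)} - {Suc 0} = {0::nat}" "nths [N, M] {Suc 0} = [M]" by (auto simp: nths_Cons)
    then show ?thesis unfolding sum.lessThan_Suc using n1(1) n2(2) by (simp add: W02_def)
  qed
  also have "(\<Sum>I\<in>{{}, {0}, {1}, {0, 1}}. wser 0 (nths [N, M] I) * wser 0 (nths [N, M] ({..<Suc (Suc 0)} - I)))
    = Zs * wser 0 [N, M] + (W02 N * W02 M + (W02 M * W02 N + wser 0 [N, M] * Zs))"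
    using ne n1 n2 by (simp add: W02_def Zs_def)
  finally have "wser 0 [N, M] = joinop N (W02 M) + joinop M (W02 N) + fps_X * (Zs * wser 0 [N, M] + (W02 N * W02 M + (W02 M * W02 N + wser 0 [N, M] * Zs)))" .
  then have SQ: "Ss * wser 0 [N, M] = Q" by (simp add: Ss_def Q_def algebra_simps)
  have eul: "fps_X * fps_deriv (W02 K) = fps_const (2 * wk 1 K) * Sv ^ 3 - of_nat (K + 2) * W02 K" for K
  proof (rule fps_ext)
    fix i
    have "of_nat i * W02 K $ i = 2 * wk 1 K * wk 1 i - of_nat (K + 2) * W02 K $ i"
      using W02_euler[of i K] by (simp add: algebra_simps)
    then show "(fps_X * fps_deriv (W02 K)) $ i = (fps_const (2 * wk 1 K) * Sv ^ 3 - of_nat (K + 2) * W02 K) $ i"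
      unfolding X_deriv_nth fps_of_nat[symmetric] by (simp add: wk_def numeral_eq_Suc)
  qed
  \<comment> \<open>The weight is K + L + 3 because \<open>joinop K\<close> shifts the index of
    \<open>W02 L\<close> by \<open>Suc K\<close>, and the Euler weight of (0,2) adds 2.\<close>
  have je: "fps_X * fps_deriv (joinop K (W02 L)) + of_nat (K + L + 3) * joinop K (W02 L) = fps_const (2 * wk 1 L) * joinop K (Sv ^ 3)" for K L
  proof (rule fps_ext)
    fix i
    have "of_nat (i + Suc K + L + 2) * W02 L $ (i + Suc K) = 2 * wk 1 L * wk 1 (i + Suc K)" by (rule W02_euler)
    then have "of_nat (Suc K) * (of_nat (i + Suc K + L + 2) * W02 L $ (i + Suc K)) = of_nat (Suc K) * (2 * wk 1 L * wk 1 (i + Suc K))" by (rule arg_cong)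
    then show "(fps_X * fps_deriv (joinop K (W02 L)) + of_nat (K + L + 3) * joinop K (W02 L)) $ i = (fps_const (2 * wk 1 L) * joinop K (Sv ^ 3)) $ i"
      unfolding fps_add_nth X_deriv_nth fps_of_nat[symmetric] fps_mult_left_const_nth
      by (simp add: joinop_def wk_def numeral_eq_Suc algebra_simps)
  qed
  have pe: "fps_X * fps_deriv (2 * fps_X * W02 N * W02 M) + of_nat (N + M + 3) * (2 * fps_X * W02 N * W02 M)
     = 2 * fps_X * Sv ^ 3 * (fps_const (2 * wk 1 N) * W02 M + fps_const (2 * wk 1 M) * W02 N)"
  proof -
    have "fps_X * fps_deriv (2 * fps_X * W02 N * W02 M) = 2 * fps_X * (W02 N * W02 M + (fps_X * fps_deriv (W02 N)) * W02 M + W02 N * (fps_X * fps_deriv (W02 M)))"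
      by (simp add: algebra_simps)
    then show ?thesis unfolding eul by (simp add: algebra_simps)
  qed
  have t3: "Sv * joinT K (Sv ^ 3) = fps_const (2 * wk 1 K) * Sv ^ 5 + fps_const (6 * wk 2 K - 2 * wk 1 K) * Sv ^ 3" for K
    using joinT_Sv_power[of K 1] by (simp add: atMost_Suc numeral_eq_Suc algebra_simps fps_const_sub[symmetric] del: fps_const_sub)
  have QE: "fps_X * fps_deriv Q + of_nat (N + M + 3) * Q
     = fps_const (2 * wk 1 M) * joinT N (Sv ^ 3) + fps_const (2 * wk 1 N) * joinT M (Sv ^ 3)"
  proof -
    have "fps_X * fps_deriv Q + of_nat (N + M + 3) * Q =
      (fps_X * fps_deriv (joinop N (W02 M)) + of_nat (N + M + 3) * joinop N (W02 M))
      + (fps_X * fps_deriv (joinop M (W02 N)) + of_nat (M + N + 3) * joinop M (W02 N))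
      + (fps_X * fps_deriv (2 * fps_X * W02 N * W02 M) + of_nat (N + M + 3) * (2 * fps_X * W02 N * W02 M))"
      by (simp add: Q_def algebra_simps)
    then show ?thesis unfolding je pe joinT_def by (simp add: algebra_simps)
  qed
  define c where "c = 8 * wk 1 N * wk 1 M"
  have w2: "3 * wk 2 K = (2 * of_nat K + 3) * wk 1 K" for K
    using wk_rec[of K 1] by (simp add: numeral_eq_Suc algebra_simps)
  have sc: "2 * wk 1 M * (6 * wk 2 N - 2 * wk 1 N) + 2 * wk 1 N * (6 * wk 2 M - 2 * wk 1 M) = c * of_nat (N + M + 2)"
  proof -
    have "2 * wk 1 M * (6 * wk 2 N - 2 * wk 1 N) + 2 * wk 1 N * (6 * wk 2 M - 2 * wk 1 M)
       = 4 * wk 1 M * (3 * wk 2 N) - 4 * wk 1 M * wk 1 N + (4 * wk 1 N * (3 * wk 2 M) - 4 * wk 1 N * wk 1 M)"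
      by (simp add: algebra_simps)
    then show ?thesis unfolding w2 c_def by (simp add: algebra_simps)
  qed
  have "Sv * (fps_X * fps_deriv Q + of_nat (N + M + 3) * Q) = fps_const c * Sv ^ 5 + fps_const (c * of_nat (N + M + 2)) * Sv ^ 3"
  proof -
    have "Sv * (fps_const (2 * wk 1 M) * joinT N (Sv ^ 3) + fps_const (2 * wk 1 N) * joinT M (Sv ^ 3))
      = fps_const (2 * wk 1 M) * (Sv * joinT N (Sv ^ 3)) + fps_const (2 * wk 1 N) * (Sv * joinT M (Sv ^ 3))"
      by (simp add: algebra_simps)
    also have "\<dots> = (fps_const (2 * wk 1 M) * fps_const (2 * wk 1 N) + fps_const (2 * wk 1 N) * fps_const (2 * wk 1 M)) * Sv ^ 5
       + (fps_const (2 * wk 1 M) * fps_const (6 * wk 2 N - 2 * wk 1 N) + fps_const (2 * wk 1 N) * fps_const (6 * wk 2 M - 2 * wk 1 M)) * Sv ^ 3"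
      unfolding t3 by (simp only: algebra_simps)
    also have "\<dots> = fps_const c * Sv ^ 5 + fps_const (c * of_nat (N + M + 2)) * Sv ^ 3"
      unfolding fps_const_mult fps_const_add sc by (simp add: c_def algebra_simps)
    finally show ?thesis unfolding QE .
  qed
  moreover have "Sv * (fps_X * fps_deriv (fps_const c * Sv\<^sup>2) + of_nat (N + M + 3) * (fps_const c * Sv\<^sup>2))
     = fps_const c * Sv ^ 5 + fps_const (c * of_nat (N + M + 2)) * Sv ^ 3"
  proof -
    have d: "fps_X * fps_deriv (Sv\<^sup>2) = Sv ^ 4 - Sv\<^sup>2"
    proof -
      have "2 * (fps_X * fps_deriv (Sv\<^sup>2)) = 2 * (Sv ^ 4 - Sv\<^sup>2)" using X_deriv_Sv[of 2] by simp
      then show ?thesis by (simp only: mult_cancel_left) simp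
    qed
    have f: "fps_X * fps_deriv (fps_const c * Sv\<^sup>2) = fps_const c * (Sv ^ 4 - Sv\<^sup>2)"
      unfolding d[symmetric] by (simp add: algebra_simps)
    have K: "of_nat (N + M + 3) = fps_const (of_nat (N + M + 2)) + (1 :: complex fps)"
      unfolding fps_of_nat by simp
    have gen: "v * (C * (v ^ 4 - v\<^sup>2) + (K + 1) * (C * v\<^sup>2)) = C * v ^ 5 + (C * K) * v ^ 3" for v C K :: "complex fps"
      by (simp add: algebra_simps numeral_eq_Suc)
    show ?thesis unfolding f K fps_const_mult[symmetric] by (rule gen)
  qed
  ultimately have "Ss * (Sv * (fps_X * fps_deriv Q + of_nat (N + M + 3) * Q)) = Ss * (Sv * (fps_X * fps_deriv (fps_const c * Sv\<^sup>2) + of_nat (N + M + 3) * (fps_const c * Sv\<^sup>2)))"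
    by simp
  then have eq: "fps_X * fps_deriv Q + of_nat (N + M + 3) * Q = fps_X * fps_deriv (fps_const c * Sv\<^sup>2) + of_nat (N + M + 3) * (fps_const c * Sv\<^sup>2)"
    unfolding mult.assoc[symmetric, of Ss Sv] by simp
  have "Q = fps_const c * Sv\<^sup>2"
  proof (rule fps_ext)
    fix i
    have "of_nat (i + (N + M + 3)) * Q $ i = of_nat (i + (N + M + 3)) * (fps_const c * Sv\<^sup>2) $ i"
      using arg_cong[OF eq, of "\<lambda>f. f $ i"]
      unfolding fps_add_nth X_deriv_nth fps_of_nat[symmetric] fps_mult_left_const_nth by (simp add: algebra_simps)
    then show "Q $ i = (fps_const c * Sv\<^sup>2) $ i" by (simp only: mult_cancel_left of_nat_eq_0_iff) simp
  qed
  then have "Ss * wser 0 [N, M] = Ss * (fps_const c * Sv ^ 3)"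
    unfolding SQ by (simp add: numeral_eq_Suc mult.left_commute[of Ss] mult.assoc[symmetric, of Ss Sv])
  then show ?thesis unfolding c_def by (rule Ss_Sv_cancel)
qed

section \<open>Residues at the branch point\<close>

text \<open>\<open>residue\<close> is a total function that is additive only at isolated
  singularities. With the punctured disc as part of the predicate, it is closed under finite sums,
  multiples and replacement by a function that agrees near 2.\<close>

definition has_residue_two :: "(complex \<Rightarrow> complex) \<Rightarrow> complex \<Rightarrow> bool" where
  "has_residue_two F r \<longleftrightarrow> (\<exists>e>0. F holomorphic_on (ball 2 e - {2})) \<and> residue F 2 = r"

lemma has_residue_two_add:
  assumes "has_residue_two F r" "has_residue_two G s"
  shows "has_residue_two (\<lambda>z. F z + G z) (r + s)"
proof -
  obtain e1 where e1: "e1 > 0" "F holomorphic_on (ball 2 e1 - {2})" using assms(1) by (auto simp: has_residue_two_def)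
  obtain e2 where e2: "e2 > 0" "G holomorphic_on (ball 2 e2 - {2})" using assms(2) by (auto simp: has_residue_two_def)
  define e where "e = min e1 e2"
  have e: "e > 0" "F holomorphic_on (ball 2 e - {2})" "G holomorphic_on (ball 2 e - {2})"
    using e1 e2 by (auto simp: e_def intro: holomorphic_on_subset)
  have "residue (\<lambda>z. F z + G z) 2 = residue F 2 + residue G 2"
    by (rule residue_add[of "ball 2 e"]) (use e in auto)
  moreover have "(\<lambda>z. F z + G z) holomorphic_on (ball 2 e - {2})" using e by (intro holomorphic_intros)
  ultimately show ?thesis using assms e(1) by (auto simp: has_residue_two_def)
qed

lemma has_residue_two_cmult:
  assumes "has_residue_two F r"
  shows "has_residue_two (\<lambda>z. c * F z) (c * r)"
proof -
  obtain e where e: "e > 0" "F holomorphic_on (ball 2 e - {2})" using assms by (auto simp: has_residue_two_def)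
  have "residue (\<lambda>z. c * F z) 2 = c * residue F 2"
    by (rule residue_lmul[of "ball 2 e"]) (use e in auto)
  moreover have "(\<lambda>z. c * F z) holomorphic_on (ball 2 e - {2})" using e by (intro holomorphic_intros)
  ultimately show ?thesis using assms e(1) by (auto simp: has_residue_two_def)
qed

lemma has_residue_two_holomorphic:
  assumes "open S" "2 \<in> S" "F holomorphic_on S"
  shows "has_residue_two F 0"
proof -
  obtain e where e: "e > 0" "ball 2 e \<subseteq> S" using assms openE by blast
  then have "F holomorphic_on (ball 2 e - {2})" using assms(3) by (auto intro: holomorphic_on_subset)
  then show ?thesis using e(1) residue_holo[OF assms] by (auto simp: has_residue_two_def)
qed

lemma has_residue_two_zero [simp]: "has_residue_two (\<lambda>_. 0) 0"
  by (rule has_residue_two_holomorphic[of UNIV]) auto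

lemma has_residue_two_sum: "(\<And>x. x \<in> A \<Longrightarrow> has_residue_two (F x) (r x)) \<Longrightarrow> has_residue_two (\<lambda>z. \<Sum>x\<in>A. F x z) (\<Sum>x\<in>A. r x)"
proof (induction A rule: infinite_finite_induct)
  case (insert x A)
  then show ?case using has_residue_two_add[of "F x" "r x"] by simp
qed simp_all

lemma has_residue_two_cong:
  assumes "has_residue_two F r" "eventually (\<lambda>z. F z = G z) (at 2)"
  shows "has_residue_two G r"
proof -
  obtain e1 where e1: "e1 > 0" "F holomorphic_on (ball 2 e1 - {2})" using assms(1) by (auto simp: has_residue_two_def)
  obtain e2 where e2: "e2 > 0" "\<And>z. z \<noteq> 2 \<Longrightarrow> dist z 2 < e2 \<Longrightarrow> F z = G z"
    using assms(2) by (auto simp: eventually_at)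
  define e where "e = min e1 e2"
  have "F holomorphic_on (ball 2 e - {2})" using e1 by (auto simp: e_def intro: holomorphic_on_subset)
  moreover have "F z = G z" if "z \<in> ball 2 e - {2}" for z
    using e2(2)[of z] that by (auto simp: e_def dist_commute)
  ultimately have "G holomorphic_on (ball 2 e - {2})" using holomorphic_cong by blast
  moreover have "residue F 2 = residue G 2" using assms(2) by (rule residue_cong) simp
  ultimately show ?thesis using assms(1) e1 e2 by (auto simp: has_residue_two_def e_def intro!: exI[of _ "min e1 e2"])
qed

lemma has_residue_two_pole: "has_residue_two (\<lambda>z. 1 / (z - 2) ^ Suc n) (if n = 0 then 1 else 0)"
proof -
  have "(\<lambda>z. 1 / (z - 2) ^ Suc n) holomorphic_on (ball 2 1 - {2 :: complex})"
    by (intro holomorphic_intros) auto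
  moreover have "residue (\<lambda>z. 1 / (z - 2) ^ Suc n) 2 = (if n = 0 then 1 else 0 :: complex)"
    using residue_holomorphic_over_power[of UNIV "2 :: complex" "\<lambda>_. 1" n] by (simp split: if_splits)
  ultimately show ?thesis unfolding has_residue_two_def by (intro conjI exI[of _ 1]) auto
qed

lemma ev_ne: "eventually (\<lambda>z. z \<noteq> a) (at (2::complex))"
proof (cases "a = 2")
  case True then show ?thesis by (simp add: eventually_at_filter)
next
  case False
  have "eventually (\<lambda>z. z \<in> - {a}) (nhds (2::complex))"
    by (rule eventually_nhds_in_open) (use False in auto)
  then show ?thesis by (auto simp: eventually_at_filter elim: eventually_mono)
qed

text \<open>The residue against 1/(w - z) reproduces a principal part at the point w. The induction
  uses the partial fractions 1/(t (w - 2 - t)) = (1/t + 1/(w - 2 - t)) / (w - 2) with t = z -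
  2.\<close>

lemma has_residue_two_principal:
  assumes w: "w \<noteq> (2::complex)"
  shows "has_residue_two (\<lambda>z. 1 / (z - 2) ^ Suc n / (w - z)) (1 / (w - 2) ^ Suc n)"
proof -
  have hol: "has_residue_two (\<lambda>z. 1 / (w - z)) 0"
    by (rule has_residue_two_holomorphic[of "- {w}"]) (use w in \<open>auto intro!: holomorphic_intros\<close>)
  show ?thesis
  proof (induction n)
    case 0
    have "has_residue_two (\<lambda>z. 1 / (w - 2) * (1 / (z - 2) ^ Suc 0 + 1 / (w - z))) (1 / (w - 2) * ((if (0::nat) = 0 then 1 else 0) + 0))"
      by (intro has_residue_two_cmult has_residue_two_add has_residue_two_pole hol)
    then have "has_residue_two (\<lambda>z. 1 / (w - 2) * (1 / (z - 2) ^ Suc 0 + 1 / (w - z))) (1 / (w - 2) ^ Suc 0)" by simp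
    then show ?case
    proof (rule has_residue_two_cong)
      show "\<forall>\<^sub>F z in at 2. 1 / (w - 2) * (1 / (z - 2) ^ Suc 0 + 1 / (w - z)) = 1 / (z - 2) ^ Suc 0 / (w - z)"
        using ev_ne[of 2] ev_ne[of w] by eventually_elim (use w in \<open>simp add: field_simps\<close>)
    qed
  next
    case (Suc n)
    have "has_residue_two (\<lambda>z. 1 / (w - 2) * (1 / (z - 2) ^ Suc (Suc n) + 1 / (z - 2) ^ Suc n / (w - z)))
      (1 / (w - 2) * ((if Suc n = 0 then 1 else 0) + 1 / (w - 2) ^ Suc n))"
      by (intro has_residue_two_cmult has_residue_two_add has_residue_two_pole Suc.IH)
    then have "has_residue_two (\<lambda>z. 1 / (w - 2) * (1 / (z - 2) ^ Suc (Suc n) + 1 / (z - 2) ^ Suc n / (w - z))) (1 / (w - 2) ^ Suc (Suc n))"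
      by simp
    then show ?case
    proof (rule has_residue_two_cong)
      have id: "1 / (w - 2) * (1 / (t * p) + 1 / p / (w - 2 - t)) = 1 / (t * p) / (w - 2 - t)"
        if "t \<noteq> 0" "p \<noteq> 0" "w - 2 - t \<noteq> 0" for t p :: complex
      proof -
        define v where "v = w - 2 - t"
        have v: "v \<noteq> 0" "w - 2 = v + t" "v + t \<noteq> 0" using that w by (auto simp: v_def)
        have "1 / (t * p) + 1 / p / v = (v + t) / (t * p * v)" using that v by (simp add: field_simps)
        then show ?thesis unfolding v_def[symmetric] v(2) using v(3) by simp
      qed
      show "\<forall>\<^sub>F z in at 2. 1 / (w - 2) * (1 / (z - 2) ^ Suc (Suc n) + 1 / (z - 2) ^ Suc n / (w - z)) = 1 / (z - 2) ^ Suc (Suc n) / (w - z)"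
        using ev_ne[of 2] ev_ne[of w]
      proof eventually_elim
        case (elim z)
        then show ?case using id[of "z - 2" "(z - 2) ^ Suc n"] by simp
      qed
    qed
  qed
qed

text \<open>In the coordinate \<open>s\<close> one has \<open>phi k = s powi (- 2 k - 1) * deriv xcurve\<close>, so that \<open>wk k\<close> lists
  the coefficients of \<open>phi k dz\<close> as a power series in \<open>x\<close> times \<open>dx\<close>.\<close>
definition phi :: "nat \<Rightarrow> complex \<Rightarrow> complex" where
  "phi k z = z ^ (2 * k - 2) / (2 - z) ^ (2 * k)"

text \<open>The numerator has degree 2k - 2, so \<open>phi k\<close> expands in negative powers of z
  - 2 alone and is its own principal part.\<close>

lemma has_residue_two_phi:
  assumes w: "w \<noteq> 2" and k: "k \<ge> 1"
  shows "has_residue_two (\<lambda>z. phi k z / (w - z)) (phi k w)"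
proof -
  let ?n = "2 * k - 2"
  have expand: "phi k z = (\<Sum>i\<le>?n. (of_nat (?n choose i) * 2 ^ (?n - i)) * (1 / (z - 2) ^ Suc (2 * k - 1 - i)))" if "z \<noteq> 2" for z
  proof -
    have "z ^ ?n = (\<Sum>i\<le>?n. of_nat (?n choose i) * (z - 2) ^ i * 2 ^ (?n - i))"
      using binomial_ring[of "z - 2" 2 ?n] by simp
    moreover have "(2 - z) ^ (2 * k) = (z - 2) ^ (2 * k)" using power2_commute[of 2 z] by (simp add: power_mult)
    ultimately have "phi k z = (\<Sum>i\<le>?n. of_nat (?n choose i) * (z - 2) ^ i * 2 ^ (?n - i)) / (z - 2) ^ (2 * k)"
      by (simp add: phi_def)
    also have "\<dots> = (\<Sum>i\<le>?n. (of_nat (?n choose i) * 2 ^ (?n - i)) * (1 / (z - 2) ^ Suc (2 * k - 1 - i)))"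
      unfolding sum_divide_distrib
    proof (rule sum.cong[OF refl])
      fix i assume i: "i \<in> {..?n}"
      have "Suc (2 * k - 1 - i) + i = 2 * k" using i k by auto
      then have "(z - 2) ^ (2 * k) = (z - 2) ^ Suc (2 * k - 1 - i) * (z - 2) ^ i" by (metis power_add)
      then show "of_nat (?n choose i) * (z - 2) ^ i * 2 ^ (?n - i) / (z - 2) ^ (2 * k) = (of_nat (?n choose i) * 2 ^ (?n - i)) * (1 / (z - 2) ^ Suc (2 * k - 1 - i))"
        using that by (simp del: power_Suc)
    qed
    finally show ?thesis .
  qed
  have "has_residue_two (\<lambda>z. \<Sum>i\<le>?n. (of_nat (?n choose i) * 2 ^ (?n - i)) * (1 / (z - 2) ^ Suc (2 * k - 1 - i) / (w - z)))
     (\<Sum>i\<le>?n. (of_nat (?n choose i) * 2 ^ (?n - i)) * (1 / (w - 2) ^ Suc (2 * k - 1 - i)))"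
    by (intro has_residue_two_sum has_residue_two_cmult has_residue_two_principal w)
  also have "(\<Sum>i\<le>?n. (of_nat (?n choose i) * 2 ^ (?n - i)) * (1 / (w - 2) ^ Suc (2 * k - 1 - i))) = phi k w"
    using expand[OF w] by simp
  finally show ?thesis
  proof (rule has_residue_two_cong)
    show "\<forall>\<^sub>F z in at 2. (\<Sum>i\<le>?n. (of_nat (?n choose i) * 2 ^ (?n - i)) * (1 / (z - 2) ^ Suc (2 * k - 1 - i) / (w - z))) = phi k z / (w - z)"
      using ev_ne[of 2]
    proof eventually_elim
      case (elim z)
      show ?case unfolding expand[OF elim] sum_divide_distrib by simp
    qed
  qed
qed

lemma deriv_xcurve: "z \<noteq> 0 \<Longrightarrow> deriv xcurve z = (2 - z) / z ^ 3"
proof -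
  assume z: "z \<noteq> 0"
  have "((\<lambda>z. (z - 1) / z ^ 2) has_field_derivative (2 - z) / z ^ 3) (at z)"
    using z by (auto intro!: derivative_eq_intros simp: field_simps power2_eq_square power3_eq_cube)
  then have "(xcurve has_field_derivative (2 - z) / z ^ 3) (at z)"
    unfolding xcurve_def[abs_def] .
  then show ?thesis by (rule DERIV_imp_deriv)
qed

lemma deriv_zbar: "z \<noteq> 1 \<Longrightarrow> deriv zbar z = - 1 / (z - 1) ^ 2"
proof -
  assume z: "z \<noteq> 1"
  have "((\<lambda>z. z / (z - 1)) has_field_derivative - 1 / (z - 1) ^ 2) (at z)"
    using z by (auto intro!: derivative_eq_intros simp: field_simps power2_eq_square)
  then have "(zbar has_field_derivative - 1 / (z - 1) ^ 2) (at z)"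
    unfolding zbar_def[abs_def] .
  then show ?thesis by (rule DERIV_imp_deriv)
qed

text \<open>With the Jacobian of the involution the kernel is a double pole at 2 times a holomorphic
  factor and 1/(w - z); all residues are computed in this form.\<close>

lemma kernel_zbar:
  assumes "z \<noteq> 0" "z \<noteq> 1" "z \<noteq> 2" "z \<noteq> w"
  shows "kernel w z * deriv zbar z = z ^ 2 / ((z - 1) * (2 - z) ^ 2 * (w - z))"
proof -
  have "zbar z - z = z * (2 - z) / (z - 1)" using assms by (simp add: zbar_def field_simps)
  then have "kernel w z = - 1 / ((w - z) * (z * (2 - z) / (z - 1)) * ((2 - z) / z ^ 3))"
    unfolding kernel_def deriv_xcurve[OF assms(1)] ycurve_def by simp
  also have "\<dots> = - ((z - 1) * z ^ 2 / ((w - z) * (2 - z) ^ 2))"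
    using assms by (simp add: divide_simps power2_eq_square power3_eq_cube)
  finally have K: "kernel w z = - ((z - 1) * z ^ 2 / ((w - z) * (2 - z) ^ 2))" .
  show ?thesis unfolding deriv_zbar[OF assms(2)] K
    using assms by (simp add: divide_simps power2_eq_square)
qed

lemma phi_Suc: "phi (Suc n) z = z ^ (2 * n) / (2 - z) ^ (2 + 2 * n)"
  by (simp add: phi_def)

text \<open>Since the derivative of \<open>zbar\<close> is -1/(z - 1)^2, this expresses that the
  differential \<open>phi k\<close> dz is odd under the involution.\<close>

lemma phi_zbar:
  assumes "z \<noteq> 1" "k \<ge> 1"
  shows "phi k (zbar z) = (z - 1) ^ 2 * phi k z"
proof -
  have "2 - zbar z = (z - 2) / (z - 1)" using assms by (simp add: zbar_def field_simps)
  then have "phi k (zbar z) = (z / (z - 1)) ^ (2 * k - 2) / ((z - 2) / (z - 1)) ^ (2 * k)"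
    by (simp add: phi_def zbar_def)
  also have "(2 * k :: nat) = (2 * k - 2) + 2" using assms by simp
  then have "((z - 2) / (z - 1)) ^ (2 * k) = ((z - 2) ^ (2 * k)) / ((z - 1) ^ (2 * k - 2) * (z - 1) ^ 2)"
    unfolding power_divide by (metis power_add)
  also have "(z - 2) ^ (2 * k) = (2 - z) ^ (2 * k)" using power2_commute[of 2 z] by (simp add: power_mult)
  finally show ?thesis using assms by (simp add: phi_def power_divide)
qed

text \<open>The integrand is a combination of two basis functions over w - z, because z^4 - z^2 (2 -
  z)^2 = 4 z^2 (z - 1). Divided by z^4 this is 1 - s^2 = 4x, so the constants agree with those of
  \<open>Sv_prod\<close>.\<close>

lemma has_residue_two_phi_phi:
  assumes w: "w \<noteq> 2" and kl: "k \<ge> 1" "l \<ge> 1"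
  shows "has_residue_two (\<lambda>z. kernel w z * deriv zbar z * (phi k z * phi l (zbar z))) (1/4 * phi (k + l + 1) w - 1/4 * phi (k + l) w)"
proof -
  have "has_residue_two (\<lambda>z. 1/4 * (phi (k + l + 1) z / (w - z)) + (- 1/4) * (phi (k + l) z / (w - z))) (1/4 * phi (k + l + 1) w + (- 1/4) * phi (k + l) w)"
    by (intro has_residue_two_add has_residue_two_cmult has_residue_two_phi w) (use kl in auto)
  then have "has_residue_two (\<lambda>z. 1/4 * (phi (k + l + 1) z / (w - z)) + (- 1/4) * (phi (k + l) z / (w - z))) (1/4 * phi (k + l + 1) w - 1/4 * phi (k + l) w)"
    by simp
  then show ?thesis
  proof (rule has_residue_two_cong)
    show "\<forall>\<^sub>F z in at 2. 1/4 * (phi (k + l + 1) z / (w - z)) + (- 1/4) * (phi (k + l) z / (w - z)) = kernel w z * deriv zbar z * (phi k z * phi l (zbar z))"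
      using ev_ne[of 0] ev_ne[of 1] ev_ne[of 2] ev_ne[of w]
    proof eventually_elim
      case (elim z)
      obtain k' l' where k': "k = Suc k'" "l = Suc l'" using kl by (metis Suc_le_D One_nat_def)
      define p where "p = z ^ (2 * k' + 2 * l')"
      define q where "q = (2 - z) ^ (2 * k' + 2 * l')"
      have q: "q \<noteq> 0" using elim by (simp add: q_def)
      have e: "phi (k + l + 1) z = z ^ 4 * p / ((2 - z) ^ 6 * q)" "phi (k + l) z = z ^ 2 * p / ((2 - z) ^ 4 * q)"
      proof -
        have "k + l + 1 = Suc (Suc (Suc (k' + l')))" "k + l = Suc (Suc (k' + l'))" using k' by simp_all
        moreover have "2 * Suc (Suc (k' + l')) = 4 + (2 * k' + 2 * l')" "2 + 2 * Suc (Suc (k' + l')) = 6 + (2 * k' + 2 * l')"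
          "2 * Suc (k' + l') = 2 + (2 * k' + 2 * l')" "2 + 2 * Suc (k' + l') = 4 + (2 * k' + 2 * l')" by simp_all
        ultimately show "phi (k + l + 1) z = z ^ 4 * p / ((2 - z) ^ 6 * q)" "phi (k + l) z = z ^ 2 * p / ((2 - z) ^ 4 * q)"
          by (simp_all only: phi_Suc power_add p_def q_def)
      qed
      have e2: "phi k z * phi l z = p / ((2 - z) ^ 4 * q)"
      proof -
        have "(2 + 2 * k') + (2 + 2 * l') = 4 + (2 * k' + 2 * l')" by simp
        then have "(2 - z) ^ (2 + 2 * k') * (2 - z) ^ (2 + 2 * l') = (2 - z) ^ 4 * q"
          unfolding q_def by (simp only: power_add[symmetric])
        moreover have "z ^ (2 * k') * z ^ (2 * l') = p" by (simp only: power_add p_def)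
        ultimately show ?thesis unfolding k' phi_Suc times_divide_times_eq by simp
      qed
      have nz: "2 - z \<noteq> 0" "w - z \<noteq> 0" "z - 1 \<noteq> 0" using elim by auto
      have R: "kernel w z * deriv zbar z * (phi k z * phi l (zbar z)) = z ^ 2 / ((z - 1) * (2 - z) ^ 2 * (w - z)) * ((z - 1) ^ 2 * (p / ((2 - z) ^ 4 * q)))"
        unfolding kernel_zbar[OF elim] phi_zbar[OF elim(2) kl(2)] e2[symmetric]
        by (simp only: mult.left_commute mult.assoc)
      have key: "z ^ 4 - z ^ 2 * (2 - z) ^ 2 = 4 * z ^ 2 * (z - 1)" by (simp add: power2_eq_square power4_eq_xxxx algebra_simps)
      have "1/4 * (phi (k + l + 1) z / (w - z)) + (- 1/4) * (phi (k + l) z / (w - z))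
         = (z ^ 4 - z ^ 2 * (2 - z) ^ 2) * p / (4 * (2 - z) ^ 6 * q * (w - z))"
        unfolding e using nz q by (simp add: divide_simps) (simp add: numeral_eq_Suc algebra_simps)
      also have "\<dots> = z ^ 2 / ((z - 1) * (2 - z) ^ 2 * (w - z)) * ((z - 1) ^ 2 * (p / ((2 - z) ^ 4 * q)))"
        unfolding key using nz q by (simp add: divide_simps) (simp add: numeral_eq_Suc algebra_simps)
      finally show ?case using R by simp
    qed
  qed
qed

lemma z_minus_zbar: "z \<noteq> 1 \<Longrightarrow> z - zbar z = - (z * (2 - z) / (z - 1))"
  by (simp add: zbar_def field_simps)

text \<open>The integrand is again exactly a combination of basis functions over w - z, with the
  coefficients found in \<open>wser_11\<close>.\<close>

lemma has_residue_two_11: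
  assumes w: "w \<noteq> 2"
  shows "has_residue_two (\<lambda>z. kernel w z * deriv zbar z * (1 / (z - zbar z) ^ 2)) (1/4 * phi 2 w - 1/4 * phi 1 w)"
proof -
  have "has_residue_two (\<lambda>z. 1/4 * (phi 2 z / (w - z)) + (- 1/4) * (phi 1 z / (w - z))) (1/4 * phi 2 w + (- 1/4) * phi 1 w)"
    by (intro has_residue_two_add has_residue_two_cmult has_residue_two_phi w) auto
  then have "has_residue_two (\<lambda>z. 1/4 * (phi 2 z / (w - z)) + (- 1/4) * (phi 1 z / (w - z))) (1/4 * phi 2 w - 1/4 * phi 1 w)"
    by simp
  then show ?thesis
  proof (rule has_residue_two_cong)
    show "\<forall>\<^sub>F z in at 2. 1/4 * (phi 2 z / (w - z)) + (- 1/4) * (phi 1 z / (w - z)) = kernel w z * deriv zbar z * (1 / (z - zbar z) ^ 2)"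
      using ev_ne[of 0] ev_ne[of 1] ev_ne[of 2] ev_ne[of w]
    proof eventually_elim
      case (elim z)
      have nz: "2 - z \<noteq> 0" "w - z \<noteq> 0" "z - 1 \<noteq> 0" using elim by auto
      have key: "z ^ 2 - (2 - z) ^ 2 = 4 * (z - 1)" by (simp add: power2_eq_square algebra_simps)
      have "1/4 * (phi 2 z / (w - z)) + (- 1/4) * (phi 1 z / (w - z)) = (z ^ 2 - (2 - z) ^ 2) / (4 * (2 - z) ^ 4 * (w - z))"
        using nz by (simp add: phi_def divide_simps) (simp add: numeral_eq_Suc algebra_simps)
      also have "\<dots> = z ^ 2 / ((z - 1) * (2 - z) ^ 2 * (w - z)) * (1 / (- (z * (2 - z) / (z - 1))) ^ 2)"
        unfolding key using nz elim by (simp add: divide_simps) (simp add: numeral_eq_Suc algebra_simps)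
      finally show ?case unfolding kernel_zbar[OF elim] z_minus_zbar[OF elim(2)] .
    qed
  qed
qed

lemma DERIV_inverse_sq:
  assumes "(f has_field_derivative f') (at x)" "f x = p" "p \<noteq> (0 :: complex)"
  shows "((\<lambda>z. 1 / (f z) ^ 2) has_field_derivative - 2 * f' / p ^ 3) (at x)"
proof -
  have "((\<lambda>z. (f z) ^ 2) has_field_derivative 2 * p * f') (at x)"
    using DERIV_power[OF assms(1), of 2] assms(2) by (simp add: mult_ac)
  then have "((\<lambda>z. inverse ((f z) ^ 2)) has_field_derivative - (inverse (p ^ 2) * (2 * p * f') * inverse (p ^ 2))) (at x)"
    using DERIV_inverse'[of "\<lambda>z. (f z) ^ 2" _ x UNIV] assms(2,3) by simp
  moreover have "- (inverse (p ^ 2) * (2 * p * f') * inverse (p ^ 2)) = - 2 * f' / p ^ 3"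
    using assms(3) by (simp add: field_simps power2_eq_square power3_eq_cube)
  ultimately show ?thesis by (simp add: inverse_eq_divide)
qed

text \<open>After clearing denominators the pole at 2 is double with holomorphic numerator
  \<open>G\<close>, so the residue is the derivative of \<open>G\<close> there. Interchanging
  \<open>a\<close> and \<open>b\<close> makes the two derivatives add up to a multiple of 1/((2 - a)
  (2 - b))^2.\<close>

lemma has_residue_two_03:
  assumes w: "w \<noteq> 2" and a: "a \<noteq> 2" and b: "b \<noteq> 2"
  shows "has_residue_two (\<lambda>z. kernel w z * deriv zbar z * (1 / (z - a) ^ 2 * (1 / (zbar z - b) ^ 2) + 1 / (z - b) ^ 2 * (1 / (zbar z - a) ^ 2)))
    (8 * phi 1 w * phi 1 a * phi 1 b)"
proof -
  \<comment> \<open>For z different from 1, \<open>D a b z\<close> is (z - a) (zbar z - b) (z -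
    1).\<close>
  define D where "D = (\<lambda>a b z. (z - a) * (z - b * z + b) :: complex)"
  define G where "G = (\<lambda>z. z ^ 2 * (z - 1) / (w - z) * (1 / (D a b z) ^ 2 + 1 / (D b a z) ^ 2))"
  define S where "S = {z. w - z \<noteq> 0 \<and> D a b z \<noteq> 0 \<and> D b a z \<noteq> 0}"
  have "open S" unfolding S_def D_def
    by (intro open_Collect_conj open_Collect_neq continuous_intros)
  have D2: "D a b 2 = (2 - a) * (2 - b)" "D b a 2 = (2 - a) * (2 - b)" by (simp_all add: D_def algebra_simps)
  have S2: "2 \<in> S" using assms by (auto simp: S_def D2)
  have hol: "G holomorphic_on S"
    unfolding G_def D_def by (intro holomorphic_intros) (auto simp: S_def D_def)
  have DD: "(D a b has_field_derivative (2 - b) + (2 - a) * (1 - b)) (at 2)" for a b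
    unfolding D_def by (auto intro!: derivative_eq_intros simp: algebra_simps)
  let ?P = "(2 - a) * (2 - b)"
  have P0: "?P \<noteq> 0" using a b by simp
  have der: "(G has_field_derivative 8 / ((w - 2) ^ 2 * ?P ^ 2)) (at 2)"
  proof -
    have i1: "((\<lambda>z. 1 / (D a b z) ^ 2) has_field_derivative - 2 * ((2 - b) + (2 - a) * (1 - b)) / ?P ^ 3) (at 2)"
      by (rule DERIV_inverse_sq[OF DD D2(1) P0])
    have i2: "((\<lambda>z. 1 / (D b a z) ^ 2) has_field_derivative - 2 * ((2 - a) + (2 - b) * (1 - a)) / ?P ^ 3) (at 2)"
      by (rule DERIV_inverse_sq[OF DD D2(2) P0])
    have "((\<lambda>z. 1 / (D a b z) ^ 2 + 1 / (D b a z) ^ 2) has_field_derivative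
        - 2 * ((2 - b) + (2 - a) * (1 - b)) / ?P ^ 3 + - 2 * ((2 - a) + (2 - b) * (1 - a)) / ?P ^ 3) (at 2)"
      by (rule DERIV_add[OF i1 i2])
    also have "- 2 * ((2 - b) + (2 - a) * (1 - b)) / ?P ^ 3 + - 2 * ((2 - a) + (2 - b) * (1 - a)) / ?P ^ 3 = - 4 / ?P ^ 2"
    proof -
      have "- 2 * ((2 - b) + (2 - a) * (1 - b)) + - 2 * ((2 - a) + (2 - b) * (1 - a)) = - 4 * ?P" by (simp add: algebra_simps)
      then show ?thesis using P0 unfolding add_divide_distrib[symmetric] by (simp add: power2_eq_square power3_eq_cube)
    qed
    finally have i: "((\<lambda>z. 1 / (D a b z) ^ 2 + 1 / (D b a z) ^ 2) has_field_derivative - 4 / ?P ^ 2) (at 2)" .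
    have q: "((\<lambda>z. z ^ 2 * (z - 1) / (w - z)) has_field_derivative 8 / (w - 2) + 4 / (w - 2) ^ 2) (at 2)"
      using w by (auto intro!: derivative_eq_intros) (simp add: divide_simps power2_eq_square)
    have "(G has_field_derivative (8 / (w - 2) + 4 / (w - 2) ^ 2) * (1 / (D a b 2) ^ 2 + 1 / (D b a 2) ^ 2) + - 4 / ?P ^ 2 * (2 ^ 2 * (2 - 1) / (w - 2))) (at 2)"
      unfolding G_def by (rule DERIV_mult[OF q i])
    moreover have "(8 / (w - 2) + 4 / (w - 2) ^ 2) * (1 / (D a b 2) ^ 2 + 1 / (D b a 2) ^ 2) + - 4 / ?P ^ 2 * (2 ^ 2 * (2 - 1) / (w - 2))
        = 8 / ((w - 2) ^ 2 * ?P ^ 2)"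
    proof -
      have gen: "(8 / W + 4 / W ^ 2) * (1 / X + 1 / X) + - 4 / X * (2 ^ 2 * (2 - 1) / W) = 8 / (W ^ 2 * X)"
        if "W \<noteq> 0" "X \<noteq> 0" for W X :: complex
        using that by (simp add: field_simps power2_eq_square)
      show ?thesis unfolding D2 by (rule gen) (use w P0 in auto)
    qed
    ultimately show ?thesis by simp
  qed
  obtain e where e: "e > 0" "ball 2 e \<subseteq> S" using \<open>open S\<close> S2 openE by blast
  have "(\<lambda>z. G z / (z - 2) ^ Suc 1) holomorphic_on (ball 2 e - {2})"
    using hol e(2) by (intro holomorphic_intros) (auto intro: holomorphic_on_subset)
  moreover have "residue (\<lambda>z. G z / (z - 2) ^ Suc 1) 2 = deriv G 2"
    using residue_holomorphic_over_power[OF \<open>open S\<close> S2 hol, of 1] by simp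
  ultimately have "has_residue_two (\<lambda>z. G z / (z - 2) ^ Suc 1) (deriv G 2)" using e(1) unfolding has_residue_two_def by blast
  also have "deriv G 2 = 8 * phi 1 w * phi 1 a * phi 1 b"
    unfolding DERIV_imp_deriv[OF der] by (simp add: phi_def power_mult_distrib power2_commute[of w 2] mult.assoc)
  finally show ?thesis
  proof (rule has_residue_two_cong)
    show "\<forall>\<^sub>F z in at 2. G z / (z - 2) ^ Suc 1 = kernel w z * deriv zbar z * (1 / (z - a) ^ 2 * (1 / (zbar z - b) ^ 2) + 1 / (z - b) ^ 2 * (1 / (zbar z - a) ^ 2))"
      using ev_ne[of 0] ev_ne[of 1] ev_ne[of 2] ev_ne[of w]
    proof eventually_elim
      case (elim z)
      have zb: "zbar z - c = (z - c * z + c) / (z - 1)" for c using elim(2) by (simp add: zbar_def field_simps)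
      have t: "1 / (z - a) ^ 2 * (1 / (zbar z - b) ^ 2) = (z - 1) ^ 2 * (1 / (D a b z) ^ 2)" for a b
        unfolding zb D_def by (simp add: power_divide power_mult_distrib)
      show ?case
      proof -
        have sq: "(z - 2) ^ Suc 1 = (2 - z) ^ 2" by (simp add: power2_eq_square algebra_simps)
        have gen: "Z * m / W * X / T = Z / (m * T * W) * (m ^ 2 * X)" if "m \<noteq> 0" for Z m W X T :: complex
          using that by (simp add: power2_eq_square mult_ac)
        show ?thesis unfolding kernel_zbar[OF elim] t distrib_left[symmetric] G_def sq
          by (rule gen) (use elim in simp)
      qed
    qed
  qed
qed

text \<open>The principal part at z = 2 of the join integrand freed from the factor 1/(w - z); its
  numbers are those of \<open>joinT_Sv_power\<close>.\<close>

definition Tsum :: "nat \<Rightarrow> complex \<Rightarrow> complex \<Rightarrow> complex" where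
  "Tsum k z y = (\<Sum>l\<le>k. 2 * of_nat (2 * l + 1) * phi (Suc (k - l)) z * phi (Suc l) y)
     - (\<Sum>l<k. 2 * of_nat (2 * l + 1) * phi (Suc (k - 1 - l)) z * phi (Suc l) y)"

lemma has_residue_two_Tsum:
  assumes w: "w \<noteq> 2"
  shows "has_residue_two (\<lambda>z. Tsum k z y / (w - z)) (Tsum k w y)"
proof -
  have "has_residue_two (\<lambda>z. (\<Sum>l\<le>k. (2 * of_nat (2 * l + 1) * phi (Suc l) y) * (phi (Suc (k - l)) z / (w - z)))
     + (- 1) * (\<Sum>l<k. (2 * of_nat (2 * l + 1) * phi (Suc l) y) * (phi (Suc (k - 1 - l)) z / (w - z))))
   ((\<Sum>l\<le>k. (2 * of_nat (2 * l + 1) * phi (Suc l) y) * phi (Suc (k - l)) w)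
     + (- 1) * (\<Sum>l<k. (2 * of_nat (2 * l + 1) * phi (Suc l) y) * phi (Suc (k - 1 - l)) w))"
    by (intro has_residue_two_add has_residue_two_sum has_residue_two_cmult has_residue_two_phi w) simp_all
  also have "((\<Sum>l\<le>k. (2 * of_nat (2 * l + 1) * phi (Suc l) y) * phi (Suc (k - l)) w)
     + (- 1) * (\<Sum>l<k. (2 * of_nat (2 * l + 1) * phi (Suc l) y) * phi (Suc (k - 1 - l)) w)) = Tsum k w y"
    by (simp add: Tsum_def mult_ac)
  finally show ?thesis
  proof (rule has_residue_two_cong, intro always_eventually allI)
    fix z
    show "(\<Sum>l\<le>k. (2 * of_nat (2 * l + 1) * phi (Suc l) y) * (phi (Suc (k - l)) z / (w - z)))
     + (- 1) * (\<Sum>l<k. (2 * of_nat (2 * l + 1) * phi (Suc l) y) * (phi (Suc (k - 1 - l)) z / (w - z))) = Tsum k z y / (w - z)"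
      by (simp add: Tsum_def diff_divide_distrib sum_divide_distrib mult_ac)
  qed
qed

text \<open>With u = s^2, v = t^2 for the coordinates s, t of the two points (the involution being
  s to -s), this is the partial fraction decomposition at u = 0 of the join term.\<close>
lemma join_partial_fraction:
  fixes u v :: complex
  assumes u: "u \<noteq> 0" and v: "v \<noteq> 0" and d: "v - u \<noteq> 0"
  shows "2 * (1 - u) * (u + v) * (1 / u) ^ Suc k / (v - u) ^ 2 =
    (\<Sum>l\<le>k. 2 * of_nat (2 * l + 1) * (1 / u) ^ Suc (k - l) * (1 / v) ^ Suc l)
    - (\<Sum>l<k. 2 * of_nat (2 * l + 1) * (1 / u) ^ Suc (k - 1 - l) * (1 / v) ^ Suc l)
    + 2 * (1 / v) ^ Suc k * ((of_nat (2 * k + 1) + (1 - 2 * of_nat k) * v) * (v - u) + 2 * v * (1 - v)) / (v - u) ^ 2"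
proof (induction k)
  case 0
  have "2 * (1 - u) * (u + v) / u = 2 / (u * v) * (v - u) ^ 2 + 2 / v * ((1 + v) * (v - u) + 2 * v * (1 - v))"
    using u v by (simp add: field_simps power2_eq_square)
  then have "2 * (1 - u) * (u + v) / u / (v - u) ^ 2 = (2 / (u * v) * (v - u) ^ 2 + 2 / v * ((1 + v) * (v - u) + 2 * v * (1 - v))) / (v - u) ^ 2"
    by (simp only:)
  also have "\<dots> = 2 / (u * v) + 2 / v * ((1 + v) * (v - u) + 2 * v * (1 - v)) / (v - u) ^ 2"
    using d by (simp add: add_divide_distrib)
  finally show ?case by simp
next
  case (Suc k)
  define p where "p = 1 / u"
  define q where "q = 1 / v"
  define r where "r = q ^ Suc k"
  define \<kappa> :: complex where "\<kappa> = of_nat k"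
  define c where "c = (\<lambda>l. 2 * of_nat (2 * l + 1) :: complex)"
  define Q where "Q = (\<lambda>\<kappa> r. 2 * r * ((2 * \<kappa> + 1 + (1 - 2 * \<kappa>) * v) * (v - u) + 2 * v * (1 - v)) / (v - u) ^ 2)"
  have s1: "(\<Sum>l\<le>Suc k. c l * p ^ Suc (Suc k - l) * q ^ Suc l) = p * (\<Sum>l\<le>k. c l * p ^ Suc (k - l) * q ^ Suc l) + c (Suc k) * p * (q * r)"
  proof -
    have "(\<Sum>l\<le>k. c l * p ^ Suc (Suc k - l) * q ^ Suc l) = p * (\<Sum>l\<le>k. c l * p ^ Suc (k - l) * q ^ Suc l)"
      unfolding sum_distrib_left by (rule sum.cong[OF refl]) (simp add: Suc_diff_le)
    then show ?thesis by (simp add: r_def)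
  qed
  have s2: "(\<Sum>l<Suc k. c l * p ^ Suc (Suc k - 1 - l) * q ^ Suc l) = p * (\<Sum>l<k. c l * p ^ Suc (k - 1 - l) * q ^ Suc l) + c k * p * r"
  proof -
    have "(\<Sum>l<k. c l * p ^ Suc (Suc k - 1 - l) * q ^ Suc l) = p * (\<Sum>l<k. c l * p ^ Suc (k - 1 - l) * q ^ Suc l)"
      unfolding sum_distrib_left
    proof (rule sum.cong[OF refl])
      fix l assume "l \<in> {..<k}"
      then have "Suc k - 1 - l = Suc (k - 1 - l)" by auto
      then show "c l * p ^ Suc (Suc k - 1 - l) * q ^ Suc l = p * (c l * p ^ Suc (k - 1 - l) * q ^ Suc l)" by simp
    qed
    then show ?thesis by (simp add: r_def)
  qed
  have qv: "q * v = 1" and pu: "p * u = 1" using u v by (simp_all add: p_def q_def)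
  have "2 * (\<kappa> + 1) + 1 = 2 * \<kappa> + 3" by simp
  have step: "p * Q \<kappa> r = 2 * (2 * \<kappa> + 3) * p * (q * r) - 2 * (2 * \<kappa> + 1) * p * r + Q (\<kappa> + 1) (q * r)"
  proof -
    have "p * (2 * r * ((2 * \<kappa> + 1 + (1 - 2 * \<kappa>) * v) * (v - u) + 2 * v * (1 - v)))
      = (2 * (2 * \<kappa> + 3) * p * (q * r) - 2 * (2 * \<kappa> + 1) * p * r) * (v - u) ^ 2
        + 2 * (q * r) * ((2 * (\<kappa> + 1) + 1 + (1 - 2 * (\<kappa> + 1)) * v) * (v - u) + 2 * v * (1 - v))"
      unfolding p_def q_def using u v by (simp add: divide_simps) (simp add: algebra_simps power2_eq_square)
    then show ?thesis unfolding Q_def using d by (simp add: field_simps)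
  qed
  have IH: "2 * (1 - u) * (u + v) * p ^ Suc k / (v - u) ^ 2 =
    (\<Sum>l\<le>k. c l * p ^ Suc (k - l) * q ^ Suc l) - (\<Sum>l<k. c l * p ^ Suc (k - 1 - l) * q ^ Suc l) + Q \<kappa> r"
    using Suc.IH unfolding p_def[symmetric] q_def[symmetric] by (simp add: c_def Q_def r_def \<kappa>_def)
  have "2 * (1 - u) * (u + v) * p ^ Suc (Suc k) / (v - u) ^ 2 = p * (2 * (1 - u) * (u + v) * p ^ Suc k / (v - u) ^ 2)"
    by simp
  also have "\<dots> = (\<Sum>l\<le>Suc k. c l * p ^ Suc (Suc k - l) * q ^ Suc l) - (\<Sum>l<Suc k. c l * p ^ Suc (Suc k - 1 - l) * q ^ Suc l) + Q (\<kappa> + 1) (q * r)"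
  proof -
    have gen: "p * (A - B + Q \<kappa> r) = (p * A + c (Suc k) * p * (q * r)) - (p * B + c k * p * r) + Q (\<kappa> + 1) (q * r)" for A B
    proof -
      have "p * (A - B + Q \<kappa> r) = p * A - p * B + p * Q \<kappa> r" by (simp only: distrib_left right_diff_distrib)
      then show ?thesis unfolding step by (simp add: c_def \<kappa>_def algebra_simps)
    qed
    show ?thesis unfolding IH s1 s2 by (rule gen)
  qed
  finally show ?case
    unfolding p_def[symmetric] q_def[symmetric] by (simp add: c_def Q_def r_def \<kappa>_def algebra_simps)
qed

lemma phi_s:
  assumes "z \<noteq> 0" "z \<noteq> 2"
  shows "phi (Suc k) z = 1 / z ^ 2 * (1 / ((2 - z) / z) ^ 2) ^ Suc k"
proof -
  have e: "2 + 2 * k = 2 * Suc k" by simp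
  have "1 / ((2 - z) / z) ^ 2 = z ^ 2 / (2 - z) ^ 2" by (simp add: power_divide)
  then have "(1 / ((2 - z) / z) ^ 2) ^ Suc k = z ^ (2 + 2 * k) / (2 - z) ^ (2 + 2 * k)"
    unfolding e power_mult by (simp only: power_divide)
  also have "z ^ (2 + 2 * k) = z ^ 2 * z ^ (2 * k)" by (rule power_add)
  finally show ?thesis unfolding phi_Suc using assms by simp
qed

text \<open>In the coordinates s and t the sum of both double poles depends only on u = s^2 and v =
  t^2. In the partial fractions the remainder \<open>H\<close> is singular only where v = u or z =
  0. It is holomorphic near z = 2, because u vanishes there and v does not, so only
  \<open>Tsum\<close> contributes.\<close>

lemma has_residue_two_join:
  assumes w: "w \<noteq> 2" and y: "y \<noteq> 0" "y \<noteq> 2" and k: "k \<ge> 1"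
  shows "has_residue_two (\<lambda>z. kernel w z * deriv zbar z * (1 / (z - y) ^ 2 * phi k (zbar z) + phi k z * (1 / (zbar z - y) ^ 2))) (Tsum k w y)"
proof -
  define v where "v = ((2 - y) / y) ^ 2"
  define U where "U = (\<lambda>z::complex. ((2 - z) / z) ^ 2)"
  define H where "H = (\<lambda>z. 1 / (z ^ 2 * y ^ 2) * (2 * (1 / v) ^ Suc k * ((of_nat (2 * k + 1) + (1 - 2 * of_nat k) * v) * (v - U z) + 2 * v * (1 - v)) / (v - U z) ^ 2))"
  have v0: "v \<noteq> 0" using y by (simp add: v_def)
  define S where "S = {z. z \<noteq> 0 \<and> w - z \<noteq> 0 \<and> v * z ^ 2 - (2 - z) ^ 2 \<noteq> 0}"
  have opS: "open S" unfolding S_def by (intro open_Collect_conj open_Collect_neq continuous_intros)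
  have S2: "2 \<in> S" using v0 w by (simp add: S_def)
  have vU: "v - U z = (v * z ^ 2 - (2 - z) ^ 2) / z ^ 2" if "z \<noteq> 0" for z
    using that by (simp add: U_def power_divide field_simps)
  have vU0: "v - U z \<noteq> 0" if "z \<in> S" for z using that vU[of z] by (simp add: S_def)
  have "(\<lambda>z. H z / (w - z)) holomorphic_on S"
  proof -
    have hU: "U holomorphic_on S" unfolding U_def by (intro holomorphic_intros) (auto simp: S_def)
    show ?thesis unfolding H_def by (intro holomorphic_intros hU) (use vU0 y in \<open>auto simp: S_def\<close>)
  qed
  then have hH: "has_residue_two (\<lambda>z. H z / (w - z)) 0" by (rule has_residue_two_holomorphic[OF opS S2])
  have "has_residue_two (\<lambda>z. Tsum k z y / (w - z) + H z / (w - z)) (Tsum k w y + 0)"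
    by (rule has_residue_two_add[OF has_residue_two_Tsum[OF w] hH])
  then have "has_residue_two (\<lambda>z. Tsum k z y / (w - z) + H z / (w - z)) (Tsum k w y)" by simp
  then show ?thesis
  proof (rule has_residue_two_cong)
    have evS: "eventually (\<lambda>z. z \<in> S) (at 2)" using opS S2 by (rule eventually_at_in_open')
    show "\<forall>\<^sub>F z in at 2. Tsum k z y / (w - z) + H z / (w - z) =
        kernel w z * deriv zbar z * (1 / (z - y) ^ 2 * phi k (zbar z) + phi k z * (1 / (zbar z - y) ^ 2))"
      using ev_ne[of 0] ev_ne[of 1] ev_ne[of 2] ev_ne[of w] evS
    proof eventually_elim
      case (elim z)
      note zz = elim(1-4)
      define s where "s = (2 - z) / z"
      define t where "t = (2 - y) / y"
      define u where "u = U z"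
      have us: "u = s ^ 2" "v = t ^ 2" by (simp_all add: u_def U_def s_def v_def t_def)
      have u0: "u \<noteq> 0" using zz by (simp add: us s_def)
      have d: "v - u \<noteq> 0" using vU0[OF elim(5)] by (simp add: u_def)
      have st: "t - s \<noteq> 0" "t + s \<noteq> 0"
        using d unfolding us by (auto simp: power2_eq_square algebra_simps add_eq_0_iff)
      \<comment> \<open>The difference of the two points is z y (t - s)/2, and the involution
        replaces s by -s; this gives the second identity.\<close>
      have zy: "z - y = z * y * (t - s) / 2" "z - y * z + y = z * y * (t + s) / 2"
        using zz y by (simp_all add: s_def t_def field_simps)
      have zb: "zbar z - y = (z - y * z + y) / (z - 1)" using zz(2) by (simp add: zbar_def field_simps)
      have ph: "phi (Suc j) z = 1 / z ^ 2 * (1 / u) ^ Suc j" "phi (Suc j) y = 1 / y ^ 2 * (1 / v) ^ Suc j" for j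
        using phi_s[OF zz(1,3)] phi_s[OF y] by (simp_all add: us s_def t_def)
      have phk: "phi k z = 1 / z ^ 2 * (1 / u) ^ k" using ph(1)[of "k - 1"] k by simp
      have T: "Tsum k z y = 1 / (z ^ 2 * y ^ 2) * ((\<Sum>l\<le>k. 2 * of_nat (2 * l + 1) * (1 / u) ^ Suc (k - l) * (1 / v) ^ Suc l)
         - (\<Sum>l<k. 2 * of_nat (2 * l + 1) * (1 / u) ^ Suc (k - 1 - l) * (1 / v) ^ Suc l))"
        unfolding Tsum_def ph right_diff_distrib sum_distrib_left by (simp add: mult_ac)
      have "Tsum k z y + H z = 1 / (z ^ 2 * y ^ 2) * (2 * (1 - u) * (u + v) * (1 / u) ^ Suc k / (v - u) ^ 2)"
        unfolding T H_def u_def[symmetric] distrib_left[symmetric] join_partial_fraction[OF u0 v0 d] ..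
      also have "\<dots> = 1 / (z ^ 2 * y ^ 2) * (2 * (1 - u) * (u + v) / (u * (v - u) ^ 2)) * (1 / u) ^ k"
        by simp
      finally have L: "Tsum k z y + H z = 1 / (z ^ 2 * y ^ 2) * (2 * (1 - u) * (u + v) / (u * (v - u) ^ 2)) * (1 / u) ^ k" .
      have br: "1 / (z - y) ^ 2 + 1 / (z - y * z + y) ^ 2 = 4 / (z ^ 2 * y ^ 2) * (2 * (u + v) / (v - u) ^ 2)"
      proof -
        have "v - u = (t - s) * (t + s)" by (simp add: us power2_eq_square algebra_simps)
        then have "2 * (u + v) / (v - u) ^ 2 = 1 / (t - s) ^ 2 + 1 / (t + s) ^ 2"
          using st unfolding us by (simp add: divide_simps) (simp add: power2_eq_square algebra_simps)
        moreover have "(z * y * (t - s) / 2) ^ 2 = z ^ 2 * y ^ 2 * (t - s) ^ 2 / 4" "(z * y * (t + s) / 2) ^ 2 = z ^ 2 * y ^ 2 * (t + s) ^ 2 / 4"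
          by (simp_all add: power_divide power_mult_distrib)
        moreover have "1 / (c * A / 4) + 1 / (c * B / 4) = 4 / c * (1 / A + 1 / B)" for c A B :: complex
          by (simp add: distrib_left)
        ultimately show ?thesis unfolding zy by (simp only:)
      qed
      have u1: "z ^ 2 * (z - 1) / (2 - z) ^ 2 = z ^ 2 * (1 - u) / (4 * u)"
        using zz by (simp add: us s_def power_divide divide_simps) (simp add: power2_eq_square algebra_simps)
      have "kernel w z * deriv zbar z * (1 / (z - y) ^ 2 * phi k (zbar z) + phi k z * (1 / (zbar z - y) ^ 2))
        = z ^ 2 / ((z - 1) * (2 - z) ^ 2 * (w - z)) * ((z - 1) ^ 2 * phi k z * (1 / (z - y) ^ 2 + 1 / (z - y * z + y) ^ 2))"
        unfolding kernel_zbar[OF zz] phi_zbar[OF zz(2) k] zb power_divide by (simp add: distrib_left)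
      also have "\<dots> = (z ^ 2 * (z - 1) / (2 - z) ^ 2) * phi k z * (1 / (z - y) ^ 2 + 1 / (z - y * z + y) ^ 2) / (w - z)"
      proof -
        have gen: "Z / (m * T * W) * (m ^ 2 * P * X) = (Z * m / T) * P * X / W" if "m \<noteq> 0" for Z m T W P X :: complex
          using that by (simp add: power2_eq_square mult_ac)
        show ?thesis by (rule gen) (use zz in simp)
      qed
      also have "\<dots> = (Tsum k z y + H z) / (w - z)"
      proof -
        have gen: "Z * a / (4 * c) * (1 / Z * p) * (4 / (Z * Y) * (2 * b / e)) / W = 1 / (Z * Y) * (2 * a * b / (c * e)) * p / W"
          if "Z \<noteq> 0" "c \<noteq> 0" "Y \<noteq> 0" "e \<noteq> 0" "W \<noteq> 0" for Z a c p Y b e W :: complex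
          using that by (simp add: divide_simps)
        show ?thesis unfolding L br u1 phk by (rule gen) (use zz u0 y d in auto)
      qed
      finally show ?case by (simp add: add_divide_distrib)
    qed
  qed
qed

section \<open>Tensor representations\<close>

definition prodw :: "(nat \<Rightarrow> 'a \<Rightarrow> complex) \<Rightarrow> nat list \<Rightarrow> 'a list \<Rightarrow> complex" where
  "prodw f ks ys = prod_list (map2 f ks ys)"

lemma prodw_simps [simp]: "prodw f [] ys = 1" "prodw f (k # ks) (y # ys) = f k y * prodw f ks ys"
  by (simp_all add: prodw_def)

text \<open>A finite sum of weighted basis products, kept as a list without normal form, since only
  the existence of a common representation matters.\<close>

type_synonym tensor = "(complex \<times> nat list) list"

definition tensor_eval :: "(nat \<Rightarrow> 'a \<Rightarrow> complex) \<Rightarrow> tensor \<Rightarrow> 'a list \<Rightarrow> complex" where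
  "tensor_eval f t ys = (\<Sum>p\<leftarrow>t. fst p * prodw f (snd p) ys)"

lemma tensor_eval_simps [simp]: "tensor_eval f [] ys = 0" "tensor_eval f (p # t) ys = fst p * prodw f (snd p) ys + tensor_eval f t ys"
  "tensor_eval f (t @ u) ys = tensor_eval f t ys + tensor_eval f u ys"
  by (simp_all add: tensor_eval_def)

lemma tensor_eval_scale: "tensor_eval f (map (\<lambda>p. (c * fst p, snd p)) t) ys = c * tensor_eval f t ys"
  by (induction t) (simp_all add: algebra_simps)

text \<open>Indices start at 1, from where on the exponent 2 k - 2 in \<open>phi\<close> is not
  truncated.\<close>

definition tensor_wf :: "nat \<Rightarrow> tensor \<Rightarrow> bool" where
  "tensor_wf n t \<longleftrightarrow> (\<forall>p\<in>set t. length (snd p) = n \<and> (\<forall>k\<in>set (snd p). k \<ge> 1))"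

text \<open>At 0, the pole of x, the coordinate s = (2 - z)/z is undefined, and 2 is the
  ramification point. Near 2 the involution sends admissible points to admissible points, by
  \<open>zbar_off_ramification\<close>.\<close>

definition off_ramification :: "complex list \<Rightarrow> bool" where "off_ramification zs \<longleftrightarrow> (\<forall>z\<in>set zs. z \<noteq> 0 \<and> z \<noteq> 2)"

text \<open>One tensor computes both a family of Taylor coefficients and a family of residues; it
  matches a term of the cut-join recursion with a term of topological recursion.\<close>
definition piece :: "nat \<Rightarrow> (nat \<Rightarrow> nat list \<Rightarrow> complex) \<Rightarrow> (complex \<Rightarrow> complex list \<Rightarrow> complex \<Rightarrow> complex) \<Rightarrow> bool" where
  "piece N A F \<longleftrightarrow> (\<exists>t. tensor_wf (Suc N) t \<and> (\<forall>m ms. length ms = N \<longrightarrow> A m ms = tensor_eval wk t (m # ms)) \<and>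
     (\<forall>w zs. length zs = N \<longrightarrow> w \<noteq> 2 \<longrightarrow> off_ramification zs \<longrightarrow> has_residue_two (F w zs) (tensor_eval phi t (w # zs))))"

lemma pieceI:
  assumes "tensor_wf (Suc N) t" "\<And>m ms. length ms = N \<Longrightarrow> A m ms = tensor_eval wk t (m # ms)"
    "\<And>w zs. length zs = N \<Longrightarrow> w \<noteq> 2 \<Longrightarrow> off_ramification zs \<Longrightarrow> has_residue_two (F w zs) (tensor_eval phi t (w # zs))"
  shows "piece N A F"
  using assms unfolding piece_def by blast

lemma pieceE:
  assumes "piece N A F"
  obtains t where "tensor_wf (Suc N) t" "\<And>m ms. length ms = N \<Longrightarrow> A m ms = tensor_eval wk t (m # ms)"
    "\<And>w zs. length zs = N \<Longrightarrow> w \<noteq> 2 \<Longrightarrow> off_ramification zs \<Longrightarrow> has_residue_two (F w zs) (tensor_eval phi t (w # zs))"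
  using assms unfolding piece_def by blast

lemma piece_zero: "piece N (\<lambda>_ _. 0) (\<lambda>_ _ _. 0)"
  by (rule pieceI[of _ "[]"]) (simp_all add: tensor_wf_def)

lemma piece_add:
  assumes "piece N A F" "piece N B G"
  shows "piece N (\<lambda>m ms. A m ms + B m ms) (\<lambda>w zs z. F w zs z + G w zs z)"
proof -
  obtain t where t: "tensor_wf (Suc N) t" "\<And>m ms. length ms = N \<Longrightarrow> A m ms = tensor_eval wk t (m # ms)"
    "\<And>w zs. length zs = N \<Longrightarrow> w \<noteq> 2 \<Longrightarrow> off_ramification zs \<Longrightarrow> has_residue_two (F w zs) (tensor_eval phi t (w # zs))"
    using pieceE[OF assms(1)] by blast
  obtain u where u: "tensor_wf (Suc N) u" "\<And>m ms. length ms = N \<Longrightarrow> B m ms = tensor_eval wk u (m # ms)"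
    "\<And>w zs. length zs = N \<Longrightarrow> w \<noteq> 2 \<Longrightarrow> off_ramification zs \<Longrightarrow> has_residue_two (G w zs) (tensor_eval phi u (w # zs))"
    using pieceE[OF assms(2)] by blast
  show ?thesis
  proof (rule pieceI[of _ "t @ u"])
    show "tensor_wf (Suc N) (t @ u)" using t(1) u(1) by (auto simp: tensor_wf_def)
  qed (simp_all add: t u has_residue_two_add)
qed

lemma piece_cmult:
  assumes "piece N A F"
  shows "piece N (\<lambda>m ms. c * A m ms) (\<lambda>w zs z. c * F w zs z)"
proof -
  obtain t where t: "tensor_wf (Suc N) t" "\<And>m ms. length ms = N \<Longrightarrow> A m ms = tensor_eval wk t (m # ms)"
    "\<And>w zs. length zs = N \<Longrightarrow> w \<noteq> 2 \<Longrightarrow> off_ramification zs \<Longrightarrow> has_residue_two (F w zs) (tensor_eval phi t (w # zs))"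
    using pieceE[OF assms(1)] by blast
  show ?thesis
  proof (rule pieceI[of _ "map (\<lambda>p. (c * fst p, snd p)) t"])
    show "tensor_wf (Suc N) (map (\<lambda>p. (c * fst p, snd p)) t)" using t(1) by (auto simp: tensor_wf_def)
  qed (simp_all add: t tensor_eval_scale has_residue_two_cmult)
qed

lemma piece_sum:
  assumes "finite X" "\<And>x. x \<in> X \<Longrightarrow> piece N (A x) (F x)"
  shows "piece N (\<lambda>m ms. \<Sum>x\<in>X. A x m ms) (\<lambda>w zs z. \<Sum>x\<in>X. F x w zs z)"
  using assms
proof (induction X rule: finite_induct)
  case (insert x X)
  then show ?case using piece_add[of N "A x" "F x"] by simp
qed (simp add: piece_zero)

lemma piece_cong:
  assumes "piece N A F" "\<And>m ms. length ms = N \<Longrightarrow> B m ms = A m ms"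
    "\<And>w zs. length zs = N \<Longrightarrow> w \<noteq> 2 \<Longrightarrow> off_ramification zs \<Longrightarrow> eventually (\<lambda>z. F w zs z = G w zs z) (at 2)"
  shows "piece N B G"
proof -
  obtain t where t: "tensor_wf (Suc N) t" "\<And>m ms. length ms = N \<Longrightarrow> A m ms = tensor_eval wk t (m # ms)"
    "\<And>w zs. length zs = N \<Longrightarrow> w \<noteq> 2 \<Longrightarrow> off_ramification zs \<Longrightarrow> has_residue_two (F w zs) (tensor_eval phi t (w # zs))"
    using pieceE[OF assms(1)] by blast
  show ?thesis
  proof (rule pieceI[OF t(1)])
    show "B m ms = tensor_eval wk t (m # ms)" if "length ms = N" for m ms using assms(2) t(2) that by simp
    show "has_residue_two (G w zs) (tensor_eval phi t (w # zs))" if "length zs = N" "w \<noteq> 2" "off_ramification zs" for w zs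
      by (rule has_residue_two_cong[OF t(3)[OF that] assms(3)[OF that]])
  qed
qed

lemma Sv_prod: "Sv * fps_X * (Sv ^ (2 * k + 1) * Sv ^ (2 * l + 1)) = fps_const (1/4) * (Sv ^ (2 * (k + l + 1) + 1) - Sv ^ (2 * (k + l) + 1))"
proof -
  let ?j = "2 * (k + l) + 1"
  have p: "Sv * (Sv ^ (2 * k + 1) * Sv ^ (2 * l + 1)) = Sv ^ (?j + 2)"
    unfolding power_Suc[symmetric] power_add[symmetric] by (rule arg_cong[of _ _ "\<lambda>n. Sv ^ n"]) simp
  have "Sv * fps_X * (Sv ^ (2 * k + 1) * Sv ^ (2 * l + 1)) = fps_const (1/4) * (4 * fps_X * (Sv * (Sv ^ (2 * k + 1) * Sv ^ (2 * l + 1))))"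
    by (simp add: numeral_fps_const mult_ac)
  also have "\<dots> = fps_const (1/4) * (Sv ^ (?j + 2) - Sv ^ ?j)" unfolding p X_Sv ..
  also have "?j + 2 = 2 * (k + l + 1) + 1" by simp
  finally show ?thesis .
qed

text \<open>Here the two recursions meet in the product terms: \<open>Sv_prod\<close> and
  \<open>has_residue_two_phi_phi\<close> have the same structure constants 1/4 and -1/4 at
  \<open>k + l + 1\<close> and \<open>k + l\<close>.\<close>

lemma piece_pure:
  assumes kl: "k \<ge> 1" "l \<ge> 1" and ks: "length ks = N" "\<forall>k\<in>set ks. k \<ge> 1"
  shows "piece N (\<lambda>m ms. (Sv * fps_X * (Sv ^ (2 * k + 1) * Sv ^ (2 * l + 1))) $ m * prodw wk ks ms)
     (\<lambda>w zs z. prodw phi ks zs * (kernel w z * deriv zbar z * (phi k z * phi l (zbar z))))"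
proof (rule pieceI[of _ "[(1/4, (k + l + 1) # ks), (- 1/4, (k + l) # ks)]"])
  show "tensor_wf (Suc N) [(1/4, (k + l + 1) # ks), (- 1/4, (k + l) # ks)]"
    using kl ks by (simp add: tensor_wf_def)
  show "(Sv * fps_X * (Sv ^ (2 * k + 1) * Sv ^ (2 * l + 1))) $ m * prodw wk ks ms = tensor_eval wk [(1/4, (k + l + 1) # ks), (- 1/4, (k + l) # ks)] (m # ms)" for m ms
    unfolding Sv_prod fps_mult_left_const_nth fps_sub_nth wk_def[symmetric] by (simp add: algebra_simps)
  show "has_residue_two (\<lambda>z. prodw phi ks zs * (kernel w z * deriv zbar z * (phi k z * phi l (zbar z)))) (tensor_eval phi [(1/4, (k + l + 1) # ks), (- 1/4, (k + l) # ks)] (w # zs))"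
    if "w \<noteq> 2" for w zs
    using has_residue_two_cmult[OF has_residue_two_phi_phi[OF that kl], of "prodw phi ks zs"] by (simp add: algebra_simps)
qed

text \<open>Places \<open>ks\<close> at the positions in \<open>I\<close> and \<open>ls\<close> at
  the others, inverting the division of a list by \<open>nths\<close>; at each step the position set
  is shifted down by one.\<close>

fun mergek :: "nat \<Rightarrow> nat set \<Rightarrow> nat list \<Rightarrow> nat list \<Rightarrow> nat list" where
  "mergek 0 I ks ls = []"
| "mergek (Suc N) I ks ls = (if 0 \<in> I then hd ks # mergek N {j. Suc j \<in> I} (tl ks) ls
     else hd ls # mergek N {j. Suc j \<in> I} ks (tl ls))"

lemma length_mergek [simp]: "length (mergek N I ks ls) = N"
  by (induction N arbitrary: I ks ls) auto

lemma mergek_aux: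
  assumes "length ys = N" "length ks = length (nths ys I)" "length ls = length (nths ys ({..<N} - I))" "I \<subseteq> {..<N}"
  shows "prodw f ks (nths ys I) * prodw f ls (nths ys ({..<N} - I)) = prodw f (mergek N I ks ls) ys
    \<and> set (mergek N I ks ls) \<subseteq> set ks \<union> set ls"
  using assms
proof (induction N arbitrary: I ks ls ys)
  case (Suc N)
  obtain y ys' where y: "ys = y # ys'" "length ys' = N" using Suc.prems(1) by (cases ys) auto
  let ?I = "{j. Suc j \<in> I}"
  have c: "{j. Suc j \<in> {..<Suc N} - I} = {..<N} - ?I" by auto
  have c': "{j. j < N \<and> Suc j \<notin> I} = {..<N} - ?I" by auto
  have IN: "?I \<subseteq> {..<N}" using Suc.prems(4) by auto
  show ?case
  proof (cases "0 \<in> I")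
    case True
    then have n: "nths ys I = y # nths ys' ?I" "nths ys ({..<Suc N} - I) = nths ys' ({..<N} - ?I)"
      by (simp_all add: y nths_Cons c c')
    obtain k ks' where k: "ks = k # ks'" using Suc.prems(2) n(1) by (cases ks) auto
    have IH: "prodw f ks' (nths ys' ?I) * prodw f ls (nths ys' ({..<N} - ?I)) = prodw f (mergek N ?I ks' ls) ys'
      \<and> set (mergek N ?I ks' ls) \<subseteq> set ks' \<union> set ls"
      by (rule Suc.IH) (use Suc.prems n k y IN in simp_all)
    have "prodw f ks (nths ys I) * prodw f ls (nths ys ({..<Suc N} - I)) = f k y * (prodw f ks' (nths ys' ?I) * prodw f ls (nths ys' ({..<N} - ?I)))"
      unfolding n k by simp
    also have "\<dots> = prodw f (mergek (Suc N) I ks ls) ys" using IH True k y by simp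
    finally show ?thesis using IH True k by auto
  next
    case False
    then have n: "nths ys I = nths ys' ?I" "nths ys ({..<Suc N} - I) = y # nths ys' ({..<N} - ?I)"
      by (simp_all add: y nths_Cons c c')
    obtain k ls' where k: "ls = k # ls'" using Suc.prems(3) n(2) by (cases ls) auto
    have IH: "prodw f ks (nths ys' ?I) * prodw f ls' (nths ys' ({..<N} - ?I)) = prodw f (mergek N ?I ks ls') ys'
      \<and> set (mergek N ?I ks ls') \<subseteq> set ks \<union> set ls'"
      by (rule Suc.IH) (use Suc.prems n k y IN in simp_all)
    have "prodw f ks (nths ys I) * prodw f ls (nths ys ({..<Suc N} - I)) = f k y * (prodw f ks (nths ys' ?I) * prodw f ls' (nths ys' ({..<N} - ?I)))"
      unfolding n k by simp
    also have "\<dots> = prodw f (mergek (Suc N) I ks ls) ys" using IH False k y by simp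
    finally show ?thesis using IH False k by auto
  qed
qed simp

lemma prodw_mergek:
  assumes "I \<subseteq> {..<N}" "length ks = card I" "length ls = N - card I" "length ys = N"
  shows "prodw f ks (nths ys I) * prodw f ls (nths ys ({..<N} - I)) = prodw f (mergek N I ks ls) ys"
proof -
  have I: "I \<subseteq> {..<length ys}" using assms by simp
  show ?thesis
    using mergek_aux[of ys N ks I ls f] assms length_nths_sub[OF I] length_nths_compl[OF I] by simp
qed

lemma set_mergek:
  assumes "I \<subseteq> {..<N}" "length ks = card I" "length ls = N - card I"
  shows "set (mergek N I ks ls) \<subseteq> set ks \<union> set ls"
proof -
  define ys :: "nat list" where "ys = replicate N 0"
  have I: "I \<subseteq> {..<length ys}" and l: "length ys = N" using assms by (simp_all add: ys_def)
  show ?thesis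
    using mergek_aux[of ys N ks I ls "\<lambda>_ _. 0"] assms l length_nths_sub[OF I] length_nths_compl[OF I] by simp
qed

lemma piece_pure_split:
  assumes I: "I \<subseteq> {..<N}" and kl: "k \<ge> 1" "l \<ge> 1"
    and ks: "length ks = card I" "\<forall>k\<in>set ks. k \<ge> 1" and ls: "length ls = N - card I" "\<forall>k\<in>set ls. k \<ge> 1"
  shows "piece N (\<lambda>m ms. (Sv * fps_X * (Sv ^ (2 * k + 1) * Sv ^ (2 * l + 1))) $ m * (prodw wk ks (nths ms I) * prodw wk ls (nths ms ({..<N} - I))))
     (\<lambda>w zs z. prodw phi ks (nths zs I) * prodw phi ls (nths zs ({..<N} - I)) * (kernel w z * deriv zbar z * (phi k z * phi l (zbar z))))"
proof (rule piece_cong)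
  show "piece N (\<lambda>m ms. (Sv * fps_X * (Sv ^ (2 * k + 1) * Sv ^ (2 * l + 1))) $ m * prodw wk (mergek N I ks ls) ms)
     (\<lambda>w zs z. prodw phi (mergek N I ks ls) zs * (kernel w z * deriv zbar z * (phi k z * phi l (zbar z))))"
    by (rule piece_pure[OF kl]) (use set_mergek[OF I ks(1) ls(1)] ks(2) ls(2) in auto)
qed (simp_all add: prodw_mergek[OF I ks(1) ls(1)])

lemma nths_single: "r < length xs \<Longrightarrow> nths xs {r} = [xs ! r]"
proof -
  assume r: "r < length xs"
  have "set (ilist (length xs) {r}) = {r}" by (rule set_ilist) (use r in auto)
  then have "ilist (length xs) {r} = [r]"
    using distinct_ilist[of "length xs" "{r}"] by (cases "ilist (length xs) {r}") (auto simp: subset_singleton_iff)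
  then show ?thesis by (simp add: nths_ilist)
qed

lemma sum_list_upt: "(\<Sum>l\<leftarrow>[0..<n]. f l) = (\<Sum>l<n. f l)"
  by (simp add: interv_sum_list_conv_sum_set_nat lessThan_atLeast0)

lemma prodw_mergek_single:
  assumes "r < N" "length ks = N - 1" "length ys = N"
  shows "prodw f (mergek N {r} [a] ks) ys = f a (ys ! r) * prodw f ks (nths ys ({..<N} - {r}))"
  using prodw_mergek[of "{r}" N "[a]" ks ys f] assms by (simp add: nths_single)

text \<open>The new index \<open>Suc l\<close> belongs to the variable that takes part in the join,
  so it is inserted at position \<open>r\<close>. \<open>joinT_Sv_power\<close> and
  \<open>Tsum\<close> supply the same coefficients.\<close>

lemma piece_pure_join:
  assumes r: "r < N" and k: "k \<ge> 1" and ks: "length ks = N - 1" "\<forall>k\<in>set ks. k \<ge> 1"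
  shows "piece N (\<lambda>m ms. (Sv * joinT (ms ! r) (Sv ^ (2 * k + 1))) $ m * prodw wk ks (nths ms ({..<N} - {r})))
     (\<lambda>w zs z. prodw phi ks (nths zs ({..<N} - {r})) *
        (kernel w z * deriv zbar z * (1 / (z - zs ! r) ^ 2 * phi k (zbar z) + phi k z * (1 / (zbar z - zs ! r) ^ 2))))"
proof -
  let ?c = "\<lambda>l. 2 * of_nat (2 * l + 1) :: complex"
  define t :: tensor where "t = map (\<lambda>l. (?c l, Suc (k - l) # mergek N {r} [Suc l] ks)) [0..<Suc k]
     @ map (\<lambda>l. (- ?c l, Suc (k - 1 - l) # mergek N {r} [Suc l] ks)) [0..<k]"
  have tensor_eval_t: "tensor_eval f t (y # ys) = ((\<Sum>l\<le>k. ?c l * f (Suc (k - l)) y * f (Suc l) (ys ! r)) - (\<Sum>l<k. ?c l * f (Suc (k - 1 - l)) y * f (Suc l) (ys ! r)))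
      * prodw f ks (nths ys ({..<N} - {r}))" if ys: "length ys = N" for f :: "nat \<Rightarrow> 'a \<Rightarrow> complex" and y ys
  proof -
    have "tensor_eval f t (y # ys) = (\<Sum>l<Suc k. ?c l * (f (Suc (k - l)) y * (f (Suc l) (ys ! r) * prodw f ks (nths ys ({..<N} - {r})))))
       + (\<Sum>l<k. - ?c l * (f (Suc (k - 1 - l)) y * (f (Suc l) (ys ! r) * prodw f ks (nths ys ({..<N} - {r})))))"
      unfolding t_def tensor_eval_def map_append sum_list_append map_map comp_def fst_conv snd_conv prodw_simps
        prodw_mergek_single[OF r ks(1) ys] sum_list_upt ..
    then show ?thesis
      by (simp only: lessThan_Suc_atMost left_diff_distrib distrib_right sum_distrib_right mult.assoc mult_minus_left sum_negf minus_add_distrib diff_conv_add_uminus)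
  qed
  show ?thesis
  proof (rule pieceI[of _ t])
    have sm: "set (mergek N {r} [Suc l] ks) \<subseteq> {Suc l} \<union> set ks" for l
      using set_mergek[of "{r}" N "[Suc l]" ks] r ks(1) by simp
    then have "\<forall>x\<in>set (mergek N {r} [Suc l] ks). x \<ge> 1" for l using ks(2) by fastforce
    then show "tensor_wf (Suc N) t" unfolding tensor_wf_def t_def by auto
    show "(Sv * joinT (ms ! r) (Sv ^ (2 * k + 1))) $ m * prodw wk ks (nths ms ({..<N} - {r})) = tensor_eval wk t (m # ms)"
      if "length ms = N" for m ms
    proof -
      have "(Sv * joinT (ms ! r) (Sv ^ (2 * k + 1))) $ m =
         (\<Sum>l\<le>k. ?c l * wk (Suc (k - l)) m * wk (Suc l) (ms ! r)) - (\<Sum>l<k. ?c l * wk (Suc (k - 1 - l)) m * wk (Suc l) (ms ! r))"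
        unfolding joinT_Sv_power fps_sub_nth fps_sum_nth fps_mult_left_const_nth wk_def[symmetric] by (simp only: mult_ac)
      then show ?thesis using tensor_eval_t[OF that, of wk m] by simp
    qed
    show "has_residue_two (\<lambda>z. prodw phi ks (nths zs ({..<N} - {r})) *
        (kernel w z * deriv zbar z * (1 / (z - zs ! r) ^ 2 * phi k (zbar z) + phi k z * (1 / (zbar z - zs ! r) ^ 2)))) (tensor_eval phi t (w # zs))"
      if zs: "length zs = N" "w \<noteq> 2" "off_ramification zs" for w zs
    proof -
      have y: "zs ! r \<noteq> 0" "zs ! r \<noteq> 2" using zs r by (auto simp: off_ramification_def)
      have "tensor_eval phi t (w # zs) = prodw phi ks (nths zs ({..<N} - {r})) * Tsum k w (zs ! r)"
        using tensor_eval_t[OF zs(1), of phi w] by (simp add: Tsum_def mult.commute)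
      then show ?thesis using has_residue_two_cmult[OF has_residue_two_join[OF zs(2) y k]] by simp
    qed
  qed
qed

declare omega.simps(2) [simp del]

definition tensor_rep :: "nat \<Rightarrow> nat \<Rightarrow> tensor \<Rightarrow> bool" where
  "tensor_rep g n t \<longleftrightarrow> tensor_wf n t \<and> (\<forall>ms. length ms = n \<longrightarrow> wcoeff g ms = tensor_eval wk t ms)
     \<and> (\<forall>zs. length zs = n \<longrightarrow> off_ramification zs \<longrightarrow> omega g zs = tensor_eval phi t zs)"

lemma tensor_eval_sum: "tensor_eval f t ys = (\<Sum>j<length t. fst (t ! j) * prodw f (snd (t ! j)) ys)"
  unfolding tensor_eval_def by (simp add: sum_list_sum_nth lessThan_atLeast0)

definition head_index :: "tensor \<Rightarrow> nat \<Rightarrow> nat" where "head_index t j = hd (snd (t ! j))"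

definition tail_index :: "tensor \<Rightarrow> nat \<Rightarrow> nat list" where "tail_index t j = tl (snd (t ! j))"

lemma tensor_wf_hdk:
  assumes "tensor_wf (Suc n) t" "j < length t"
  shows "head_index t j \<ge> 1" "length (tail_index t j) = n" "\<forall>k\<in>set (tail_index t j). k \<ge> 1" "snd (t ! j) = head_index t j # tail_index t j"
proof -
  have "length (snd (t ! j)) = Suc n" "\<forall>k\<in>set (snd (t ! j)). k \<ge> 1"
    using assms(1) nth_mem[OF assms(2)] unfolding tensor_wf_def by blast+
  then show "head_index t j \<ge> 1" "length (tail_index t j) = n" "\<forall>k\<in>set (tail_index t j). k \<ge> 1" "snd (t ! j) = head_index t j # tail_index t j"
    by (cases "snd (t ! j)"; auto simp: head_index_def tail_index_def)+
qed

lemma tensor_eval_Cons: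
  assumes "tensor_wf (Suc n) t"
  shows "tensor_eval f t (y # ys) = (\<Sum>j<length t. fst (t ! j) * (f (head_index t j) y * prodw f (tail_index t j) ys))"
  unfolding tensor_eval_sum
proof (rule sum.cong[OF refl])
  fix j assume "j \<in> {..<length t}"
  then show "fst (t ! j) * prodw f (snd (t ! j)) (y # ys) = fst (t ! j) * (f (head_index t j) y * prodw f (tail_index t j) ys)"
    using tensor_wf_hdk(4)[OF assms, of j] by simp
qed

lemma wser_tev:
  assumes "tensor_rep g (Suc n) t" "length ms = n"
  shows "wser g ms = (\<Sum>j<length t. fps_const (fst (t ! j) * prodw wk (tail_index t j) ms) * Sv ^ (2 * head_index t j + 1))"
proof (rule fps_ext)
  fix m
  have "tensor_wf (Suc n) t" "wcoeff g (m # ms) = tensor_eval wk t (m # ms)" using assms by (simp_all add: tensor_rep_def)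
  then show "wser g ms $ m = (\<Sum>j<length t. fps_const (fst (t ! j) * prodw wk (tail_index t j) ms) * Sv ^ (2 * head_index t j + 1)) $ m"
    unfolding fps_sum_nth fps_mult_left_const_nth wk_def[symmetric] by (simp add: wser_def tensor_eval_Cons mult_ac)
qed

lemma omega_tev:
  assumes "tensor_rep g (Suc n) t" "length zs = n" "off_ramification zs" "z \<noteq> 0" "z \<noteq> 2"
  shows "omega g (z # zs) = (\<Sum>j<length t. fst (t ! j) * prodw phi (tail_index t j) zs * phi (head_index t j) z)"
proof -
  have "off_ramification (z # zs)" using assms by (simp add: off_ramification_def)
  then have "tensor_wf (Suc n) t" "omega g (z # zs) = tensor_eval phi t (z # zs)" using assms by (simp_all add: tensor_rep_def)
  then show ?thesis by (simp add: tensor_eval_Cons mult_ac)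
qed

lemma off_ramification_nths: "off_ramification zs \<Longrightarrow> off_ramification (nths zs I)"
  using set_nths_subset[of zs I] by (auto simp: off_ramification_def)

lemma zbar_off_ramification: "z \<noteq> 0 \<Longrightarrow> z \<noteq> 1 \<Longrightarrow> z \<noteq> 2 \<Longrightarrow> zbar z \<noteq> 0 \<and> zbar z \<noteq> 2"
  by (auto simp: zbar_def field_simps)

lemma piece_split:
  assumes I: "I \<subseteq> {..<N}" and t: "tensor_rep h (Suc (card I)) t" and u: "tensor_rep h' (Suc (N - card I)) u"
  shows "piece N (\<lambda>m ms. (Sv * fps_X * (wser h (nths ms I) * wser h' (nths ms ({..<N} - I)))) $ m)
     (\<lambda>w zs z. kernel w z * deriv zbar z * (omega h (z # nths zs I) * omega h' (zbar z # nths zs ({..<N} - I))))"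
proof (rule piece_cong)
  have gt: "tensor_wf (Suc (card I)) t" and gu: "tensor_wf (Suc (N - card I)) u" using t u by (simp_all add: tensor_rep_def)
  show "piece N (\<lambda>m ms. \<Sum>i<length t. \<Sum>j<length u. fst (t ! i) * fst (u ! j) *
       ((Sv * fps_X * (Sv ^ (2 * head_index t i + 1) * Sv ^ (2 * head_index u j + 1))) $ m * (prodw wk (tail_index t i) (nths ms I) * prodw wk (tail_index u j) (nths ms ({..<N} - I)))))
    (\<lambda>w zs z. \<Sum>i<length t. \<Sum>j<length u. fst (t ! i) * fst (u ! j) *
       (prodw phi (tail_index t i) (nths zs I) * prodw phi (tail_index u j) (nths zs ({..<N} - I)) * (kernel w z * deriv zbar z * (phi (head_index t i) z * phi (head_index u j) (zbar z)))))"
  proof (intro piece_sum finite_lessThan piece_cmult)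
    fix i j assume ij: "i \<in> {..<length t}" "j \<in> {..<length u}"
    show "piece N (\<lambda>m ms. (Sv * fps_X * (Sv ^ (2 * head_index t i + 1) * Sv ^ (2 * head_index u j + 1))) $ m * (prodw wk (tail_index t i) (nths ms I) * prodw wk (tail_index u j) (nths ms ({..<N} - I))))
      (\<lambda>w zs z. prodw phi (tail_index t i) (nths zs I) * prodw phi (tail_index u j) (nths zs ({..<N} - I)) * (kernel w z * deriv zbar z * (phi (head_index t i) z * phi (head_index u j) (zbar z))))"
      using tensor_wf_hdk[OF gt, of i] tensor_wf_hdk[OF gu, of j] ij by (intro piece_pure_split I) auto
  qed
next
  fix m :: nat and ms :: "nat list" assume l: "length ms = N"
  have I': "I \<subseteq> {..<length ms}" using I l by simp
  have len: "length (nths ms I) = card I" "length (nths ms ({..<N} - I)) = N - card I"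
    using length_nths_sub[OF I'] length_nths_compl[OF I'] l by simp_all
  have e: "Sv * fps_X * (wser h (nths ms I) * wser h' (nths ms ({..<N} - I)))
    = (\<Sum>i<length t. \<Sum>j<length u. fps_const (fst (t ! i) * prodw wk (tail_index t i) (nths ms I) * (fst (u ! j) * prodw wk (tail_index u j) (nths ms ({..<N} - I))))
        * (Sv * fps_X * (Sv ^ (2 * head_index t i + 1) * Sv ^ (2 * head_index u j + 1))))"
    unfolding wser_tev[OF t len(1)] wser_tev[OF u len(2)] sum_product unfolding sum_distrib_left
    by (intro sum.cong refl) (simp only: fps_const_mult[symmetric] mult_ac)
  show "(Sv * fps_X * (wser h (nths ms I) * wser h' (nths ms ({..<N} - I)))) $ m
    = (\<Sum>i<length t. \<Sum>j<length u. fst (t ! i) * fst (u ! j) *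
       ((Sv * fps_X * (Sv ^ (2 * head_index t i + 1) * Sv ^ (2 * head_index u j + 1))) $ m * (prodw wk (tail_index t i) (nths ms I) * prodw wk (tail_index u j) (nths ms ({..<N} - I)))))"
    unfolding e fps_sum_nth fps_mult_left_const_nth by (simp only: mult_ac)
next
  fix w zs assume l: "length zs = N" and o: "off_ramification zs"
  have I': "I \<subseteq> {..<length zs}" using I l by simp
  have len: "length (nths zs I) = card I" "length (nths zs ({..<N} - I)) = N - card I"
    using length_nths_sub[OF I'] length_nths_compl[OF I'] l by simp_all
  show "\<forall>\<^sub>F z in at 2. (\<Sum>i<length t. \<Sum>j<length u. fst (t ! i) * fst (u ! j) *
       (prodw phi (tail_index t i) (nths zs I) * prodw phi (tail_index u j) (nths zs ({..<N} - I)) * (kernel w z * deriv zbar z * (phi (head_index t i) z * phi (head_index u j) (zbar z)))))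
     = kernel w z * deriv zbar z * (omega h (z # nths zs I) * omega h' (zbar z # nths zs ({..<N} - I)))"
    using ev_ne[of 0] ev_ne[of 1] ev_ne[of 2]
  proof eventually_elim
    case (elim z)
    have zb: "zbar z \<noteq> 0" "zbar z \<noteq> 2" using zbar_off_ramification[OF elim] by simp_all
    show ?case
      unfolding omega_tev[OF t len(1) off_ramification_nths[OF o] elim(1,3)] omega_tev[OF u len(2) off_ramification_nths[OF o] zb] sum_product unfolding sum_distrib_left
      by (intro sum.cong refl) (simp only: mult_ac)
  qed
qed

text \<open>Convolving the coefficient sequences of the first two slots multiplies powers of
  \<open>Sv\<close>; on the other side these slots are filled with \<open>z\<close> and
  \<open>zbar z\<close>. Both reduce to the product case.\<close>

lemma piece_diag:
  assumes t: "tensor_rep g (Suc (Suc N)) t"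
  shows "piece N (\<lambda>m ms. (Sv * fps_X * wdiag g ms) $ m)
     (\<lambda>w zs z. kernel w z * deriv zbar z * omega g (z # zbar z # zs))"
proof (rule piece_cong)
  have gt: "tensor_wf (Suc (Suc N)) t" using t by (simp add: tensor_rep_def)
  define K where "K = (\<lambda>j. head_index t j)"
  define L where "L = (\<lambda>j. hd (tail_index t j))"
  define R where "R = (\<lambda>j. tl (tail_index t j))"
  have g: "K j \<ge> 1" "L j \<ge> 1" "length (R j) = N" "\<forall>k\<in>set (R j). k \<ge> 1" "tail_index t j = L j # R j" if "j < length t" for j
  proof -
    have "length (tail_index t j) = Suc N" "\<forall>k\<in>set (tail_index t j). k \<ge> 1" using tensor_wf_hdk[OF gt that] by simp_all
    then show "L j \<ge> 1" "length (R j) = N" "\<forall>k\<in>set (R j). k \<ge> 1" "tail_index t j = L j # R j"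
      by (cases "tail_index t j"; auto simp: L_def R_def)+
    show "K j \<ge> 1" using tensor_wf_hdk[OF gt that] by (simp add: K_def)
  qed
  have tev2: "tensor_eval f t (x # y # ys) = (\<Sum>j<length t. fst (t ! j) * (f (K j) x * (f (L j) y * prodw f (R j) ys)))" for f :: "nat \<Rightarrow> 'a \<Rightarrow> complex" and x y ys
    unfolding tensor_eval_Cons[OF gt] by (rule sum.cong[OF refl]) (simp add: g K_def)
  show "piece N (\<lambda>m ms. \<Sum>j<length t. fst (t ! j) * ((Sv * fps_X * (Sv ^ (2 * K j + 1) * Sv ^ (2 * L j + 1))) $ m * prodw wk (R j) ms))
    (\<lambda>w zs z. \<Sum>j<length t. fst (t ! j) * (prodw phi (R j) zs * (kernel w z * deriv zbar z * (phi (K j) z * phi (L j) (zbar z)))))"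
    by (intro piece_sum finite_lessThan piece_cmult piece_pure) (use g in auto)
  show "(Sv * fps_X * wdiag g ms) $ m = (\<Sum>j<length t. fst (t ! j) * ((Sv * fps_X * (Sv ^ (2 * K j + 1) * Sv ^ (2 * L j + 1))) $ m * prodw wk (R j) ms))"
    if l: "length ms = N" for m ms
  proof -
    have "wdiag g ms = (\<Sum>j<length t. fps_const (fst (t ! j) * prodw wk (R j) ms) * (Sv ^ (2 * K j + 1) * Sv ^ (2 * L j + 1)))"
    proof (rule fps_ext)
      fix n
      have "wdiag g ms $ n = (\<Sum>i\<le>n. tensor_eval wk t ((n - i) # i # ms))"
        using t l by (simp add: wdiag_def tensor_rep_def)
      also have "\<dots> = (\<Sum>j<length t. \<Sum>i\<le>n. fst (t ! j) * (wk (K j) (n - i) * (wk (L j) i * prodw wk (R j) ms)))"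
        unfolding tev2 by (rule sum.swap)
      also have "\<dots> = (\<Sum>j<length t. (fps_const (fst (t ! j) * prodw wk (R j) ms) * (Sv ^ (2 * L j + 1) * Sv ^ (2 * K j + 1))) $ n)"
        unfolding fps_mult_left_const_nth fps_mult_nth[of "Sv ^ _"] wk_def[symmetric] sum_distrib_left atLeast0AtMost
        by (simp only: mult_ac)
      finally show "wdiag g ms $ n = (\<Sum>j<length t. fps_const (fst (t ! j) * prodw wk (R j) ms) * (Sv ^ (2 * K j + 1) * Sv ^ (2 * L j + 1))) $ n"
        by (simp only: fps_sum_nth mult.commute)
    qed
    then have e: "Sv * fps_X * wdiag g ms = (\<Sum>j<length t. fps_const (fst (t ! j) * prodw wk (R j) ms) * (Sv * fps_X * (Sv ^ (2 * K j + 1) * Sv ^ (2 * L j + 1))))"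
      by (simp only: sum_distrib_left mult_ac)
    show ?thesis unfolding e fps_sum_nth fps_mult_left_const_nth by (simp only: mult_ac)
  qed
  fix w zs assume l: "length zs = N" and o: "off_ramification zs"
  show "\<forall>\<^sub>F z in at 2. (\<Sum>j<length t. fst (t ! j) * (prodw phi (R j) zs * (kernel w z * deriv zbar z * (phi (K j) z * phi (L j) (zbar z)))))
     = kernel w z * deriv zbar z * omega g (z # zbar z # zs)"
    using ev_ne[of 0] ev_ne[of 1] ev_ne[of 2]
  proof eventually_elim
    case (elim z)
    have "off_ramification (z # zbar z # zs)" using zbar_off_ramification[OF elim] elim o by (simp add: off_ramification_def)
    then have e: "omega g (z # zbar z # zs) = tensor_eval phi t (z # zbar z # zs)" using t l by (simp add: tensor_rep_def)
    show ?case unfolding e tev2 sum_distrib_left by (simp only: mult_ac)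
  qed
qed

lemma joinT_sum: "finite A \<Longrightarrow> joinT N (\<Sum>j\<in>A. f j) = (\<Sum>j\<in>A. joinT N (f j))"
proof (induction A rule: finite_induct)
  case empty
  then show ?case by (simp add: joinT_def joinop_def)
next
  case (insert x A)
  then show ?case unfolding sum.insert[OF insert.hyps] insert.IH[symmetric] by (simp add: joinT_def joinop_add distrib_left)
qed

text \<open>The two terms, with omega_{0,2} at \<open>z\<close> and at \<open>zbar z\<close>, are
  kept together, because \<open>has_residue_two_join\<close> evaluates only their sum.\<close>

lemma piece_join:
  assumes r: "r < N" and t: "tensor_rep g (Suc (N - 1)) t"
  shows "piece N (\<lambda>m ms. (Sv * joinT (ms ! r) (wser g (nths ms ({..<N} - {r})))) $ m)
     (\<lambda>w zs z. kernel w z * deriv zbar z * (1 / (z - zs ! r) ^ 2 * omega g (zbar z # nths zs ({..<N} - {r}))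
        + omega g (z # nths zs ({..<N} - {r})) * (1 / (zbar z - zs ! r) ^ 2)))"
proof (rule piece_cong)
  have gt: "tensor_wf (Suc (N - 1)) t" using t by (simp add: tensor_rep_def)
  show "piece N (\<lambda>m ms. \<Sum>j<length t. fst (t ! j) * ((Sv * joinT (ms ! r) (Sv ^ (2 * head_index t j + 1))) $ m * prodw wk (tail_index t j) (nths ms ({..<N} - {r}))))
     (\<lambda>w zs z. \<Sum>j<length t. fst (t ! j) * (prodw phi (tail_index t j) (nths zs ({..<N} - {r})) *
        (kernel w z * deriv zbar z * (1 / (z - zs ! r) ^ 2 * phi (head_index t j) (zbar z) + phi (head_index t j) z * (1 / (zbar z - zs ! r) ^ 2)))))"
    by (intro piece_sum finite_lessThan piece_cmult piece_pure_join r) (use tensor_wf_hdk[OF gt] in auto)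
  have len: "length (nths ys ({..<N} - {r})) = N - 1" if "length ys = N" for ys :: "'x list"
    using length_nths_compl[of "{r}" ys] that r by simp
  show "(Sv * joinT (ms ! r) (wser g (nths ms ({..<N} - {r})))) $ m =
    (\<Sum>j<length t. fst (t ! j) * ((Sv * joinT (ms ! r) (Sv ^ (2 * head_index t j + 1))) $ m * prodw wk (tail_index t j) (nths ms ({..<N} - {r}))))"
    if l: "length ms = N" for m ms
  proof -
    have e: "Sv * joinT (ms ! r) (wser g (nths ms ({..<N} - {r}))) = (\<Sum>j<length t. fps_const (fst (t ! j) * prodw wk (tail_index t j) (nths ms ({..<N} - {r}))) * (Sv * joinT (ms ! r) (Sv ^ (2 * head_index t j + 1))))"
      unfolding wser_tev[OF t len[OF l]] joinT_sum[OF finite_lessThan] joinT_scale sum_distrib_left by (simp only: mult_ac)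
    show ?thesis unfolding e fps_sum_nth fps_mult_left_const_nth by (simp only: mult_ac)
  qed
  fix w zs assume l: "length zs = N" and o: "off_ramification zs"
  show "\<forall>\<^sub>F z in at 2. (\<Sum>j<length t. fst (t ! j) * (prodw phi (tail_index t j) (nths zs ({..<N} - {r})) *
        (kernel w z * deriv zbar z * (1 / (z - zs ! r) ^ 2 * phi (head_index t j) (zbar z) + phi (head_index t j) z * (1 / (zbar z - zs ! r) ^ 2)))))
     = kernel w z * deriv zbar z * (1 / (z - zs ! r) ^ 2 * omega g (zbar z # nths zs ({..<N} - {r}))
        + omega g (z # nths zs ({..<N} - {r})) * (1 / (zbar z - zs ! r) ^ 2))"
    using ev_ne[of 0] ev_ne[of 1] ev_ne[of 2]
  proof eventually_elim
    case (elim z)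
    have zb: "zbar z \<noteq> 0" "zbar z \<noteq> 2" using zbar_off_ramification[OF elim] by simp_all
    define a b where "a = 1 / (z - zs ! r) ^ 2" and "b = 1 / (zbar z - zs ! r) ^ 2"
    show ?case
      unfolding omega_tev[OF t len[OF l] off_ramification_nths[OF o] elim(1,3)] omega_tev[OF t len[OF l] off_ramification_nths[OF o] zb] a_def[symmetric] b_def[symmetric]
      by (simp only: sum_distrib_left sum_distrib_right sum.distrib[symmetric] distrib_left mult_ac)
  qed
qed

text \<open>The two factors have \<open>card I + 1\<close> and \<open>N - card I + 1\<close>
  arguments; the inequalities are 2h - 2 + n > 0 for each of them.\<close>

abbreviation stable_pairs :: "nat \<Rightarrow> nat \<Rightarrow> (nat \<times> nat set) set" where
  "stable_pairs g N \<equiv> {(h, I). h \<le> g \<and> I \<subseteq> {..<N} \<and> 2 * h + card I \<ge> 2 \<and> 2 * (g - h) + (N - card I) \<ge> 2}"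

text \<open>The pairs outside \<open>stable_pairs\<close> contain a factor of type (0,1) or (0,2).
  The bound on 2g + N keeps these four families disjoint; for (0,3), singletons would coincide with
  complements of singletons.\<close>

lemma pair_sum:
  fixes F :: "nat \<Rightarrow> nat set \<Rightarrow> 'b :: comm_monoid_add"
  assumes "2 * g + N \<ge> 3"
  defines "R \<equiv> stable_pairs g N"
  shows "finite R" "(\<Sum>h\<le>g. \<Sum>I\<in>Pow {..<N}. F h I) = F 0 {} + F g {..<N} + (\<Sum>r<N. F 0 {r}) + (\<Sum>r<N. F g ({..<N} - {r})) + (\<Sum>(h, I)\<in>R. F h I)"
proof -
  let ?P = "{..g} \<times> Pow {..<N}"
  let ?A = "(\<lambda>r. (0, {r})) ` {..<N}"
  let ?B = "(\<lambda>r. (g, {..<N} - {r})) ` {..<N}"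
  have fP: "finite ?P" by simp
  have Rsub: "R \<subseteq> ?P" by (auto simp: R_def)
  show fR: "finite R" using finite_subset[OF Rsub fP] .
  have cB: "card ({..<N} - {r}) = N - 1" if "r < N" for r using that by simp
  have P: "?P = {(0, {})} \<union> {(g, {..<N})} \<union> ?A \<union> ?B \<union> R"
  proof
    show "{(0, {})} \<union> {(g, {..<N})} \<union> ?A \<union> ?B \<union> R \<subseteq> ?P" using Rsub by auto
    show "?P \<subseteq> {(0, {})} \<union> {(g, {..<N})} \<union> ?A \<union> ?B \<union> R"
    proof (rule subsetI, rule ccontr)
      fix p assume "p \<in> ?P" and np: "p \<notin> {(0, {})} \<union> {(g, {..<N})} \<union> ?A \<union> ?B \<union> R"
      then obtain h I where p: "p = (h, I)" and h: "h \<le> g" and I: "I \<subseteq> {..<N}" by blast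
      note n = np[unfolded p]
      have fI: "finite I" using I finite_subset by blast
      have cI: "card I \<le> N" using card_le_sub[OF I] .
      have "\<not> (2 * h + card I \<ge> 2 \<and> 2 * (g - h) + (N - card I) \<ge> 2)" using n h I by (simp add: R_def)
      then consider "h = 0" "card I = 0" | "h = 0" "card I = 1" | "h = g" "N - card I = 0" | "h = g" "N - card I = 1" using h by linarith
      then show False
      proof cases
        case 1
        then show False using n fI by simp
      next
        case 2
        then obtain r where "I = {r}" using card_1_singletonE by blast
        then show False using n 2 I by auto
      next
        case 3
        then have "I = {..<N}" using I cI by (intro card_subset_eq) auto
        then show False using n 3 by simp
      next
        case 4
        then have "card ({..<N} - I) = 1" using card_Diff_subset[OF fI I] by simp
        then obtain r where r: "{..<N} - I = {r}" using card_1_singletonE by blast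
        then have "I = {..<N} - {r}" "r < N" using I by auto
        then show False using n 4 by auto
      qed
    qed
  qed
  have d1: "(0, {}) \<noteq> (g, {..<N})"
  proof
    assume e: "(0, {}) = (g, {..<N})"
    then have "card {..<N} = 0" by (metis card.empty prod.inject)
    then show False using e assms(1) by simp
  qed
  have d2: "({(0, {})} \<union> {(g, {..<N})}) \<inter> ?A = {}"
  proof -
    have "(g, {..<N}) \<noteq> (0, {r})" for r
    proof
      assume e: "(g, {..<N}) = (0, {r})"
      then have "card {..<N} = card {r}" by (metis prod.inject)
      then show False using e assms(1) by simp
    qed
    then show ?thesis by auto
  qed
  have d3: "({(0, {})} \<union> {(g, {..<N})} \<union> ?A) \<inter> ?B = {}"
  proof -
    have "(g, {..<N} - {r}) \<noteq> (0, {})" "(g, {..<N} - {r}) \<noteq> (g, {..<N})" "(g, {..<N} - {r}) \<noteq> (0, {s})" "(0, {s}) \<noteq> (g, {..<N} - {r})" if "r < N" for r s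
    proof -
      show "(g, {..<N} - {r}) \<noteq> (g, {..<N})" using that by auto
      show "(g, {..<N} - {r}) \<noteq> (0, {})"
      proof
        assume e: "(g, {..<N} - {r}) = (0, {})"
        then have "card ({..<N} - {r}) = 0" by (metis card.empty prod.inject)
        then show False using e assms(1) cB[OF that] by simp
      qed
      show n3: "(g, {..<N} - {r}) \<noteq> (0, {s})"
      proof
        assume e: "(g, {..<N} - {r}) = (0, {s})"
        then have "card ({..<N} - {r}) = card {s}" by (metis prod.inject)
        then show False using e assms(1) cB[OF that] by simp
      qed
      show "(0, {s}) \<noteq> (g, {..<N} - {r})" using n3 by (rule not_sym)
    qed
    then show ?thesis by auto
  qed
  have d4: "({(0, {})} \<union> {(g, {..<N})} \<union> ?A \<union> ?B) \<inter> R = {}" by (auto simp: R_def)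
  have iA: "inj_on (\<lambda>r. (0::nat, {r})) {..<N}" by (auto simp: inj_on_def)
  have iB: "inj_on (\<lambda>r. (g, {..<N} - {r})) {..<N}" by (auto simp: inj_on_def)
  have "(\<Sum>h\<le>g. \<Sum>I\<in>Pow {..<N}. F h I) = (\<Sum>(h, I)\<in>?P. F h I)" by (rule sum.cartesian_product)
  also have "\<dots> = (\<Sum>(h, I)\<in>{(0, {})} \<union> {(g, {..<N})} \<union> ?A \<union> ?B. F h I) + (\<Sum>(h, I)\<in>R. F h I)"
    unfolding P using d4 fR by (intro sum.union_disjoint) auto
  also have "(\<Sum>(h, I)\<in>{(0, {})} \<union> {(g, {..<N})} \<union> ?A \<union> ?B. F h I) = (\<Sum>(h, I)\<in>{(0, {})} \<union> {(g, {..<N})} \<union> ?A. F h I) + (\<Sum>(h, I)\<in>?B. F h I)"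
    using d3 by (intro sum.union_disjoint) auto
  also have "(\<Sum>(h, I)\<in>{(0, {})} \<union> {(g, {..<N})} \<union> ?A. F h I) = (\<Sum>(h, I)\<in>{(0, {})} \<union> {(g, {..<N})}. F h I) + (\<Sum>(h, I)\<in>?A. F h I)"
    using d2 by (intro sum.union_disjoint) auto
  also have "(\<Sum>(h, I)\<in>{(0, {})} \<union> {(g, {..<N})}. F h I) = F 0 {} + F g {..<N}"
  proof -
    have gen: "sum f ({p} \<union> {q}) = f p + f q" if "p \<noteq> q" for f :: "nat \<times> nat set \<Rightarrow> 'b" and p q
      using that by (subst sum.union_disjoint) auto
    show ?thesis unfolding gen[OF d1] by simp
  qed
  also have "(\<Sum>(h, I)\<in>?A. F h I) = (\<Sum>r<N. F 0 {r})" unfolding sum.reindex[OF iA] by simp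
  also have "(\<Sum>(h, I)\<in>?B. F h I) = (\<Sum>r<N. F g ({..<N} - {r}))" unfolding sum.reindex[OF iB] by simp
  finally show "(\<Sum>h\<le>g. \<Sum>I\<in>Pow {..<N}. F h I) = F 0 {} + F g {..<N} + (\<Sum>r<N. F 0 {r}) + (\<Sum>r<N. F g ({..<N} - {r})) + (\<Sum>(h, I)\<in>R. F h I)" .
qed

lemma nths_full: "length ys = N \<Longrightarrow> nths ys {..<N} = ys"
  by (rule nths_all) simp

lemma full_diff: "r < N \<Longrightarrow> {..<N} - ({..<N} - {r}) = {r :: nat}" by auto

text \<open>The two (0,1) factors contribute 2xz times the unknown series, which moves to the left
  and leaves s = 1 - 2xz there. The (0,2) factors combine with the join terms into
  \<open>joinT\<close>, and everything is multiplied by 1/s.\<close>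

lemma wser_step:
  assumes st: "2 * g + N \<ge> 3" and l: "length ms = N"
  shows "wser g ms = (\<Sum>r<N. Sv * joinT (ms ! r) (wser g (nths ms ({..<N} - {r}))))
     + (if g = 0 then 0 else Sv * fps_X * wdiag (g - 1) ms)
     + (\<Sum>(h, I)\<in>stable_pairs g N.
          Sv * fps_X * (wser h (nths ms I) * wser (g - h) (nths ms ({..<N} - I))))"
proof -
  define F where "F = (\<lambda>h I. wser h (nths ms I) * wser (g - h) (nths ms ({..<N} - I)))"
  define D where "D = (if g = 0 then 0 else wdiag (g - 1) ms)"
  define Q where "Q = (\<Sum>(h, I)\<in>stable_pairs g N. F h I)"
  define V where "V = (\<lambda>r. wser g (nths ms ({..<N} - {r})))"
  have ne: "\<not> (g = 0 \<and> ms = [])" using st l by auto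
  have "wser g ms = (\<Sum>r<N. joinop (ms ! r) (V r)) + fps_X * (D + (\<Sum>h\<le>g. \<Sum>I\<in>Pow {..<N}. F h I))"
    using wser_rec[of g ms] ne l unfolding D_def F_def V_def by simp
  also have "(\<Sum>h\<le>g. \<Sum>I\<in>Pow {..<N}. F h I) = F 0 {} + F g {..<N} + (\<Sum>r<N. F 0 {r}) + (\<Sum>r<N. F g ({..<N} - {r})) + Q"
    unfolding Q_def by (rule pair_sum(2)[OF st])
  also have "F 0 {} = Zs * wser g ms"
    by (simp add: F_def Zs_def nths_full[OF l] del: nths_upt_eq_take)
  also have "F g {..<N} = wser g ms * Zs"
    by (simp_all add: F_def Zs_def nths_full[OF l] del: nths_upt_eq_take)
  also have "(\<Sum>r<N. F 0 {r}) = (\<Sum>r<N. W02 (ms ! r) * V r)"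
    by (rule sum.cong[OF refl]) (simp add: F_def nths_single l W02_def V_def)
  also have "(\<Sum>r<N. F g ({..<N} - {r})) = (\<Sum>r<N. W02 (ms ! r) * V r)"
  proof (rule sum.cong[OF refl])
    fix r assume "r \<in> {..<N}"
    then have "r < N" by simp
    then show "F g ({..<N} - {r}) = W02 (ms ! r) * V r"
      unfolding F_def full_diff[OF \<open>r < N\<close>] by (simp add: nths_single l W02_def V_def)
  qed
  finally have e: "wser g ms = (\<Sum>r<N. joinop (ms ! r) (V r)) + fps_X * (D + (Zs * wser g ms + wser g ms * Zs + (\<Sum>r<N. W02 (ms ! r) * V r) + (\<Sum>r<N. W02 (ms ! r) * V r) + Q))" .
  have "(\<Sum>r<N. joinT (ms ! r) (V r)) = (\<Sum>r<N. joinop (ms ! r) (V r)) + 2 * fps_X * (\<Sum>r<N. W02 (ms ! r) * V r)"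
    unfolding joinT_def sum.distrib sum_distrib_left by (simp only: mult.assoc)
  moreover have gen: "(1 - 2 * X * Z) * W = JT + X * (D + Q)"
    if "W = J + X * (D + (Z * W + W * Z + Y + Y + Q))" "JT = J + 2 * X * Y" for W J X D Z Y Q JT :: "complex fps"
  proof -
    have "(1 - 2 * X * Z) * W = W - 2 * X * Z * W" by (simp add: algebra_simps)
    also have "\<dots> = (J + X * (D + (Z * W + W * Z + Y + Y + Q))) - 2 * X * Z * W" using that(1) by simp
    also have "\<dots> = JT + X * (D + Q)" unfolding that(2) by (simp add: algebra_simps)
    finally show ?thesis .
  qed
  ultimately have "Ss * wser g ms = (\<Sum>r<N. joinT (ms ! r) (V r)) + fps_X * (D + Q)"
    unfolding Ss_def using e by blast
  then have "Sv * (Ss * wser g ms) = Sv * ((\<Sum>r<N. joinT (ms ! r) (V r)) + fps_X * (D + Q))" by simp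
  then have "wser g ms = Sv * ((\<Sum>r<N. joinT (ms ! r) (V r)) + fps_X * (D + Q))"
    by (simp only: mult.assoc[symmetric] Ss_Sv mult_1_left)
  also have "\<dots> = (\<Sum>r<N. Sv * joinT (ms ! r) (V r)) + Sv * fps_X * D + Sv * fps_X * Q"
    by (simp add: sum_distrib_left distrib_left mult.assoc)
  also have "Sv * fps_X * Q = (\<Sum>(h, I)\<in>stable_pairs g N. Sv * fps_X * F h I)"
    by (simp add: Q_def sum_distrib_left case_prod_unfold)
  also have "Sv * fps_X * D = (if g = 0 then 0 else Sv * fps_X * wdiag (g - 1) ms)" by (simp add: D_def)
  finally show ?thesis unfolding V_def F_def .
qed

text \<open>The absence of omega_{0,1} corresponds to the division by s in \<open>wser_step\<close>;
  the other terms are regrouped into the same three kinds.\<close>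

lemma omega_step:
  assumes st: "2 * g + N \<ge> 3" and l: "length zs = N"
  shows "omega g (w # zs) = residue (\<lambda>z. (\<Sum>r<N. kernel w z * deriv zbar z * (1 / (z - zs ! r) ^ 2 * omega g (zbar z # nths zs ({..<N} - {r}))
        + omega g (z # nths zs ({..<N} - {r})) * (1 / (zbar z - zs ! r) ^ 2)))
     + (if g = 0 then 0 else kernel w z * deriv zbar z * omega (g - 1) (z # zbar z # zs))
     + (\<Sum>(h, I)\<in>stable_pairs g N.
          kernel w z * deriv zbar z * (omega h (z # nths zs I) * omega (g - h) (zbar z # nths zs ({..<N} - I))))) 2"
proof -
  have w02: "omega 0 [z, y] = 1 / (z - y) ^ 2" for z y by (simp add: omega.simps(2))
  have ne: "\<not> (g = 0 \<and> zs = [])" "\<not> (g = 0 \<and> length zs = 1)" using st l by auto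
  have br: "kernel w z * deriv zbar z *
         ((if g = 0 then 0 else omega (g - 1) (z # zbar z # zs)) +
          (\<Sum>g1\<in>{0..g}. \<Sum>I\<in>Pow {..<length zs}.
             if (g1 = 0 \<and> I = {}) \<or> (g1 = g \<and> I = {..<length zs}) then 0
             else omega g1 (z # nths zs I) * omega (g - g1) (zbar z # nths zs ({..<length zs} - I))))
    = (\<Sum>r<N. kernel w z * deriv zbar z * (1 / (z - zs ! r) ^ 2 * omega g (zbar z # nths zs ({..<N} - {r}))
        + omega g (z # nths zs ({..<N} - {r})) * (1 / (zbar z - zs ! r) ^ 2)))
     + (if g = 0 then 0 else kernel w z * deriv zbar z * omega (g - 1) (z # zbar z # zs))
     + (\<Sum>(h, I)\<in>stable_pairs g N. kernel w z * deriv zbar z * (omega h (z # nths zs I) * omega (g - h) (zbar z # nths zs ({..<N} - I))))" for z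
  proof -
    define G where "G = (\<lambda>h I. if (h = 0 \<and> I = {}) \<or> (h = g \<and> I = {..<N}) then 0
             else omega h (z # nths zs I) * omega (g - h) (zbar z # nths zs ({..<N} - I)))"
    define D where "D = (if g = 0 then 0 else omega (g - 1) (z # zbar z # zs))"
    have "(\<Sum>g1\<in>{0..g}. \<Sum>I\<in>Pow {..<length zs}.
             if (g1 = 0 \<and> I = {}) \<or> (g1 = g \<and> I = {..<length zs}) then 0
             else omega g1 (z # nths zs I) * omega (g - g1) (zbar z # nths zs ({..<length zs} - I)))
        = (\<Sum>h\<le>g. \<Sum>I\<in>Pow {..<N}. G h I)" unfolding G_def l atLeast0AtMost ..
    also have "\<dots> = G 0 {} + G g {..<N} + (\<Sum>r<N. G 0 {r}) + (\<Sum>r<N. G g ({..<N} - {r})) + (\<Sum>(h, I)\<in>stable_pairs g N. G h I)"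
      by (rule pair_sum(2)[OF st])
    also have "G 0 {} = 0" by (simp add: G_def)
    also have "G g {..<N} = 0" by (simp add: G_def)
    also have "(\<Sum>r<N. G 0 {r}) = (\<Sum>r<N. 1 / (z - zs ! r) ^ 2 * omega g (zbar z # nths zs ({..<N} - {r})))"
    proof (rule sum.cong[OF refl])
      fix r assume "r \<in> {..<N}"
      then have r: "r < N" by simp
      have "\<not> (0 = g \<and> {r} = {..<N})"
      proof
        assume e: "0 = g \<and> {r} = {..<N}"
        then have "{..<N} = {r}" by simp
        then have "card {..<N} = card {r}" by (rule arg_cong)
        then have "N = 1" by simp
        then show False using e st by simp
      qed
      then have "\<not> ((0 = (0::nat) \<and> {r} = {}) \<or> (0 = g \<and> {r} = {..<N}))" by blast
      then have "G 0 {r} = omega 0 (z # nths zs {r}) * omega (g - 0) (zbar z # nths zs ({..<N} - {r}))"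
        unfolding G_def by (rule if_not_P)
      then show "G 0 {r} = 1 / (z - zs ! r) ^ 2 * omega g (zbar z # nths zs ({..<N} - {r}))"
        unfolding nths_single[of r zs, unfolded l, OF r] w02 by simp
    qed
    also have "(\<Sum>r<N. G g ({..<N} - {r})) = (\<Sum>r<N. omega g (z # nths zs ({..<N} - {r})) * (1 / (zbar z - zs ! r) ^ 2))"
    proof (rule sum.cong[OF refl])
      fix r assume "r \<in> {..<N}"
      then have r: "r < N" by simp
      have 1: "\<not> (g = 0 \<and> {..<N} - {r} = {})"
      proof
        assume e: "g = 0 \<and> {..<N} - {r} = {}"
        then have "card ({..<N} - {r}) = 0" by (metis card.empty)
        moreover have "card ({..<N} - {r}) = N - 1" using r by simp
        ultimately show False using conjunct1[OF e] st by linarith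
      qed
      have 2: "{..<N} - {r} \<noteq> {..<N}" using r by auto
      have "\<not> ((g = 0 \<and> {..<N} - {r} = {}) \<or> (g = g \<and> {..<N} - {r} = {..<N}))" using 1 2 by blast
      then have "G g ({..<N} - {r}) = omega g (z # nths zs ({..<N} - {r})) * omega (g - g) (zbar z # nths zs ({..<N} - ({..<N} - {r})))"
        unfolding G_def by (rule if_not_P)
      then show "G g ({..<N} - {r}) = omega g (z # nths zs ({..<N} - {r})) * (1 / (zbar z - zs ! r) ^ 2)"
        unfolding full_diff[OF r] nths_single[of r zs, unfolded l, OF r] diff_self_eq_0 w02 .
    qed
    also have "(\<Sum>(h, I)\<in>stable_pairs g N. G h I) = (\<Sum>(h, I)\<in>stable_pairs g N. omega h (z # nths zs I) * omega (g - h) (zbar z # nths zs ({..<N} - I)))"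
    proof (rule sum.cong[OF refl], clarify)
      fix h and I :: "nat set" assume "2 \<le> 2 * h + card I" "2 \<le> 2 * (g - h) + (N - card I)"
      then have "\<not> ((h = 0 \<and> I = {}) \<or> (h = g \<and> I = {..<N}))" by auto
      then show "G h I = omega h (z # nths zs I) * omega (g - h) (zbar z # nths zs ({..<N} - I))" by (simp only: G_def if_False)
    qed
    finally show ?thesis unfolding D_def[symmetric] add_0
      by (simp add: D_def distrib_left sum_distrib_left sum.distrib case_prod_unfold)
  qed
  show ?thesis unfolding omega.simps(2)[of g w zs] if_not_P[OF ne(1)] if_not_P[OF ne(2)] br ..
qed

lemma tensor_rep_from_piece:
  assumes "piece N (\<lambda>m ms. wcoeff g (m # ms)) F"
    and "\<And>w zs. length zs = N \<Longrightarrow> omega g (w # zs) = residue (F w zs) 2"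
  shows "\<exists>t. tensor_rep g (Suc N) t"
proof -
  obtain t where t: "tensor_wf (Suc N) t" "\<And>m ms. length ms = N \<Longrightarrow> wcoeff g (m # ms) = tensor_eval wk t (m # ms)"
    "\<And>w zs. length zs = N \<Longrightarrow> w \<noteq> 2 \<Longrightarrow> off_ramification zs \<Longrightarrow> has_residue_two (F w zs) (tensor_eval phi t (w # zs))"
    using pieceE[OF assms(1)] by blast
  have "wcoeff g ms = tensor_eval wk t ms" if "length ms = Suc N" for ms
    using that t(2) by (cases ms) simp_all
  moreover have "omega g zs = tensor_eval phi t zs" if "length zs = Suc N" "off_ramification zs" for zs
  proof (cases zs)
    case (Cons w ys)
    then have y: "length ys = N" "w \<noteq> 2" "off_ramification ys" using that by (auto simp: off_ramification_def)
    show ?thesis using t(3)[OF y] assms(2)[OF y(1)] unfolding Cons has_residue_two_def by simp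
  qed (use that in simp)
  ultimately have "tensor_rep g (Suc N) t" using t(1) by (simp add: tensor_rep_def)
  then show ?thesis ..
qed

text \<open>All ingredients have smaller 2g + N: a join lowers N, the diagonal trades one genus for
  one variable, and in a stable product the two values add up to 2g + N while each is at least
  2.\<close>

lemma tensor_rep_step:
  assumes st: "2 * g + N \<ge> 3"
    and IH: "\<And>h n. 2 * h + n \<ge> 2 \<Longrightarrow> 2 * h + n < 2 * g + N \<Longrightarrow> \<exists>t. tensor_rep h (Suc n) t"
  shows "\<exists>t. tensor_rep g (Suc N) t"
proof (rule tensor_rep_from_piece)
  define A where "A = (\<lambda>m ms. (\<Sum>r<N. (Sv * joinT (ms ! r) (wser g (nths ms ({..<N} - {r})))) $ m)
     + (if g = 0 then 0 else (Sv * fps_X * wdiag (g - 1) ms) $ m)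
     + (\<Sum>p\<in>stable_pairs g N. (Sv * fps_X * (wser (fst p) (nths ms (snd p)) * wser (g - fst p) (nths ms ({..<N} - snd p)))) $ m))"
  define F where "F = (\<lambda>w zs z. (\<Sum>r<N. kernel w z * deriv zbar z * (1 / (z - zs ! r) ^ 2 * omega g (zbar z # nths zs ({..<N} - {r}))
        + omega g (z # nths zs ({..<N} - {r})) * (1 / (zbar z - zs ! r) ^ 2)))
     + (if g = 0 then 0 else kernel w z * deriv zbar z * omega (g - 1) (z # zbar z # zs))
     + (\<Sum>p\<in>stable_pairs g N. kernel w z * deriv zbar z * (omega (fst p) (z # nths zs (snd p)) * omega (g - fst p) (zbar z # nths zs ({..<N} - snd p)))))"
  show "omega g (w # zs) = residue (F w zs) 2" if "length zs = N" for w zs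
    using omega_step[OF st that, of w] unfolding F_def case_prod_unfold .
  have "piece N A F"
    unfolding A_def F_def
  proof (intro piece_add piece_sum finite_lessThan pair_sum(1)[OF st])
    fix r assume "r \<in> {..<N}"
    then have r: "r < N" by simp
    have "\<exists>t. tensor_rep g (Suc (N - 1)) t" by (rule IH) (use st r in auto)
    then obtain t where "tensor_rep g (Suc (N - 1)) t" ..
    then show "piece N (\<lambda>m ms. (Sv * joinT (ms ! r) (wser g (nths ms ({..<N} - {r})))) $ m)
     (\<lambda>w zs z. kernel w z * deriv zbar z * (1 / (z - zs ! r) ^ 2 * omega g (zbar z # nths zs ({..<N} - {r}))
        + omega g (z # nths zs ({..<N} - {r})) * (1 / (zbar z - zs ! r) ^ 2)))" by (rule piece_join[OF r])
  next
    show "piece N (\<lambda>m ms. if g = 0 then 0 else (Sv * fps_X * wdiag (g - 1) ms) $ m)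
      (\<lambda>w zs z. if g = 0 then 0 else kernel w z * deriv zbar z * omega (g - 1) (z # zbar z # zs))"
    proof (cases "g = 0")
      case True
      then show ?thesis using piece_zero by simp
    next
      case False
      have "\<exists>t. tensor_rep (g - 1) (Suc (Suc N)) t" by (rule IH) (use st False in auto)
      then obtain t where "tensor_rep (g - 1) (Suc (Suc N)) t" ..
      then show ?thesis unfolding if_not_P[OF False] by (rule piece_diag)
    qed
  next
    fix p assume "p \<in> stable_pairs g N"
    then obtain h I where p: "p = (h, I)" and h: "h \<le> g" and I: "I \<subseteq> {..<N}" and s: "2 * h + card I \<ge> 2" "2 * (g - h) + (N - card I) \<ge> 2" by auto
    have cI: "card I \<le> N" using card_le_sub[OF I] .
    have "\<exists>t. tensor_rep h (Suc (card I)) t" by (rule IH) (use s h cI in auto)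
    then obtain t where t: "tensor_rep h (Suc (card I)) t" ..
    have "\<exists>u. tensor_rep (g - h) (Suc (N - card I)) u" by (rule IH) (use s h cI in auto)
    then obtain u where u: "tensor_rep (g - h) (Suc (N - card I)) u" ..
    show "piece N (\<lambda>m ms. (Sv * fps_X * (wser (fst p) (nths ms (snd p)) * wser (g - fst p) (nths ms ({..<N} - snd p)))) $ m)
      (\<lambda>w zs z. kernel w z * deriv zbar z * (omega (fst p) (z # nths zs (snd p)) * omega (g - fst p) (zbar z # nths zs ({..<N} - snd p))))"
      unfolding p fst_conv snd_conv by (rule piece_split[OF I t u])
  qed
  then show "piece N (\<lambda>m ms. wcoeff g (m # ms)) F"
  proof (rule piece_cong)
    fix m :: nat and ms :: "nat list" assume l: "length ms = N"
    have "wcoeff g (m # ms) = wser g ms $ m" by (simp add: wser_def)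
    also have "\<dots> = A m ms"
      unfolding wser_step[OF st l] A_def fps_add_nth fps_sum_nth case_prod_unfold by simp
    finally show "wcoeff g (m # ms) = A m ms" .
  qed simp
qed

lemma tensor_rep_11: "\<exists>t. tensor_rep 1 (Suc 0) t"
proof (rule tensor_rep_from_piece)
  let ?F = "\<lambda>w zs z. kernel w z * deriv zbar z * (1 / (z - zbar z) ^ 2)"
  show "omega 1 (w # zs) = residue (?F w zs) 2" if "length zs = 0" for w and zs :: "complex list"
  proof -
    have w02: "omega 0 [z, y] = 1 / (z - y) ^ 2" for z y by (simp add: omega.simps(2))
    have z: "zs = []" using that by simp
    have "(\<Sum>g1\<in>{0..1::nat}. \<Sum>I\<in>Pow {..<length zs}.
             if (g1 = 0 \<and> I = {}) \<or> (g1 = 1 \<and> I = {..<length zs}) then 0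
             else omega g1 (z # nths zs I) * omega (1 - g1) (zbar z # nths zs ({..<length zs} - I))) = 0" for z
    proof (rule sum.neutral, intro ballI sum.neutral)
      fix h I assume "h \<in> {0..1::nat}" "I \<in> Pow {..<length zs}"
      then have "(h = 0 \<and> I = {}) \<or> (h = 1 \<and> I = {..<length zs})" unfolding z by auto
      then show "(if (h = 0 \<and> I = {}) \<or> (h = 1 \<and> I = {..<length zs}) then 0
             else omega h (z # nths zs I) * omega (1 - h) (zbar z # nths zs ({..<length zs} - I))) = 0" by (simp only: if_True)
    qed
    then show ?thesis unfolding omega.simps(2)[of 1 w zs] by (simp add: z w02)
  qed
  show "piece 0 (\<lambda>m ms. wcoeff 1 (m # ms)) ?F"
  proof (rule pieceI[of _ "[(1/4, [2]), (-1/4, [1])]"])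
    show "tensor_wf (Suc 0) [(1/4, [2]), (-1/4, [1])]" by (simp add: tensor_wf_def)
    show "wcoeff 1 (m # ms) = tensor_eval wk [(1/4, [2]), (-1/4, [1])] (m # ms)" if "length ms = 0" for m ms
    proof -
      have "wcoeff 1 [m] = wser 1 [] $ m" by (simp add: wser_def)
      then show ?thesis using that unfolding wser_11 fps_mult_left_const_nth fps_sub_nth by (simp add: wk_def right_diff_distrib)
    qed
    show "has_residue_two (?F w zs) (tensor_eval phi [(1/4, [2]), (-1/4, [1])] (w # zs))" if "length zs = 0" "w \<noteq> 2" for w and zs :: "complex list"
      using has_residue_two_11[OF that(2)] that(1) by simp
  qed
qed

lemma tensor_rep_03: "\<exists>t. tensor_rep 0 (Suc 2) t"
proof (rule tensor_rep_from_piece)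
  let ?F = "\<lambda>w zs z. kernel w z * deriv zbar z * (1 / (z - zs ! 0) ^ 2 * (1 / (zbar z - zs ! 1) ^ 2) + 1 / (z - zs ! 1) ^ 2 * (1 / (zbar z - zs ! 0) ^ 2))"
  have two: "\<exists>a b. zs = [a, b]" if "length zs = 2" for zs :: "'x list"
    using that by (cases zs; cases "tl zs") auto
  show "omega 0 (w # zs) = residue (?F w zs) 2" if zs: "length zs = 2" for w and zs :: "complex list"
  proof -
    obtain a b where ab: "zs = [a, b]" using two[OF zs] by blast
    have n1: "{..<Suc (Suc 0)} - {0} = {1::nat}" "{..<Suc (Suc 0)} - {1} = {0::nat}" "{..<Suc (Suc 0)} = {0,1::nat}" by auto
    have n2: "nths [a, b] {0} = [a]" "nths [a, b] {1} = [b]" by (simp_all add: nths_Cons)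
    have ne: "{0} \<noteq> {1::nat}" "{} \<noteq> {0::nat}" "{0::nat} \<noteq> {0, 1}" "{1::nat} \<noteq> {0, 1}" "{0, 1::nat} \<noteq> {}" by auto
    have w02: "omega 0 [z, y] = 1 / (z - y) ^ 2" for z y by (simp add: omega.simps(2))
    have s0: "(\<Sum>h\<in>{0::nat}. G h) = G 0" for G :: "nat \<Rightarrow> complex" by simp
    have n3: "{0, 1} - {0} = {1::nat}" "{0, 1} - {1} = {0::nat}" "{0} \<noteq> ({} :: nat set)" "{0} \<noteq> {0, 1::nat}" "{1} \<noteq> {0, 1::nat}" "{1} \<noteq> ({} :: nat set)" by auto
    have S: "(\<Sum>I\<in>{{}, {0}, {1}, {0, 1::nat}}. H I) = H {} + (H {0} + (H {1} + H {0, 1}))" for H :: "nat set \<Rightarrow> complex"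
      using ne by simp
    have "(\<Sum>g1\<in>{0..0}. \<Sum>I\<in>Pow {..<length zs}.
             if (g1 = 0 \<and> I = {}) \<or> (g1 = 0 \<and> I = {..<length zs}) then 0
             else omega g1 (z # nths zs I) * omega (0 - g1) (zbar z # nths zs ({..<length zs} - I)))
      = 1 / (z - zs ! 0) ^ 2 * (1 / (zbar z - zs ! 1) ^ 2) + 1 / (z - zs ! 1) ^ 2 * (1 / (zbar z - zs ! 0) ^ 2)" for z
    proof -
      have l: "length zs = Suc (Suc 0)" by (simp add: ab)
      have z0: "zs ! 0 = a" "zs ! 1 = b" by (simp_all add: ab)
      have "(\<Sum>g1\<in>{0..0}. \<Sum>I\<in>Pow {..<length zs}.
             if (g1 = 0 \<and> I = {}) \<or> (g1 = 0 \<and> I = {..<length zs}) then 0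
             else omega g1 (z # nths zs I) * omega (0 - g1) (zbar z # nths zs ({..<length zs} - I)))
       = (\<Sum>I\<in>{{}, {0}, {1}, {0, 1}}. if (0 = (0::nat) \<and> I = {}) \<or> (0 = (0::nat) \<and> I = {..<Suc (Suc 0)}) then 0
             else omega 0 (z # nths zs I) * omega (0 - 0) (zbar z # nths zs ({..<Suc (Suc 0)} - I)))"
        unfolding l Pow_lessThan_2 atLeastAtMost_singleton by (rule s0)
      also have "\<dots> = (\<Sum>I\<in>{{}, {0}, {1}, {0, 1}}. if I = {} \<or> I = {0, 1} then 0
             else omega 0 (z # nths zs I) * omega 0 (zbar z # nths zs ({0, 1} - I)))"
        unfolding n1(3) by (simp only: simp_thms diff_self_eq_0)
      also have "\<dots> = omega 0 (z # nths zs {0}) * omega 0 (zbar z # nths zs {1}) + omega 0 (z # nths zs {1}) * omega 0 (zbar z # nths zs {0})"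
        unfolding S using ne n3 by (simp only: if_True if_False simp_thms add_0_left add_0_right)
      finally show ?thesis unfolding z0 unfolding ab n2 w02 .
    qed
    then show ?thesis unfolding omega.simps(2)[of 0 w zs] by (simp add: ab)
  qed
  show "piece 2 (\<lambda>m ms. wcoeff 0 (m # ms)) ?F"
  proof (rule pieceI[of _ "[(8, [1, 1, 1])]"])
    show "tensor_wf (Suc 2) [(8, [1, 1, 1])]" by (simp add: tensor_wf_def)
    show "wcoeff 0 (m # ms) = tensor_eval wk [(8, [1, 1, 1])] (m # ms)" if ms: "length ms = 2" for m ms
    proof -
      obtain a b where ab: "ms = [a, b]" using two[OF ms] by blast
      have "wcoeff 0 (m # ms) = wser 0 [a, b] $ m" by (simp add: wser_def ab)
      also have "\<dots> = 8 * wk 1 a * wk 1 b * wk 1 m" unfolding wser_03 fps_mult_left_const_nth by (simp add: wk_def numeral_eq_Suc)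
      finally show ?thesis by (simp add: ab mult_ac)
    qed
    show "has_residue_two (?F w zs) (tensor_eval phi [(8, [1, 1, 1])] (w # zs))" if h: "length zs = 2" "w \<noteq> 2" "off_ramification zs" for w and zs :: "complex list"
    proof -
      obtain a b where ab: "zs = [a, b]" using two[OF h(1)] by blast
      have "a \<noteq> 2" "b \<noteq> 2" using h(3) by (auto simp: ab off_ramification_def)
      from has_residue_two_03[OF h(2) this] show ?thesis by (simp add: ab mult_ac)
    qed
  qed
qed

theorem tensor_rep_exists: "2 * g + N \<ge> 2 \<Longrightarrow> \<exists>t. tensor_rep g (Suc N) t"
proof (induction "2 * g + N" arbitrary: g N rule: less_induct)
  case less
  show ?case
  proof (cases "2 * g + N \<ge> 3")
    case True
    then show ?thesis by (rule tensor_rep_step) (rule less.hyps)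
  next
    case False
    then have "g = 1 \<and> N = 0 \<or> g = 0 \<and> N = 2" using less.prems by arith
    then show ?thesis using tensor_rep_11 tensor_rep_03 by auto
  qed
qed

section \<open>Expansion at the origin\<close>

definition sq :: "complex \<Rightarrow> complex" where "sq x = csqrt (1 - 4 * x)"

lemma sq_sq: "sq x ^ 2 = 1 - 4 * x"
  by (simp add: sq_def)

text \<open>For |x| < 1/4 the number 1 - 4x has positive real part, which keeps it off the cut of
  the principal root and keeps s away from 0 and -1.\<close>

lemma sq_branch:
  assumes "x \<in> ball 0 (1/4)"
  shows "1 - 4 * x \<notin> \<real>\<^sub>\<le>\<^sub>0" "Re (sq x) > 0"
proof -
  have "\<bar>Re x\<bar> < 1/4" using assms abs_Re_le_cmod[of x] by simp
  then have "Re (1 - 4 * x) > 0" by simp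
  then show n: "1 - 4 * x \<notin> \<real>\<^sub>\<le>\<^sub>0" by (auto simp: complex_nonpos_Reals_iff)
  have "Re (sq x) \<noteq> 0"
  proof
    assume "Re (sq x) = 0"
    then have "Re (sq x ^ 2) \<le> 0" by (simp add: power2_eq_square)
    then show False using \<open>Re (1 - 4 * x) > 0\<close> by (simp add: sq_sq)
  qed
  moreover have "Re (sq x) \<ge> 0" using csqrt_principal[of "1 - 4 * x"] by (auto simp: sq_def)
  ultimately show "Re (sq x) > 0" by simp
qed

lemma sq_nonzero:
  assumes "x \<in> ball 0 (1/4)"
  shows "sq x \<noteq> 0" "1 + sq x \<noteq> 0"
proof -
  have "Re (sq x) > 0" by (rule sq_branch(2)[OF assms])
  then show "sq x \<noteq> 0" "1 + sq x \<noteq> 0"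
    by (metis less_irrefl zero_complex.sel(1)) (metis \<open>Re (sq x) > 0\<close> add_pos_pos less_irrefl one_complex.sel(1) plus_complex.sel(1) zero_complex.sel(1) zero_less_one)
qed

lemma holomorphic_sq: "sq holomorphic_on ball 0 (1/4)"
  unfolding sq_def by (intro holomorphic_intros) (use sq_branch(1) in auto)

text \<open>Both series square to 1 - 4x, and the constant term 1 decides between the two
  roots.\<close>

lemma sq_expansion: "sq has_fps_expansion Ss"
proof -
  define F where "F = fps_expansion sq 0"
  have an: "sq analytic_on {0}" using holomorphic_sq by (auto simp: analytic_at intro!: exI[of _ "ball 0 (1/4)"])
  have F: "sq has_fps_expansion F"
    unfolding F_def by (rule analytic_at_imp_has_fps_expansion_0[OF an])
  have "(\<lambda>x. sq x ^ 2) has_fps_expansion F ^ 2" by (intro fps_expansion_intros F)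
  then have "(\<lambda>x. 1 - 4 * x) has_fps_expansion F ^ 2" by (simp add: sq_sq)
  moreover have "(\<lambda>x :: complex. 1 - 4 * x) has_fps_expansion 1 - 4 * fps_X" by (intro fps_expansion_intros)
  ultimately have "F ^ 2 = Ss ^ 2" unfolding Ss_sq by (rule fps_expansion_unique_complex)
  then have "(F - Ss) * (F + Ss) = 0" by (simp add: power2_eq_square algebra_simps)
  moreover have "F $ 0 = 1" using has_fps_expansion_imp_0_eq_fps_nth_0[OF F] by (simp add: sq_def)
  then have "(F + Ss) $ 0 \<noteq> 0" by simp
  then have "F + Ss \<noteq> 0" by (metis fps_zero_nth)
  ultimately have "F = Ss" by simp
  then show ?thesis using F by simp
qed

text \<open>The rationalised form has no singularity at 0 and covers the separately defined value
  there.\<close>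

lemma zbranch_sq:
  assumes "x \<in> ball 0 (1/4)"
  shows "zbranch x = 2 * inverse (1 + sq x)"
proof (cases "x = 0")
  case True
  then show ?thesis by (simp add: zbranch_def sq_def)
next
  case False
  have "4 * x = (1 - sq x) * (1 + sq x)" using sq_sq[of x] by (simp add: power2_eq_square algebra_simps)
  then have x: "2 * x = (1 - sq x) * (1 + sq x) / 2" by simp
  then have nz: "1 - sq x \<noteq> 0" using False by auto
  have gen: "a / (a * b / 2) = 2 * inverse b" if "a \<noteq> 0" for a b :: complex
    using that by (cases "b = 0") (simp_all add: divide_simps)
  have "zbranch x = (1 - sq x) / (2 * x)" using False unfolding zbranch_def sq_def by (rule if_not_P)
  then show ?thesis unfolding x gen[OF nz] .
qed

lemma zbranch_facts:
  assumes x: "x \<in> ball 0 (1/4)"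
  shows "zbranch x \<noteq> 0" "zbranch x \<noteq> 2" "(2 - zbranch x) / zbranch x = sq x" "deriv xcurve (zbranch x) = sq x / zbranch x ^ 2"
proof -
  note n = sq_nonzero[OF x]
  show z: "zbranch x \<noteq> 0" unfolding zbranch_sq[OF x] using n by simp
  have "(2 - 2 * inverse b) / (2 * inverse b) = b - 1" if "b \<noteq> 0" for b :: complex
    using that by (simp add: divide_simps)
  from this[OF n(2)] show s: "(2 - zbranch x) / zbranch x = sq x" unfolding zbranch_sq[OF x] by simp
  show "zbranch x \<noteq> 2" using s n by auto
  have "deriv xcurve (zbranch x) = (2 - zbranch x) / zbranch x / zbranch x ^ 2"
    unfolding deriv_xcurve[OF z] by (simp add: power3_eq_cube power2_eq_square)
  then show "deriv xcurve (zbranch x) = sq x / zbranch x ^ 2" unfolding s .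
qed

lemma phi_zbranch:
  assumes x: "x \<in> ball 0 (1/4)" and k: "k \<ge> 1"
  shows "phi k (zbranch x) / deriv xcurve (zbranch x) = inverse (sq x) ^ (2 * k + 1)"
proof -
  obtain j where j: "k = Suc j" using k by (cases k) auto
  note n = sq_nonzero[OF x] and z = zbranch_facts[OF x]
  have "phi k (zbranch x) = 1 / zbranch x ^ 2 * (1 / sq x ^ 2) ^ k"
    unfolding j phi_s[OF z(1,2)] z(3) ..
  then have "phi k (zbranch x) / deriv xcurve (zbranch x) = (inverse (sq x) ^ 2) ^ k * inverse (sq x)"
    unfolding z(4) using n z by (simp add: field_simps power_inverse)
  also have "\<dots> = inverse (sq x) ^ (2 * k + 1)" by (simp add: power_mult)
  finally show ?thesis .
qed

text \<open>Absolute summability is included so that products of series in different variables can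
  be summed over lists of exponents.\<close>

definition power_series_of :: "(nat \<Rightarrow> complex) \<Rightarrow> (complex \<Rightarrow> complex) \<Rightarrow> bool" where
  "power_series_of a f \<longleftrightarrow> (\<forall>x\<in>ball 0 (1/4). (\<lambda>m. norm (a m * x ^ m)) summable_on UNIV \<and> ((\<lambda>m. a m * x ^ m) has_sum f x) UNIV)"

lemma serofI:
  assumes F: "f has_fps_expansion F" and hol: "f holomorphic_on ball 0 (1/4)"
  shows "power_series_of (fps_nth F) f"
  unfolding power_series_of_def
proof
  fix x :: complex assume x: "x \<in> ball 0 (1/4)"
  have h: "f holomorphic_on eball 0 (ereal (1/4))" using hol by simp
  have nx: "ereal (norm x) < ereal (1/4)" using x by simp
  have "ereal (1/4) \<le> fps_conv_radius F" by (rule holomorphic_on_imp_fps_conv_radius_ge[OF F h])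
  then have "ereal (norm x) < fps_conv_radius F" using nx by (rule less_le_trans[rotated])
  then have s: "summable (\<lambda>m. norm (F $ m * x ^ m))" by (rule norm_summable_fps)
  have "(\<lambda>m. F $ m * x ^ m) sums f x" by (rule has_fps_expansion_imp_sums_complex[OF F h nx])
  with s have "((\<lambda>m. F $ m * x ^ m) has_sum f x) UNIV" by (rule norm_summable_imp_has_sum)
  moreover have "(\<lambda>m. norm (F $ m * x ^ m)) summable_on UNIV"
    using norm_summable_imp_summable_on[of "\<lambda>m. norm (F $ m * x ^ m)"] s by (simp only: real_norm_def abs_norm_cancel)
  ultimately show "(\<lambda>m. norm (F $ m * x ^ m)) summable_on UNIV \<and> ((\<lambda>m. F $ m * x ^ m) has_sum f x) UNIV" by simp
qed

lemma power_series_of_wk: "power_series_of (wk k) (\<lambda>x. inverse (sq x) ^ (2 * k + 1))"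
proof -
  have "(\<lambda>x. inverse (sq x) ^ (2 * k + 1)) has_fps_expansion Sv ^ (2 * k + 1)"
    unfolding Sv_def by (intro fps_expansion_intros sq_expansion) simp
  moreover have "(\<lambda>x. inverse (sq x) ^ (2 * k + 1)) holomorphic_on ball 0 (1/4)"
    by (intro holomorphic_intros holomorphic_sq) (use sq_nonzero in auto)
  ultimately have "power_series_of (fps_nth (Sv ^ (2 * k + 1))) (\<lambda>x. inverse (sq x) ^ (2 * k + 1))" by (rule serofI)
  then show ?thesis by (simp only: wk_def[abs_def])
qed

lemma power_series_of_Zs: "power_series_of (fps_nth Zs) zbranch"
proof -
  have "(1 + Ss) * Zs = 2 * Zs - 2 * (fps_X * Zs\<^sup>2)" by (simp add: Ss_def power2_eq_square algebra_simps)
  also have "fps_X * Zs\<^sup>2 = Zs - 1" using Zs_eq by (metis add_diff_cancel_left')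
  finally have "(1 + Ss) * Zs = 2" by (simp add: algebra_simps)
  moreover have S: "(1 + Ss) $ 0 \<noteq> 0" by simp
  ultimately have Z: "Zs = 2 * inverse (1 + Ss)"
    using inverse_mult_eq_1[OF S] by (metis mult.assoc mult.commute mult_1_left)
  have "(\<lambda>x. 2 * inverse (1 + sq x)) has_fps_expansion Zs"
    unfolding Z by (intro fps_expansion_intros sq_expansion S)
  moreover have "(\<lambda>x. 2 * inverse (1 + sq x)) holomorphic_on ball 0 (1/4)"
    by (intro holomorphic_intros holomorphic_sq) (use sq_nonzero in auto)
  ultimately have "power_series_of (fps_nth Zs) (\<lambda>x. 2 * inverse (1 + sq x))" by (rule serofI)
  then show ?thesis unfolding power_series_of_def using zbranch_sq by simp
qed

text \<open>Fubini for families indexed by lists, divided into head and tail; absolute convergence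
  justifies the double sum.\<close>

lemma has_sum_Cons_product:
  fixes f :: "'a \<Rightarrow> complex" and h :: "'a list \<Rightarrow> complex"
  assumes f: "(\<lambda>x. norm (f x)) summable_on UNIV" "(f has_sum s) UNIV"
    and h: "(\<lambda>x. norm (h x)) summable_on {ms. length ms = n}" "(h has_sum t) {ms. length ms = n}"
  shows "(\<lambda>ms. norm (f (hd ms) * h (tl ms))) summable_on {ms. length ms = Suc n}"
    "((\<lambda>ms. f (hd ms) * h (tl ms)) has_sum s * t) {ms. length ms = Suc n}"
proof -
  let ?P = "UNIV \<times> {ms :: 'a list. length ms = n}"
  let ?c = "\<lambda>(m :: 'a, ms). m # ms"
  have inj: "inj_on ?c ?P" by (auto simp: inj_on_def)
  have im: "?c ` ?P = {ms. length ms = Suc n}"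
    by (auto simp: length_Suc_conv image_iff)
  have abs: "(\<lambda>p. norm ((\<lambda>(x, y). f x * h y) p)) summable_on ?P"
  proof (rule summable_on_SigmaI)
    show "((\<lambda>y. norm ((\<lambda>(x, y). f x * h y) (x, y))) has_sum norm (f x) * infsum (\<lambda>y. norm (h y)) {ms. length ms = n}) {ms. length ms = n}" for x
      using has_sum_cmult_right[OF has_sum_infsum[OF h(1)], of "norm (f x)"] by (simp add: norm_mult)
    show "(\<lambda>x. norm (f x) * infsum (\<lambda>y. norm (h y)) {ms. length ms = n}) summable_on UNIV"
      by (rule summable_on_cmult_left[OF f(1)])
  qed simp
  have sum: "((\<lambda>(x, y). f x * h y) has_sum s * t) ?P"
  proof (rule has_sum_SigmaI)
    show "((\<lambda>y. (\<lambda>(x, y). f x * h y) (x, y)) has_sum f x * t) {ms. length ms = n}" for x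
      using has_sum_cmult_right[OF h(2), of "f x"] by simp
    show "((\<lambda>x. f x * t) has_sum s * t) UNIV" by (rule has_sum_cmult_left[OF f(2)])
    show "(\<lambda>(x, y). f x * h y) summable_on ?P" by (rule abs_summable_summable[OF abs])
  qed
  show "(\<lambda>ms. norm (f (hd ms) * h (tl ms))) summable_on {ms. length ms = Suc n}"
    unfolding im[symmetric] summable_on_reindex[OF inj] using abs by (simp add: o_def case_prod_unfold)
  show "((\<lambda>ms. f (hd ms) * h (tl ms)) has_sum s * t) {ms. length ms = Suc n}"
    unfolding im[symmetric] has_sum_reindex[OF inj] using sum by (simp add: o_def case_prod_unfold)
qed

definition monomial :: "nat list \<Rightarrow> complex list \<Rightarrow> complex" where
  "monomial ms xs = prodw (\<lambda>m x. x ^ m) ms xs"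

lemma prodw_has_sum:
  assumes "\<And>k. k \<in> set ks \<Longrightarrow> power_series_of (a k) (f k)" "length xs = length ks" "set xs \<subseteq> ball 0 (1/4)"
  shows "(\<lambda>ms. norm (prodw a ks ms * monomial ms xs)) summable_on {ms. length ms = length ks}
     \<and> ((\<lambda>ms. prodw a ks ms * monomial ms xs) has_sum prodw f ks xs) {ms. length ms = length ks}"
  using assms
proof (induction ks arbitrary: xs)
  case Nil
  have e: "{ms :: nat list. length ms = length []} = {[]}" by auto
  have "((\<lambda>ms. prodw a [] ms * monomial ms xs) has_sum sum (\<lambda>ms. prodw a [] ms * monomial ms xs) {[]}) {[]}" by (rule has_sum_finite) simp
  then show ?case using Nil unfolding e by (simp add: monomial_def)
next
  case (Cons k ks)
  then obtain x ys where xs: "xs = x # ys" by (cases xs) auto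
  have IH: "(\<lambda>ms. norm (prodw a ks ms * monomial ms ys)) summable_on {ms. length ms = length ks}"
     "((\<lambda>ms. prodw a ks ms * monomial ms ys) has_sum prodw f ks ys) {ms. length ms = length ks}"
    using Cons.IH[of ys] Cons.prems by (auto simp: xs)
  have k: "(\<lambda>m. norm (a k m * x ^ m)) summable_on UNIV" "((\<lambda>m. a k m * x ^ m) has_sum f k x) UNIV"
    using Cons.prems by (auto simp: power_series_of_def xs)
  have e: "prodw a (k # ks) ms * monomial ms xs = (a k (hd ms) * x ^ hd ms) * (prodw a ks (tl ms) * monomial (tl ms) ys)"
    if "ms \<in> {ms. length ms = length (k # ks)}" for ms
    using that by (cases ms) (simp_all add: xs monomial_def mult_ac)
  have l: "{ms :: nat list. length ms = length (k # ks)} = {ms. length ms = Suc (length ks)}" by simp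
  note P = has_sum_Cons_product[OF k IH, folded l]
  have "(\<lambda>ms. norm (prodw a (k # ks) ms * monomial ms xs)) summable_on {ms. length ms = length (k # ks)}"
    using P(1) by (subst summable_on_cong[OF arg_cong[of _ _ norm, OF e]])
  moreover have "((\<lambda>ms. prodw a (k # ks) ms * monomial ms xs) has_sum f k x * prodw f ks ys) {ms. length ms = length (k # ks)}"
    using P(2) by (subst has_sum_cong[OF e])
  ultimately show ?case by (simp add: xs)
qed

lemma tensor_eval_has_sum:
  assumes "tensor_wf n t" "\<And>k. k \<ge> 1 \<Longrightarrow> power_series_of (a k) (f k)" "length xs = n" "set xs \<subseteq> ball 0 (1/4)"
  shows "((\<lambda>ms. tensor_eval a t ms * monomial ms xs) has_sum tensor_eval f t xs) {ms. length ms = n}"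
  using assms(1)
proof (induction t)
  case Nil
  then show ?case by simp
next
  case (Cons p t)
  then have p: "length (snd p) = n" "\<forall>k\<in>set (snd p). k \<ge> 1" and t: "tensor_wf n t" by (auto simp: tensor_wf_def)
  have "((\<lambda>ms. prodw a (snd p) ms * monomial ms xs) has_sum prodw f (snd p) xs) {ms. length ms = n}"
    using prodw_has_sum[of "snd p" a f xs] p assms by simp
  then have "((\<lambda>ms. fst p * (prodw a (snd p) ms * monomial ms xs)) has_sum fst p * prodw f (snd p) xs) {ms. length ms = n}"
    by (rule has_sum_cmult_right)
  from has_sum_add[OF this Cons.IH[OF t]] show ?case by (simp add: algebra_simps)
qed

lemma prod_list_nth: "(\<Prod>i<length xs. g (xs ! i)) = prod_list (map g xs)" for g :: "'a \<Rightarrow> complex"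
  by (induction xs rule: rev_induct) (simp_all add: nth_append)

lemma prodw_divide:
  "length ks = length xs \<Longrightarrow> prodw f ks (map h xs) / prod_list (map d xs) = prodw (\<lambda>k x. f k (h x) / d x) ks xs"
proof (induction ks xs rule: list_induct2)
  case (Cons k ks x xs)
  show ?case
    unfolding list.map prodw_simps prod_list.Cons Cons.IH[symmetric] by (rule times_divide_times_eq[symmetric])
qed simp

lemma prodw_cong: "length ks = length xs \<Longrightarrow> (\<And>k x. k \<in> set ks \<Longrightarrow> x \<in> set xs \<Longrightarrow> f k x = g k x) \<Longrightarrow> prodw f ks xs = prodw g ks xs"
  by (induction ks xs rule: list_induct2) simp_all

lemma term_eq:
  "length xs = length ms \<Longrightarrow> monoH g (map Suc ms) * (\<Prod>i<length ms. of_nat (map Suc ms ! i) * (xs ! i) ^ (map Suc ms ! i - 1))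
    = wcoeff g ms * monomial ms xs"
proof -
  assume l: "length xs = length ms"
  have "(\<Prod>i<length ms. of_nat (map Suc ms ! i) * (xs ! i) ^ (map Suc ms ! i - 1))
      = (\<Prod>i<length ms. of_nat (Suc (ms ! i)) * (xs ! i) ^ (ms ! i))" by (rule prod.cong) simp_all
  also have "\<dots> = (\<Prod>i<length ms. of_nat (Suc (ms ! i))) * (\<Prod>i<length ms. (xs ! i) ^ (ms ! i))" by (rule prod.distrib)
  also have "(\<Prod>i<length ms. of_nat (Suc (ms ! i)) :: complex) = prod_list (map (\<lambda>m. of_nat (Suc m)) ms)" by (rule prod_list_nth)
  also have "(\<Prod>i<length ms. (xs ! i) ^ (ms ! i)) = monomial ms xs"
    using l[symmetric]
  proof (induction ms xs rule: list_induct2)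
    case (Cons m ms x xs)
    then show ?case by (simp add: monomial_def prod.lessThan_Suc_shift del: prod.lessThan_Suc)
  qed (simp add: monomial_def)
  finally show ?thesis by (simp add: wcoeff_def mult_ac)
qed

theorem theorem1:
  fixes g n :: nat
  assumes "n \<ge> 1" and "(g, n) \<noteq> (0, 2)"
  shows "\<exists>r>0. \<forall>xs :: complex list. length xs = n \<and> (\<forall>x\<in>set xs. norm x < r) \<longrightarrow>
     ((\<lambda>mu. monoH g mu * (\<Prod>i<n. of_nat (mu ! i) * (xs ! i) ^ (mu ! i - 1)))
        has_sum (omega g (map zbranch xs) / (\<Prod>i<n. deriv xcurve (zbranch (xs ! i)))))
       {mu. length mu = n \<and> (\<forall>k\<in>set mu. 1 \<le> k)}"
proof (intro exI[of _ "1/4"] conjI allI impI)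
  \<comment> \<open>The radius 1/4 is the distance from 0 to the branch value x(2), where s
    vanishes.\<close>
  fix xs :: "complex list" assume "length xs = n \<and> (\<forall>x\<in>set xs. norm x < 1/4)"
  then have l: "length xs = n" and b: "set xs \<subseteq> ball 0 (1/4)" by auto
  have inj: "inj_on (map Suc) {ms. length ms = n}" using inj_on_subset[OF inj_mapI[OF inj_Suc]] by blast
  have im: "map Suc ` {ms. length ms = n} = {mu. length mu = n \<and> (\<forall>k\<in>set mu. 1 \<le> k)}"
  proof (intro equalityI subsetI)
    fix mu :: "nat list" assume mu: "mu \<in> {mu. length mu = n \<and> (\<forall>k\<in>set mu. 1 \<le> k)}"
    then have "mu = map Suc (map (\<lambda>k. k - 1) mu)" by (auto simp: o_def intro!: map_idI[symmetric])
    then show "mu \<in> map Suc ` {ms. length ms = n}" using mu by (metis (mono_tags, lifting) imageI length_map mem_Collect_eq)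
  qed auto
  have P: "(\<Prod>i<n. deriv xcurve (zbranch (xs ! i))) = prod_list (map (\<lambda>x. deriv xcurve (zbranch x)) xs)"
    using prod_list_nth[of "\<lambda>x. deriv xcurve (zbranch x)" xs] l by simp
  have "((\<lambda>ms. wcoeff g ms * monomial ms xs) has_sum omega g (map zbranch xs) / prod_list (map (\<lambda>x. deriv xcurve (zbranch x)) xs)) {ms. length ms = n}"
  proof (cases "g = 0 \<and> n = 1")
    case True
    \<comment> \<open>For (0,1) the quotient of the differentials is z itself, with the series
      \<open>Zs\<close>. The index list \<open>[0]\<close> below is a placeholder that lets
      \<open>prodw_has_sum\<close> apply.\<close>
    then obtain x where x: "xs = [x]" using l by (auto simp: length_Suc_conv)
    then have xb: "x \<in> ball 0 (1/4)" using b by simp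
    have S: "((\<lambda>ms. prodw (\<lambda>_. fps_nth Zs) [0] ms * monomial ms xs) has_sum prodw (\<lambda>_. zbranch) [0] xs) {ms. length ms = length [0 :: nat]}"
      using prodw_has_sum[of "[0]" "\<lambda>_. fps_nth Zs" "\<lambda>_. zbranch" xs] power_series_of_Zs b x by simp
    have c: "wcoeff g ms * monomial ms xs = prodw (\<lambda>_. fps_nth Zs) [0] ms * monomial ms xs" if "ms \<in> {ms. length ms = n}" for ms
      using that True by (cases ms) (auto simp: Zs_def wser_def)
    have o: "omega g (map zbranch xs) / prod_list (map (\<lambda>x. deriv xcurve (zbranch x)) xs) = prodw (\<lambda>_. zbranch) [0] xs"
      using True zbranch_facts[OF xb] sq_nonzero[OF xb] by (simp add: x omega.simps(2))
    have l1: "{ms :: nat list. length ms = length [0 :: nat]} = {ms. length ms = n}" using True by simp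
    show ?thesis unfolding o using S[unfolded l1] by (rule has_sum_cong[THEN iffD2, rotated]) (rule c)
  next
    case False
    obtain N where N: "n = Suc N" using assms(1) by (cases n) auto
    have "2 * g + N \<ge> 2" using False assms(2) N by (cases g) auto
    then obtain t where t: "tensor_rep g n t" using tensor_rep_exists N by blast
    have S: "((\<lambda>ms. tensor_eval wk t ms * monomial ms xs) has_sum tensor_eval (\<lambda>k x. inverse (sq x) ^ (2 * k + 1)) t xs) {ms. length ms = n}"
      by (rule tensor_eval_has_sum[OF _ power_series_of_wk l b]) (use t in \<open>simp add: tensor_rep_def\<close>)
    have c: "wcoeff g ms * monomial ms xs = tensor_eval wk t ms * monomial ms xs" if "ms \<in> {ms. length ms = n}" for ms
      using t that by (simp add: tensor_rep_def)
    \<comment> \<open>Division by the derivatives of x turns each \<open>phi k\<close> into an odd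
      power of 1/s, so the tensor is evaluated on functions whose Taylor coefficients are the
      \<open>wk k\<close>.\<close>
    have o: "omega g (map zbranch xs) / prod_list (map (\<lambda>x. deriv xcurve (zbranch x)) xs) = tensor_eval (\<lambda>k x. inverse (sq x) ^ (2 * k + 1)) t xs"
    proof -
      have "off_ramification (map zbranch xs)" using zbranch_facts b by (auto simp: off_ramification_def)
      then have "omega g (map zbranch xs) = tensor_eval phi t (map zbranch xs)" and gt: "tensor_wf n t" using t l by (simp_all add: tensor_rep_def)
      then have "omega g (map zbranch xs) / prod_list (map (\<lambda>x. deriv xcurve (zbranch x)) xs)
        = (\<Sum>p\<leftarrow>t. fst p * prodw phi (snd p) (map zbranch xs)) * inverse (prod_list (map (\<lambda>x. deriv xcurve (zbranch x)) xs))"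
        by (simp add: tensor_eval_def divide_inverse)
      also have "\<dots> = (\<Sum>p\<leftarrow>t. fst p * (prodw phi (snd p) (map zbranch xs) / prod_list (map (\<lambda>x. deriv xcurve (zbranch x)) xs)))"
        unfolding sum_list_mult_const[symmetric] by (simp only: divide_inverse mult.assoc)
      also have "\<dots> = tensor_eval (\<lambda>k x. inverse (sq x) ^ (2 * k + 1)) t xs"
        unfolding tensor_eval_def
      proof (intro arg_cong[of _ _ sum_list] map_cong refl)
        fix p assume "p \<in> set t"
        then have p: "length (snd p) = length xs" "\<forall>k\<in>set (snd p). k \<ge> 1" using gt l by (auto simp: tensor_wf_def)
        have "prodw (\<lambda>k x. phi k (zbranch x) / deriv xcurve (zbranch x)) (snd p) xs = prodw (\<lambda>k x. inverse (sq x) ^ (2 * k + 1)) (snd p) xs"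
          by (rule prodw_cong[OF p(1)]) (use p(2) b phi_zbranch in blast)
        then show "fst p * (prodw phi (snd p) (map zbranch xs) / prod_list (map (\<lambda>x. deriv xcurve (zbranch x)) xs)) = fst p * prodw (\<lambda>k x. inverse (sq x) ^ (2 * k + 1)) (snd p) xs"
          unfolding prodw_divide[OF p(1)] by simp
      qed
      finally show ?thesis .
    qed
    show ?thesis unfolding o using S by (rule has_sum_cong[THEN iffD2, rotated]) (rule c)
  qed
  then have "(((\<lambda>mu. monoH g mu * (\<Prod>i<n. of_nat (mu ! i) * (xs ! i) ^ (mu ! i - 1))) \<circ> map Suc) has_sum omega g (map zbranch xs) / prod_list (map (\<lambda>x. deriv xcurve (zbranch x)) xs)) {ms. length ms = n}"
  proof (rule has_sum_cong[THEN iffD1, rotated])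
    show "wcoeff g ms * monomial ms xs = ((\<lambda>mu. monoH g mu * (\<Prod>i<n. of_nat (mu ! i) * (xs ! i) ^ (mu ! i - 1))) \<circ> map Suc) ms"
      if "ms \<in> {ms. length ms = n}" for ms
      using term_eq[of xs ms g] that l by simp
  qed
  then show "((\<lambda>mu. monoH g mu * (\<Prod>i<n. of_nat (mu ! i) * (xs ! i) ^ (mu ! i - 1)))
        has_sum (omega g (map zbranch xs) / (\<Prod>i<n. deriv xcurve (zbranch (xs ! i)))))
       {mu. length mu = n \<and> (\<forall>k\<in>set mu. 1 \<le> k)}"
    unfolding P im[symmetric] has_sum_reindex[OF inj] .
qed simp

end
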